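(* Let $X$ be a compact manifold with boundary and $\pi:W\to X$ a real vector bundle. The cohomology of the complex $$\mathcal C^k=C^\infty(X;\Lambda^k)\oplus\{(\alpha,\beta):\alpha\in C^\infty(\mathbb SW;\Lambda^{k-1}),\ \beta\in C^\infty(\overline W_{\partial X};\Lambda^{k-1}),\ \iota_\partial^*\alpha=\iota_\partial^*\beta\}$$ with differential $$D(u,(\alpha,\beta))=\big(du,\ (-\pi^*u-d\alpha,\ -\pi^*i^*u-d\beta)\big)$$ is the cohomology with compact supports of $W|_{X\setminus\partial X}$: $H^k(\mathcal C^*,D)\cong H^k_c(W|_{X\setminus\partial X})$.
   Context: $\overline W$ is the fibrewise radial compactification of $W$; its boundary hypersurfaces are $\mathbb SW=(W\setminus0)/\mathbb R^+$ (the part at infinity) and $\overline W_{\partial X}$ (the part over $\partial X$). $\iota_\partial$ denotes the inclusion of the corner $\mathbb SW|_{\partial X}$ into either hypersurface, $i:\partial X\to X$ is the inclusion of the boundary, and $\pi$ also denotes the projections of $\mathbb SW$ to $X$ and of $\overline W_{\partial X}$ to $\partial X$. $\Lambda^k$ denotes the bundle of $k$-forms. *)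

theory Defs
  imports "HOL-Analysis.Analysis" "HOL-Library.Function_Algebras"
begin

section \<open>Real vector spaces of functions, cohomology of a complex\<close>

instantiation "fun" :: (type, real_vector) real_vector
begin

definition scaleR_fun :: "real \<Rightarrow> ('a \<Rightarrow> 'b) \<Rightarrow> 'a \<Rightarrow> 'b" where
  "scaleR_fun c f = (\<lambda>x. c *\<^sub>R f x)"

instance
  by standard (simp_all add: scaleR_fun_def fun_eq_iff scaleR_add_right scaleR_add_left)

end

record 'v real_vs =
  vs_carrier :: "'v set"
  vs_add :: "'v \<Rightarrow> 'v \<Rightarrow> 'v"
  vs_scale :: "real \<Rightarrow> 'v \<Rightarrow> 'v"

definition vs_iso :: "'v real_vs \<Rightarrow> 'w real_vs \<Rightarrow> bool" where
  "vs_iso V V' \<longleftrightarrow> (\<exists>\<Phi>. bij_betw \<Phi> (vs_carrier V) (vs_carrier V') \<and>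
     (\<forall>x\<in>vs_carrier V. \<forall>y\<in>vs_carrier V. \<Phi> (vs_add V x y) = vs_add V' (\<Phi> x) (\<Phi> y)) \<and>
     (\<forall>c. \<forall>x\<in>vs_carrier V. \<Phi> (vs_scale V c x) = vs_scale V' c (\<Phi> x)))"

text \<open>The degree \<open>k\<close> cohomology of a complex of subspaces \<open>C k\<close>, as the space of cosets \<open>z + d ` C (k - 1)\<close>
  of cocycles \<open>z\<close>.  In \<open>vs_scale\<close> the coboundaries are added so that scaling by \<open>0\<close> gives the whole zero class.\<close>

definition cohomology :: "(int \<Rightarrow> 'v::real_vector set) \<Rightarrow> ('v \<Rightarrow> 'v) \<Rightarrow> int \<Rightarrow> 'v set real_vs" where
  "cohomology C d k =
     \<lparr> vs_carrier = {z \<in> C k. d z = 0} // {(x, y). y - x \<in> d ` C (k - 1)},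
       vs_add = (\<lambda>A B. {a + b | a b. a \<in> A \<and> b \<in> B}),
       vs_scale = (\<lambda>c A. {c *\<^sub>R a + b | a b. a \<in> A \<and> b \<in> d ` C (k - 1)}) \<rparr>"

section \<open>Calculus on subsets of Euclidean space\<close>

text \<open>Since dimensions vary (boundaries, total spaces, sphere bundles), \<open>\<real>\<^sup>n\<close> is the library's
  \<^const>\<open>Euclidean_space\<close>: sequences vanishing from index \<open>n\<close> on.\<close>

type_synonym rvec = "nat \<Rightarrow> real"

abbreviation Rn :: "nat \<Rightarrow> rvec set" where
  "Rn n \<equiv> topspace (Euclidean_space n)"

text \<open>Partial derivative relative to \<open>S\<close>; one-sided at the boundary when \<open>S\<close> is relatively open in a quadrant.\<close>

definition pd :: "rvec set \<Rightarrow> nat \<Rightarrow> (rvec \<Rightarrow> real) \<Rightarrow> rvec \<Rightarrow> real" where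
  "pd S i f x = vector_derivative (\<lambda>t. f (x(i := t))) (at (x i) within {t. x(i := t) \<in> S})"

definition smooth_open :: "nat \<Rightarrow> rvec set \<Rightarrow> (rvec \<Rightarrow> real) \<Rightarrow> bool" where
  "smooth_open n U f \<longleftrightarrow> openin (Euclidean_space n) U \<and>
     (\<forall>js\<in>lists {..<n}. let g = foldr (pd U) js f in
        continuous_map (subtopology (Euclidean_space n) U) euclideanreal g \<and>
        (\<forall>x\<in>U. \<forall>i<n. (\<lambda>t. g (x(i := t))) differentiable (at (x i))))"

definition smooth_fun :: "nat \<Rightarrow> rvec set \<Rightarrow> (rvec \<Rightarrow> real) \<Rightarrow> bool" where
  "smooth_fun n S f \<longleftrightarrow>
     (\<forall>x\<in>S. \<exists>U g. x \<in> U \<and> smooth_open n U g \<and> (\<forall>y\<in>S \<inter> U. g y = f y))"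

definition dir_deriv :: "nat \<Rightarrow> rvec set \<Rightarrow> rvec \<Rightarrow> (rvec \<Rightarrow> real) \<Rightarrow> rvec \<Rightarrow> real" where
  "dir_deriv n S v f x = (\<Sum>i<n. v i * pd S i f x)"

definition tangent_map :: "nat \<Rightarrow> rvec set \<Rightarrow> (rvec \<Rightarrow> rvec) \<Rightarrow> rvec \<Rightarrow> rvec \<Rightarrow> rvec" where
  "tangent_map n S F x v = (\<lambda>i. dir_deriv n S v (\<lambda>y. F y i) x)"

text \<open>Alternating \<open>k\<close>-linear forms on \<open>\<real>\<^sup>n\<close>, extended by \<open>0\<close> to argument lists that are not \<open>k\<close>-tuples
  in \<open>\<real>\<^sup>n\<close>.  For \<open>k < 0\<close> only the zero form remains.\<close>

definition alt_form :: "nat \<Rightarrow> int \<Rightarrow> (rvec list \<Rightarrow> real) \<Rightarrow> bool" where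
  "alt_form n k a \<longleftrightarrow>
     (\<forall>vs. a vs \<noteq> 0 \<longrightarrow> int (length vs) = k \<and> set vs \<subseteq> Rn n) \<and>
     (\<forall>vs i v w c. set vs \<subseteq> Rn n \<and> i < length vs \<and> v \<in> Rn n \<and> w \<in> Rn n \<longrightarrow>
        a (vs[i := c *\<^sub>R v + w]) = c * a (vs[i := v]) + a (vs[i := w])) \<and>
     (\<forall>vs i j. i < j \<and> j < length vs \<and> vs ! i = vs ! j \<longrightarrow> a vs = 0)"

section \<open>Manifolds with corners\<close>

text \<open>A manifold is given by an atlas.  A chart with \<open>cdim = n\<close> and \<open>ccor = m\<close> maps its domain onto a relatively
  open subset of \<open>[0,\<infinity>)\<^sup>m \<times> \<real>\<^sup>n\<^sup>-\<^sup>m\<close>.\<close>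

record 'a chart =
  cdim :: nat
  ccor :: nat
  cdom :: "'a set"
  cmap :: "'a \<Rightarrow> rvec"

definition cmodel :: "'a chart \<Rightarrow> rvec topology" where
  "cmodel c = subtopology (Euclidean_space (cdim c)) {x. \<forall>i<ccor c. 0 \<le> x i}"

abbreviation cimage :: "'a chart \<Rightarrow> rvec set" where
  "cimage c \<equiv> cmap c ` cdom c"

abbreviation cinv :: "'a chart \<Rightarrow> rvec \<Rightarrow> 'a" where
  "cinv c \<equiv> inv_into (cdom c) (cmap c)"

definition rep_dom :: "('a \<Rightarrow> 'b) \<Rightarrow> 'a chart \<Rightarrow> 'b chart \<Rightarrow> rvec set" where
  "rep_dom f c d = cmap c ` (cdom c \<inter> f -` cdom d)"

definition local_rep :: "('a \<Rightarrow> 'b) \<Rightarrow> 'a chart \<Rightarrow> 'b chart \<Rightarrow> rvec \<Rightarrow> rvec" where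
  "local_rep f c d = cmap d \<circ> f \<circ> cinv c"

definition rep_tangent :: "('a \<Rightarrow> 'b) \<Rightarrow> 'a chart \<Rightarrow> 'b chart \<Rightarrow> rvec \<Rightarrow> rvec \<Rightarrow> rvec" where
  "rep_tangent f c d = tangent_map (cdim c) (rep_dom f c d) (local_rep f c d)"

definition carrier_of :: "'a chart set \<Rightarrow> 'a set" where
  "carrier_of M = (\<Union>c\<in>M. cdom c)"

definition mfd_topology :: "'a chart set \<Rightarrow> 'a topology" where
  "mfd_topology M = topology_generated_by {V. \<exists>c\<in>M. V \<subseteq> cdom c \<and> openin (cmodel c) (cmap c ` V)}"

definition smooth_atlas :: "'a chart set \<Rightarrow> bool" where
  "smooth_atlas M \<longleftrightarrow>
     (\<forall>c\<in>M. ccor c \<le> cdim c \<and> inj_on (cmap c) (cdom c) \<and> openin (cmodel c) (cimage c)) \<and>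
     (\<forall>c\<in>M. \<forall>d\<in>M. openin (cmodel c) (rep_dom id c d) \<and>
        (\<forall>i. smooth_fun (cdim c) (rep_dom id c d) (\<lambda>x. local_rep id c d x i)))"

definition manifold_with_corners :: "'a chart set \<Rightarrow> bool" where
  "manifold_with_corners M \<longleftrightarrow>
     smooth_atlas M \<and> Hausdorff_space (mfd_topology M) \<and> second_countable (mfd_topology M)"

definition compact_manifold_with_boundary :: "'a chart set \<Rightarrow> bool" where
  "compact_manifold_with_boundary M \<longleftrightarrow>
     manifold_with_corners M \<and> (\<forall>c\<in>M. ccor c \<le> 1) \<and> compact_space (mfd_topology M)"

definition bdry :: "'a chart set \<Rightarrow> 'a set" where
  "bdry M = {p. \<exists>c\<in>M. p \<in> cdom c \<and> (\<exists>i<ccor c. cmap c p i = 0)}"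

text \<open>The boundary as a manifold, for a manifold with boundary (all \<open>ccor c \<le> 1\<close>): the coordinate \<open>0\<close>,
  which vanishes on the boundary, is dropped.\<close>

definition boundary_mfd :: "'a chart set \<Rightarrow> 'a chart set" where
  "boundary_mfd M =
     {\<lparr> cdim = cdim c - 1, ccor = 0, cdom = cdom c \<inter> bdry M, cmap = (\<lambda>p i. cmap c p (Suc i)) \<rparr> | c.
        c \<in> M \<and> ccor c = 1}"

definition restrict_mfd :: "'a chart set \<Rightarrow> 'a set \<Rightarrow> 'a chart set" where
  "restrict_mfd M A = (\<lambda>c. c \<lparr> cdom := cdom c \<inter> A \<rparr>) ` M"

abbreviation interior_pts :: "'a chart set \<Rightarrow> 'a set" where
  "interior_pts M \<equiv> carrier_of M - bdry M"

section \<open>Differential forms\<close>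

text \<open>A form is a family of local forms \<open>\<omega> c\<close> on the chart images which transform into each other under
  the transition maps; it is \<open>0\<close> at charts outside the atlas and at points outside the chart image,
  so that equality of forms is equality of functions.\<close>

type_synonym 'a form = "'a chart \<Rightarrow> rvec \<Rightarrow> rvec list \<Rightarrow> real"

definition forms :: "'a chart set \<Rightarrow> int \<Rightarrow> 'a form set" where
  "forms M k = {\<omega>.
     (\<forall>c x. \<not> (c \<in> M \<and> x \<in> cimage c) \<longrightarrow> \<omega> c x = 0) \<and>
     (\<forall>c\<in>M. \<forall>x\<in>cimage c. alt_form (cdim c) k (\<omega> c x)) \<and>
     (\<forall>c\<in>M. \<forall>vs. smooth_fun (cdim c) (cimage c) (\<lambda>x. \<omega> c x vs)) \<and>
     (\<forall>c\<in>M. \<forall>d\<in>M. \<forall>x\<in>rep_dom id c d. \<forall>vs. set vs \<subseteq> Rn (cdim c) \<longrightarrow>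
        \<omega> c x vs = \<omega> d (local_rep id c d x) (map (rep_tangent id c d x) vs))}"

text \<open>\<open>d\<omega>(v\<^sub>0,\<dots>,v\<^sub>k) = \<Sum>\<^sub>l (-1)\<^sup>l D\<^bsub>v\<^sub>l\<^esub> (\<omega>(v\<^sub>0,\<dots>,v\<^sub>l omitted,\<dots>,v\<^sub>k))\<close> for constant vector fields in a chart.\<close>

definition ext_d :: "'a chart set \<Rightarrow> 'a form \<Rightarrow> 'a form" where
  "ext_d M \<omega> = (\<lambda>c x vs.
     if c \<in> M \<and> x \<in> cimage c \<and> set vs \<subseteq> Rn (cdim c)
     then \<Sum>l<length vs. (- 1) ^ l *
            dir_deriv (cdim c) (cimage c) (vs ! l) (\<lambda>y. \<omega> c y (take l vs @ drop (Suc l) vs)) x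
     else 0)"

text \<open>Pull-back along a smooth map \<open>f\<close> from \<open>M\<close> to \<open>N\<close>; by compatibility the choice of the chart \<open>d\<close> of \<open>N\<close>
  around the image point is immaterial.\<close>

definition pullback :: "'a chart set \<Rightarrow> 'b chart set \<Rightarrow> ('a \<Rightarrow> 'b) \<Rightarrow> 'b form \<Rightarrow> 'a form" where
  "pullback M N f \<omega> = (\<lambda>c x vs.
     if c \<in> M \<and> x \<in> cimage c \<and> set vs \<subseteq> Rn (cdim c)
     then let d = (SOME d. d \<in> N \<and> f (cinv c x) \<in> cdom d)
          in \<omega> d (local_rep f c d x) (map (rep_tangent f c d x) vs)
     else 0)"

definition form_support :: "'a chart set \<Rightarrow> 'a form \<Rightarrow> 'a set" where
  "form_support M \<omega> =
     mfd_topology M closure_of {p. \<exists>c\<in>M. p \<in> cdom c \<and> \<omega> c (cmap c p) \<noteq> 0}"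

definition compact_forms :: "'a chart set \<Rightarrow> int \<Rightarrow> 'a form set" where
  "compact_forms M k = {\<omega> \<in> forms M k. compactin (mfd_topology M) (form_support M \<omega>)}"

definition compact_cohomology :: "'a chart set \<Rightarrow> int \<Rightarrow> 'a form set real_vs" where
  "compact_cohomology M = cohomology (compact_forms M) (ext_d M)"

section \<open>Vector bundles, sphere bundles, radial compactification\<close>

record ('a, 'w) triv =
  trank :: nat
  tdom :: "'a set"
  tmap :: "'w \<Rightarrow> rvec"

record ('a, 'w) vbundle =
  total :: "'w set"
  proj :: "'w \<Rightarrow> 'a"
  vadd :: "'w \<Rightarrow> 'w \<Rightarrow> 'w"
  vscale :: "real \<Rightarrow> 'w \<Rightarrow> 'w"
  trivs :: "('a, 'w) triv set"

definition fibre :: "('a, 'w) vbundle \<Rightarrow> 'a \<Rightarrow> 'w set" where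
  "fibre E p = {w \<in> total E. proj E w = p}"

definition append_vec :: "nat \<Rightarrow> rvec \<Rightarrow> rvec \<Rightarrow> rvec" where
  "append_vec n x y = (\<lambda>i. if i < n then x i else y (i - n))"

definition total_chart :: "('a, 'w) vbundle \<Rightarrow> 'a chart \<Rightarrow> ('a, 'w) triv \<Rightarrow> 'w chart" where
  "total_chart E c t =
     \<lparr> cdim = cdim c + trank t, ccor = ccor c,
       cdom = {w \<in> total E. proj E w \<in> cdom c \<inter> tdom t},
       cmap = (\<lambda>w. append_vec (cdim c) (cmap c (proj E w)) (tmap t w)) \<rparr>"

definition total_mfd :: "'a chart set \<Rightarrow> ('a, 'w) vbundle \<Rightarrow> 'w chart set" where
  "total_mfd M E = {total_chart E c t | c t. c \<in> M \<and> t \<in> trivs E}"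

text \<open>Smoothness of the transition functions of the bundle is part of the smoothness of the atlas of the
  total space.  The fibres inherit the vector space axioms from \<open>\<real>\<^sup>r\<close> through the trivializations.\<close>

definition vector_bundle :: "'a chart set \<Rightarrow> ('a, 'w) vbundle \<Rightarrow> bool" where
  "vector_bundle M E \<longleftrightarrow>
     proj E ` total E \<subseteq> carrier_of M \<and>
     (\<Union>t\<in>trivs E. tdom t) = carrier_of M \<and>
     (\<forall>t\<in>trivs E. openin (mfd_topology M) (tdom t)) \<and>
     (\<forall>t\<in>trivs E. \<forall>p\<in>tdom t. bij_betw (tmap t) (fibre E p) (Rn (trank t)) \<and>
        (\<forall>v\<in>fibre E p. \<forall>w\<in>fibre E p.
           vadd E v w \<in> fibre E p \<and> tmap t (vadd E v w) = tmap t v + tmap t w) \<and>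
        (\<forall>a. \<forall>v\<in>fibre E p.
           vscale E a v \<in> fibre E p \<and> tmap t (vscale E a v) = a *\<^sub>R tmap t v)) \<and>
     smooth_atlas (total_mfd M E)"

definition restrict_bundle :: "('a, 'w) vbundle \<Rightarrow> 'a set \<Rightarrow> ('a, 'w) vbundle" where
  "restrict_bundle E A = E \<lparr> total := {w \<in> total E. proj E w \<in> A},
     trivs := (\<lambda>t. t \<lparr> tdom := tdom t \<inter> A \<rparr>) ` trivs E \<rparr>"

definition nonzero :: "('a, 'w) vbundle \<Rightarrow> 'w set" where
  "nonzero E = {w \<in> total E. vscale E 0 w \<noteq> w}"

definition ray :: "('a, 'w) vbundle \<Rightarrow> 'w \<Rightarrow> 'w set" where
  "ray E w = {vscale E a w | a. 0 < a}"

definition ray_rep :: "'w set \<Rightarrow> 'w" where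
  "ray_rep R = (SOME w. w \<in> R)"

definition sphere_proj :: "('a, 'w) vbundle \<Rightarrow> 'w set \<Rightarrow> 'a" where
  "sphere_proj E R = proj E (ray_rep R)"

text \<open>\<open>\<S>E = (E - 0) / \<real>\<^sup>+\<close>, as a set of rays.  On the open half space \<open>\<sigma> v\<^sub>j > 0\<close> (\<open>\<sigma> = \<plusminus>1\<close>) of the fibre, the fibre
  coordinates of the ray of \<open>v\<close> are \<open>v\<^sub>i / (\<sigma> v\<^sub>j)\<close> for \<open>i \<noteq> j\<close>.\<close>

definition drop_coord :: "nat \<Rightarrow> rvec \<Rightarrow> rvec" where
  "drop_coord j v = (\<lambda>i. v (if i < j then i else Suc i))"

definition sphere_chart ::
    "('a, 'w) vbundle \<Rightarrow> 'a chart \<Rightarrow> ('a, 'w) triv \<Rightarrow> nat \<Rightarrow> real \<Rightarrow> 'w set chart" where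
  "sphere_chart E c t j \<sigma> =
     \<lparr> cdim = cdim c + trank t - 1, ccor = ccor c,
       cdom = {R \<in> ray E ` nonzero E.
                 sphere_proj E R \<in> cdom c \<inter> tdom t \<and> 0 < \<sigma> * tmap t (ray_rep R) j},
       cmap = (\<lambda>R. append_vec (cdim c) (cmap c (sphere_proj E R))
                 (drop_coord j ((1 / (\<sigma> * tmap t (ray_rep R) j)) *\<^sub>R tmap t (ray_rep R)))) \<rparr>"

definition sphere_mfd :: "'a chart set \<Rightarrow> ('a, 'w) vbundle \<Rightarrow> 'w set chart set" where
  "sphere_mfd M E = {sphere_chart E c t j \<sigma> | c t j \<sigma>.
     c \<in> M \<and> t \<in> trivs E \<and> j < trank t \<and> \<sigma> \<in> {1, - 1}}"

text \<open>The fibrewise radial compactification: the disjoint union of \<open>E\<close> (\<^const>\<open>Inl\<close>) and \<open>\<S>E\<close> (\<^const>\<open>Inr\<close>, at infinity).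
  Near infinity its coordinates are \<open>\<rho> = 1 / (\<sigma> v\<^sub>j) \<ge> 0\<close>, with \<open>\<rho> = 0\<close> on \<open>\<S>E\<close>, and those of the ray of \<open>v\<close>.
  These are the projective coordinates on the closed half sphere in \<open>\<real> \<times> \<real>\<^sup>r\<close>, into which
  \<open>\<real>\<^sup>r\<close> is embedded by \<open>v \<mapsto> (1, v) / |(1, v)|\<close>.\<close>

definition finite_chart :: "'w chart \<Rightarrow> ('w + 'w set) chart" where
  "finite_chart c = \<lparr> cdim = cdim c, ccor = ccor c, cdom = Inl ` cdom c, cmap = cmap c \<circ> projl \<rparr>"

definition infinity_chart ::
    "('a, 'w) vbundle \<Rightarrow> 'a chart \<Rightarrow> ('a, 'w) triv \<Rightarrow> nat \<Rightarrow> real \<Rightarrow> ('w + 'w set) chart" where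
  "infinity_chart E c t j \<sigma> = (let s = sphere_chart E c t j \<sigma> in
     \<lparr> cdim = Suc (cdim s), ccor = Suc (ccor s),
       cdom = Inl ` {w \<in> nonzero E. ray E w \<in> cdom s} \<union> Inr ` cdom s,
       cmap = case_sum (\<lambda>w. case_nat (1 / (\<sigma> * tmap t w j)) (cmap s (ray E w)))
                       (\<lambda>R. case_nat 0 (cmap s R)) \<rparr>)"

definition radial_compactification :: "'a chart set \<Rightarrow> ('a, 'w) vbundle \<Rightarrow> ('w + 'w set) chart set" where
  "radial_compactification M E = finite_chart ` total_mfd M E \<union>
     {infinity_chart E c t j \<sigma> | c t j \<sigma>.
        c \<in> M \<and> t \<in> trivs E \<and> j < trank t \<and> \<sigma> \<in> {1, - 1}}"

definition radial_proj :: "('a, 'w) vbundle \<Rightarrow> 'w + 'w set \<Rightarrow> 'a" where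
  "radial_proj E = case_sum (proj E) (sphere_proj E)"

section \<open>The complex\<close>

text \<open>The hypersurface of the radial compactification of \<open>W\<close> over \<open>\<partial>X\<close>, i.e. the fibrewise radial compactification
  of \<open>W|\<^bsub>\<partial>X\<^esub>\<close>, and the corner \<open>\<S>W|\<^bsub>\<partial>X\<^esub>\<close>.  The inclusion of the corner is \<^const>\<open>id\<close> into \<open>\<S>W\<close>
  and \<^const>\<open>Inr\<close> into the former hypersurface.\<close>

definition boundary_face :: "'a chart set \<Rightarrow> ('a, 'w) vbundle \<Rightarrow> ('w + 'w set) chart set" where
  "boundary_face X W = radial_compactification (boundary_mfd X) (restrict_bundle W (bdry X))"

definition corner_mfd :: "'a chart set \<Rightarrow> ('a, 'w) vbundle \<Rightarrow> 'w set chart set" where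
  "corner_mfd X W = sphere_mfd (boundary_mfd X) (restrict_bundle W (bdry X))"

type_synonym ('a, 'w) cochain = "'a form \<times> 'w set form \<times> ('w + 'w set) form"

definition cochains :: "'a chart set \<Rightarrow> ('a, 'w) vbundle \<Rightarrow> int \<Rightarrow> ('a, 'w) cochain set" where
  "cochains X W k = {(u, (\<alpha>, \<beta>)).
     u \<in> forms X k \<and> \<alpha> \<in> forms (sphere_mfd X W) (k - 1) \<and> \<beta> \<in> forms (boundary_face X W) (k - 1) \<and>
     pullback (corner_mfd X W) (sphere_mfd X W) id \<alpha> =
       pullback (corner_mfd X W) (boundary_face X W) Inr \<beta>}"

definition cochain_D :: "'a chart set \<Rightarrow> ('a, 'w) vbundle \<Rightarrow> ('a, 'w) cochain \<Rightarrow> ('a, 'w) cochain" where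
  "cochain_D X W = (\<lambda>(u, (\<alpha>, \<beta>)).
     (ext_d X u,
      (- pullback (sphere_mfd X W) X (sphere_proj W) u - ext_d (sphere_mfd X W) \<alpha>,
       - pullback (boundary_face X W) (boundary_mfd X) (radial_proj W)
            (pullback (boundary_mfd X) X id u)
         - ext_d (boundary_face X W) \<beta>)))"

definition interior_total :: "'a chart set \<Rightarrow> ('a, 'w) vbundle \<Rightarrow> 'w chart set" where
  "interior_total X W =
     total_mfd (restrict_mfd X (interior_pts X)) (restrict_bundle W (interior_pts X))"

end

theory Submission imports Defs begin

text \<open>The cochains living over the boundary form an acyclic complex: the compactified fibres contract to the zero section,
so \<open>u \<mapsto> \<pi>\<^sup>*u\<close> is a quasi-isomorphism from the boundary to its compactified bundle.  Restriction to the boundary is onto,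
hence the complex may be replaced by the pairs \<open>(u, \<alpha>)\<close> vanishing over the boundary, and, pushing along the flow of a
homotopy that retracts a neighbourhood of the boundary onto it, by pairs vanishing over a neighbourhood.  Fix a fibre metric,
let \<open>r\<close> be the radial projection onto the sphere bundle, \<open>s\<close> the zero section and \<open>\<chi>\<close> a radial cutoff equal to \<open>1\<close>
far out.  Then \<open>(u, \<alpha>) \<mapsto> \<pi>\<^sup>*u + d(\<chi> r\<^sup>*\<alpha>)\<close> has compact support, and an inverse up to homotopy is
\<open>\<omega> \<mapsto> (s\<^sup>*\<omega>, K\<omega>)\<close>, where \<open>K\<close> integrates \<open>\<omega>\<close> along the rays.\<close>

notation (input) iff (infixr "<->" 25) and scaleR (infixr "*R" 75) and has_real_derivative (infix "hrd" 50)
abbreviation "mopen M V == openin (mfd_topology M) V"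
abbreviation "ropen S V == openin (top_of_set S) V"
abbreviation "tos == top_of_set"
abbreviation "mtop == mfd_topology"
abbreviation "car == carrier_of"
abbreviation "atl == smooth_atlas"
abbreviation "rtan == rep_tangent"
abbreviation "pb == pullback"
abbreviation "lrep == local_rep"
abbreviation "ddv == dir_deriv"
abbreviation "bmf == boundary_mfd"
abbreviation "cim c == cimage c"
lemmas op_sub = openin_imp_subset and cont_prodI = continuous_on_coordinatewise_then_product and cont_comp = continuous_on_compose2 and sfun_def = scaleR_fun_def and zfun_def = zero_fun_def and hrd_iff = has_real_derivative_iff_has_vector_derivative and cpt_iff = compactin_euclidean_iff and cont_pre = continuous_openin_preimage and hrd_within = has_field_derivative_at_within and hrd_cong = has_field_derivative_cong_ev and car_def = carrier_of_def and atl_def = smooth_atlas_def and lrep_def = local_rep_def and ddv_def = dir_deriv_def and pb_def = pullback_def and tmap_def = tangent_map_def and rm_def = restrict_mfd_def and tot_def = total_mfd_def and vb_def = vector_bundle_def and sch_def = sphere_chart_def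

section \<open>Calculus on open subsets of Euclidean space\<close>

lemma Euclidean_space_top: "Euclidean_space n = tos (Rn n)"
 by (simp add: Euclidean_space_def topspace_Euclidean_space euclidean_product_topology)

lemma Rn_iff: "x:Rn n <-> (ALL i>=n. x i = 0)" by (simp add: topspace_Euclidean_space)

lemma Rn_upd [simp]: "i < n ==> x(i := t):Rn n <-> x:Rn n" by (auto simp: Rn_iff)

definition cube :: "nat => rvec => real => rvec set" where
 "cube n x dl = {y:Rn n. ALL i<n. \<bar>y i - x i\<bar> < dl}"

lemma open_box: "open {y::rvec. ALL i<n. \<bar>y i - x i\<bar> < dl}"
proof -
 have "{y::rvec. ALL i<n. \<bar>y i - x i\<bar> < dl} = {y. ALL i:{..<n}. y i:ball (x i) dl}" by (auto simp: dist_real_def abs_minus_commute)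
 thus ?thesis using product_topology_basis'[of "{..<n}" "%i. ball (x i) dl" "%i. i"] by simp
qed

lemma openin_cubeD:
 assumes "ropen S U" "S <= Rn n" "x:U"
 shows "EX dl>0. cube n x dl Int S <= U"
proof -
 obtain T where T: "open T" "U = S Int T" using assms(1) by (auto simp: openin_open)
 have "x:T" using assms(3) T by auto
 obtain X where X: "x:Pi\<^sub>E UNIV X" "!!i. open (X i)" "finite {i. X i ~= UNIV}" "Pi\<^sub>E UNIV X <= T"
 using product_topology_open_contains_basis[of "%i. euclidean" UNIV T x] T `x:T` by (auto simp: open_fun_def)
 have "ALL i. EX d>0. ball (x i) d <= X i" using X(1,2) by (intro allI) (metis PiE_mem UNIV_I openE)
 then obtain d where d: "!!i. d i > 0" "!!i. ball (x i) (d i) <= X i" by metis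
 define dl where "dl = Min (insert 1 (d ` {i. X i ~= UNIV}))"
 have pos: "dl > 0" using X(3) d(1) by (auto simp: dl_def)
 have le: "dl <= d i" if "X i ~= UNIV" for i using that X(3) by (auto simp: dl_def)
 have "y:U" if "y:cube n x dl" "y:S" for y
 proof -
 have "y i:X i" for i
 proof (cases "i < n & X i ~= UNIV")
 case True
 hence "\<bar>y i - x i\<bar> < d i" using that(1) le[of i] by (force simp: cube_def)
 thus ?thesis using d(2)[of i] by (auto simp: dist_real_def abs_minus_commute)
 next
 case False
 then consider "X i = UNIV" | "i >= n" by linarith
 thus ?thesis
 proof cases
 case 2
 hence "y i = 0" "x i = 0" using that(2) assms T by (blast dest: Rn_iff[THEN iffD1])+
 thus ?thesis using PiE_mem[OF X(1), of i] by simp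
 qed simp
 qed
 hence "y:Pi\<^sub>E UNIV X" by (simp add: PiE_iff)
 thus ?thesis using X(4) T that by blast
 qed
 thus ?thesis using pos by blast
qed

lemma cube_mono: "dl <= ep ==> cube n x dl <= cube n x ep" by (force simp: cube_def)

lemma continuous_cubeD:
 fixes f :: "rvec => real"
 assumes "continuous_on S f" "S <= Rn n" "x:S" "e > 0"
 shows "EX dl>0. ALL y:S Int cube n x dl. \<bar>f y - f x\<bar> < e"
proof -
 have "ropen S (S Int f -` ball (f x) e)" using assms(1) continuous_openin_preimage_gen by blast
 moreover have "x:S Int f -` ball (f x) e" using assms(3,4) by simp
 ultimately obtain dl where "dl > 0" "cube n x dl Int S <= S Int f -` ball (f x) e" using openin_cubeD[OF _ assms(2)] by blast
 moreover have "\<bar>f y - f x\<bar> < e" if "f y:ball (f x) e" for y using that by (simp add: dist_real_def abs_minus_commute)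
 ultimately show ?thesis by (intro exI[of _ dl]) blast
qed

lemma cont_crd [continuous_intros]: "continuous_on S (%x::rvec. x i)"
 by (rule continuous_on_subset[OF continuous_on_product_coordinates subset_UNIV])

lemma slice_open:
 assumes "ropen (Rn n) U" "x:U" "i < n"
 shows "EX dl>0. ALL t. \<bar>t - x i\<bar> < dl --> x(i := t):U"
proof -
 obtain dl where d: "dl > 0" "cube n x dl Int Rn n <= U" using openin_cubeD[OF assms(1) order_refl assms(2)] by auto
 have "x:Rn n" using assms op_sub by blast
 hence "x(i := t):cube n x dl" if "\<bar>t - x i\<bar> < dl" for t using that assms(3) d(1) by (auto simp: cube_def Rn_iff)
 thus ?thesis using d by (auto simp: cube_def intro!: exI[of _ dl])
qed

lemma slice_eventually:
 assumes "ropen (Rn n) U" "x:U" "i < n"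
 shows "eventually (%t. x(i := t):U) (nhds (x i))" using slice_open[OF assms] by (auto simp: eventually_nhds_metric dist_real_def)

abbreviation has_pd :: "(rvec => real) => nat => rvec => real => bool" where
 "has_pd f i x d \<equiv> ((%t. f (x(i := t))) hrd d) (at (x i))"

lemma has_pd_cong:
 assumes "ropen (Rn n) U" "x:U" "i < n" "!!y. y:U ==> f y = g y"
 shows "has_pd f i x d <-> has_pd g i x d"
 by (rule DERIV_cong_ev) (use slice_eventually[OF assms(1-3)] assms(4) in "auto elim: eventually_mono")

fun CK :: "nat => nat => rvec set => (rvec => real) => bool" where
 "CK 0 n U f <-> continuous_on U f"
| "CK (Suc k) n U f <-> continuous_on U f &
 (EX D. ALL i<n. CK k n U (D i) & (ALL x:U. has_pd f i x (D i x)))"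

lemma CK_cont: "CK k n U f ==> continuous_on U f" by (cases k) auto

lemma CK_cong:
 assumes "ropen (Rn n) U" "!!y. y:U ==> f y = g y"
 shows "CK k n U f <-> CK k n U g"
proof (cases k)
 case 0 thus ?thesis using assms(2) by (auto intro: continuous_on_eq)
next
 case (Suc k)
 have "continuous_on U f <-> continuous_on U g" using assms(2) by (rule continuous_on_cong[OF refl])
 moreover have "has_pd f i x d <-> has_pd g i x d" if "x:U" "i < n" for i x d
 using has_pd_cong[OF assms(1) that, of f g d] assms(2) by auto
 ultimately show ?thesis unfolding Suc by (simp cong: conj_cong)
qed

lemma CK_Suc_imp: "CK (Suc k) n U f ==> CK k n U f"
proof (induction k arbitrary: f)
 case (Suc k)
 from Suc.prems obtain D where D: "continuous_on U f" "ALL i<n. CK (Suc k) n U (D i) & (ALL x:U. has_pd f i x (D i x))"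
 unfolding CK.simps(2)[of "Suc k"] by blast
 have "ALL i<n. CK k n U (D i) & (ALL x:U. has_pd f i x (D i x))" using D(2) Suc.IH by (metis (no_types, lifting))
 thus ?case unfolding CK.simps(2) using D(1) by blast
qed simp

lemma CK_subset: "CK k n U f ==> V <= U ==> CK k n V f"
proof (induction k arbitrary: f)
 case 0 thus ?case using continuous_on_subset by auto
next
 case (Suc k)
 from Suc.prems obtain D where D: "continuous_on U f" "ALL i<n. CK k n U (D i) & (ALL x:U. has_pd f i x (D i x))"
 unfolding CK.simps(2) by blast
 have "ALL i<n. CK k n V (D i) & (ALL x:V. has_pd f i x (D i x))" using D(2) Suc.IH[OF _ Suc.prems(2)] Suc.prems(2) by blast
 thus ?case unfolding CK.simps(2) using D(1) continuous_on_subset[OF D(1) Suc.prems(2)] by blast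
qed

lemma CK_const [simp]: "CK k n U (%x. c)"
 by (induction k arbitrary: c) (auto intro!: exI[of _ "%i x. 0"] continuous_intros derivative_eq_intros)

lemma CK_coord: "CK k n U (%x. x i)"
proof (cases k)
 case (Suc l)
 have "has_pd (%x. x i) j x (if j = i then 1 else 0)" for j x by auto
 thus ?thesis unfolding Suc CK.simps by (intro conjI continuous_intros exI[of _ "%j x. if j = i then 1 else 0"]) auto
qed (auto intro: continuous_intros)

lemma CK_add: "CK k n U f ==> CK k n U g ==> CK k n U (%x. f x + g x)"
proof (induction k arbitrary: f g)
 case 0 thus ?case by (auto intro: continuous_intros)
next
 case (Suc k)
 obtain D E where D: "ALL i<n. CK k n U (D i) & (ALL x:U. has_pd f i x (D i x))"
 and E: "ALL i<n. CK k n U (E i) & (ALL x:U. has_pd g i x (E i x))"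
 and "continuous_on U f" "continuous_on U g" using Suc.prems by (auto simp only: CK.simps)
 moreover have "ALL i<n. CK k n U (%x. D i x + E i x) & (ALL x:U. has_pd (%x. f x + g x) i x (D i x + E i x))"
 using D E Suc.IH by (auto intro: derivative_intros)
 ultimately show ?case unfolding CK.simps by (intro conjI continuous_intros exI[of _ "%i x. D i x + E i x"]) auto
qed

lemma CK_mult: "CK k n U f ==> CK k n U g ==> CK k n U (%x. f x * g x)"
proof (induction k arbitrary: f g)
 case 0 thus ?case by (auto intro: continuous_intros)
next
 case (Suc k)
 obtain D E where D: "ALL i<n. CK k n U (D i) & (ALL x:U. has_pd f i x (D i x))"
 and E: "ALL i<n. CK k n U (E i) & (ALL x:U. has_pd g i x (E i x))"
 and c: "continuous_on U f" "continuous_on U g" using Suc.prems by (auto simp only: CK.simps)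
 have fg: "CK k n U f" "CK k n U g" using Suc.prems CK_Suc_imp by auto
 have "ALL i<n. CK k n U (%x. D i x * g x + E i x * f x) &
 (ALL x:U. has_pd (%x. f x * g x) i x (D i x * g x + E i x * f x))"
 proof (intro allI impI conjI ballI)
 fix i x assume i: "i < n" "x:U"
 show "has_pd (%x. f x * g x) i x (D i x * g x + E i x * f x)"
 using DERIV_mult[of "%t. f (x(i:=t))" "D i x" "x i" UNIV "%t. g (x(i:=t))" "E i x"] D E i by simp
 qed (use D E fg in "auto intro!: CK_add Suc.IH")
 thus ?case unfolding CK.simps using c by (intro conjI continuous_intros exI[of _ "%i x. D i x * g x + E i x * f x"]) auto
qed

lemma CK_uminus: "CK k n U f ==> CK k n U (%x. - f x)" using CK_mult[OF CK_const[of k n U "-1"], of f] by simp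

lemma CK_diff: "CK k n U f ==> CK k n U g ==> CK k n U (%x. f x - g x)" using CK_add[OF _ CK_uminus, of k n U f g] by simp

lemma CK_sum: "(!!a. a:A ==> CK k n U (f a)) ==> CK k n U (%x. \<Sum>a\<in>A. f a x)"
 by (induction A rule: infinite_finite_induct) (auto intro: CK_add)

lemma CK_chain1:
 fixes F :: "(real => real) set"
 assumes F: "!!ph. ph:F ==> EX ps:F. ALL s:I. (ph hrd ps s) (at s)"
 shows "ph:F ==> CK k n U f ==> f ` U <= I ==> CK k n U (%x. ph (f x))"
proof (induction k arbitrary: ph)
 case 0
 obtain ps where "ALL s:I. (ph hrd ps s) (at s)" using F 0 by blast
 hence "continuous_on I ph" using DERIV_isCont continuous_at_imp_continuous_on by blast
 thus ?case using 0 by (auto intro: cont_comp[of I])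
next
 case (Suc k)
 obtain ps where ps: "ps:F" "ALL s:I. (ph hrd ps s) (at s)" using F Suc by blast
 hence c: "continuous_on I ph" using DERIV_isCont continuous_at_imp_continuous_on by blast
 obtain D where D: "ALL i<n. CK k n U (D i) & (ALL x:U. has_pd f i x (D i x))" "continuous_on U f"
 using Suc.prems by (auto simp only: CK.simps)
 have "CK k n U (%x. ps (f x))" using Suc ps CK_Suc_imp by blast
 hence "ALL i<n. CK k n U (%x. ps (f x) * D i x)" using D by (auto intro: CK_mult)
 moreover have "has_pd (%x. ph (f x)) i x (ps (f x) * D i x)" if "i < n" "x:U" for i x
 using that D(1) ps(2) Suc.prems(3) by (intro DERIV_chain2) (auto simp: image_subset_iff)
 moreover have "continuous_on U (%x. ph (f x))" using c D(2) Suc.prems(3) cont_comp by blast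
 ultimately show ?case unfolding CK.simps by (intro conjI exI[of _ "%i x. ps (f x) * D i x"]) auto
qed

lemma CK_powr:
 assumes "CK k n U f" "!!x. x:U ==> f x > 0"
 shows "CK k n U (%x. f x powr a)"
proof -
 have "EX ps:{%s::real. c * s powr a |c a. True}. ALL s:{0<..}. (ph hrd ps s) (at s)"
 if "ph:{%s. c * s powr a |c a. True}" for ph
 proof -
 obtain c a where ph: "ph = (%s. c * s powr a)" using `ph:_` by force
 hence "ALL s:{0<..}. (ph hrd (c * a) * s powr (a - 1)) (at s)" by (auto intro!: derivative_eq_intros has_real_derivative_powr)
 thus ?thesis by (intro bexI[of _ "%s. (c * a) * s powr (a - 1)"]) auto
 qed
 from CK_chain1[where F = "{%s. c * s powr a |c a. True}" and I = "{0<..}" and ph = "%s. 1 * s powr a", OF this _ assms(1)]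
 show ?thesis using assms(2) by fastforce
qed

lemma CK_sin: "CK k n U f ==> CK k n U (%x. sin (f x))"
proof -
 have "EX ps:{%s. c * sin s + d * cos s |c d. True}. ALL s:UNIV. (ph hrd ps s) (at s)"
 if "ph:{%s. c * sin s + d * cos s |c d. True}" for ph :: "real => real"
 proof -
 obtain c d where ph: "ph = (%s. c * sin s + d * cos s)" using `ph:_` by force
 have "(ph hrd (- d) * sin s + c * cos s) (at s)" for s unfolding ph by (auto intro!: derivative_eq_intros)
 thus ?thesis by (intro bexI[of _ "%s. (- d) * sin s + c * cos s"] CollectI exI[of _ "- d"] exI[of _ c]) auto
 qed
 from CK_chain1[where F = "{%s. c * sin s + d * cos s |c d. True}" and I = UNIV and ph = "%s. 1 * sin s + 0 * cos s", OF this, of k n U f]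
 moreover have "EX c d. sin = (%s::real. c * sin s + d * cos s)" by (intro exI[of _ 1] exI[of _ 0]) simp
 ultimately show "CK k n U f ==> ?thesis" by auto
qed

text \<open>All functions \<open>p(1/s) exp(-1/s)\<close> are flat at \<open>0\<close>; this class is closed under derivatives.\<close>

definition flat :: "real poly => real => real" where
 "flat p s = (if s > 0 then poly p (1/s) * exp (- (1/s)) else 0)"

lemma poly_exp_tendsto: "((%u::real. poly p u * exp (- u)) \<longlongrightarrow> 0) at_top"
proof -
 have "((%u::real. \<Sum>i\<le>degree p. coeff p i * (u ^ i / exp u)) \<longlongrightarrow> (\<Sum>i\<le>degree p. coeff p i * 0)) at_top"
 by (intro tendsto_sum tendsto_mult tendsto_const tendsto_power_div_exp_0)
 moreover have "(%u::real. \<Sum>i\<le>degree p. coeff p i * (u ^ i / exp u)) = (%u. poly p u * exp (- u))"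
 by (auto simp: fun_eq_iff poly_altdef exp_minus divide_inverse sum_distrib_right mult.assoc)
 ultimately show ?thesis by simp
qed

lemma flat_deriv: "(flat p hrd flat ((p - pderiv p) * [:0,0,1:]) s) (at s)"
proof -
 consider "s > 0" | "s < 0" | "s = 0" by linarith
 thus ?thesis
 proof cases
 case 1
 have "((%s. poly p (1/s) * exp (- (1/s))) hrd flat ((p - pderiv p) * [:0,0,1:]) s) (at s)"
 using 1 by (auto intro!: derivative_eq_intros simp: flat_def field_simps power2_eq_square)
 moreover have "eventually (%t. flat p t = poly p (1/t) * exp (- (1/t))) (nhds s)"
 using eventually_nhds_in_open[of "{0<..}" s] 1 by (auto simp: flat_def elim!: eventually_mono)
 ultimately show ?thesis by (subst DERIV_cong_ev[OF refl _ refl])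
 next
 case 2
 have "eventually (%t. flat p t = 0) (nhds s)"
 using eventually_nhds_in_open[of "{..<0}" s] 2 by (auto simp: flat_def elim!: eventually_mono)
 moreover have "((%t. 0) hrd flat ((p - pderiv p) * [:0,0,1:]) s) (at s)" using 2 by (auto simp: flat_def)
 ultimately show ?thesis by (subst DERIV_cong_ev[OF refl _ refl])
 next
 case 3
 have "((%h. flat p h / h) \<longlongrightarrow> 0) (at_right 0)"
 proof -
 have "((%h::real. poly (p * [:0,1:]) (inverse h) * exp (- inverse h)) \<longlongrightarrow> 0) (at_right 0)"
 by (rule filterlim_compose[OF poly_exp_tendsto filterlim_inverse_at_top_right])
 moreover have "eventually (%h. poly (p * [:0,1:]) (inverse h) * exp (- inverse h) = flat p h / h) (at_right 0)"
 using eventually_at_right_less[of "0::real"] by (rule eventually_mono) (simp add: flat_def divide_inverse)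
 ultimately show ?thesis by (rule Lim_transform_eventually)
 qed
 moreover have "((%h. flat p h / h) \<longlongrightarrow> 0) (at_left 0)" using eventually_at_left_field[of "%h. flat p h / h = 0" 0]
 by (intro tendsto_eventually) (auto simp: flat_def intro!: exI[of _ "-1"])
 ultimately have "((%h. flat p h / h) \<longlongrightarrow> 0) (at 0)" using filterlim_split_at by blast
 thus ?thesis using 3 by (simp add: DERIV_def flat_def)
 qed
qed

definition step :: "real => real" where
 "step s = flat 1 s * (flat 1 s + flat 1 (1 - s)) powr -1"

lemma step_den_pos: "flat 1 s + flat 1 (1 - s) > 0" by (auto simp: flat_def add_pos_nonneg add_nonneg_pos)

lemma step_props: "s <= 0 ==> step s = 0" "s >= 1 ==> step s = 1" "0 <= step s" "step s <= 1" "s > 0 ==> step s > 0"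
proof -
 have step: "step s = flat 1 s / (flat 1 s + flat 1 (1 - s))" using step_den_pos[of s] by (simp add: step_def powr_minus_divide)
 have "flat 1 s >= 0" "flat 1 (1 - s) >= 0" by (auto simp: flat_def)
 thus "0 <= step s" "step s <= 1" using step_den_pos[of s] by (auto simp: step)
 show "s > 0 ==> step s > 0" using step_den_pos[of s] by (auto simp: step flat_def)
qed (auto simp: step_def flat_def powr_minus_divide)

lemma CK_flat:
 assumes "CK k n U f"
 shows "CK k n U (%x. flat p (f x))"
proof (rule CK_chain1[where F = "range flat" and I = UNIV and ph = "flat p"])
 fix ph :: "real => real" assume "ph:range flat"
 then obtain q where "ph = flat q" by blast
 thus "EX ps:range flat. ALL s:UNIV. (ph hrd ps s) (at s)"
 using flat_deriv by (intro bexI[of _ "flat ((q - pderiv q) * [:0,0,1:])"]) simp_all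
qed (use assms in auto)

lemma CK_step: "CK k n U f ==> CK k n U (%x. step (f x))" unfolding step_def using step_den_pos
 by (intro CK_mult CK_powr CK_flat CK_add CK_diff CK_const) auto

lemma C1_approx_aux:
 assumes U: "cube n x dl <= U" "x:Rn n" and D: "!!i z. i < n ==> z:U ==> has_pd f i z (D i z)"
 and e: "!!i z. i < n ==> z:cube n x dl ==> \<bar>D i z - D i x\<bar> <= e" and y: "y:cube n x dl"
 shows "m <= n ==> \<bar>f (%i. if i < m then y i else x i) - f x - (\<Sum>i<m. D i x * (y i - x i))\<bar> <= e * (\<Sum>i<m. \<bar>y i - x i\<bar>)"
proof (induction m)
 case (Suc m)
 let ?z = "%i. if i < m then y i else x i"
 have mn: "m < n" using Suc by simp
 have d0: "dl > 0" using y mn by (force simp: cube_def)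
 have seg: "?z(m := t):cube n x dl" if "\<bar>t - x m\<bar> < dl" for t using that y d0 U(2) mn by (auto simp: cube_def Rn_iff)
 have ym: "\<bar>y m - x m\<bar> < dl" using y mn by (auto simp: cube_def)
 have der: "((%t. f (?z(m := t))) hrd D m (?z(m := t))) (at t)" if "\<bar>t - x m\<bar> < dl" for t
 using D[OF mn, of "?z(m := t)"] seg[OF that] U(1) by auto
 have step: "\<bar>f (?z(m := y m)) - f (?z(m := x m)) - D m x * (y m - x m)\<bar> <= e * \<bar>y m - x m\<bar>"
 proof -
 have "EX xi. \<bar>xi - x m\<bar> < dl & f (?z(m := y m)) - f (?z(m := x m)) = (y m - x m) * D m (?z(m := xi))"
 proof (cases "y m" "x m" rule: linorder_cases)
 case less
 obtain xi where "y m < xi" "xi < x m" "f (?z(m := x m)) - f (?z(m := y m)) = (x m - y m) * D m (?z(m := xi))"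
 using MVT2[OF less, of "%t. f (?z(m := t))" "%t. D m (?z(m := t))"] der ym by fastforce
 thus ?thesis using ym by (intro exI[of _ xi]) (auto simp: algebra_simps)
 next
 case greater
 obtain xi where "x m < xi" "xi < y m" "f (?z(m := y m)) - f (?z(m := x m)) = (y m - x m) * D m (?z(m := xi))"
 using MVT2[OF greater, of "%t. f (?z(m := t))" "%t. D m (?z(m := t))"] der ym by fastforce
 thus ?thesis using ym by (intro exI[of _ xi]) (auto simp: algebra_simps)
 qed (auto intro!: exI[of _ "x m"] simp: d0)
 then obtain xi where xi: "\<bar>xi - x m\<bar> < dl" "f (?z(m := y m)) - f (?z(m := x m)) = (y m - x m) * D m (?z(m := xi))" by blast
 have "\<bar>f (?z(m := y m)) - f (?z(m := x m)) - D m x * (y m - x m)\<bar> = \<bar>D m (?z(m := xi)) - D m x\<bar> * \<bar>y m - x m\<bar>"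
 unfolding xi(2) by (simp add: abs_mult[symmetric] algebra_simps)
 also have "\<dots> <= e * \<bar>y m - x m\<bar>" using e[OF mn seg[OF xi(1)]] by (rule mult_right_mono) simp
 finally show ?thesis .
 qed
 have z1: "?z(m := y m) = (%i. if i < Suc m then y i else x i)" by (auto simp: fun_eq_iff less_Suc_eq)
 have z2: "?z(m := x m) = ?z" by (auto simp: fun_eq_iff)
 show ?case using step Suc.IH Suc.prems unfolding z1 z2 by (simp add: algebra_simps)
qed simp

lemma C1_approx:
 assumes U: "ropen (Rn n) U" "x:U" and D: "!!i z. i < n ==> z:U ==> has_pd f i z (D i z)"
 and c: "!!i. i < n ==> continuous_on U (D i)" and "e > 0"
 shows "EX dl>0. ALL y:cube n x dl. y:U & \<bar>f y - f x - (\<Sum>i<n. D i x * (y i - x i))\<bar> <= e * (\<Sum>i<n. \<bar>y i - x i\<bar>)"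
proof -
 have sub: "U <= Rn n" using U op_sub by blast
 obtain d0 where d0: "d0 > 0" "cube n x d0 Int Rn n <= U" using openin_cubeD[OF U(1) order_refl U(2)] by blast
 have "ALL i<n. EX d>0. ALL y:U Int cube n x d. \<bar>D i y - D i x\<bar> < e" using continuous_cubeD[OF c sub U(2) `e > 0`] by blast
 then obtain d where d: "!!i. i < n ==> d i > 0" "!!i y. i < n ==> y:U Int cube n x (d i) ==> \<bar>D i y - D i x\<bar> < e" by metis
 define dl where "dl = Min (insert d0 (d ` {..<n}))"
 have dl: "dl > 0" "dl <= d0" "!!i. i < n ==> dl <= d i" using d0 d(1) by (auto simp: dl_def)
 have cu: "cube n x dl <= U" using cube_mono[OF dl(2), of n x] d0(2) by (auto simp: cube_def)
 have xn: "x:Rn n" using U sub by auto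
 show ?thesis
 proof (intro exI conjI ballI)
 fix y assume y: "y:cube n x dl"
 show "y:U" using y cu by auto
 have e': "\<bar>D i z - D i x\<bar> <= e" if "i < n" "z:cube n x dl" for i z
 proof -
 have "z:U Int cube n x (d i)" using that cu cube_mono[OF dl(3)[OF that(1)], of n x] by blast
 from d(2)[OF that(1) this] show ?thesis by simp
 qed
 have "\<bar>f (%i. if i < n then y i else x i) - f x - (\<Sum>i<n. D i x * (y i - x i))\<bar> <= e * (\<Sum>i<n. \<bar>y i - x i\<bar>)"
 by (rule C1_approx_aux[where U = U and dl = dl]) (assumption | rule cu xn D e' y order_refl)+
 moreover have "(%i. if i < n then y i else x i) = y" using y xn by (auto simp: cube_def Rn_iff fun_eq_iff)
 ultimately show "\<bar>f y - f x - (\<Sum>i<n. D i x * (y i - x i))\<bar> <= e * (\<Sum>i<n. \<bar>y i - x i\<bar>)" by simp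
 qed (rule dl)
qed

lemma curve_chain:
 assumes U: "ropen (Rn n) U" and D: "!!i z. i < n ==> z:U ==> has_pd f i z (D i z)"
 and c: "!!i. i < n ==> continuous_on U (D i)"
 and ga: "!!i. i < n ==> ((%t. ga t i) hrd v i) (at s within T)"
 and gan: "!!t. t:T ==> ga t:Rn n" and "ga s:U" and "s:T"
 shows "((%t. f (ga t)) hrd (\<Sum>i<n. v i * D i (ga s))) (at s within T)"
proof -
 define x where "x = ga s"
 define C where "C = (\<Sum>i<n. (\<bar>v i\<bar> + 1))"
 have C0: "C >= 0" unfolding C_def by (intro sum_nonneg) auto
 have lim: "((%t. (ga t i - x i) / (t - s)) \<longlongrightarrow> v i) (at s within T)" if "i < n" for i
 using ga[OF that] by (simp add: has_field_derivative_iff x_def)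
 have cont: "((%t. ga t i) \<longlongrightarrow> x i) (at s within T)" if "i < n" for i
 using DERIV_continuous[OF ga[OF that]] by (simp add: continuous_within x_def)
 have "((%t. (f (ga t) - f x) / (t - s) - (\<Sum>i<n. D i x * ((ga t i - x i) / (t - s)))) \<longlongrightarrow> 0) (at s within T)"
 proof (rule tendstoI)
 fix e :: real assume "e > 0"
 define e' where "e' = e / (C + 1)"
 have e': "e' > 0" "e' * C < e" using `e > 0` C0 by (auto simp: e'_def field_simps)
 obtain dl where dl: "dl > 0" "!!y. y:cube n x dl ==> \<bar>f y - f x - (\<Sum>i<n. D i x * (y i - x i))\<bar> <= e' * (\<Sum>i<n. \<bar>y i - x i\<bar>)"
 using C1_approx[OF U `ga s:U` D c e'(1)] unfolding x_def by blast
 have 1: "eventually (%t. ALL i:{..<n}. \<bar>ga t i - x i\<bar> < dl) (at s within T)"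
 using tendstoD[OF cont dl(1)] by (intro eventually_ball_finite) (auto simp: dist_real_def)
 have 2: "eventually (%t. ALL i:{..<n}. \<bar>(ga t i - x i) / (t - s) - v i\<bar> < 1) (at s within T)"
 using tendstoD[OF lim, of _ 1] by (intro eventually_ball_finite) (auto simp: dist_real_def)
 have 3: "eventually (%t. t:T & t ~= s) (at s within T)" by (auto simp: eventually_at_filter)
 show "eventually (%t. dist ((f (ga t) - f x) / (t - s) - (\<Sum>i<n. D i x * ((ga t i - x i) / (t - s)))) 0 < e) (at s within T)"
 using 1 2 3
 proof eventually_elim
 case (elim t)
 hence "ga t:cube n x dl" using gan by (auto simp: cube_def)
 from dl(2)[OF this] have a: "\<bar>f (ga t) - f x - (\<Sum>i<n. D i x * (ga t i - x i))\<bar> <= e' * (\<Sum>i<n. \<bar>ga t i - x i\<bar>)" .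
 have "(f (ga t) - f x) / (t - s) - (\<Sum>i<n. D i x * ((ga t i - x i) / (t - s))) = (f (ga t) - f x - (\<Sum>i<n. D i x * (ga t i - x i))) / (t - s)"
 by (simp add: diff_divide_distrib sum_divide_distrib right_diff_distrib)
 hence "\<bar>(f (ga t) - f x) / (t - s) - (\<Sum>i<n. D i x * ((ga t i - x i) / (t - s)))\<bar> <= e' * (\<Sum>i<n. \<bar>ga t i - x i\<bar>) / \<bar>t - s\<bar>"
 using a by (simp add: abs_divide divide_right_mono)
 also have "\<dots> = e' * (\<Sum>i<n. \<bar>(ga t i - x i) / (t - s)\<bar>)" by (simp add: abs_divide sum_divide_distrib[symmetric])
 also have "\<dots> <= e' * C" unfolding C_def
 proof (intro mult_left_mono sum_mono)
 fix i assume "i:{..<n}"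
 hence "\<bar>(ga t i - x i) / (t - s) - v i\<bar> < 1" using elim by blast
 thus "\<bar>(ga t i - x i) / (t - s)\<bar> <= \<bar>v i\<bar> + 1" by linarith
 qed (use e' in auto)
 also have "\<dots> < e" by (rule e')
 finally show ?case by (simp add: dist_real_def)
 qed
 qed
 moreover have "((%t. \<Sum>i<n. D i x * ((ga t i - x i) / (t - s))) \<longlongrightarrow> (\<Sum>i<n. D i x * v i)) (at s within T)"
 by (intro tendsto_sum tendsto_mult tendsto_const lim) auto
 ultimately have "((%t. (f (ga t) - f x) / (t - s) - (\<Sum>i<n. D i x * ((ga t i - x i) / (t - s))) + (\<Sum>i<n. D i x * ((ga t i - x i) / (t - s)))) \<longlongrightarrow> 0 + (\<Sum>i<n. D i x * v i)) (at s within T)"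
 by (rule tendsto_add)
 thus ?thesis by (simp add: has_field_derivative_iff x_def mult.commute)
qed

lemma continuous_on_vec:
 fixes F :: "'a::topological_space => rvec"
 assumes "!!x. x:U ==> F x:Rn m" "!!j. j < m ==> continuous_on U (%x. F x j)"
 shows "continuous_on U F"
proof (rule cont_prodI)
 fix j show "continuous_on U (%x. F x j)"
 proof (cases "j < m")
 case False
 hence "F x j = 0" if "x:U" for x using assms(1)[OF that] by (auto simp: Rn_iff)
 thus ?thesis by (subst continuous_on_cong[OF refl, where g = "%x. 0"]) auto
 qed (use assms(2) in auto)
qed

lemma has_pd_compose:
 assumes U: "ropen (Rn n) U" and V: "ropen (Rn m) V"
 and FV: "!!x. x:U ==> F x:V" and FR: "!!x. x:U ==> F x:Rn m"
 and D: "!!j. j < m ==> continuous_on V (D j)" "!!j x. j < m ==> x:V ==> has_pd h j x (D j x)"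
 and i: "i < n" "x:U" and E: "!!j. j < m ==> has_pd (%x. F x j) i x (E j)"
 shows "has_pd (%x. h (F x)) i x (\<Sum>j<m. E j * D j (F x))"
proof -
 obtain dl where dl: "dl > 0" "!!t. \<bar>t - x i\<bar> < dl ==> x(i := t):U" using slice_open[OF U i(2,1)] by blast
 define T where "T = {x i - dl <..< x i + dl}"
 have T: "open T" "x i:T" using dl(1) by (auto simp: T_def)
 have "((%t. h ((%t. F (x(i := t))) t)) hrd (\<Sum>j<m. E j * D j ((%t. F (x(i := t))) (x i)))) (at (x i) within T)"
 proof (rule curve_chain[OF V D(2) D(1)])
 fix t assume "t:T"
 hence "\<bar>t - x i\<bar> < dl" by (simp add: T_def abs_less_iff)
 thus "F (x(i := t)):Rn m" using dl(2)[of t] FR by simp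
 next
 fix j assume "j < m"
 from E[OF this] show "((%t. F (x(i := t)) j) hrd E j) (at (x i) within T)" by (rule hrd_within)
 next
 show "F (x(i := x i)):V" using FV[OF i(2)] by simp
 qed (assumption | rule T)+
 thus ?thesis by (simp add: at_within_open[OF T(2,1)])
qed

lemma CK_compose:
 assumes U: "ropen (Rn n) U" and V: "ropen (Rn m) V"
 and FV: "!!x. x:U ==> F x:V" and FR: "!!x. x:U ==> F x:Rn m"
 shows "CK k m V h ==> (!!j. j < m ==> CK k n U (%x. F x j)) ==> CK k n U (%x. h (F x))"
proof (induction k arbitrary: h)
 case 0
 have "continuous_on U F" by (rule continuous_on_vec) (use 0 FR in auto)
 thus ?case using 0 FV by (auto intro: cont_comp[of V h])
next
 case (Suc k)
 have "continuous_on U F" by (rule continuous_on_vec) (use CK_cont[OF Suc.prems(2)] FR in auto)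
 hence cc: "continuous_on U (%x. h (F x))" using CK_cont[OF Suc.prems(1)] FV cont_comp[of V h U F] by (simp add: image_subset_iff)
 obtain D where D: "!!i. i < m ==> CK k m V (D i)" "!!i x. i < m ==> x:V ==> has_pd h i x (D i x)"
 using Suc.prems(1) unfolding CK.simps by blast
 have "ALL j. EX E. j < m --> (ALL i<n. CK k n U (E i) & (ALL x:U. has_pd (%x. F x j) i x (E i x)))"
 using Suc.prems(2) unfolding CK.simps by blast
 then obtain E where E: "!!i j. j < m ==> i < n ==> CK k n U (E j i)"
 "!!i j x. j < m ==> i < n ==> x:U ==> has_pd (%x. F x j) i x (E j i x)" by metis
 have 1: "CK k n U (%x. \<Sum>j<m. E j i x * D j (F x))" if "i < n" for i
 using that E(1) Suc.IH D(1) Suc.prems(2) CK_Suc_imp by (intro CK_sum CK_mult) auto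
 have 2: "has_pd (%x. h (F x)) i x (\<Sum>j<m. E j i x * D j (F x))" if i: "i < n" "x:U" for i x
 by (rule has_pd_compose[where E = "%j. E j i x", OF U V FV FR CK_cont[OF D(1)] D(2) i E(2)[OF _ i]])
 show ?case unfolding CK.simps using cc 1 2 by (intro conjI exI[of _ "%i x. \<Sum>j<m. E j i x * D j (F x)"]) auto
qed

lemma mixed_quotient:
 assumes h: "h > 0" and ij: "i ~= j" and U: "!!s t. 0 <= s ==> s <= h ==> 0 <= t ==> t <= h ==> x(i := x i + s, j := x j + t):U"
 and D: "!!z. z:U ==> has_pd f i z (Di z)" "!!z. z:U ==> has_pd Di j z (Dij z)"
 defines "F \<equiv> %s t. f (x(i := x i + s, j := x j + t))"
 shows "EX s t. 0 < s & s < h & 0 < t & t < h & F h h - F h 0 - (F 0 h - F 0 0) = h * (h * Dij (x(i := x i + s, j := x j + t)))"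
proof -
 let ?x = "%s t. x(i := x i + s, j := x j + t)"
 have di: "((%s. f (?x s t)) hrd Di (?x s t)) (at s)" if "0 <= s" "s <= h" "0 <= t" "t <= h" for s t
 proof -
 have "((%u. f ((?x s t)(i := u))) hrd Di (?x s t)) (at (x i + s))" using D(1)[OF U[OF that]] ij by auto
 hence "((%s'. f ((?x s t)(i := s' + x i))) hrd Di (?x s t)) (at s)" by (subst (asm) add.commute) (simp only: DERIV_shift)
 moreover have "(?x s t)(i := s' + x i) = ?x s' t" for s' using ij by (auto simp: fun_eq_iff)
 ultimately show ?thesis by simp
 qed
 have dij: "((%t. Di (?x s t)) hrd Dij (?x s t)) (at t)" if "0 <= s" "s <= h" "0 <= t" "t <= h" for s t
 proof -
 have "((%u. Di ((?x s t)(j := u))) hrd Dij (?x s t)) (at (x j + t))" using D(2)[OF U[OF that]] by auto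
 thus ?thesis by (subst (asm) add.commute) (simp add: DERIV_shift add.commute)
 qed
 have "EX s>0. s < h & (f (?x h h) - f (?x h 0)) - (f (?x 0 h) - f (?x 0 0)) = (h - 0) * (Di (?x s h) - Di (?x s 0))"
 by (rule MVT2[OF h, of "%s. f (?x s h) - f (?x s 0)"]) (intro DERIV_diff di; use h in simp)
 then obtain s where s: "0 < s" "s < h" "F h h - F h 0 - (F 0 h - F 0 0) = h * (Di (?x s h) - Di (?x s 0))" by (auto simp: F_def)
 have "EX t>0. t < h & Di (?x s h) - Di (?x s 0) = (h - 0) * Dij (?x s t)" by (rule MVT2[OF h]) (intro dij; use s in simp)
 thus ?thesis using s by auto
qed

lemma second_partials_commute:
 assumes U: "ropen (Rn n) U" "x:U" and ij: "i < n" "j < n"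
 and D: "!!z. z:U ==> has_pd f i z (Di z)" "!!z. z:U ==> has_pd f j z (Dj z)"
 and DD: "!!z. z:U ==> has_pd Di j z (Dij z)" "!!z. z:U ==> has_pd Dj i z (Dji z)"
 and c: "continuous_on U Dij" "continuous_on U Dji"
 shows "Dij x = Dji x"
proof (cases "i = j")
 case True
 have "Di z = Dj z" if "z:U" for z using D that DERIV_unique True by blast
 hence "has_pd Di i x d <-> has_pd Dj i x d" for d using has_pd_cong[OF U(1,2) ij(1)] by blast
 thus ?thesis using DD U(2) True DERIV_unique by blast
next
 case False
 show ?thesis
 proof (rule ccontr)
 assume ne: "Dij x ~= Dji x"
 define e where "e = \<bar>Dij x - Dji x\<bar> / 2"
 have "e > 0" using ne by (simp add: e_def)
 have sub: "U <= Rn n" using U op_sub by blast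
 obtain d1 where d1: "d1 > 0" "!!y. y:U Int cube n x d1 ==> \<bar>Dij y - Dij x\<bar> < e"
 using continuous_cubeD[OF c(1) sub U(2) `e > 0`] by blast
 obtain d2 where d2: "d2 > 0" "!!y. y:U Int cube n x d2 ==> \<bar>Dji y - Dji x\<bar> < e"
 using continuous_cubeD[OF c(2) sub U(2) `e > 0`] by blast
 obtain d0 where d0: "d0 > 0" "cube n x d0 Int Rn n <= U" using openin_cubeD[OF U(1) order_refl U(2)] by blast
 define h where "h = Min {d0, d1, d2} / 2"
 have h: "h > 0" "h < d0" "h < d1" "h < d2" using d0 d1 d2 by (auto simp: h_def)
 have xn: "x:Rn n" using U sub by auto
 let ?x = "%s t. x(i := x i + s, j := x j + t)"
 have cu: "?x s t:U Int cube n x d1 Int cube n x d2" if "0 <= s" "s <= h" "0 <= t" "t <= h" for s t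
 proof -
 have "?x s t:cube n x r" if "h < r" for r using that `0 <= s` `s <= h` `0 <= t` `t <= h` h(1) xn ij by (auto simp: cube_def Rn_iff)
 thus ?thesis using h d0(2) by (auto simp: cube_def)
 qed
 have sw: "x(j := x j + t, i := x i + s) = ?x s t" for s t using False by (auto simp: fun_eq_iff)
 obtain s t where st: "0 < s" "s < h" "0 < t" "t < h" "f (?x h h) - f (?x h 0) - (f (?x 0 h) - f (?x 0 0)) = h * (h * Dij (?x s t))"
 using mixed_quotient[where U = U, OF h(1) False _ D(1) DD(1)] cu by blast
 obtain s' t' where st': "0 < s'" "s' < h" "0 < t'" "t' < h" "f (?x h h) - f (?x 0 h) - (f (?x h 0) - f (?x 0 0)) = h * (h * Dji (?x t' s'))"
 using mixed_quotient[where U = U and x = x, OF h(1) False[symmetric] _ D(2) DD(2)] cu unfolding sw by blast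
 have "h * (h * Dij (?x s t)) = h * (h * Dji (?x t' s'))" using st(5) st'(5) by linarith
 hence "Dij (?x s t) = Dji (?x t' s')" using h(1) by simp
 moreover have "\<bar>Dij (?x s t) - Dij x\<bar> < e" by (rule d1(2)) (use cu[of s t] st in auto)
 moreover have "\<bar>Dji (?x t' s') - Dji x\<bar> < e" by (rule d2(2)) (use cu[of t' s'] st' in auto)
 ultimately show False unfolding e_def by (auto simp: abs_if split: if_splits)
 qed
qed

section \<open>Smooth functions on relatively open subsets of quadrants\<close>

lemma pd_open:
 assumes "ropen (Rn n) U" "x:U" "i < n" "has_pd f i x d"
 shows "pd U i f x = d"
proof -
 obtain dl where dl: "dl > 0" "!!t. \<bar>t - x i\<bar> < dl ==> x(i := t):U" using slice_open[OF assms(1-3)] by blast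
 have "x i:interior {t. x(i := t):U}"
 proof (rule interiorI[of "{x i - dl <..< x i + dl}"])
 show "{x i - dl <..< x i + dl} <= {t. x(i := t):U}"
 proof
 fix t assume "t:{x i - dl <..< x i + dl}"
 hence "\<bar>t - x i\<bar> < dl" by (simp add: abs_less_iff)
 thus "t:{t. x(i := t):U}" using dl(2) by simp
 qed
 qed (use dl in auto)
 hence "pd U i f x = vector_derivative (%t. f (x(i := t))) (at (x i))" unfolding pd_def by (simp only: at_within_interior)
 thus ?thesis using vector_derivative_at[OF iffD1[OF hrd_iff assms(4)]] by (rule trans)
qed

lemma continuous_map_Rn:
 assumes "ropen (Rn n) U"
 shows "continuous_map (subtopology (Euclidean_space n) U) euclideanreal g <-> continuous_on U g" using op_sub[OF assms]
 by (subst Euclidean_space_top) (simp add: subtopology_subtopology continuous_map_iff_continuous Int_absorb1)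

lemma smooth_openD:
 assumes "smooth_open n U f" "js:lists {..<n}"
 shows "continuous_on U (foldr (pd U) js f)" "x:U ==> i < n ==> (%t. foldr (pd U) js f (x(i := t))) differentiable (at (x i))"
proof -
 have U: "ropen (Rn n) U" using assms(1) by (simp add: smooth_open_def Euclidean_space_top[symmetric])
 have *: "continuous_map (subtopology (Euclidean_space n) U) euclideanreal (foldr (pd U) js f) &
 (ALL x:U. ALL i<n. (%t. foldr (pd U) js f (x(i := t))) differentiable (at (x i)))" using assms unfolding smooth_open_def Let_def by blast
 show "continuous_on U (foldr (pd U) js f)" using * continuous_map_Rn[OF U] by simp
 show "x:U ==> i < n ==> (%t. foldr (pd U) js f (x(i := t))) differentiable (at (x i))" using * by simp
qed

lemma smooth_open_imp_CK: "smooth_open n U f ==> CK k n U f"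
proof (induction k arbitrary: f)
 case (0 f)
 thus ?case using smooth_openD(1)[of n U f "[]"] by simp
next
 case (Suc k f)
 have U: "ropen (Rn n) U" using Suc.prems by (simp add: smooth_open_def Euclidean_space_top[symmetric])
 have c: "continuous_on U f" using smooth_openD(1)[OF Suc.prems, of "[]"] by simp
 have "smooth_open n U (pd U i f)" if "i < n" for i unfolding smooth_open_def Let_def
 proof (intro conjI ballI allI impI)
 fix js assume "js:lists {..<n}"
 hence js: "js @ [i]:lists {..<n}" using that by simp
 show "continuous_map (subtopology (Euclidean_space n) U) euclideanreal (foldr (pd U) js (pd U i f))"
 using smooth_openD(1)[OF Suc.prems js] continuous_map_Rn[OF U] by simp
 fix x j assume "x:U" "j < n"
 thus "(%t. foldr (pd U) js (pd U i f) (x(j := t))) differentiable at (x j)" using smooth_openD(2)[OF Suc.prems js] by simp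
 qed (use U in "simp add: Euclidean_space_top[symmetric]")
 hence 1: "CK k n U (pd U i f)" if "i < n" for i using Suc.IH that by blast
 have 2: "has_pd f i x (pd U i f x)" if "i < n" "x:U" for i x
 proof -
 have "(%t. f (x(i := t))) differentiable (at (x i))" using smooth_openD(2)[OF Suc.prems, of "[]"] that by simp
 then obtain d where d: "has_pd f i x d" by (auto simp: real_differentiable_def)
 show ?thesis using pd_open[OF U that(2,1) d] d by simp
 qed
 show ?case unfolding CK.simps by (intro conjI exI[of _ "%i. pd U i f"] c allI impI ballI 1 2)
qed

lemma CK_pd:
 assumes U: "ropen (Rn n) U" and i: "i < n" and f: "!!k. CK k n U f"
 shows "CK k n U (pd U i f)" "x:U ==> has_pd f i x (pd U i f x)"
proof -
 have *: "EX D. CK k n U D & (ALL x:U. has_pd f i x (D x))" for k using f[of "Suc k"] i by auto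
 then obtain D where D: "CK k n U D" "ALL x:U. has_pd f i x (D x)" by blast
 hence eq: "pd U i f x = D x" if "x:U" for x using pd_open[OF U that i] that by blast
 show "CK k n U (pd U i f)" using CK_cong[of n U "pd U i f" D k, OF U eq] D(1) by blast
 show "x:U ==> has_pd f i x (pd U i f x)" using D eq by auto
qed

lemma smooth_open_iff: "smooth_open n U f <-> ropen (Rn n) U & (ALL k. CK k n U f)"
proof safe
 assume "smooth_open n U f"
 thus "ropen (Rn n) U" by (simp add: smooth_open_def Euclidean_space_top[symmetric])
next
 fix k assume "smooth_open n U f" thus "CK k n U f" by (rule smooth_open_imp_CK)
next
 assume U: "ropen (Rn n) U" and f: "ALL k. CK k n U f"
 have *: "ALL k. CK k n U (foldr (pd U) js f)" if "js:lists {..<n}" for js using that by (induction js) (use f CK_pd(1)[OF U] in auto)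
 show "smooth_open n U f" unfolding smooth_open_def Let_def
 proof (intro conjI ballI allI impI)
 fix js assume js: "js:lists {..<n}"
 show "continuous_map (subtopology (Euclidean_space n) U) euclideanreal (foldr (pd U) js f)"
 using CK_cont[OF *[OF js, rule_format]] continuous_map_Rn[OF U] by simp
 fix x i assume "x:U" "i < n"
 hence "has_pd (foldr (pd U) js f) i x (pd U i (foldr (pd U) js f) x)" using CK_pd(2)[OF U _ *[OF js, rule_format]] by blast
 thus "(%t. foldr (pd U) js f (x(i := t))) differentiable at (x i)" by (auto simp: real_differentiable_def)
 qed (use U in "simp add: Euclidean_space_top[symmetric]")
qed

lemma openin_preimage:
 fixes f :: "rvec => 'b::topological_space"
 assumes "ropen S U" "continuous_on U f" "open A"
 shows "ropen S {x:U. f x:A}"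
proof -
 have "ropen U (U Int f -` A)" using assms(2,3) continuous_openin_preimage_gen by metis
 hence "ropen S (U Int f -` A)" using assms(1) openin_trans by metis
 moreover have "U Int f -` A = {x:U. f x:A}" by blast
 ultimately show ?thesis by simp
qed

definition smpt :: "nat => rvec set => (rvec => real) => rvec => bool" where
 "smpt n S f x <-> (EX U g. x:U & smooth_open n U g & (ALL y:S Int U. g y = f y))"

lemma smooth_fun_pt: "smooth_fun n S f <-> (ALL x:S. smpt n S f x)" by (simp add: smooth_fun_def smpt_def)

lemma smptI: "x:U ==> ropen (Rn n) U ==> (!!k. CK k n U g) ==> (!!y. y:S ==> y:U ==> g y = f y) ==> smpt n S f x"
 unfolding smpt_def smooth_open_iff by blast

lemma smptE:
 assumes "smpt n S f x"
 shows "EX U g. x:U & ropen (Rn n) U & (ALL k. CK k n U g) & (ALL y:S Int U. g y = f y)"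
 using assms unfolding smpt_def smooth_open_iff by blast

lemma smpt_cong:
 assumes "ropen (Rn n) V" "x:V" "!!y. y:S ==> y:V ==> f y = f' y" "smpt n S f x"
 shows "smpt n S f' x"
proof -
 obtain U g where g: "x:U" "ropen (Rn n) U" "!!k. CK k n U g" "!!y. y:S ==> y:U ==> g y = f y" using smptE[OF assms(4)] by blast
 show ?thesis by (rule smptI[of x "U Int V" n g]) (use g assms CK_subset[OF g(3)] in "auto intro: openin_Int")
qed

lemma smpt_mono: "smpt n S f x ==> S' <= S ==> smpt n S' f x" unfolding smpt_def by blast

lemma smpt_local:
 assumes "smpt n S' f x" "ropen S S'" "S <= Rn n" "x:S'"
 shows "smpt n S f x"
proof -
 obtain U g where g: "x:U" "ropen (Rn n) U" "!!k. CK k n U g" "!!y. y:S' ==> y:U ==> g y = f y" using smptE[OF assms(1)] by blast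
 obtain V where V: "open V" "S' = S Int V" using assms(2) by (auto simp: openin_open)
 show ?thesis by (rule smptI[of x "U Int (Rn n Int V)" n g])
 (use g V assms CK_subset[OF g(3)] in "auto intro: openin_Int openin_open_Int")
qed

lemma smpt_const [simp]: "x:Rn n ==> smpt n S (%x. c) x" by (rule smptI[of x "Rn n"]) auto

lemma smpt_coord [simp]: "x:Rn n ==> smpt n S (%x. x i) x" by (rule smptI[of x "Rn n"]) (auto intro: CK_coord)

lemma smpt_binop:
 assumes "!!U a b k. CK k n U a ==> CK k n U b ==> CK k n U (%x. h (a x) (b x))"
 and "smpt n S f x" "smpt n S g x"
 shows "smpt n S (%x. h (f x) (g x)) x"
proof -
 obtain U f' where f: "x:U" "ropen (Rn n) U" "!!k. CK k n U f'" "!!y. y:S ==> y:U ==> f' y = f y" using smptE[OF assms(2)] by blast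
 obtain V g' where g: "x:V" "ropen (Rn n) V" "!!k. CK k n V g'" "!!y. y:S ==> y:V ==> g' y = g y" using smptE[OF assms(3)] by blast
 show ?thesis by (rule smptI[of x "U Int V" n "%x. h (f' x) (g' x)"])
 (use f g assms(1)[OF CK_subset[OF f(3)] CK_subset[OF g(3)]] in "auto intro: openin_Int")
qed

lemma smpt_add: "smpt n S f x ==> smpt n S g x ==> smpt n S (%x. f x + g x) x" by (rule smpt_binop) (rule CK_add)

lemma smpt_mult: "smpt n S f x ==> smpt n S g x ==> smpt n S (%x. f x * g x) x" by (rule smpt_binop) (rule CK_mult)

lemma smpt_diff: "smpt n S f x ==> smpt n S g x ==> smpt n S (%x. f x - g x) x" by (rule smpt_binop) (rule CK_diff)

lemma smpt_sin: "smpt n S f x ==> smpt n S (%x. sin (f x)) x" by (rule smpt_binop[where h = "%a b. sin a"]) (auto intro: CK_sin)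

lemma smpt_step: "smpt n S f x ==> smpt n S (%x. step (f x)) x" by (rule smpt_binop[where h = "%a b. step a"]) (auto intro: CK_step)

lemma smpt_sum: "x:Rn n ==> (!!a. a:A ==> smpt n S (f a) x) ==> smpt n S (%x. \<Sum>a\<in>A. f a x) x"
 by (induction A rule: infinite_finite_induct) (auto intro: smpt_add)

lemma smpt_unop:
 assumes "!!U a k. ropen (Rn n) U ==> CK k n U a ==> a ` U <= A ==> CK k n U (%x. h (a x))" "open A"
 and "smpt n S f x" "f x:A" "x:S"
 shows "smpt n S (%x. h (f x)) x"
proof -
 obtain U f' where f: "x:U" "ropen (Rn n) U" "!!k. CK k n U f'" "!!y. y:S ==> y:U ==> f' y = f y" using smptE[OF assms(3)] by blast
 let ?V = "{x:U. f' x:A}"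
 have V: "ropen (Rn n) ?V" using openin_preimage[OF f(2) CK_cont[OF f(3)[of 0]] assms(2)] .
 show ?thesis by (rule smptI[of x ?V n "%x. h (f' x)"])
 (use f V assms(4,5) in "auto intro!: assms(1) CK_subset[OF f(3)]")
qed

lemma smpt_powr:
 assumes "smpt n S f x" "x:S" "f x > 0" and h: "!!s. s > 0 ==> h s = s powr a"
 shows "smpt n S (%x. h (f x)) x"
proof (rule smpt_unop[where A = "{0<..}" and h = h and f = f])
 fix U g k assume U: "ropen (Rn n) U" "CK k n U g" and p: "g ` U <= {0<..}"
 hence "CK k n U (%x. g x powr a)" by (intro CK_powr) auto
 moreover have "h (g y) = g y powr a" if "y:U" for y using p h that by auto
 ultimately show "CK k n U (%x. h (g x))" using CK_cong[OF U(1), of "%x. h (g x)" "%x. g x powr a" k] by simp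
qed (use assms in auto)

lemma smpt_divide:
 assumes "smpt n S f x" "smpt n S g x" "x:S" "g x > 0"
 shows "smpt n S (%x. f x / g x) x" unfolding divide_inverse
 using smpt_powr[OF assms(2-4), of inverse "-1"] assms by (intro smpt_mult) (auto simp: powr_minus_divide inverse_eq_divide)

lemma smpt_sqrt: "smpt n S f x ==> x:S ==> f x > 0 ==> smpt n S (%x. sqrt (f x)) x"
 using smpt_powr[of n S f x sqrt "1 / 2"] by (simp add: powr_half_sqrt)

definition quad :: "nat => nat => rvec set" where
 "quad n m = {x:Rn n. ALL i<m. 0 <= x i}"

lemma cmodel_top: "cmodel c = tos (quad (cdim c) (ccor c))" unfolding cmodel_def
 by (subst Euclidean_space_top) (simp add: subtopology_subtopology quad_def Collect_conj_eq)

definition qopen :: "nat => rvec set => bool" where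
 "qopen n S <-> (EX m. ropen (quad n m) S)"

lemma qopen_Rn: "qopen n S ==> S <= Rn n" by (auto simp: qopen_def quad_def dest!: op_sub)

lemma qopen_openin: "qopen n S ==> ropen S S' ==> qopen n S'" unfolding qopen_def by (metis openin_trans)

lemma qopen_thick:
 assumes "qopen n S" "x:S" "i < n"
 shows "at (x i) within {t. x(i := t):S} ~= bot"
proof -
 obtain m where m: "ropen (quad n m) S" using assms(1) by (auto simp: qopen_def)
 have xq: "x:quad n m" using m assms op_sub by blast
 obtain dl where dl: "dl > 0" "cube n x dl Int quad n m <= S" using openin_cubeD[OF m _ assms(2), of n] by (auto simp: quad_def)
 have "{x i <..< x i + dl} <= {t. x(i := t):S}"
 proof
 fix t assume t: "t:{x i <..< x i + dl}"
 hence "x(i := t):cube n x dl Int quad n m" using xq assms(3) dl(1) by (auto simp: cube_def quad_def Rn_iff)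
 thus "t:{t. x(i := t):S}" using dl(2) by auto
 qed
 moreover have "x i islimpt {x i <..< x i + dl}" using dl(1) by (intro islimpt_greaterThanLessThan1) simp
 ultimately show ?thesis by (metis islimpt_subset trivial_limit_within)
qed

abbreviation has_pdw :: "rvec set => (rvec => real) => nat => rvec => real => bool" where
 "has_pdw S f i x d \<equiv> ((%t. f (x(i := t))) hrd d) (at (x i) within {t. x(i := t):S})"

lemma pd_eqI:
 assumes "qopen n S" "x:S" "i < n" "has_pdw S f i x d"
 shows "pd S i f x = d" unfolding pd_def using assms(4) by (intro vector_derivative_within qopen_thick[OF assms(1-3)]) (simp add: hrd_iff)

lemma has_pdw_ext:
 assumes S: "qopen n S" "x:S" "i < n" and U: "x:U" "ropen (Rn n) U"
 and g: "has_pd g i x d" and eq: "!!y. y:S ==> y:U ==> g y = f y"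
 shows "has_pdw S f i x d"
proof -
 have "has_pdw S g i x d" using g by (rule hrd_within)
 moreover have "\<forall>\<^sub>F t in nhds (x i). t:{t. x(i := t):S} --> g (x(i := t)) = f (x(i := t))"
 using slice_eventually[OF U(2,1) S(3)] eq by (auto elim!: eventually_mono)
 ultimately show ?thesis using S by (subst (asm) hrd_cong[OF refl _ refl refl]) auto
qed

lemma pd_ext:
 assumes S: "qopen n S" "x:S" "i < n" and U: "x:U" "ropen (Rn n) U"
 and g: "!!k. CK k n U g" and eq: "!!y. y:S ==> y:U ==> g y = f y"
 shows "pd S i f x = pd U i g x" by (rule pd_eqI[OF S has_pdw_ext[OF S U CK_pd(2)[OF U(2) S(3) g U(1)] eq]])

lemma has_pdw:
 assumes S: "qopen n S" "x:S" "i < n" and f: "smpt n S f x"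
 shows "has_pdw S f i x (pd S i f x)"
proof -
 obtain U g where g: "x:U" "ropen (Rn n) U" "!!k. CK k n U g" "!!y. y:S ==> y:U ==> g y = f y" using smptE[OF f] by blast
 have e: "pd S i f x = pd U i g x" by (rule pd_ext[OF S g])
 show ?thesis unfolding e by (rule has_pdw_ext[OF S g(1,2) CK_pd(2)[OF g(2) S(3) g(3,1)] g(4)])
qed

lemma smpt_pd:
 assumes S: "qopen n S" "i < n" and f: "smpt n S f x"
 shows "smpt n S (pd S i f) x"
proof -
 obtain U g where g: "x:U" "ropen (Rn n) U" "!!k. CK k n U g" "!!y. y:S ==> y:U ==> g y = f y" using smptE[OF f] by blast
 show ?thesis by (rule smptI[OF g(1,2) CK_pd(1)[OF g(2) S(2) g(3)]]) (use pd_ext[OF S(1) _ S(2) _ g(2-4)] in auto)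
qed

lemma pd_cong:
 assumes "x:S" "i < n" "ropen (Rn n) V" "x:V" "!!y. y:S ==> y:V ==> f y = g y"
 shows "pd S i f x = pd S i g x"
proof -
 have "has_pdw S f i x d <-> has_pdw S g i x d" for d using slice_eventually[OF assms(3,4,2)] assms(1,5)
 by (intro hrd_cong) (auto elim!: eventually_mono)
 thus ?thesis unfolding pd_def vector_derivative_def hrd_iff by simp
qed

lemma pd_add:
 assumes "qopen n S" "x:S" "i < n" "smpt n S f x" "smpt n S g x"
 shows "pd S i (%x. f x + g x) x = pd S i f x + pd S i g x"
 by (rule pd_eqI[OF assms(1-3)]) (intro derivative_intros has_pdw[OF assms(1-3)] assms)

lemma pd_diff:
 assumes "qopen n S" "x:S" "i < n" "smpt n S f x" "smpt n S g x"
 shows "pd S i (%x. f x - g x) x = pd S i f x - pd S i g x"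
 by (rule pd_eqI[OF assms(1-3)]) (intro derivative_intros has_pdw[OF assms(1-3)] assms)

lemma pd_cmult:
 assumes "qopen n S" "x:S" "i < n" "smpt n S f x"
 shows "pd S i (%x. c * f x) x = c * pd S i f x" by (rule pd_eqI[OF assms(1-3)]) (intro DERIV_cmult has_pdw[OF assms(1-3)] assms)

lemma pd_const [simp]:
 assumes "qopen n S" "x:S" "i < n"
 shows "pd S i (%x. c) x = 0" by (rule pd_eqI[OF assms]) simp

lemma pd_coord:
 assumes "qopen n S" "x:S" "i < n"
 shows "pd S i (%x. x j) x = (if i = j then 1 else 0)" by (rule pd_eqI[OF assms]) auto

lemma pd_sum:
 assumes "qopen n S" "x:S" "i < n" "!!a. a:A ==> smpt n S (f a) x"
 shows "pd S i (%x. \<Sum>a\<in>A. f a x) x = (\<Sum>a\<in>A. pd S i (f a) x)"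
 by (rule pd_eqI[OF assms(1-3)]) (intro DERIV_sum has_pdw[OF assms(1-3)] assms)

lemma pd_commute:
 assumes S: "qopen n S" "x:S" and ij: "i < n" "j < n" and f: "smpt n S f x"
 shows "pd S i (pd S j f) x = pd S j (pd S i f) x"
proof -
 obtain U g where g: "x:U" "ropen (Rn n) U" "!!k. CK k n U g" "!!y. y:S ==> y:U ==> g y = f y" using smptE[OF f] by blast
 note D = CK_pd[OF g(2) _ g(3)]
 have e: "pd S k f y = pd U k g y" if "y:S" "y:U" "k < n" for k y by (rule pd_ext[OF S(1) _ _ _ g(2-4)]) (use that in auto)
 have "pd S i (pd S j f) x = pd U i (pd U j g) x" by (rule pd_ext[OF S ij(1) g(1,2) D(1)[OF ij(2)]]) (use e ij in auto)
 moreover have "pd S j (pd S i f) x = pd U j (pd U i g) x" by (rule pd_ext[OF S ij(2) g(1,2) D(1)[OF ij(1)]]) (use e ij in auto)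
 moreover have "pd U i (pd U j g) x = pd U j (pd U i g) x" by (rule second_partials_commute[OF g(2,1) ij(2,1) D(2)[OF ij(2)] D(2)[OF ij(1)]
 CK_pd(2)[OF g(2) ij(1) D(1)[OF ij(2)]] CK_pd(2)[OF g(2) ij(2) D(1)[OF ij(1)]]
 CK_cont[OF CK_pd(1)[OF g(2) ij(1) D(1)[OF ij(2)], of 0]] CK_cont[OF CK_pd(1)[OF g(2) ij(2) D(1)[OF ij(1)], of 0]]])
 ultimately show ?thesis by simp
qed

lemma chain_aux:
 assumes S: "qopen n S" "x:S" and S2: "qopen m S2" and FS: "!!y. y:S ==> F y:S2"
 and F: "!!j. j < m ==> smpt n S (%x. F x j) x" and h: "smpt m S2 h (F x)"
 shows "smpt n S (%x. h (F x)) x"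
 "i < n ==> pd S i (%x. h (F x)) x = (\<Sum>j<m. pd S i (%x. F x j) x * pd S2 j h (F x))"
proof -
 obtain V h' where h': "F x:V" "ropen (Rn m) V" "!!k. CK k m V h'" "!!y. y:S2 ==> y:V ==> h' y = h y" using smptE[OF h] by blast
 have "ALL j. EX U g. j < m --> x:U & ropen (Rn n) U & (ALL k. CK k n U g) & (ALL y:S Int U. g y = F y j)"
 using smptE[OF F] by (intro allI) (case_tac "j < m"; simp)
 from choice[OF this] obtain U where
 "ALL j. EX g. j < m --> x:U j & ropen (Rn n) (U j) & (ALL k. CK k n (U j) g) & (ALL y:S Int U j. g y = F y j)" by blast
 from choice[OF this] obtain g where
 gg: "ALL j. j < m --> x:U j & ropen (Rn n) (U j) & (ALL k. CK k n (U j) (g j)) & (ALL y:S Int U j. g j y = F y j)" by blast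
 hence g: "!!j. j < m ==> x:U j" "!!j. j < m ==> ropen (Rn n) (U j)"
 "!!j k. j < m ==> CK k n (U j) (g j)" "!!j y. j < m ==> y:S ==> y:U j ==> g j y = F y j" by simp_all
 have FR: "F y j = 0" if "y:S" "j >= m" for y j using FS[OF that(1)] qopen_Rn[OF S2] that(2) by (auto simp: Rn_iff)
 define G where "G y = (%j. if j < m then g j y else 0)" for y
 define U0 where "U0 = Rn n Int (\<Inter>j\<in>{..<m}. U j)"
 have U0: "ropen (Rn n) U0"
 proof (cases "m = 0")
 case False
 have "ropen (Rn n) (\<Inter>j\<in>{..<m}. U j)" using g(2) False by (intro openin_INT2) auto
 thus ?thesis unfolding U0_def by (intro openin_Int) auto
 qed (simp add: U0_def)
 have GR: "G y:Rn m" for y by (simp add: G_def Rn_iff)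
 have CG: "CK k n U0 (%y. G y j)" if "j < m" for k j using CK_subset[OF g(3)[OF that], of U0 k] that by (auto simp: G_def U0_def)
 have cG: "continuous_on U0 G" using CK_cont[OF CG] by (intro continuous_on_vec[of _ _ m]) (auto simp: GR)
 obtain V' where V': "open V'" "V = Rn m Int V'" using h'(2) by (auto simp: openin_open)
 define U1 where "U1 = {y:U0. G y:V'}"
 have U1: "ropen (Rn n) U1" unfolding U1_def by (rule openin_preimage[OF U0 cG V'(1)])
 have GV: "G y:V" if "y:U1" for y using that GR V' by (auto simp: U1_def)
 have GF: "G y = F y" if "y:S" "y:U0" for y using that g(4) FR by (auto simp: G_def U0_def fun_eq_iff)
 have x1: "x:U1" using S qopen_Rn[OF S(1)] g(1) GF[of x] h'(1) V' by (auto simp: U1_def U0_def)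
 have C1: "CK k n U1 (%y. h' (G y))" for k by (rule CK_compose[OF U1 h'(2) GV GR h'(3)]) (auto intro: CK_subset[OF CG] simp: U1_def)
 have eq: "h' (G y) = h (F y)" if "y:S" "y:U1" for y using that GF[of y] GV[of y] h'(4)[of "G y"] FS by (auto simp: U1_def)
 show "smpt n S (%x. h (F x)) x" by (rule smptI[OF x1 U1 C1 eq])
 assume i: "i < n"
 have Gx: "G x = F x" using GF x1 S(2) by (auto simp: U1_def)
 have "has_pd (%y. h' (G y)) i x (\<Sum>j<m. pd S i (%x. F x j) x * pd V j h' (G x))"
 proof (rule has_pd_compose[OF U1 h'(2) GV GR])
 fix j assume j: "j < m"
 show "continuous_on V (pd V j h')" using CK_cont[OF CK_pd(1)[OF h'(2) j h'(3)]] .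
 show "has_pd h' j z (pd V j h' z)" if "z:V" for z using CK_pd(2)[OF h'(2) j h'(3) that] .
 have C2: "CK k n U1 (%y. G y j)" for k using CK_subset[OF CG[OF j]] by (auto simp: U1_def)
 have "pd S i (%x. F x j) x = pd U1 i (%y. G y j) x" by (rule pd_ext[OF S i x1 U1 C2]) (use GF in "auto simp: U1_def")
 thus "has_pd (%y. G y j) i x (pd S i (%x. F x j) x)" using CK_pd(2)[OF U1 i C2 x1] by simp
 qed (use i x1 in auto)
 from pd_eqI[OF S i has_pdw_ext[OF S i x1 U1 this eq]]
 have "pd S i (%x. h (F x)) x = (\<Sum>j<m. pd S i (%x. F x j) x * pd V j h' (G x))" .
 moreover have "pd S2 j h (F x) = pd V j h' (F x)" if "j < m" for j using FS[OF S(2)] h' that by (intro pd_ext[OF S2]) auto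
 ultimately show "pd S i (%x. h (F x)) x = (\<Sum>j<m. pd S i (%x. F x j) x * pd S2 j h (F x))" using Gx by (auto intro!: sum.cong)
qed

lemmas smpt_compose = chain_aux(1)
lemmas pd_compose = chain_aux(2)

section \<open>Integrals depending on parameters\<close>

lemma has_pd_integral:
 assumes V: "ropen (Rn (Suc n)) V" and U: "ropen (Rn n) U"
 and UV: "!!x t. x:U ==> t:{a..b} ==> x(n := t):V"
 and G: "!!k. CK k (Suc n) V G" and i: "i < n" "x:U"
 shows "has_pd (%x. integral {a..b} (%t. G (x(n := t)))) i x (integral {a..b} (%t. pd V i G (x(n := t))))"
proof -
 have UR: "U <= Rn n" using U op_sub by blast
 have cn: "continuous_on (A \<times> {a..b}) (%(s, t). h ((x(i := s))(n := t)))"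
 if h: "continuous_on V h" and A: "!!s. s:A ==> x(i := s):U" for h :: "rvec => real" and A
 proof -
 have "continuous_on (A \<times> {a..b}) (%p. ((x(i := fst p))(n := snd p)) j)" for j
 by (cases "j = n"; cases "j = i") (auto intro!: continuous_intros)
 hence "continuous_on (A \<times> {a..b}) (%p. (x(i := fst p))(n := snd p))" by (rule cont_prodI)
 hence "continuous_on (A \<times> {a..b}) (%p. h ((x(i := fst p))(n := snd p)))" by (rule cont_comp[OF h]) (auto intro!: UV A)
 thus ?thesis by (simp add: case_prod_unfold)
 qed
 obtain dl where dl: "dl > 0" "!!t. \<bar>t - x i\<bar> < dl ==> x(i := t):U" using slice_open[OF U i(2,1)] by blast
 define A where "A = {x i - dl <..< x i + dl}"
 have A: "open A" "x i:A" "convex A" using dl(1) by (auto simp: A_def)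
 have AU: "x(i := s):U" if "s:A" for s
 proof -
 have "\<bar>s - x i\<bar> < dl" using that by (simp add: A_def abs_less_iff)
 thus ?thesis using dl(2) by simp
 qed
 have "((%s. integral (cbox a b) (%t. G ((x(i := s))(n := t)))) has_field_derivative
 integral (cbox a b) (%t. pd V i G ((x(i := x i))(n := t)))) (at (x i) within A)"
 proof (rule leibniz_rule_field_derivative[where fx = "%s t. pd V i G ((x(i := s))(n := t))"])
 fix s t assume s: "s:A" and t: "t:cbox a b"
 hence v: "(x(i := s))(n := t):V" using UV AU by auto
 have "has_pd G i ((x(i := s))(n := t)) (pd V i G ((x(i := s))(n := t)))" using CK_pd(2)[OF V _ G v, of i] i by auto
 moreover have "((x(i := s))(n := t))(i := u) = (x(i := u))(n := t)" for u using i by (auto simp: fun_eq_iff)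
 ultimately have "((%u. G ((x(i := u))(n := t))) has_field_derivative pd V i G ((x(i := s))(n := t))) (at s)" using i by simp
 thus "((%u. G ((x(i := u))(n := t))) has_field_derivative pd V i G ((x(i := s))(n := t))) (at s within A)" by (rule hrd_within)
 next
 fix s assume "s:A"
 hence "continuous_on ({s} \<times> {a..b}) (%(s, t). G ((x(i := s))(n := t)))" by (intro cn CK_cont[OF G]) (auto intro: AU)
 hence "continuous_on {a..b} (%t. (%(s, t). G ((x(i := s))(n := t))) (s, t))" by (rule cont_comp) (auto intro!: continuous_intros)
 hence "continuous_on {a..b} (%t. G ((x(i := s))(n := t)))" by simp
 thus "(%t. G ((x(i := s))(n := t))) integrable_on cbox a b" by (simp add: integrable_continuous_real)
 next
 have "continuous_on V (pd V i G)" using CK_cont[OF CK_pd(1)[OF V _ G, where k = 0]] i by simp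
 from cn[OF this AU] show "continuous_on (A \<times> cbox a b) (%(s, t). pd V i G ((x(i := s))(n := t)))" by simp
 qed (use A in auto)
 thus ?thesis by (simp add: at_within_open[OF A(2,1)])
qed

lemma CK_integral:
 assumes V: "ropen (Rn (Suc n)) V" and U: "ropen (Rn n) U"
 and UV: "!!x t. x:U ==> t:{a..b} ==> x(n := t):V"
 shows "(!!k. CK k (Suc n) V G) ==> CK k n U (%x. integral {a..b} (%t. G (x(n := t))))"
proof (induction k arbitrary: G)
 case (0 G)
 have "continuous_on (U \<times> cbox a b) (%p. (fst p)(n := snd p))"
 proof (rule cont_prodI)
 fix j
 have "continuous_on (U \<times> cbox a b) (%p. fst p j)"
 by (rule cont_comp[OF cont_crd[of UNIV] continuous_on_fst[OF continuous_on_id]]) simp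
 thus "continuous_on (U \<times> cbox a b) (%p. ((fst p)(n := snd p)) j)" by (cases "j = n") (auto intro!: continuous_intros)
 qed
 hence "continuous_on (U \<times> cbox a b) (%p. G ((fst p)(n := snd p)))" by (rule cont_comp[OF CK_cont[OF 0(1)]]) (auto intro!: UV)
 hence "continuous_on U (%x. integral (cbox a b) (%t. G (x(n := t))))"
 by (intro integral_continuous_on_param) (simp only: case_prod_unfold)
 thus ?case by (simp only: CK.simps box_real)
next
 case (Suc k G)
 have 1: "CK k n U (%x. integral {a..b} (%t. pd V i G (x(n := t))))" if "i < n" for i
 by (rule Suc.IH) (use CK_pd(1)[OF V _ Suc.prems] that in auto)
 have 2: "CK k n U (%x. integral {a..b} (%t. G (x(n := t))))" by (rule Suc.IH[OF Suc.prems])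
 show ?case unfolding CK.simps by (intro conjI exI[of _ "%i x. integral {a..b} (%t. pd V i G (x(n := t)))"] allI impI ballI 1
 CK_cont[OF 2] has_pd_integral[OF V U UV Suc.prems])
qed

lemma integral_line_aux:
 assumes S: "qopen n S" "x:S" and S': "qopen (Suc n) S'"
 and SS: "!!y t. y:S ==> t:{a..b} ==> y(n := t):S'"
 and G: "!!t. t:{a..b} ==> smpt (Suc n) S' G (x(n := t))" and ab: "a <= b"
 shows "EX U g. x:U & ropen (Rn n) U & (ALL k. CK k n U g) &
 (ALL y:S Int U. ((%t. G (y(n := t))) has_integral g y) {a..b}) &
 (ALL i<n. ((%t. pd S' i G (x(n := t))) has_integral pd U i g x) {a..b})"
proof -
 define Q where "Q c d U g <-> x:U & ropen (Rn n) U & (ALL k. CK k n U g) &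
 (ALL y:S Int U. ((%t. G (y(n := t))) has_integral g y) {c..d}) &
 (ALL i<n. ((%t. pd S' i G (x(n := t))) has_integral pd U i g x) {c..d})" for c d U g
 define P where "P c d <-> (a <= c --> c <= d --> d <= b --> Ex (%U. Ex (Q c d U)))" for c d
 have "P a b" using ab
 proof (induction rule: Bolzano)
 case (trans c d e)
 show ?case unfolding P_def
 proof (intro impI)
 assume le: "a <= c" "c <= e" "e <= b"
 then obtain U g V h where "Q c d U g" "Q d e V h" using trans unfolding P_def by force
 hence U: "x:U" "ropen (Rn n) U" "!!k. CK k n U g"
 "!!y. y:S ==> y:U ==> ((%t. G (y(n := t))) has_integral g y) {c..d}"
 "!!i. i < n ==> ((%t. pd S' i G (x(n := t))) has_integral pd U i g x) {c..d}"
 and V: "x:V" "ropen (Rn n) V" "!!k. CK k n V h"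
 "!!y. y:S ==> y:V ==> ((%t. G (y(n := t))) has_integral h y) {d..e}"
 "!!i. i < n ==> ((%t. pd S' i G (x(n := t))) has_integral pd V i h x) {d..e}" unfolding Q_def by auto
 have o: "ropen (Rn n) (U Int V)" using U V by auto
 have C: "CK k n (U Int V) g" "CK k n (U Int V) h" for k using CK_subset[OF U(3)] CK_subset[OF V(3)] by auto
 have p: "pd (U Int V) i (%x. g x + h x) x = pd U i g x + pd V i h x" if "i < n" for i
 by (rule pd_open[OF o]) (use that U V in "auto intro!: DERIV_add CK_pd(2)[OF U(2)] CK_pd(2)[OF V(2)]")
 show "Ex (%U. Ex (Q c e U))" unfolding Q_def
 using has_integral_combine[OF trans(3,4) U(4) V(4)] has_integral_combine[OF trans(3,4) U(5) V(5)]
 by (intro exI[of _ "U Int V"] exI[of _ "%x. g x + h x"]) (use U(1) V(1) o C p in "auto intro!: CK_add")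
 qed
 next
 case (local t0)
 obtain V g where V: "x(n := t0):V" "ropen (Rn (Suc n)) V" "!!k. CK k (Suc n) V g" "!!y. y:S' ==> y:V ==> g y = G y"
 using smptE[OF G[of t0]] local by auto
 obtain dl where dl: "dl > 0" "cube (Suc n) (x(n := t0)) dl Int Rn (Suc n) <= V" using openin_cubeD[OF V(2) order_refl V(1)] by blast
 have xR: "x:Rn n" using S qopen_Rn by blast
 define U where "U = cube n x dl"
 have "U = Rn n Int {y. ALL i<n. \<bar>y i - x i\<bar> < dl}" by (auto simp: U_def cube_def)
 hence U: "ropen (Rn n) U" using openin_open_Int[OF open_box] by simp
 have xU: "x:U" using xR dl by (auto simp: U_def cube_def)
 have UV: "y(n := t):V" if "y:U" "\<bar>t - t0\<bar> < dl" for y t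
 proof -
 have "y(n := t):cube (Suc n) (x(n := t0)) dl" using that by (auto simp: U_def cube_def Rn_iff less_Suc_eq)
 thus ?thesis using dl(2) by (auto simp: cube_def)
 qed
 show ?case unfolding P_def
 proof (intro exI[of _ dl] conjI allI impI dl(1), elim conjE)
 fix c d assume cd: "a <= c" "c <= d" "d <= b" "c <= t0" "t0 <= d" "d - c < dl"
 have UV': "y(n := t):V" if "y:U" "t:{c..d}" for y t using that cd by (intro UV) auto
 have SS': "y(n := t):S'" if "y:S" "t:{c..d}" for y t using that cd by (intro SS) auto
 let ?g = "%x. integral {c..d} (%t. g (x(n := t)))"
 have cint: "(%t. h (y(n := t))) integrable_on {c..d}" if "y:U" "continuous_on V h" for h :: "rvec => real" and y
 proof -
 have "continuous_on {c..d} (%t. (y(n := t)) j)" for j by (cases "j = n") (auto intro!: continuous_intros)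
 hence "continuous_on {c..d} (%t. y(n := t))" by (rule cont_prodI)
 hence "continuous_on {c..d} (%t. h (y(n := t)))" by (rule cont_comp[OF that(2)]) (use UV' that in auto)
 thus ?thesis by (rule integrable_continuous_real)
 qed
 have i1: "((%t. G (y(n := t))) has_integral ?g y) {c..d}" if "y:S" "y:U" for y
 using integrable_integral[OF cint[OF that(2) CK_cont[OF V(3)[of 0]]]] by (rule has_integral_eq[rotated]) (use UV' SS' V(4) that in auto)
 have i2: "((%t. pd S' i G (x(n := t))) has_integral pd U i ?g x) {c..d}" if "i < n" for i
 proof -
 have e: "pd U i ?g x = integral {c..d} (%t. pd V i g (x(n := t)))"
 by (rule pd_open[OF U xU that has_pd_integral[OF V(2) U UV' V(3) that xU]])
 have 1: "((%t. pd V i g (x(n := t))) has_integral integral {c..d} (%t. pd V i g (x(n := t)))) {c..d}"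
 by (intro integrable_integral cint xU CK_cont[OF CK_pd(1)[OF V(2) _ V(3), where k = 0]]) (use that in auto)
 have 2: "pd V i g (x(n := t)) = pd S' i G (x(n := t))" if "t:{c..d}" for t
 using pd_ext[OF S' SS'[OF S(2) that] _ UV'[OF xU that] V(2,3,4), of i] `i < n` by simp
 show ?thesis unfolding e by (rule has_integral_eq[OF 2 1])
 qed
 show "Ex (%U. Ex (Q c d U))" unfolding Q_def
 by (intro exI[of _ U] exI[of _ ?g] conjI xU U allI CK_integral[OF V(2) U UV' V(3)]) (use i1 i2 in auto)
 qed
 qed
 thus ?thesis using ab unfolding P_def Q_def by simp
qed

lemma integral_line:
 assumes S: "qopen n S" "x:S" and S': "qopen (Suc n) S'"
 and SS: "!!y t. y:S ==> t:{a..b} ==> y(n := t):S'"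
 and G: "!!t. t:{a..b} ==> smpt (Suc n) S' G (x(n := t))" and ab: "a <= b"
 shows "smpt n S (%x. integral {a..b} (%t. G (x(n := t)))) x" (is ?A)
 and "(%t. G (x(n := t))) integrable_on {a..b}" (is ?B)
 and "i < n ==> ((%t. pd S' i G (x(n := t))) has_integral pd S i (%x. integral {a..b} (%t. G (x(n := t)))) x) {a..b}" (is "_ ==> ?C")
proof -
 obtain U g where g: "x:U" "ropen (Rn n) U" "!!k. CK k n U g"
 "!!y. y:S ==> y:U ==> ((%t. G (y(n := t))) has_integral g y) {a..b}"
 "!!i. i < n ==> ((%t. pd S' i G (x(n := t))) has_integral pd U i g x) {a..b}" using integral_line_aux[OF assms] by (auto simp: Ball_def)
 have eq: "g y = integral {a..b} (%t. G (y(n := t)))" if "y:S" "y:U" for y using g(4)[OF that] by (simp add: integral_unique)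
 show ?A by (rule smptI[OF g(1-3) eq])
 show ?B using g(4)[OF S(2) g(1)] by blast
 show ?C if "i < n" unfolding pd_ext[OF S that g(1-3) eq, simplified] using g(5)[OF that] .
qed

section \<open>Alternating forms\<close>

abbreviation rem_at :: "nat => 'b list => 'b list" where
 "rem_at l vs \<equiv> take l vs @ drop (Suc l) vs"

lemma Rn_add: "v:Rn n ==> w:Rn n ==> v + w:Rn n"
 and Rn_scale: "v:Rn n ==> c *R v:Rn n"
 and Rn_zero: "0:Rn n" by (auto simp: Rn_iff sfun_def)

lemma alt_zero: "alt_form n k a ==> int (length vs) ~= k | ~ set vs <= Rn n ==> a vs = 0" by (auto simp: alt_form_def)

lemma alt_lin:
 "alt_form n k a ==> set vs <= Rn n ==> i < length vs ==> v:Rn n ==> w:Rn n ==>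
 a (vs[i := c *R v + w]) = c * a (vs[i := v]) + a (vs[i := w])" by (simp add: alt_form_def)

lemma alt_rep: "alt_form n k a ==> i < j ==> j < length vs ==> vs ! i = vs ! j ==> a vs = 0" unfolding alt_form_def by blast

lemma alt_formI:
 assumes "!!vs. int (length vs) ~= k | ~ set vs <= Rn n ==> a vs = 0"
 "!!vs i v w c. set vs <= Rn n ==> int (length vs) = k ==> i < length vs ==> v:Rn n ==> w:Rn n ==>
 a (vs[i := c *R v + w]) = c * a (vs[i := v]) + a (vs[i := w])"
 "!!vs i j. set vs <= Rn n ==> int (length vs) = k ==> i < j ==> j < length vs ==> vs ! i = vs ! j ==> a vs = 0"
 shows "alt_form n k a" unfolding alt_form_def
proof (intro conjI allI impI)
 fix vs i v w c assume *: "set vs <= Rn n & i < length vs & v:Rn n & w:Rn n"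
 show "a (vs[i := c *R v + w]) = c * a (vs[i := v]) + a (vs[i := w])"
 using assms(2)[of vs i v w c] assms(1)[of "vs[i := c *R v + w]"] assms(1)[of "vs[i := v]"] assms(1)[of "vs[i := w]"] *
 by (cases "int (length vs) = k") auto
next
 fix vs :: "rvec list" and i j assume *: "i < j & j < length vs & vs ! i = vs ! j"
 show "a vs = 0" using assms(3)[of vs i j] assms(1)[of vs] * by (cases "int (length vs) = k & set vs <= Rn n") auto
qed (use assms(1) in blast)+

lemma alt_lin0:
 assumes "alt_form n k a" "set vs <= Rn n" "v:Rn n" "w:Rn n"
 shows "a ((c *R v + w) # vs) = c * a (v # vs) + a (w # vs)" using alt_lin[OF assms(1), of "v # vs" 0 v w c] assms by simp

lemma alt_zero_vec: "alt_form n k a ==> a (0 # vs) = 0"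
proof -
 assume a: "alt_form n k a"
 show ?thesis
 proof (cases "set vs <= Rn n")
 case True thus ?thesis using alt_lin0[OF a True Rn_zero Rn_zero, of 1] by simp
 qed (use alt_zero[OF a, of "0 # vs"] in auto)
qed

lemma alt_sum0:
 assumes a: "alt_form n k a" and vs: "set vs <= Rn n" and v: "!!j. j:J ==> v j:Rn n"
 shows "a ((%i. \<Sum>j\<in>J. c j * v j i) # vs) = (\<Sum>j\<in>J. c j * a (v j # vs))" using v
proof (induction J rule: infinite_finite_induct)
 case (insert j J)
 have "(%i. \<Sum>j\<in>insert j J. c j * v j i) = c j *R v j + (%i. \<Sum>j\<in>J. c j * v j i)"
 using insert by (auto simp: fun_eq_iff sfun_def)
 moreover have "(%i. \<Sum>j\<in>J. c j * v j i):Rn n" using insert by (auto simp: Rn_iff intro!: sum.neutral)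
 ultimately show ?case using insert alt_lin0[OF a vs] by simp
qed (use alt_zero_vec[OF a, of vs] in "simp_all add: zfun_def")

definition bvec :: "nat => rvec" where "bvec i = (%j. if j = i then 1 else 0)"

lemma bvec_Rn: "i < n ==> bvec i:Rn n" by (auto simp: bvec_def Rn_iff)

lemma bvec_expand: "v:Rn n ==> v = (%i. \<Sum>j<n. v j * bvec j i)"
proof
 fix i assume "v:Rn n"
 have "(\<Sum>j<n. v j * bvec j i) = (\<Sum>j<n. if j = i then v j else 0)" by (intro sum.cong) (auto simp: bvec_def)
 also have "\<dots> = v i" using `v:Rn n` by (auto simp: Rn_iff)
 finally show "v i = (\<Sum>j<n. v j * bvec j i)" by simp
qed

lemma alt_expand0:
 assumes "alt_form n k a" "set vs <= Rn n" "v:Rn n"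
 shows "a (v # vs) = (\<Sum>j<n. v j * a (bvec j # vs))"
 using alt_sum0[OF assms(1,2), of "{..<n}" bvec v] bvec_Rn bvec_expand[OF assms(3)] by simp

lemma alt_contract:
 assumes a: "alt_form n k a" and u: "u:Rn n"
 shows "alt_form n (k - 1) (%vs. a (u # vs))"
proof (rule alt_formI)
 fix vs i v w and c :: real assume "set vs <= Rn n" "i < length vs" "v:Rn n" "w:Rn n"
 thus "a (u # vs[i := c *R v + w]) = c * a (u # vs[i := v]) + a (u # vs[i := w])" using alt_lin[OF a, of "u # vs" "Suc i" v w c] u by simp
next
 fix vs :: "rvec list" and i j assume "i < j" "j < length vs" "vs ! i = vs ! j"
 thus "a (u # vs) = 0" using alt_rep[OF a, of "Suc i" "Suc j" "u # vs"] by simp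
next
 fix vs assume "int (length vs) ~= k - 1 | ~ set vs <= Rn n"
 thus "a (u # vs) = 0" using alt_zero[OF a, of "u # vs"] by auto
qed

lemma alt_swap:
 assumes a: "alt_form n k a"
 shows "a (u # v # vs) = - a (v # u # vs)"
proof (cases "u:Rn n & v:Rn n & set vs <= Rn n")
 case True
 let ?s = "1 *R u + v"
 have s: "?s:Rn n" using True Rn_add by simp
 have r: "a (w # w # vs) = 0" for w using alt_rep[OF a, of 0 1 "w # w # vs"] by simp
 have "a (?s # ?s # vs) = a (u # ?s # vs) + a (v # ?s # vs)" using alt_lin0[OF a, of "?s # vs" u v 1] True s by simp
 also have "a (u # ?s # vs) = a (u # u # vs) + a (u # v # vs)" using alt_lin0[OF alt_contract[OF a, of u], of vs u v 1] True by simp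
 also have "a (v # ?s # vs) = a (v # u # vs) + a (v # v # vs)" using alt_lin0[OF alt_contract[OF a, of v], of vs u v 1] True by simp
 finally show ?thesis using r by simp
next
 case False
 thus ?thesis using alt_zero[OF a, of "u # v # vs"] alt_zero[OF a, of "v # u # vs"] by auto
qed

lemma alt_move: "alt_form n k a ==> a (xs @ z # ys) = (-1) ^ length xs * a (z # xs @ ys)"
proof (induction xs arbitrary: k a)
 case (Cons x xs)
 show ?case
 proof (cases "x:Rn n")
 case True
 have "a ((x # xs) @ z # ys) = (-1) ^ length xs * a (x # z # xs @ ys)" using Cons.IH[OF alt_contract[OF Cons.prems True]] by simp
 thus ?thesis using alt_swap[OF Cons.prems, of x z "xs @ ys"] by simp
 next
 case False
 thus ?thesis using alt_zero[OF Cons.prems] by auto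
 qed
qed simp

lemma alt_update:
 assumes "alt_form n k a" "l < length vs"
 shows "a (vs[l := z]) = (-1) ^ l * a (z # rem_at l vs)"
 using alt_move[OF assms(1), of "take l vs" z "drop (Suc l) vs"] assms(2) by (simp add: upd_conv_take_nth_drop)

lemma alt_map:
 assumes a: "alt_form m k a" and L: "!!v w c. v:Rn n ==> w:Rn n ==> L (c *R v + w) = c *R L v + L w"
 and R: "!!v. v:Rn n ==> L v:Rn m"
 shows "alt_form n k (%vs. if set vs <= Rn n then a (map L vs) else 0)"
proof (rule alt_formI)
 fix vs :: "rvec list" assume "int (length vs) ~= k | ~ set vs <= Rn n"
 thus "(if set vs <= Rn n then a (map L vs) else 0) = 0" using alt_zero[OF a, of "map L vs"] by auto
next
 fix vs i v w and c :: real assume *: "set vs <= Rn n" "i < length vs" "v:Rn n" "w:Rn n"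
 have "set (vs[i := z]) <= Rn n" if "z:Rn n" for z using * that set_update_subset_insert[of vs i z] by auto
 moreover have "set (map L vs) <= Rn m" using * R by auto
 ultimately show "(if set (vs[i := c *R v + w]) <= Rn n then a (map L (vs[i := c *R v + w])) else 0) =
 c * (if set (vs[i := v]) <= Rn n then a (map L (vs[i := v])) else 0) + (if set (vs[i := w]) <= Rn n then a (map L (vs[i := w])) else 0)"
 using * alt_lin[OF a, of "map L vs" i "L v" "L w" c] L[OF *(3,4)] R Rn_add Rn_scale by (simp add: map_update)
next
 fix vs :: "rvec list" and i j assume "i < j" "j < length vs" "vs ! i = vs ! j"
 thus "(if set vs <= Rn n then a (map L vs) else 0) = 0" using alt_rep[OF a, of i j "map L vs"] by auto
qed

lemma alt_op:
 fixes w :: "'b => rvec list => real"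
 assumes w: "!!y. y:S ==> alt_form n k (w y)"
 and c: "!!f g. (!!y. y:S ==> f y = g y) ==> T f = T g"
 and l: "!!c us us'. T (%y. c * w y us + w y us') = c * T (%y. w y us) + T (%y. w y us')"
 shows "alt_form n k (%us. T (%y. w y us) :: real)"
proof (rule alt_formI)
 have z: "T (%y. w y us) = 0" if "!!y. y:S ==> w y us = 0" for us
 using l[of 1 us us] c[of "%y. w y us" "%y. 1 * w y us + w y us"] that by simp
 show "T (%y. w y vs) = 0" if "int (length vs) ~= k | ~ set vs <= Rn n" for vs by (rule z) (use w alt_zero that in blast)
 show "T (%y. w y vs) = 0" if "i < j" "j < length vs" "vs ! i = vs ! j" for vs i j by (rule z) (use w alt_rep that in blast)
 show "T (%y. w y (vs[i := a *R v + u])) = a * T (%y. w y (vs[i := v])) + T (%y. w y (vs[i := u]))"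
 if "set vs <= Rn n" "i < length vs" "v:Rn n" "u:Rn n" for vs i v u a unfolding l[symmetric] by (rule c) (use alt_lin[OF w] that in auto)
qed

lemma alt_ConsI:
 assumes z: "!!vs. int (length vs) ~= k + 1 | ~ set vs <= Rn n ==> a vs = 0"
 and t: "!!v. v:Rn n ==> alt_form n k (%us. a (v # us))"
 and l: "!!v w c us. v:Rn n ==> w:Rn n ==> set us <= Rn n ==> a ((c *R v + w) # us) = c * a (v # us) + a (w # us)"
 and r: "!!v us. v:Rn n ==> set us <= Rn n ==> a (v # v # us) = 0"
 shows "alt_form n (k + 1) a"
proof (rule alt_formI)
 fix vs :: "rvec list" and i j
 { fix v w and c :: real assume *: "set vs <= Rn n" "i < length vs" "v:Rn n" "w:Rn n"
 then obtain u us where "vs = u # us" by (cases vs) auto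
 thus "a (vs[i := c *R v + w]) = c * a (vs[i := v]) + a (vs[i := w])" using * l alt_lin[OF t] by (cases i) auto }
 assume ij: "i < j" "j < length vs" "vs ! i = vs ! j" and V: "set vs <= Rn n"
 then obtain u us where vs: "vs = u # us" by (cases vs) auto
 hence u: "u:Rn n" using V by simp
 show "a vs = 0"
 proof (cases i)
 case 0
 then obtain m where m: "j = Suc m" "m < length us" "us ! m = u" using ij vs by (cases j) auto
 have "us = take m us @ u # drop (Suc m) us" using id_take_nth_drop[OF m(2)] m(3) by simp
 hence "a vs = (-1) ^ length (take m us) * a (u # u # take m us @ drop (Suc m) us)"
 using alt_move[OF t[OF u], of "take m us" u "drop (Suc m) us"] vs by simp
 moreover have "set (rem_at m us) <= Rn n" using V vs set_take_subset[of m us] set_drop_subset[of "Suc m" us] by auto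
 ultimately show ?thesis using r[OF u] by simp
 next
 case (Suc m)
 thus ?thesis using alt_rep[OF t[OF u], of m "j - 1" us] ij vs by (cases j) auto
 qed
qed (rule z)

lemma alt_plus: "alt_form n k a ==> alt_form n k b ==> alt_form n k (%vs. a vs + b vs)"
 by (rule alt_formI) (simp_all add: alt_lin alt_zero distrib_left alt_rep)

lemma alt_cmult: "alt_form n k a ==> alt_form n k (%vs. c * a vs)"
 by (rule alt_formI) (simp_all add: alt_lin alt_zero distrib_left mult.left_commute alt_rep)

lemma alt_0: "alt_form n k (%vs. 0)" by (rule alt_formI) auto

lemma alt_sum: "(!!j. j:J ==> alt_form n k (a j)) ==> alt_form n k (%vs. \<Sum>j\<in>J. a j vs)"
 by (induction J rule: infinite_finite_induct) (auto intro: alt_plus alt_0)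

text \<open>The terms with second derivatives \<open>B\<close> cancel in the exterior derivative of a pull-back.\<close>

lemma alt_correction:
 assumes B: "!!u v. B u v = B v u"
 shows "alt_form m k a ==> set (map L vs) <= Rn m ==>
 (\<Sum>l<length vs. (-1) ^ l * (\<Sum>p<length vs - 1. a ((map L (rem_at l vs))[p := B (vs ! l) (rem_at l vs ! p)]))) = 0"
proof (induction vs arbitrary: k a)
 case (Cons v vs)
 show ?case
 proof (cases vs)
 case Nil thus ?thesis by simp
 next
 case (Cons u us)
 let ?n = "length vs"
 have Lv: "L v:Rn m" using Cons.prems by auto
 have IH: "(\<Sum>l<?n. (-1) ^ l * (\<Sum>p<?n - 1. a (L v # (map L (rem_at l vs))[p := B (vs ! l) (rem_at l vs ! p)]))) = 0"
 using Cons.IH[OF alt_contract[OF Cons.prems(1) Lv]] Cons.prems by auto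
 have n: "?n = Suc (?n - 1)" using Cons by simp
 let ?t = "%l. (\<Sum>p<?n. a ((map L (rem_at l (v # vs)))[p := B ((v # vs) ! l) (rem_at l (v # vs) ! p)]))"
 have t0: "?t 0 = (\<Sum>p<?n. (-1) ^ p * a (B v (vs ! p) # rem_at p (map L vs)))"
 by (intro sum.cong) (auto simp: alt_update[OF Cons.prems(1)])
 have tS: "?t (Suc l) = a (B (vs ! l) v # map L (rem_at l vs)) +
 (\<Sum>p<?n - 1. a (L v # (map L (rem_at l vs))[p := B (vs ! l) (rem_at l vs ! p)]))" for l
 by (subst n, subst sum.lessThan_Suc_shift) simp
 have "(\<Sum>l<length (v # vs). (-1) ^ l * ?t l) = ?t 0 + (\<Sum>l<?n. (-1) ^ Suc l * ?t (Suc l))"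
 unfolding list.size(4) One_nat_def add_Suc_right add_0_right by (subst sum.lessThan_Suc_shift) simp
 also have "(\<Sum>l<?n. (-1) ^ Suc l * ?t (Suc l)) = - (\<Sum>l<?n. (-1) ^ l * a (B (vs ! l) v # map L (rem_at l vs)))
 - (\<Sum>l<?n. (-1) ^ l * (\<Sum>p<?n - 1. a (L v # (map L (rem_at l vs))[p := B (vs ! l) (rem_at l vs ! p)])))"
 unfolding tS by (simp add: distrib_left sum.distrib sum_negf sum_subtractf)
 finally show ?thesis unfolding IH t0 by (simp add: B take_map drop_map)
 qed
qed simp

section \<open>Exterior derivative in coordinates\<close>

lemma ddv_cong:
 assumes "x:S" "ropen (Rn n) V" "x:V" "!!y. y:S ==> y:V ==> f y = g y"
 shows "ddv n S v f x = ddv n S v g x" unfolding ddv_def using pd_cong[OF assms(1) _ assms(2-4)] by (intro sum.cong) auto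

lemma ddv_cong': "x:S ==> (!!y. y:S ==> f y = g y) ==> S <= Rn n ==> ddv n S v f x = ddv n S v g x"
 by (rule ddv_cong[of _ _ _ "Rn n"]) auto

context
 fixes n S x assumes S: "qopen n S" "x:S"
begin

lemma xRn: "x:Rn n" using S qopen_Rn by blast

lemma ddv_add: "smpt n S f x ==> smpt n S g x ==> ddv n S v (%y. f y + g y) x = ddv n S v f x + ddv n S v g x"
 by (simp add: ddv_def pd_add[OF S] distrib_left sum.distrib)

lemma ddv_diff: "smpt n S f x ==> smpt n S g x ==> ddv n S v (%y. f y - g y) x = ddv n S v f x - ddv n S v g x"
 by (simp add: ddv_def pd_diff[OF S] right_diff_distrib sum_subtractf)

lemma ddv_cmult: "smpt n S f x ==> ddv n S v (%y. c * f y) x = c * ddv n S v f x"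
 by (simp add: ddv_def pd_cmult[OF S] sum_distrib_left mult.left_commute)

lemma ddv_const: "ddv n S v (%y. c) x = 0" by (simp add: ddv_def pd_const[OF S])

lemma ddv_coord: "v:Rn n ==> ddv n S v (%y. y j) x = v j"
proof -
 assume "v:Rn n"
 have "ddv n S v (%y. y j) x = (\<Sum>i<n. if i = j then v i else 0)" unfolding ddv_def by (intro sum.cong) (auto simp: pd_coord[OF S])
 thus ?thesis using `v:Rn n` by (auto simp: Rn_iff)
qed

lemma ddv_sum: "(!!a. a:A ==> smpt n S (f a) x) ==> ddv n S v (%y. \<Sum>a\<in>A. f a y) x = (\<Sum>a\<in>A. ddv n S v (f a) x)"
 unfolding ddv_def by (simp add: pd_sum[OF S] sum_distrib_left sum.swap[of _ A])

lemma smpt_ddv: "smpt n S f x ==> smpt n S (ddv n S v f) x"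
 unfolding ddv_def using xRn by (intro smpt_sum smpt_mult smpt_const smpt_pd[OF S(1)]) auto

lemma ddv_commute: "smpt n S f x ==> ddv n S v (ddv n S w f) x = ddv n S w (ddv n S v f) x"
proof -
 assume f: "smpt n S f x"
 have e: "ddv n S v (ddv n S w f) x = (\<Sum>i<n. \<Sum>j<n. v i * (w j * pd S i (pd S j f) x))" for v w
 proof -
 have "ddv n S v (%y. \<Sum>j<n. w j * pd S j f y) x = (\<Sum>j<n. w j * ddv n S v (pd S j f) x)"
 using f xRn by (subst ddv_sum) (auto intro!: sum.cong ddv_cmult smpt_pd[OF S(1)] smpt_mult)
 also have "\<dots> = (\<Sum>j<n. \<Sum>i<n. v i * (w j * pd S i (pd S j f) x))" by (simp add: ddv_def sum_distrib_left mult.left_commute)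
 finally show ?thesis by (subst sum.swap) (simp add: ddv_def[abs_def])
 qed
 show ?thesis unfolding e by (subst sum.swap) (auto intro!: sum.cong simp: pd_commute[OF S _ _ f] mult.left_commute)
qed

lemma ddv_lin: "ddv n S (c *R v + w) f x = c * ddv n S v f x + ddv n S w f x"
 by (simp add: ddv_def sfun_def algebra_simps sum.distrib sum_distrib_left)

end

definition ddr :: "nat => rvec set => (rvec => rvec list => real) => rvec => rvec list => real" where
 "ddr n S w x vs = (\<Sum>l<length vs. (- 1) ^ l * ddv n S (vs ! l) (%y. w y (rem_at l vs)) x)"

lemma ddr_Nil [simp]: "ddr n S w x [] = 0" by (simp add: ddr_def)

lemma ddr_Cons: "ddr n S w x (v # vs) = ddv n S v (%y. w y vs) x - ddr n S (%y us. w y (v # us)) x vs"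
 unfolding ddr_def list.size(4) One_nat_def add_Suc_right add_0_right by (subst sum.lessThan_Suc_shift) (simp add: sum_negf)

lemma ddr_cong:
 assumes "x:S" "ropen (Rn n) V" "x:V"
 "!!y us. y:S ==> y:V ==> set us <= set vs ==> Suc (length us) = length vs ==> f y us = g y us"
 shows "ddr n S f x vs = ddr n S g x vs" unfolding ddr_def
proof (intro sum.cong refl arg_cong2[where f = "(*)"] ddv_cong[OF assms(1-3)] assms(4))
 fix l assume "l:{..<length vs}"
 thus "set (rem_at l vs) <= set vs" "Suc (length (rem_at l vs)) = length vs"
 using set_take_subset[of l vs] set_drop_subset[of "Suc l" vs] by auto
qed

context
 fixes n S x assumes S: "qopen n S" "x:S"
begin

lemma smpt_ddr: "(!!us. smpt n S (%y. w y us) x) ==> smpt n S (%y. ddr n S w y vs) x" unfolding ddr_def using xRn[OF S]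
 by (intro smpt_sum smpt_mult smpt_const smpt_ddv[OF S]) auto

lemma ddr_diff: "(!!us. smpt n S (%y. w y us) x) ==> (!!us. smpt n S (%y. w' y us) x) ==>
 ddr n S (%y us. w y us - w' y us) x vs = ddr n S w x vs - ddr n S w' x vs"
 by (simp add: ddr_def ddv_diff[OF S] right_diff_distrib sum_subtractf)

lemma ddr_add: "(!!us. smpt n S (%y. w y us) x) ==> (!!us. smpt n S (%y. w' y us) x) ==>
 ddr n S (%y us. w y us + w' y us) x vs = ddr n S w x vs + ddr n S w' x vs" by (simp add: ddr_def ddv_add[OF S] distrib_left sum.distrib)

lemma ddr_cmult: "(!!us. smpt n S (%y. w y us) x) ==> ddr n S (%y us. c * w y us) x vs = c * ddr n S w x vs"
 by (simp add: ddr_def ddv_cmult[OF S] sum_distrib_left mult.left_commute)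

lemma ddr_ddv:
 assumes w: "!!us. smpt n S (%y. w y us) x"
 shows "ddv n S v (%y. ddr n S w y vs) x = ddr n S (%y us. ddv n S v (%z. w z us) y) x vs"
proof -
 note d = smpt_ddv[OF S w]
 have "ddv n S v (%y. ddr n S w y vs) x =
 (\<Sum>l<length vs. ddv n S v (%y. (- 1) ^ l * ddv n S (vs ! l) (%y. w y (rem_at l vs)) y) x)"
 unfolding ddr_def using d xRn[OF S] by (intro ddv_sum[OF S] smpt_mult) auto
 also have "\<dots> = ddr n S (%y us. ddv n S v (%z. w z us) y) x vs" unfolding ddr_def
 by (intro sum.cong refl) (simp add: ddv_cmult[OF S d] ddv_commute[OF S w])
 finally show ?thesis .
qed

lemma ddr_ddr:
 "(!!us. smpt n S (%y. w y us) x) ==> ddr n S (%y us. ddr n S w y us) x vs = 0"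
proof (induction vs arbitrary: w)
 case (Cons v vs)
 have "ddr n S (%y us. ddr n S w y (v # us)) x vs =
 ddr n S (%y us. ddv n S v (%z. w z us) y) x vs - ddr n S (%y us. ddr n S (%z us. w z (v # us)) y us) x vs" unfolding ddr_Cons
 by (rule ddr_diff) (intro smpt_ddv[OF S] smpt_ddr Cons.prems)+
 also have "ddr n S (%y us. ddr n S (%z us. w z (v # us)) y us) x vs = 0" by (rule Cons.IH) (rule Cons.prems)
 finally show ?case unfolding ddr_Cons[of n S "%y us. ddr n S w y us"] ddr_ddv[OF Cons.prems] by simp
qed simp

end

lemma alt_pd:
 assumes S: "qopen n S" "x:S" "i < n" and a: "!!y. y:S ==> alt_form m k (w y)"
 and w: "!!us. smpt n S (%y. w y us) x"
 shows "alt_form m k (%us. pd S i (%y. w y us) x)"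
proof (rule alt_op[OF a, where T = "%f. pd S i f x"])
 show "pd S i f x = pd S i g x" if "!!y. y:S ==> f y = g y" for f g
 by (rule pd_cong[of x S i n "Rn n"]) (use S xRn[OF S(1,2)] that in auto)
qed (use xRn[OF S(1,2)] in "auto simp: pd_add[OF S] pd_cmult[OF S] w smpt_mult")

lemma alt_ddv:
 assumes S: "qopen n S" "x:S" and a: "!!y. y:S ==> alt_form m k (w y)"
 and w: "!!us. smpt n S (%y. w y us) x"
 shows "alt_form m k (%us. ddv n S v (%y. w y us) x)" unfolding ddv_def by (intro alt_sum alt_cmult alt_pd[OF S _ a w]) auto

lemma alt_ddr:
 assumes S: "qopen n S" "x:S"
 shows "(!!y. y:S ==> alt_form n k (w y)) ==> (!!us. smpt n S (%y. w y us) x) ==>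
 alt_form n (k + 1) (%vs. if set vs <= Rn n then ddr n S w x vs else 0)"
proof (induction "nat (k + 1)" arbitrary: k w)
 case 0
 have "(%vs. if set vs <= Rn n then ddr n S w x vs else 0) = (%vs. 0)"
 proof
 fix vs
 have "ddr n S w x vs = ddr n S (%y us. 0) x vs" by (rule ddr_cong[OF S(2), of _ "Rn n"]) (use 0 alt_zero[OF 0(2)] xRn[OF S] in auto)
 thus "(if set vs <= Rn n then ddr n S w x vs else 0) = 0" by (simp add: ddr_def ddv_const[OF S])
 qed
 thus ?case by (simp only: alt_0)
next
 case (Suc m)
 note a = Suc.prems(1) and w = Suc.prems(2)
 note D = alt_ddv[OF S a w]
 show ?case
 proof (rule alt_ConsI)
 fix vs assume *: "int (length vs) ~= k + 1 | ~ set vs <= Rn n"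
 have "ddr n S w x vs = 0" if "set vs <= Rn n" unfolding ddr_def using that * by (intro sum.neutral ballI) (auto simp: alt_zero[OF D])
 thus "(if set vs <= Rn n then ddr n S w x vs else 0) = 0" by simp
 next
 fix v assume v: "v:Rn n"
 let ?d = "%us. if set us <= Rn n then ddr n S (%y us. w y (v # us)) x us else 0"
 have "alt_form n (k - 1 + 1) ?d" by (rule Suc.hyps(1)) (use Suc.hyps(2) w alt_contract[OF a v] in auto)
 hence "alt_form n k (%us. ddv n S v (%y. w y us) x + (- 1) * ?d us)" using alt_plus[OF D alt_cmult[of n k ?d "- 1"]] by simp
 moreover have "(%us. if set (v # us) <= Rn n then ddr n S w x (v # us) else 0) =
 (%us. ddv n S v (%y. w y us) x + (- 1) * ?d us)" using v alt_zero[OF D] by (auto simp: ddr_Cons)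
 ultimately show "alt_form n k (%us. if set (v # us) <= Rn n then ddr n S w x (v # us) else 0)" by simp
 next
 fix v u us and c :: real assume *: "v:Rn n" "u:Rn n" "set us <= Rn n"
 have "ddr n S (%y us. w y ((c *R v + u) # us)) x us = ddr n S (%y us. c * w y (v # us) + w y (u # us)) x us"
 by (rule ddr_cong[OF S(2), of _ "Rn n"]) (use * alt_lin0[OF a] xRn[OF S] in auto)
 also have "\<dots> = c * ddr n S (%y us. w y (v # us)) x us + ddr n S (%y us. w y (u # us)) x us"
 using w xRn[OF S] by (subst ddr_add[OF S]) (auto simp: ddr_cmult[OF S] intro: smpt_mult)
 finally show "(if set ((c *R v + u) # us) <= Rn n then ddr n S w x ((c *R v + u) # us) else 0) =
 c * (if set (v # us) <= Rn n then ddr n S w x (v # us) else 0) + (if set (u # us) <= Rn n then ddr n S w x (u # us) else 0)"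
 using * Rn_add Rn_scale by (simp add: ddr_Cons ddv_lin[OF S] right_diff_distrib)
 next
 fix v us assume *: "v:Rn n" "set us <= Rn n"
 have "ddr n S (%y us. w y (v # v # us)) x us = ddr n S (%y us. 0) x us"
 by (rule ddr_cong[OF S(2), of _ "Rn n"]) (use alt_rep[OF a, of _ 0 1 "v # v # us'" for us'] xRn[OF S] in auto)
 thus "(if set (v # v # us) <= Rn n then ddr n S w x (v # v # us) else 0) = 0" by (simp add: ddr_Cons) (simp add: ddr_def ddv_const[OF S])
 qed
qed

section \<open>Pull-back in coordinates\<close>

lemma smpt_cR:
 assumes "smpt n S g x" "x:Rn n" "!!y. y:S ==> f y = g y"
 shows "smpt n S f x" by (rule smpt_cong[of n "Rn n" x S g f]) (use assms in auto)

lemma smpt_alt_curves: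
 assumes x: "x:Rn n"
 shows "(!!us. smpt n S (%y. A y us) x) ==> (!!y. y:S ==> alt_form m k (A y)) ==>
 (!!u y. u:set Us ==> y:S ==> u y:Rn m) ==>
 (!!u j. u:set Us ==> j < m ==> smpt n S (%y. u y j) x) ==>
 smpt n S (%y. A y (map (%u. u y) Us)) x"
proof (induction Us arbitrary: A k)
 case (Cons u Us)
 have "smpt n S (%y. \<Sum>j<m. u y j * A y (bvec j # map (%u. u y) Us)) x"
 proof (intro smpt_sum smpt_mult x)
 fix j assume j: "j:{..<m}"
 show "smpt n S (%y. u y j) x" using Cons.prems(4) j by simp
 show "smpt n S (%y. A y (bvec j # map (%u. u y) Us)) x" by (rule Cons.IH[where k = "k - 1"])
 (use Cons.prems j bvec_Rn in "auto intro: alt_contract")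
 qed
 thus ?case
 proof (rule smpt_cR[OF _ x])
 fix y assume y: "y:S"
 show "A y (map (%u. u y) (u # Us)) = (\<Sum>j<m. u y j * A y (bvec j # map (%u. u y) Us))"
 using alt_expand0[OF Cons.prems(2)[OF y], of "map (%u. u y) Us" "u y"] Cons.prems(3) y by auto
 qed
qed simp

lemma alt_curves_deriv:
 assumes s: "s:T"
 shows "(!!t. t:T ==> alt_form m k (A t)) ==> alt_form m k A' ==>
 (!!us. ((%t. A t us) hrd A' us) (at s within T)) ==>
 length Us' = length Us ==>
 (!!u t. u:set Us ==> t:T ==> u t:Rn m) ==>
 (!!l j. l < length Us ==> j < m ==> ((%t. (Us ! l) t j) hrd (Us' ! l) j) (at s within T)) ==>
 set Us' <= Rn m ==>
 ((%t. A t (map (%u. u t) Us)) has_real_derivative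
 A' (map (%u. u s) Us) + (\<Sum>l<length Us. A s ((map (%u. u s) Us)[l := Us' ! l]))) (at s within T)"
proof (induction Us arbitrary: A A' k Us')
 case (Cons u Us)
 obtain u' vs where U': "Us' = u' # vs" "length vs = length Us" using Cons.prems(4) by (cases Us') auto
 let ?r = "%t. map (%u. u t) Us"
 have rR: "set (?r t) <= Rn m" if "t:T" for t using Cons.prems(5) that by auto
 have u'R: "u':Rn m" "set vs <= Rn m" using Cons.prems(7) U' by auto
 let ?D = "%j. A' (bvec j # ?r s) + (\<Sum>l<length Us. A s (bvec j # (?r s)[l := vs ! l]))"
 have "((%t. \<Sum>j<m. u t j * A t (bvec j # ?r t)) has_real_derivative
 (\<Sum>j<m. u' j * A s (bvec j # ?r s) + ?D j * u s j)) (at s within T)"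
 proof (rule DERIV_sum)
 fix j assume "j:{..<m}"
 hence j: "j < m" by simp
 have 1: "((%t. u t j) hrd u' j) (at s within T)" using Cons.prems(6)[of 0 j] j U' by simp
 have 2: "((%t. A t (bvec j # ?r t)) hrd ?D j) (at s within T)"
 proof (rule Cons.IH[where k = "k - 1"])
 fix l i assume "l < length Us" "i < m"
 thus "((%t. (Us ! l) t i) hrd (vs ! l) i) (at s within T)" using Cons.prems(6)[of "Suc l" i] U' by simp
 qed (use Cons.prems U' j bvec_Rn in "auto intro: alt_contract")
 show "((%t. u t j * A t (bvec j # ?r t)) hrd u' j * A s (bvec j # ?r s) + ?D j * u s j) (at s within T)" using DERIV_mult[OF 1 2] .
 qed
 moreover have "(\<Sum>j<m. u' j * A s (bvec j # ?r s) + ?D j * u s j) =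
 A' (map (%u. u s) (u # Us)) + (\<Sum>l<length (u # Us). A s ((map (%u. u s) (u # Us))[l := Us' ! l]))"
 proof -
 have us: "u s:Rn m" using Cons.prems(5) s by simp
 have a: "(\<Sum>j<m. u' j * A s (bvec j # ?r s)) = A s (u' # ?r s)" using alt_expand0[OF Cons.prems(1)[OF s] rR[OF s] u'R(1)] by simp
 have b: "(\<Sum>j<m. A' (bvec j # ?r s) * u s j) = A' (u s # ?r s)"
 using alt_expand0[OF Cons.prems(2) rR[OF s] us] by (simp add: mult.commute)
 have c: "(\<Sum>j<m. A s (bvec j # (?r s)[l := vs ! l]) * u s j) = A s (u s # (?r s)[l := vs ! l])" if "l < length Us" for l
 proof -
 have "set ((?r s)[l := vs ! l]) <= Rn m"
 proof (rule subset_trans[OF set_update_subset_insert])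
 have "vs ! l:Rn m" using u'R(2) U'(2) that by (metis nth_mem subsetD)
 thus "insert (vs ! l) (set (?r s)) <= Rn m" using rR[OF s] by simp
 qed
 from alt_expand0[OF Cons.prems(1)[OF s] this us] show ?thesis by (simp add: mult.commute)
 qed
 have "(\<Sum>j<m. u' j * A s (bvec j # ?r s) + ?D j * u s j) =
 (\<Sum>j<m. u' j * A s (bvec j # ?r s)) + (\<Sum>j<m. A' (bvec j # ?r s) * u s j) +
 (\<Sum>l<length Us. \<Sum>j<m. A s (bvec j # (?r s)[l := vs ! l]) * u s j)"
 using sum.swap[of "%l j. A s (bvec j # (?r s)[l := vs ! l]) * u s j" "{..<m}" "{..<length Us}"]
 by (simp add: sum.distrib distrib_right sum_distrib_right)
 also have "\<dots> = A s (u' # ?r s) + A' (u s # ?r s) + (\<Sum>l<length Us. A s (u s # (?r s)[l := vs ! l]))"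
 unfolding a b using c by simp
 finally show ?thesis unfolding U' list.size(4) One_nat_def add_Suc_right add_0_right by (subst sum.lessThan_Suc_shift) simp
 qed
 ultimately have "((%t. \<Sum>j<m. u t j * A t (bvec j # ?r t)) has_real_derivative
 A' (map (%u. u s) (u # Us)) + (\<Sum>l<length (u # Us). A s ((map (%u. u s) (u # Us))[l := Us' ! l]))) (at s within T)" by simp
 moreover have e: "A t (map (%u. u t) (u # Us)) = (\<Sum>j<m. u t j * A t (bvec j # ?r t))" if "t:T" for t
 using alt_expand0[OF Cons.prems(1)[OF that] rR[OF that], of "u t"] Cons.prems(5) that by simp
 ultimately show ?case by (subst hrd_cong[OF refl _ refl refl s, where g = "%t. \<Sum>j<m. u t j * A t (bvec j # ?r t)"])
 (auto intro!: always_eventually)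
qed simp

lemma tangent_map_Rn:
 assumes "qopen n S" "x:S" "!!y. y:S ==> F y:Rn m"
 shows "tangent_map n S F x v:Rn m"
proof -
 have "ddv n S v (%y. F y j) x = 0" if "j >= m" for j
 proof -
 have "ddv n S v (%y. F y j) x = ddv n S v (%y. 0) x" by (rule ddv_cong') (use assms qopen_Rn that in "auto simp: Rn_iff")
 thus ?thesis using ddv_const[OF assms(1,2)] by simp
 qed
 thus ?thesis by (simp add: tmap_def Rn_iff)
qed

lemma tangent_map_lin:
 assumes "qopen n S" "x:S"
 shows "tangent_map n S F x (c *R v + w) = c *R tangent_map n S F x v + tangent_map n S F x w"
 by (rule ext) (simp only: tmap_def ddv_lin[OF assms], simp add: sfun_def)

locale coord_map =
 fixes n S m S2 F
 assumes S: "qopen n S" and S2: "qopen m S2" and FS: "!!y. y:S ==> F y:S2"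
 and F: "!!x j. x:S ==> smpt n S (%y. F y j) x"
begin

abbreviation T where "T \<equiv> tangent_map n S F"

definition B where "B x u v = (%j. ddv n S u (%y. T y v j) x)"

lemma FR: "y:S ==> F y:Rn m" using FS qopen_Rn[OF S2] by blast

lemma TR: "x:S ==> T x v:Rn m" by (rule tangent_map_Rn[OF S]) (use FR in auto)

lemma T_smooth: "x:S ==> smpt n S (%y. T y v j) x" unfolding tmap_def using smpt_ddv[OF S _ F] by simp

lemma B_commute: "x:S ==> B x u v = B x v u" unfolding B_def tmap_def using ddv_commute[OF S _ F] by simp

lemma smooth_comp: "x:S ==> smpt m S2 h (F x) ==> smpt n S (%y. h (F y)) x" by (rule smpt_compose[OF S _ S2 FS F])

lemma ddv_comp:
 assumes "x:S" "smpt m S2 h (F x)"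
 shows "ddv n S v (%y. h (F y)) x = ddv m S2 (T x v) h (F x)"
proof -
 have "ddv n S v (%y. h (F y)) x = (\<Sum>i<n. \<Sum>j<m. v i * (pd S i (%y. F y j) x * pd S2 j h (F x)))"
 unfolding ddv_def using pd_compose[OF S assms(1) S2 FS F assms(2)] assms(1) by (simp add: sum_distrib_left)
 thus ?thesis by (subst (asm) sum.swap) (simp add: ddv_def tmap_def sum_distrib_right mult.assoc)
qed

context
 fixes w k assumes w: "!!y. y:S ==> alt_form m k (w (F y))"
begin

lemma smooth_pull:
 assumes x: "x:S" and sw: "!!us. smpt m S2 (%z. w z us) (F x)"
 shows "smpt n S (%y. w (F y) (map (T y) us)) x"
proof -
 have "smpt n S (%y. (%y. w (F y)) y (map (%u. u y) (map (%v y. T y v) us))) x"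
 by (rule smpt_alt_curves[where m = m and k = k, OF xRn[OF S x] smooth_comp[OF x sw] w])
 (use x TR T_smooth in auto)
 thus ?thesis by (simp add: comp_def)
qed

lemma ddv_pull:
 assumes x: "x:S" and sw: "!!us. smpt m S2 (%z. w z us) (F x)" and us: "set us <= Rn n" and v: "v:Rn n"
 shows "ddv n S v (%y. w (F y) (map (T y) us)) x =
 ddv m S2 (T x v) (%z. w z (map (T x) us)) (F x) + (\<Sum>l<length us. w (F x) ((map (T x) us)[l := B x v (us ! l)]))"
proof -
 have wx: "alt_form m k (w (F x))" using w x by simp
 let ?R = "%i l. (%j. pd S i (%y. T y (us ! l) j) x)"
 have RR: "?R i l:Rn m" if "i < n" for i l
 proof -
 have "pd S i (%y. T y (us ! l) j) x = 0" if "j >= m" for j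
 proof -
 have "pd S i (%y. T y (us ! l) j) x = pd S i (%y. 0) x"
 by (rule pd_cong[where V = "Rn n"]) (use x `i < n` xRn[OF S x] TR that in "auto simp: Rn_iff")
 thus ?thesis using pd_const[OF S x `i < n`] by simp
 qed
 thus ?thesis by (simp add: Rn_iff)
 qed
 have pdi: "pd S i (%y. w (F y) (map (T y) us)) x = pd S i (%y. w (F y) (map (T x) us)) x +
 (\<Sum>l<length us. w (F x) ((map (T x) us)[l := ?R i l]))" if i: "i < n" for i
 proof (rule pd_eqI[OF S x i])
 let ?W = "{t. x(i := t):S}"
 have "((%t. (%t. w (F (x(i := t)))) t (map (%u. u t) (map (%v t. T (x(i := t)) v) us))) has_real_derivative
 (%vs. pd S i (%y. w (F y) vs) x) (map (%u. u (x i)) (map (%v t. T (x(i := t)) v) us)) +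
 (\<Sum>l<length (map (%v t. T (x(i := t)) v) us). (%t. w (F (x(i := t)))) (x i)
 ((map (%u. u (x i)) (map (%v t. T (x(i := t)) v) us))[l := map (?R i) [0..<length us] ! l]))) (at (x i) within ?W)"
 proof (rule alt_curves_deriv[where k = k and m = m])
 show "alt_form m k (%vs. pd S i (%y. w (F y) vs) x)" by (rule alt_pd[OF S x i]) (use w x sw smooth_comp in auto)
 show "((%t. w (F (x(i := t))) vs) hrd pd S i (%y. w (F y) vs) x) (at (x i) within ?W)" for vs
 by (rule has_pdw[OF S x i]) (use x sw smooth_comp in auto)
 fix l j assume l: "l < length (map (%v t. T (x(i := t)) v) us)" and j: "j < m"
 show "((%t. (map (%v t. T (x(i := t)) v) us ! l) t j) hrd (map (?R i) [0..<length us] ! l) j) (at (x i) within ?W)"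
 using has_pdw[OF S x i T_smooth[OF x], of "us ! l" j] l by simp
 next
 fix t assume "t:?W"
 hence t: "x(i := t):S" by simp
 show "alt_form m k (w (F (x(i := t))))" by (rule w[OF t])
 fix u assume "u:set (map (%v t. T (x(i := t)) v) us)"
 thus "u t:Rn m" using TR[OF t] by (auto simp del: fun_upd_apply)
 qed (use x RR[OF i] in auto)
 thus "((%t. w (F (x(i := t))) (map (T (x(i := t))) us)) hrd pd S i (%y. w (F y) (map (T x) us)) x +
 (\<Sum>l<length us. w (F x) ((map (T x) us)[l := ?R i l]))) (at (x i) within ?W)" by (simp add: comp_def)
 qed
 have corr: "(\<Sum>i<n. v i * w (F x) ((map (T x) us)[l := ?R i l])) = w (F x) ((map (T x) us)[l := B x v (us ! l)])"
 if l: "l < length us" for l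
 proof -
 have rs: "set (rem_at l (map (T x) us)) <= Rn m"
 using TR[OF x] set_take_subset[of l "map (T x) us"] set_drop_subset[of "Suc l" "map (T x) us"] by auto
 have "B x v (us ! l) = (%j. \<Sum>i<n. v i * ?R i l j)" by (simp add: B_def ddv_def)
 thus ?thesis using alt_update[OF wx, of l "map (T x) us"] alt_sum0[OF wx rs, of "{..<n}" "%i. ?R i l" v] RR l
 by (simp add: sum_distrib_left mult.left_commute)
 qed
 have "ddv n S v (%y. w (F y) (map (T y) us)) x = (\<Sum>i<n. v i * pd S i (%y. w (F y) (map (T x) us)) x) +
 (\<Sum>l<length us. \<Sum>i<n. v i * w (F x) ((map (T x) us)[l := ?R i l]))" unfolding ddv_def using pdi
 by (subst sum.swap[of _ "{..<n}" "{..<length us}"]) (simp add: distrib_left sum.distrib sum_distrib_left)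
 also have "(\<Sum>i<n. v i * pd S i (%y. w (F y) (map (T x) us)) x) = ddv m S2 (T x v) (%z. w z (map (T x) us)) (F x)"
 using ddv_comp[OF x sw, of v "map (T x) us"] by (simp add: ddv_def)
 finally show ?thesis using corr by simp
qed

lemma ddr_pull:
 assumes x: "x:S" and sw: "!!us. smpt m S2 (%z. w z us) (F x)" and vs: "set vs <= Rn n"
 shows "ddr n S (%y us. w (F y) (map (T y) us)) x vs = ddr m S2 w (F x) (map (T x) vs)"
proof -
 have wx: "alt_form m k (w (F x))" using w x by simp
 have rs: "set (rem_at l vs) <= Rn n" for l using vs set_take_subset[of l vs] set_drop_subset[of "Suc l" vs] by auto
 have "ddr n S (%y us. w (F y) (map (T y) us)) x vs =
 (\<Sum>l<length vs. (-1) ^ l * (ddv m S2 (T x (vs ! l)) (%z. w z (map (T x) (rem_at l vs))) (F x) +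
 (\<Sum>p<length vs - 1. w (F x) ((map (T x) (rem_at l vs))[p := B x (vs ! l) (rem_at l vs ! p)]))))" unfolding ddr_def
 proof (intro sum.cong refl arg_cong2[where f = "(*)"])
 fix l assume l: "l:{..<length vs}"
 have len: "length (rem_at l vs) = length vs - 1" using l by auto
 have v: "vs ! l:Rn n" using l vs nth_mem by blast
 show "ddv n S (vs ! l) (%y. w (F y) (map (T y) (rem_at l vs))) x =
 ddv m S2 (T x (vs ! l)) (%z. w z (map (T x) (rem_at l vs))) (F x) +
 (\<Sum>p<length vs - 1. w (F x) ((map (T x) (rem_at l vs))[p := B x (vs ! l) (rem_at l vs ! p)]))"
 using ddv_pull[OF x sw rs[of l] v] unfolding len .
 qed
 also have "\<dots> = (\<Sum>l<length vs. (-1) ^ l * ddv m S2 (T x (vs ! l)) (%z. w z (map (T x) (rem_at l vs))) (F x)) +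
 (\<Sum>l<length vs. (-1) ^ l * (\<Sum>p<length vs - 1. w (F x) ((map (T x) (rem_at l vs))[p := B x (vs ! l) (rem_at l vs ! p)])))"
 by (simp only: distrib_left sum.distrib)
 also have "(\<Sum>l<length vs. (-1) ^ l * (\<Sum>p<length vs - 1. w (F x) ((map (T x) (rem_at l vs))[p := B x (vs ! l) (rem_at l vs ! p)]))) = 0"
 using alt_correction[where B = "B x" and L = "T x", OF B_commute[OF x] wx] TR[OF x] by auto
 finally show ?thesis by (simp add: ddr_def take_map drop_map)
qed

end

end

section \<open>Smooth maps between manifolds with corners\<close>

lemma pd_local:
 assumes "ropen S S'" "x:S'" "S <= Rn n" "i < n"
 shows "pd S' i f x = pd S i f x"
proof -
 obtain V where V: "open V" "S' = S Int V" using assms(1) by (auto simp: openin_open)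
 have o: "ropen (Rn n) (Rn n Int V)" using V by auto
 have x: "x:Rn n Int V" using assms V by auto
 obtain dl where dl: "dl > 0" "!!t. \<bar>t - x i\<bar> < dl ==> x(i := t):V" using slice_open[OF o x assms(4)] by blast
 let ?A = "{x i - dl <..< x i + dl}"
 have "{t. x(i := t):S'} Int ?A - {x i} = {t. x(i := t):S} Int ?A - {x i}"
 proof -
 have "x(i := t):V" if "t:?A" for t
 proof -
 have "\<bar>t - x i\<bar> < dl" using that by (simp add: abs_less_iff)
 thus ?thesis by (rule dl(2))
 qed
 thus ?thesis unfolding V by blast
 qed
 hence "at (x i) within {t. x(i := t):S'} = at (x i) within {t. x(i := t):S}" using dl(1) by (intro at_within_nhd[of _ ?A]) auto
 thus ?thesis by (simp add: pd_def)
qed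

lemma ddv_local:
 assumes "ropen S S'" "x:S'" "S <= Rn n"
 shows "ddv n S' v f x = ddv n S v f x" unfolding ddv_def using pd_local[OF assms] by simp

lemma tangent_map_local:
 assumes "ropen S S'" "x:S'" "S <= Rn n"
 shows "tangent_map n S' F x v = tangent_map n S F x v" unfolding tmap_def using ddv_local[OF assms] by simp

lemma ddr_local:
 assumes "ropen S S'" "x:S'" "S <= Rn n"
 shows "ddr n S' w x vs = ddr n S w x vs" unfolding ddr_def using ddv_local[OF assms] by simp

lemma openin_nbhdI:
 assumes "A <= S" "!!x. x:A ==> EX S'. ropen S S' & x:S' & S' <= A"
 shows "ropen S A" using assms(2) openin_subopen by blast

lemma openin_restrict:
 assumes "ropen A Y" "S <= A"
 shows "ropen S (S Int Y)"
proof -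
 obtain T where "open T" "Y = A Int T" using assms(1) by (auto simp: openin_open)
 thus ?thesis using assms(2) by (auto simp: openin_open intro!: exI[of _ T])
qed

lemma smpts_preimage:
 assumes S: "S <= Rn n" "x:S" and F: "!!j. j < m ==> smpt n S (%y. F y j) x"
 and FS: "!!y. y:S ==> F y:S2" and S2: "S2 <= Rn m" and W: "ropen S2 W" "F x:W"
 shows "EX S'. ropen S S' & x:S' & F ` S' <= W"
proof -
 obtain W' where W': "open W'" "W = S2 Int W'" using W(1) by (auto simp: openin_open)
 have "EX A. ropen S A & x:A & F ` A <= W'"
 proof -
 have o: "ropen (Rn m) (Rn m Int W')" using W' by auto
 have Fx: "F x:Rn m Int W'" using FS[OF S(2)] S2 W W' by auto
 obtain dl where dl: "dl > 0" "cube m (F x) dl Int Rn m <= Rn m Int W'" using openin_cubeD[OF o order_refl Fx] by blast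
 have "EX A. ropen S A & x:A & (ALL y:A. \<bar>F y j - F x j\<bar> < dl)" if j: "j < m" for j
 proof -
 obtain U g where g: "x:U" "ropen (Rn n) U" "!!k. CK k n U g" "!!y. y:S ==> y:U ==> g y = F y j" using smptE[OF F[OF j]] by blast
 have "ropen (Rn n) {y:U. g y:ball (g x) dl}" using openin_preimage[OF g(2) CK_cont[OF g(3)[of 0]]] by blast
 hence "ropen S (S Int {y:U. g y:ball (g x) dl})" by (rule openin_restrict[OF _ S(1)])
 thus ?thesis using g S(2) dl(1) by (intro exI[of _ "S Int {y:U. g y:ball (g x) dl}"]) (auto simp: dist_real_def abs_minus_commute)
 qed
 then obtain A where A: "!!j. j < m ==> ropen S (A j)" "!!j. j < m ==> x:A j"
 "!!j y. j < m ==> y:A j ==> \<bar>F y j - F x j\<bar> < dl" by metis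
 define A' where "A' = S Int (\<Inter>j\<in>{..<m}. A j)"
 have "ropen S A'"
 proof (cases "m = 0")
 case False
 thus ?thesis unfolding A'_def using A(1) by (intro openin_Int openin_INT2) auto
 qed (simp add: A'_def)
 moreover have "F y:W'" if "y:A'" for y
 proof -
 have "F y:cube m (F x) dl" using that A(3) FS S2 by (auto simp: A'_def cube_def)
 thus ?thesis using dl(2) by (auto simp: cube_def)
 qed
 ultimately show ?thesis using A(2) S(2) by (intro exI[of _ A']) (auto simp: A'_def)
 qed
 then obtain A where A: "ropen S A" "x:A" "F ` A <= W'" by blast
 thus ?thesis using FS W' op_sub[OF A(1)] by (intro exI[of _ A]) auto
qed

locale atlas =
 fixes M :: "'a chart set"
 assumes atlas: "atl M"
begin

lemma inj: "c:M ==> inj_on (cmap c) (cdom c)" using atlas by (simp add: atl_def)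

lemma cinv_cmap [simp]: "c:M ==> p:cdom c ==> cinv c (cmap c p) = p" using inj by (simp add: inv_into_f_f)

lemma cim_quad: "c:M ==> ropen (quad (cdim c) (ccor c)) (cim c)" using atlas by (simp add: atl_def cmodel_top)

lemma cim_qopen: "c:M ==> qopen (cdim c) (cim c)" using cim_quad by (auto simp: qopen_def)

lemma cim_Rn: "c:M ==> cim c <= Rn (cdim c)" using cim_qopen qopen_Rn by blast

lemma cmap_Rn: "c:M ==> p:cdom c ==> cmap c p:Rn (cdim c)" using cim_Rn by blast

lemma rep_dom_id: "rep_dom id c d = cmap c ` (cdom c Int cdom d)" by (simp add: rep_dom_def)

lemma overlap_open: "c:M ==> d:M ==> ropen (cim c) (cmap c ` (cdom c Int cdom d))"
proof -
 assume c: "c:M" "d:M"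
 hence "ropen (quad (cdim c) (ccor c)) (rep_dom id c d)" using atlas by (simp add: atl_def cmodel_top)
 thus ?thesis unfolding rep_dom_id by (rule openin_subset_trans) (use op_sub[OF cim_quad[OF c(1)]] in auto)
qed

lemma transition_smooth:
 "c:M ==> d:M ==> p:cdom c ==> p:cdom d ==>
 smpt (cdim c) (cmap c ` (cdom c Int cdom d)) (%x. cmap d (cinv c x) j) (cmap c p)"
 using atlas by (auto simp: atl_def smooth_fun_pt rep_dom_def lrep_def)

lemma chart_openI:
 assumes c: "c:M" and S: "ropen (cim c) S"
 shows "mopen M {q:cdom c. cmap c q:S}"
proof -
 have "cmap c ` {q:cdom c. cmap c q:S} = S" using op_sub[OF S] by auto
 moreover have "openin (cmodel c) S" unfolding cmodel_top using S cim_quad[OF c] openin_trans by blast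
 ultimately show ?thesis unfolding mfd_topology_def using c by (intro topology_generated_by_Basis) auto
qed

lemma cdom_open: "c:M ==> mopen M (cdom c)"
proof -
 assume c: "c:M"
 have "{q:cdom c. cmap c q:cim c} = cdom c" by auto
 thus ?thesis using chart_openI[OF c, of "cim c"] by simp
qed

lemma open_chart:
 assumes V: "mopen M V" and c: "c:M"
 shows "ropen (cim c) (cmap c ` (V Int cdom c))"
proof -
 have "generate_topology_on {V. EX c:M. V <= cdom c & openin (cmodel c) (cmap c ` V)} V"
 using V by (simp add: mfd_topology_def openin_topology_generated_by_iff)
 thus ?thesis
 proof induction
 case (Int a b)
 have "a Int b Int cdom c = (a Int cdom c) Int (b Int cdom c)" by blast
 hence "cmap c ` (a Int b Int cdom c) = cmap c ` (a Int cdom c) Int cmap c ` (b Int cdom c)"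
 using inj_on_image_Int[OF inj[OF c], of "a Int cdom c" "b Int cdom c"] by simp
 thus ?case using openin_Int[OF Int.IH] by simp
 next
 case (UN K)
 have "cmap c ` (\<Union>K Int cdom c) = \<Union>((%k. cmap c ` (k Int cdom c)) ` K)" by blast
 moreover have "ropen (cim c) (\<Union>((%k. cmap c ` (k Int cdom c)) ` K))" by (rule openin_Union) (use UN.IH in blast)
 ultimately show ?case by simp
 next
 case (Basis V)
 then obtain d where d: "d:M" "V <= cdom d" "openin (cmodel d) (cmap d ` V)" by blast
 have dV: "ropen (cim d) (cmap d ` V)" using d(3) unfolding cmodel_top
 by (rule openin_subset_trans) (use d op_sub[OF cim_quad[OF d(1)]] in auto)
 let ?S = "cmap c ` (cdom c Int cdom d)"
 show ?case
 proof (rule openin_nbhdI)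
 fix x assume "x:cmap c ` (V Int cdom c)"
 then obtain p where p: "p:V" "p:cdom c" "x = cmap c p" by blast
 hence pd: "p:cdom d" using d by blast
 have "EX S'. ropen ?S S' & x:S' & (%x. cmap d (cinv c x)) ` S' <= cmap d ` V"
 proof (rule smpts_preimage[OF _ _ _ _ cim_Rn[OF d(1)] dV])
 show "smpt (cdim c) ?S (%y. cmap d (cinv c y) j) x" if "j < cdim d" for j unfolding p(3) by (rule transition_smooth[OF c d(1) p(2) pd])
 qed (use p pd c cim_Rn[OF c] in auto)
 then obtain S' where S': "ropen ?S S'" "x:S'" "(%x. cmap d (cinv c x)) ` S' <= cmap d ` V" by blast
 have "S' <= cmap c ` (V Int cdom c)"
 proof
 fix y assume y: "y:S'"
 then obtain q where q: "q:cdom c" "q:cdom d" "y = cmap c q" using op_sub[OF S'(1)] by blast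
 hence "cmap d q:cmap d ` V" using S'(3) y c by auto
 hence "q:V" using inj[OF d(1)] q(2) d(2) by (auto dest: inj_onD)
 thus "y:cmap c ` (V Int cdom c)" using q by blast
 qed
 thus "EX S'. ropen (cim c) S' & x:S' & S' <= cmap c ` (V Int cdom c)" using S' openin_trans[OF S'(1) overlap_open[OF c d(1)]] by blast
 qed blast
 qed simp
qed

lemma opn_car: "mopen M V ==> V <= car M"
proof -
 assume "mopen M V"
 hence "V <= topspace (mtop M)" by (rule openin_subset)
 thus ?thesis by (auto simp: mfd_topology_def topology_generated_by_topspace car_def)
qed

lemma tsp: "topspace (mtop M) = car M"
proof
 show "car M <= topspace (mtop M)" unfolding car_def using cdom_open openin_subset by blast
qed (use opn_car in blast)

lemma openin_mfdI:
 assumes "V <= car M" "!!p. p:V ==> EX A. mopen M A & p:A & A <= V"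
 shows "mopen M V" using assms(2) openin_subopen by blast

end

definition sfn :: "'a chart set => 'a => ('a => real) => bool" where
 "sfn M p h <-> (ALL c:M. p:cdom c --> smpt (cdim c) (cim c) (%x. h (cinv c x)) (cmap c p))"

definition smap :: "'a chart set => 'b chart set => 'a => ('a => 'b) => bool" where
 "smap M N p f <-> (EX V. mopen M V & p:V &
 (EX d:N. f ` V <= cdom d & (ALL j. sfn M p (%q. cmap d (f q) j))))"

context atlas
begin

lemma sfnD: "sfn M p h ==> c:M ==> p:cdom c ==> smpt (cdim c) (cim c) (%x. h (cinv c x)) (cmap c p)" by (simp add: sfn_def)

lemma sfnI:
 assumes c: "c:M" "p:cdom c" and h: "smpt (cdim c) (cim c) (%x. h (cinv c x)) (cmap c p)"
 shows "sfn M p h" unfolding sfn_def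
proof (intro ballI impI)
 fix d assume d: "d:M" "p:cdom d"
 let ?S = "cmap d ` (cdom d Int cdom c)"
 have o: "ropen (cim d) ?S" using overlap_open d c by blast
 have S: "qopen (cdim d) ?S" using qopen_openin[OF cim_qopen[OF d(1)] o] .
 have "smpt (cdim d) ?S (%x. (%x. h (cinv c x)) (cmap c (cinv d x))) (cmap d p)"
 proof (rule smpt_compose[where F = "%x. cmap c (cinv d x)" and h = "%x. h (cinv c x)", OF S _ cim_qopen[OF c(1)]])
 show "smpt (cdim c) (cim c) (%x. h (cinv c x)) (cmap c (cinv d (cmap d p)))" using h d by simp
 show "smpt (cdim d) ?S (%y. cmap c (cinv d y) j) (cmap d p)" if "j < cdim c" for j using transition_smooth[OF d(1) c(1) d(2) c(2)] by simp
 qed (use c d in auto)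
 hence "smpt (cdim d) ?S (%x. h (cinv d x)) (cmap d p)" by (rule smpt_cR) (use c d cmap_Rn in auto)
 thus "smpt (cdim d) (cim d) (%x. h (cinv d x)) (cmap d p)" by (rule smpt_local[OF _ o cim_Rn[OF d(1)]]) (use c d in auto)
qed

lemma sfn_cong:
 assumes "sfn M p h" "mopen M V" "p:V" "!!q. q:V ==> h q = h' q"
 shows "sfn M p h'" unfolding sfn_def
proof (intro ballI impI)
 fix d assume d: "d:M" "p:cdom d"
 let ?S = "cmap d ` (V Int cdom d)"
 have "smpt (cdim d) ?S (%x. h (cinv d x)) (cmap d p)" using sfnD[OF assms(1) d] by (rule smpt_mono) auto
 hence "smpt (cdim d) ?S (%x. h' (cinv d x)) (cmap d p)" by (rule smpt_cR) (use d cmap_Rn assms(4) in auto)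
 thus "smpt (cdim d) (cim d) (%x. h' (cinv d x)) (cmap d p)"
 by (rule smpt_local[OF _ open_chart[OF assms(2) d(1)] cim_Rn[OF d(1)]]) (use d assms(3) in auto)
qed

lemma sfn_coord:
 assumes c: "c:M" "p:cdom c"
 shows "sfn M p (%q. cmap c q j)"
proof (rule sfnI[OF c])
 have "smpt (cdim c) (cim c) (%x. x j) (cmap c p)" using cmap_Rn[OF c] by simp
 thus "smpt (cdim c) (cim c) (%x. cmap c (cinv c x) j) (cmap c p)" by (rule smpt_cR) (use c cmap_Rn in "auto simp: f_inv_into_f")
qed

lemma sfn_const [simp]: "sfn M p (%q. a)" unfolding sfn_def using cmap_Rn by simp

lemma sfn_binop:
 assumes "!!n S a b x. smpt n S a x ==> smpt n S b x ==> smpt n S (%x. F (a x) (b x)) x"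
 shows "sfn M p h ==> sfn M p h' ==> sfn M p (%q. F (h q) (h' q))" unfolding sfn_def by (simp add: assms)

lemma sfn_add: "sfn M p h ==> sfn M p h' ==> sfn M p (%q. h q + h' q)" by (rule sfn_binop) (rule smpt_add)
lemma sfn_mult: "sfn M p h ==> sfn M p h' ==> sfn M p (%q. h q * h' q)" by (rule sfn_binop) (rule smpt_mult)
lemma sfn_diff: "sfn M p h ==> sfn M p h' ==> sfn M p (%q. h q - h' q)" by (rule sfn_binop) (rule smpt_diff)
lemma sfn_sin: "sfn M p h ==> sfn M p (%q. sin (h q))" by (rule sfn_binop[where F = "%a b. sin a"]) (rule smpt_sin)
lemma sfn_step: "sfn M p h ==> sfn M p (%q. step (h q))" by (rule sfn_binop[where F = "%a b. step a"]) (rule smpt_step)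
lemma sfn_sum: "(!!a. a:A ==> sfn M p (h a)) ==> sfn M p (%q. \<Sum>a\<in>A. h a q)"
 by (induction A rule: infinite_finite_induct) (auto intro: sfn_add)
lemma sfn_power: "sfn M p h ==> sfn M p (%q. h q ^ k)" by (induction k) (auto intro: sfn_mult)
lemma sfn_divide: "sfn M p h ==> sfn M p h' ==> h' p > 0 ==> sfn M p (%q. h q / h' q)" unfolding sfn_def by (auto intro!: smpt_divide)
lemma sfn_sqrt: "sfn M p h ==> h p > 0 ==> sfn M p (%q. sqrt (h q))" unfolding sfn_def by (auto intro!: smpt_sqrt)

lemma sfn_pre:
 assumes h: "!!q. q:D ==> sfn M q h" and D: "mopen M D" and A: "open A"
 shows "mopen M {q:D. h q:A}"
proof (rule openin_mfdI)
 show "{q:D. h q:A} <= car M" using opn_car[OF D] by auto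
 fix p assume p: "p:{q:D. h q:A}"
 then obtain c where c: "c:M" "p:cdom c" using opn_car[OF D] by (auto simp: car_def)
 define F where "F x = (%j::nat. if j = 0 then h (cinv c x) else 0)" for x
 have "ropen (Rn 1) (Rn 1 Int {y. y 0:A})" using product_topology_basis'[of "{0::nat}" "%_. A" "%i. i"] A by auto
 then obtain S' where S': "ropen (cim c) S'" "cmap c p:S'" "F ` S' <= Rn 1 Int {y. y 0:A}"
 using smpts_preimage[of "cim c" "cdim c" "cmap c p" 1 F "Rn 1" "Rn 1 Int {y. y 0:A}"]
 cim_Rn[OF c(1)] c sfnD[OF h c] p by (auto simp: F_def Rn_iff)
 have "mopen M (D Int {q:cdom c. cmap c q:S'})" using D chart_openI[OF c(1) S'(1)] by blast
 moreover have "h q:A" if "q:cdom c" "cmap c q:S'" for q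
 proof -
 have "F (cmap c q):Rn 1 Int {y. y 0:A}" using S'(3) that by blast
 thus ?thesis using that c by (simp add: F_def)
 qed
 ultimately show "EX B. mopen M B & p:B & B <= {q:D. h q:A}" using p c S'(2) by (intro exI[of _ "D Int {q:cdom c. cmap c q:S'}"]) auto
qed

end

locale atlas2 = A: atlas M + B: atlas N for M :: "'a chart set" and N :: "'b chart set"
begin

lemma smap_car: "smap M N p f ==> p:car M & f p:car N" unfolding smap_def car_def using A.opn_car[unfolded car_def] by blast

lemma smap_cont:
 assumes f: "smap M N p f" and W: "mopen N W" "f p:W"
 shows "EX V. mopen M V & p:V & f ` V <= W"
proof -
 obtain V d where V: "mopen M V" "p:V" and d: "d:N" "f ` V <= cdom d"
 and s: "!!j. sfn M p (%q. cmap d (f q) j)" using f unfolding smap_def by blast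
 obtain c where c: "c:M" "p:cdom c" using V A.opn_car by (auto simp: car_def)
 let ?S = "cmap c ` (V Int cdom c)"
 have o: "ropen (cim c) ?S" using A.open_chart[OF V(1) c(1)] .
 have "EX S'. ropen ?S S' & cmap c p:S' & (%x. cmap d (f (cinv c x))) ` S' <= cmap d ` (W Int cdom d)"
 proof (rule smpts_preimage[OF _ _ _ _ B.cim_Rn[OF d(1)] B.open_chart[OF W(1) d(1)]])
 show "smpt (cdim c) ?S (%y. cmap d (f (cinv c y)) j) (cmap c p)" if "j < cdim d" for j by (rule smpt_mono[OF A.sfnD[OF s c]]) auto
 show "cmap d (f (cinv c (cmap c p))):cmap d ` (W Int cdom d)" using c d V W by auto
 fix y assume "y:?S"
 thus "cmap d (f (cinv c y)):cim d" using c d by auto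
 qed (use c V A.cim_Rn[OF c(1)] in auto)
 then obtain S' where S': "ropen ?S S'" "cmap c p:S'" "(%x. cmap d (f (cinv c x))) ` S' <= cmap d ` (W Int cdom d)" by blast
 have "ropen (cim c) S'" using S'(1) o openin_trans by blast
 from A.chart_openI[OF c(1) this]
 have "mopen M {q:cdom c. cmap c q:S'}" .
 moreover have "f q:W" if "q:cdom c" "cmap c q:S'" for q
 proof -
 have "q:V" using that op_sub[OF S'(1)] A.inj[OF c(1)] by (auto dest: inj_onD)
 moreover have "cmap d (f q):cmap d ` (W Int cdom d)" using S'(3) that c by auto
 ultimately show ?thesis using B.inj[OF d(1)] d by (auto dest: inj_onD)
 qed
 ultimately show ?thesis using c S'(2) by (intro exI[of _ "{q:cdom c. cmap c q:S'}"]) auto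
qed

lemma sfn_compose:
 assumes f: "smap M N p f" and h: "sfn N (f p) h"
 shows "sfn M p (%q. h (f q))"
proof -
 obtain V d where V: "mopen M V" "p:V" and d: "d:N" "f ` V <= cdom d"
 and s: "!!j. sfn M p (%q. cmap d (f q) j)" using f unfolding smap_def by blast
 show ?thesis unfolding sfn_def
 proof (intro ballI impI)
 fix c assume c: "c:M" "p:cdom c"
 let ?S = "cmap c ` (V Int cdom c)"
 have o: "ropen (cim c) ?S" using A.open_chart[OF V(1) c(1)] .
 have S: "qopen (cdim c) ?S" using qopen_openin[OF A.cim_qopen[OF c(1)] o] .
 have "smpt (cdim c) ?S (%x. (%y. h (cinv d y)) (cmap d (f (cinv c x)))) (cmap c p)"
 proof (rule smpt_compose[where F = "%x. cmap d (f (cinv c x))" and h = "%y. h (cinv d y)", OF S _ B.cim_qopen[OF d(1)]])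
 show "smpt (cdim d) (cim d) (%y. h (cinv d y)) (cmap d (f (cinv c (cmap c p))))" using B.sfnD[OF h d(1)] c d V by auto
 show "smpt (cdim c) ?S (%y. cmap d (f (cinv c y)) j) (cmap c p)" if "j < cdim d" for j by (rule smpt_mono[OF A.sfnD[OF s c]]) auto
 qed (use c d V in auto)
 hence "smpt (cdim c) ?S (%x. h (f (cinv c x))) (cmap c p)" by (rule smpt_cR) (use c d V A.cmap_Rn B.cinv_cmap in auto)
 thus "smpt (cdim c) (cim c) (%x. h (f (cinv c x))) (cmap c p)" by (rule smpt_local[OF _ o A.cim_Rn[OF c(1)]]) (use c V in auto)
 qed
qed

lemma smap_chart:
 assumes f: "smap M N p f" and d: "d:N" "f p:cdom d"
 shows "EX V. mopen M V & p:V & f ` V <= cdom d" "sfn M p (%q. cmap d (f q) j)"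
 using smap_cont[OF f B.cdom_open[OF d(1)] d(2)] sfn_compose[OF f B.sfn_coord[OF d]] by auto

lemma smap_cong:
 assumes "smap M N p f" "mopen M V" "p:V" "!!q. q:V ==> f q = g q"
 shows "smap M N p g"
proof -
 obtain W d where W: "mopen M W" "p:W" and d: "d:N" "f ` W <= cdom d"
 and s: "!!j. sfn M p (%q. cmap d (f q) j)" using assms(1) unfolding smap_def by blast
 show ?thesis unfolding smap_def
 proof (intro exI[of _ "V Int W"] conjI bexI[of _ d] allI)
 show "sfn M p (%q. cmap d (g q) j)" for j by (rule A.sfn_cong[OF s assms(2,3)]) (use assms(4) in auto)
 show "g ` (V Int W) <= cdom d" using assms(4) d(2) by force
 qed (use assms W d in auto)
qed

end

lemma smap_id: "atl M ==> p:car M ==> smap M M p (%q. q)"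
proof -
 assume M: "atl M" "p:car M"
 interpret atlas M by standard (rule M)
 obtain c where c: "c:M" "p:cdom c" using M by (auto simp: car_def)
 show ?thesis unfolding smap_def by (intro exI[of _ "cdom c"] conjI bexI[of _ c]) (use c cdom_open sfn_coord in auto)
qed

lemma smap_compose:
 assumes "atl M" "atl N" "atl P" "smap M N p f" "smap N P (f p) g"
 shows "smap M P p (%q. g (f q))"
proof -
 interpret MN: atlas2 M N by standard (use assms in auto)
 obtain W e where W: "mopen N W" "f p:W" and e: "e:P" "g ` W <= cdom e"
 and s: "!!j. sfn N (f p) (%q. cmap e (g q) j)" using assms(5) unfolding smap_def by blast
 obtain V where V: "mopen M V" "p:V" "f ` V <= W" using MN.smap_cont[OF assms(4) W] by blast
 show ?thesis unfolding smap_def by (intro exI[of _ V] conjI bexI[of _ e]) (use V e MN.sfn_compose[OF assms(4) s] in auto)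
qed

section \<open>Forms on open subsets\<close>

definition smaps :: "'a chart set => 'b chart set => 'a set => ('a => 'b) => bool" where
 "smaps M N D f <-> mopen M D & (ALL p:D. smap M N p f)"

definition fo :: "'a chart set => 'a set => int => 'a form => bool" where
 "fo M D k om <-> (ALL p:D. ALL c:M. p:cdom c -->
 alt_form (cdim c) k (om c (cmap c p)) &
 (ALL vs. smpt (cdim c) (cim c) (%x. om c x vs) (cmap c p)) &
 (ALL d:M. p:cdom d --> (ALL vs. set vs <= Rn (cdim c) -->
 om c (cmap c p) vs = om d (cmap d p) (map (rtan id c d (cmap c p)) vs))))"

definition agree :: "'a chart set => 'a set => 'a form => 'a form => bool" where
 "agree M D om om' <-> (ALL p:D. ALL c:M. p:cdom c --> om c (cmap c p) = om' c (cmap c p))"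

definition zero_out :: "'a chart set => 'a form => bool" where
 "zero_out M om <-> (ALL c x. ~ (c:M & x:cim c) --> om c x = 0)"

definition fmul :: "('a => real) => 'a form => 'a form" where
 "fmul h om = (%c x vs. h (cinv c x) * om c x vs)"

lemma agreeD: "agree M D om om' ==> p:D ==> c:M ==> p:cdom c ==> om c (cmap c p) = om' c (cmap c p)" by (simp add: agree_def)

lemma agreeI: "(!!p c vs. p:D ==> c:M ==> p:cdom c ==> om c (cmap c p) vs = om' c (cmap c p) vs) ==> agree M D om om'"
 by (auto simp: agree_def)

lemma agree_sym: "agree M D om om' ==> agree M D om' om" by (simp add: agree_def)
lemma agree_trans: "agree M D om om' ==> agree M D om' om'' ==> agree M D om om''" by (simp add: agree_def)
lemma agree_refl: "agree M D om om" by (simp add: agree_def)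
lemma agree_mono: "agree M D om om' ==> D' <= D ==> agree M D' om om'" by (auto simp: agree_def)
lemma agree_Un: "agree M D om om' ==> agree M D' om om' ==> agree M (D Un D') om om'" by (auto simp: agree_def)

lemma agree_eq: "agree M (car M) om om' ==> zero_out M om ==> zero_out M om' ==> om = om'"
proof (rule ext, rule ext)
 fix c x assume a: "agree M (car M) om om'" "zero_out M om" "zero_out M om'"
 show "om c x = om' c x"
 proof (cases "c:M & x:cim c")
 case True
 then obtain p where "p:cdom c" "x = cmap c p" by blast
 thus ?thesis using agreeD[OF a(1), of p c] True by (auto simp: car_def)
 next
 case False thus ?thesis using a unfolding zero_out_def by metis
 qed
qed

lemma fo_mono: "fo M D k om ==> D' <= D ==> fo M D' k om" unfolding fo_def by blast
lemma fo_Un: "fo M D k om ==> fo M D' k om ==> fo M (D Un D') k om" unfolding fo_def by blast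

lemma smaps_open: "smaps M N D f ==> mopen M D" by (simp add: smaps_def)
lemma smapsD: "smaps M N D f ==> p:D ==> smap M N p f" by (simp add: smaps_def)
lemma smaps_subset: "smaps M N D f ==> mopen M D' ==> D' <= D ==> smaps M N D' f" by (auto simp: smaps_def)

context atlas
begin

lemma foD:
 assumes "fo M D k om" "p:D" "c:M" "p:cdom c"
 shows "alt_form (cdim c) k (om c (cmap c p))"
 "smpt (cdim c) (cim c) (%x. om c x vs) (cmap c p)"
 "d:M ==> p:cdom d ==> set vs <= Rn (cdim c) ==>
 om c (cmap c p) vs = om d (cmap d p) (map (rtan id c d (cmap c p)) vs)" using assms unfolding fo_def by blast+

lemma forms_fo: "om:forms M k <-> zero_out M om & fo M (car M) k om"
proof -
 have "fo M (car M) k om <-> (ALL c:M. ALL p:cdom c.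
 alt_form (cdim c) k (om c (cmap c p)) &
 (ALL vs. smpt (cdim c) (cim c) (%x. om c x vs) (cmap c p)) &
 (ALL d:M. p:cdom d --> (ALL vs. set vs <= Rn (cdim c) -->
 om c (cmap c p) vs = om d (cmap d p) (map (rtan id c d (cmap c p)) vs))))" unfolding fo_def car_def by blast
 also have "\<dots> <-> (ALL c:M. ALL p:cdom c.
 alt_form (cdim c) k (om c (cmap c p)) &
 (ALL vs. smpt (cdim c) (cim c) (%x. om c x vs) (cmap c p)) &
 (ALL d:M. p:cdom d --> (ALL vs. set vs <= Rn (cdim c) -->
 om c (cmap c p) vs = om d (lrep id c d (cmap c p)) (map (rtan id c d (cmap c p)) vs))))" by (simp add: lrep_def cong: ball_cong)
 also have "\<dots> <-> (ALL c:M. ALL x:cim c. alt_form (cdim c) k (om c x)) &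
 (ALL c:M. ALL vs. smooth_fun (cdim c) (cim c) (%x. om c x vs)) &
 (ALL c:M. ALL d:M. ALL x:rep_dom id c d. ALL vs. set vs <= Rn (cdim c) -->
 om c x vs = om d (lrep id c d x) (map (rtan id c d x) vs))" unfolding smooth_fun_pt rep_dom_id by blast
 finally show ?thesis by (simp add: forms_def zero_out_def)
qed

lemma fo_open_chart:
 assumes "fo M D k om" "mopen M D" "c:M"
 shows "ropen (cim c) (cmap c ` (D Int cdom c))"
 "x:cmap c ` (D Int cdom c) ==> alt_form (cdim c) k (om c x)"
 "x:cmap c ` (D Int cdom c) ==> smpt (cdim c) (cim c) (%x. om c x vs) x"
 using open_chart[OF assms(2,3)] foD[OF assms(1) _ assms(3)] by auto

lemma fo_agree:
 assumes f: "fo M D k om" and D: "mopen M D" and a: "agree M D om om'"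
 shows "fo M D k om'" unfolding fo_def
proof (intro ballI impI conjI allI)
 fix p c assume p: "p:D" and c: "c:M" "p:cdom c"
 show "alt_form (cdim c) k (om' c (cmap c p))" using foD(1)[OF f p c] agreeD[OF a p c] by simp
 fix vs
 have "smpt (cdim c) (cmap c ` (D Int cdom c)) (%x. om c x vs) (cmap c p)" by (rule smpt_mono[OF foD(2)[OF f p c]]) auto
 hence "smpt (cdim c) (cmap c ` (D Int cdom c)) (%x. om' c x vs) (cmap c p)" by (rule smpt_cR) (use c cmap_Rn agreeD[OF a _ c(1)] in auto)
 thus "smpt (cdim c) (cim c) (%x. om' c x vs) (cmap c p)"
 by (rule smpt_local[OF _ open_chart[OF D c(1)] cim_Rn[OF c(1)]]) (use p c in auto)
 fix d assume d: "d:M" "p:cdom d" "set vs <= Rn (cdim c)"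
 show "om' c (cmap c p) vs = om' d (cmap d p) (map (rtan id c d (cmap c p)) vs)"
 using foD(3)[OF f p c d] agreeD[OF a p c] agreeD[OF a p d(1,2)] by simp
qed

lemma fo_zero: "fo M D k 0" unfolding fo_def using cmap_Rn by (auto simp: zfun_def alt_0)

lemma fo_zero': "mopen M D ==> (!!p c. p:D ==> c:M ==> p:cdom c ==> om c (cmap c p) = 0) ==> fo M D k om"
 by (rule fo_agree[OF fo_zero]) (auto simp: agree_def)

lemma fo_add: "fo M D k om ==> fo M D k om' ==> fo M D k (om + om')" unfolding fo_def plus_fun_def by (auto intro: alt_plus smpt_add)

lemma fo_fmul:
 assumes "fo M D k om" "!!p. p:D ==> sfn M p h"
 shows "fo M D k (fmul h om)" unfolding fo_def fmul_def
proof (intro ballI impI conjI allI)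
 fix p c assume p: "p:D" and c: "c:M" "p:cdom c"
 show "alt_form (cdim c) k ((%vs. h (cinv c (cmap c p)) * om c (cmap c p) vs))" using alt_cmult[OF foD(1)[OF assms(1) p c]] .
 show "smpt (cdim c) (cim c) (%x. h (cinv c x) * om c x vs) (cmap c p)" for vs
 by (intro smpt_mult sfnD[OF assms(2)[OF p] c] foD(2)[OF assms(1) p c])
 fix d vs assume d: "d:M" "p:cdom d" "set vs <= Rn (cdim c)"
 show "h (cinv c (cmap c p)) * om c (cmap c p) vs =
 h (cinv d (cmap d p)) * om d (cmap d p) (map (rtan id c d (cmap c p)) vs)" using foD(3)[OF assms(1) p c d] c d by simp
qed

lemma fo_cmult: "fo M D k om ==> fo M D k (a *R om)" using fo_fmul[of D k om "%_. a"] by (simp add: fmul_def sfun_def)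

lemma fo_uminus: "fo M D k om ==> fo M D k (- om)" using fo_cmult[of D k om "-1"] by simp

lemma fo_diff: "fo M D k om ==> fo M D k om' ==> fo M D k (om - om')" using fo_add[OF _ fo_uminus, of D k om om'] by simp

end

context atlas2
begin

lemma pull_local:
 assumes f: "smaps M N D f" and p: "p:D" and c: "c:M" "p:cdom c" and d: "d:N" "f p:cdom d"
 and W: "ropen (cim d) W" "cmap d (f p):W"
 shows "EX S'. ropen (cim c) S' & cmap c p:S' & S' <= cmap c ` (D Int cdom c) &
 (ALL x:S'. f (cinv c x):cdom d & lrep f c d x:W) &
 coord_map (cdim c) S' (cdim d) (cim d) (lrep f c d) &
 (ALL x:S'. ALL v. tangent_map (cdim c) S' (lrep f c d) x v = rtan f c d x v)"
proof -
 have Wo: "mopen N {q:cdom d. cmap d q:W}" by (rule B.chart_openI[OF d(1) W(1)])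
 obtain V where V: "mopen M V" "p:V" "f ` V <= {q:cdom d. cmap d q:W}" using smap_cont[OF smapsD[OF f p] Wo] d W by blast
 let ?V = "V Int D"
 let ?S = "cmap c ` (?V Int cdom c)"
 have o: "ropen (cim c) ?S" using A.open_chart[OF openin_Int[OF V(1) smaps_open[OF f]] c(1)] .
 have qS: "qopen (cdim c) ?S" using qopen_openin[OF A.cim_qopen[OF c(1)] o] .
 have sub: "?S <= rep_dom f c d" using V by (auto simp: rep_dom_def)
 have o2: "ropen (rep_dom f c d) ?S" by (rule openin_subset_trans[OF o sub]) (auto simp: rep_dom_def)
 have rR: "rep_dom f c d <= Rn (cdim c)" using A.cim_Rn[OF c(1)] by (auto simp: rep_dom_def)
 have cm: "coord_map (cdim c) ?S (cdim d) (cim d) (lrep f c d)"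
 proof
 fix x j assume "x:?S"
 then obtain q where q: "q:V" "q:D" "q:cdom c" "x = cmap c q" by blast
 hence "f q:cdom d" using V by blast
 from A.sfnD[OF smap_chart(2)[OF smapsD[OF f q(2)] d(1) this] c(1) q(3), of j]
 have "smpt (cdim c) (cim c) (%x. cmap d (f (cinv c x)) j) x" unfolding q(4) .
 thus "smpt (cdim c) ?S (%y. lrep f c d y j) x" by (auto simp: lrep_def intro: smpt_mono)
 qed (use qS B.cim_qopen[OF d(1)] V c in "auto simp: lrep_def")
 show ?thesis
 proof (intro exI[of _ ?S] conjI o cm)
 show "ALL x:?S. ALL v. tangent_map (cdim c) ?S (lrep f c d) x v = rtan f c d x v"
 using tangent_map_local[OF o2 _ rR] by (simp add: rep_tangent_def)
 qed (use p c V in "auto simp: lrep_def")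
qed

lemma rtan_Rn:
 assumes "smaps M N D f" "p:D" "c:M" "p:cdom c" "d:N" "f p:cdom d"
 shows "rtan f c d (cmap c p) v:Rn (cdim d)"
 and "rtan f c d (cmap c p) (a *R v + w) = a *R rtan f c d (cmap c p) v + rtan f c d (cmap c p) w"
proof -
 obtain S' where S': "ropen (cim c) S'" "cmap c p:S'" "coord_map (cdim c) S' (cdim d) (cim d) (lrep f c d)"
 "ALL x:S'. ALL v. tangent_map (cdim c) S' (lrep f c d) x v = rtan f c d x v"
 using pull_local[OF assms openin_subtopology_self] assms by blast
 interpret C: coord_map "cdim c" S' "cdim d" "cim d" "lrep f c d" by (rule S')
 show "rtan f c d (cmap c p) v:Rn (cdim d)" using C.TR[OF S'(2)] S'(2,4) by simp
 show "rtan f c d (cmap c p) (a *R v + w) = a *R rtan f c d (cmap c p) v + rtan f c d (cmap c p) w"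
 using tangent_map_lin[OF C.S S'(2)] S'(2,4) by metis
qed

end

lemma rtan_chain:
 assumes at: "atl M" "atl N" "atl P"
 and f: "smaps M N D f" and g: "smaps N P E g" and fp: "f p:E" and p: "p:D"
 and c: "c:M" "p:cdom c" and d: "d:N" "f p:cdom d" and e: "e:P" "g (f p):cdom e"
 shows "rtan (%q. g (f q)) c e (cmap c p) v = rtan g d e (cmap d (f p)) (rtan f c d (cmap c p) v)"
proof -
 interpret MN: atlas2 M N by standard (use at in auto)
 interpret NP: atlas2 N P by standard (use at in auto)
 obtain S2 where S2: "ropen (cim d) S2" "cmap d (f p):S2" "S2 <= cmap d ` (E Int cdom d)"
 "ALL x:S2. g (cinv d x):cdom e" and G: "coord_map (cdim d) S2 (cdim e) (cim e) (lrep g d e)"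
 "ALL x:S2. ALL v. tangent_map (cdim d) S2 (lrep g d e) x v = rtan g d e x v"
 using NP.pull_local[OF g fp d e openin_subtopology_self] e by blast
 obtain S1 where S1: "ropen (cim c) S1" "cmap c p:S1" "S1 <= cmap c ` (D Int cdom c)"
 "ALL x:S1. f (cinv c x):cdom d & lrep f c d x:S2" and F: "coord_map (cdim c) S1 (cdim d) (cim d) (lrep f c d)"
 "ALL x:S1. ALL v. tangent_map (cdim c) S1 (lrep f c d) x v = rtan f c d x v" using MN.pull_local[OF f p c d S2(1,2)] by blast
 interpret F: coord_map "cdim c" S1 "cdim d" "cim d" "lrep f c d" by (rule F)
 interpret G: coord_map "cdim d" S2 "cdim e" "cim e" "lrep g d e" by (rule G)
 let ?gf = "%q. g (f q)"
 have bk: "cinv d (lrep f c d x) = f (cinv c x)" if "x:S1" for x using S1(4) that d(1) by (simp add: lrep_def)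
 have sub: "S1 <= rep_dom ?gf c e"
 proof
 fix x assume x: "x:S1"
 then obtain q where q: "q:D" "q:cdom c" "x = cmap c q" using S1(3) by blast
 have "g (cinv d (lrep f c d x)):cdom e" using S1(4) S2(4) x by blast
 hence "g (f q):cdom e" using bk[OF x] q c by simp
 thus "x:rep_dom ?gf c e" using q by (auto simp: rep_dom_def)
 qed
 have o: "ropen (rep_dom ?gf c e) S1" by (rule openin_subset_trans[OF S1(1) sub]) (auto simp: rep_dom_def)
 have rR: "rep_dom ?gf c e <= Rn (cdim c)" using MN.A.cim_Rn[OF c(1)] by (auto simp: rep_dom_def)
 have x: "cmap c p:S1" by (rule S1)
 have Fx: "lrep f c d (cmap c p) = cmap d (f p)" using c by (simp add: lrep_def)
 have "rtan ?gf c e (cmap c p) v i = rtan g d e (cmap d (f p)) (rtan f c d (cmap c p) v) i" for i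
 proof -
 have "rtan ?gf c e (cmap c p) v i = ddv (cdim c) S1 v (%y. lrep ?gf c e y i) (cmap c p)"
 unfolding rep_tangent_def tmap_def using ddv_local[OF o x rR] by simp
 also have "\<dots> = ddv (cdim c) S1 v (%y. lrep g d e (lrep f c d y) i) (cmap c p)"
 by (rule ddv_cong'[OF x]) (use bk F.S qopen_Rn in "auto simp: lrep_def")
 also have "\<dots> = ddv (cdim d) (cim d) (rtan f c d (cmap c p) v) (%y. lrep g d e y i) (cmap d (f p))"
 proof -
 have "smpt (cdim d) (cim d) (%y. lrep g d e y i) (lrep f c d (cmap c p))"
 using smpt_local[OF G.F S2(1) MN.B.cim_Rn[OF d(1)]] S2(2) Fx by simp
 from F.ddv_comp[OF x this, of v] show ?thesis using F(2) x Fx by simp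
 qed
 also have "\<dots> = ddv (cdim d) S2 (rtan f c d (cmap c p) v) (%y. lrep g d e y i) (cmap d (f p))"
 using ddv_local[OF S2(1,2) MN.B.cim_Rn[OF d(1)]] by simp
 also have "\<dots> = rtan g d e (cmap d (f p)) (rtan f c d (cmap c p) v) i" using G(2) S2(2) by (metis tmap_def)
 finally show ?thesis .
 qed
 thus ?thesis by blast
qed

lemma smaps_id: "atl M ==> mopen M D ==> smaps M M D id"
proof -
 assume M: "atl M" "mopen M D"
 interpret atlas M by standard (rule M)
 show ?thesis unfolding smaps_def id_def using M(2) opn_car[OF M(2)] smap_id[OF M(1)] by auto
qed

lemma smaps_compose:
 assumes "atl M" "atl N" "atl P" "smaps M N D f" "smaps N P E g" "!!p. p:D ==> f p:E"
 shows "smaps M P D (%q. g (f q))" unfolding smaps_def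
 using smap_compose[OF assms(1-3) smapsD[OF assms(4)] smapsD[OF assms(5) assms(6)]] smaps_open[OF assms(4)] by simp

lemma rtan_id:
 assumes "atl M" "c:M" "p:cdom c" "v:Rn (cdim c)"
 shows "rtan id c c (cmap c p) v = v"
proof
 interpret atlas M by standard (rule assms)
 fix i
 have r: "rep_dom id c c = cim c" by (simp add: rep_dom_id)
 have "ddv (cdim c) (cim c) v (%y. lrep id c c y i) (cmap c p) = ddv (cdim c) (cim c) v (%y. y i) (cmap c p)"
 by (rule ddv_cong') (use assms cim_Rn in "auto simp: lrep_def f_inv_into_f")
 thus "rtan id c c (cmap c p) v i = v i"
 using ddv_coord[OF cim_qopen[OF assms(2)] _ assms(4)] assms(3) by (simp add: rep_tangent_def tmap_def r)
qed

lemma pb_eq: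
 assumes at: "atl M" "atl N" and f: "smaps M N D f" and w: "fo N E k om" and fp: "f p:E" and p: "p:D"
 and c: "c:M" "p:cdom c" and d: "d:N" "f p:cdom d" and vs: "set vs <= Rn (cdim c)"
 shows "pb M N f om c (cmap c p) vs = om d (cmap d (f p)) (map (rtan f c d (cmap c p)) vs)"
proof -
 interpret MN: atlas2 M N by standard (use at in auto)
 define e where "e = (SOME d. d:N & f p:cdom d)"
 have e: "e:N" "f p:cdom e" using someI[of "%d. d:N & f p:cdom d" d] d by (auto simp: e_def)
 have 1: "pb M N f om c (cmap c p) vs = om e (cmap e (f p)) (map (rtan f c e (cmap c p)) vs)"
 using c vs by (simp add: pb_def Let_def e_def[symmetric] lrep_def)
 have vs': "set (map (rtan f c e (cmap c p)) vs) <= Rn (cdim e)" using MN.rtan_Rn(1)[OF f p c e] by auto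
 have carr: "smaps N N (car N) id" by (rule smaps_id[OF at(2)]) (metis MN.B.tsp openin_topspace)
 have "f p:car N" using d by (auto simp: car_def)
 have "rtan f c d (cmap c p) = rtan id e d (cmap e (f p)) o rtan f c e (cmap c p)"
 using rtan_chain[OF at(1,2,2) f carr `f p:car N` p c e d(1)] d by (simp add: fun_eq_iff)
 thus ?thesis unfolding 1 MN.B.foD(3)[OF w fp e d vs'] by simp
qed

lemma pb_zo: "zero_out M (pb M N f om)" by (auto simp: zero_out_def pb_def fun_eq_iff)

lemma ext_d_zero_out: "zero_out M (ext_d M om)" by (auto simp: zero_out_def ext_d_def fun_eq_iff)

lemma pb_fo:
 assumes at: "atl M" "atl N" and f: "smaps M N D f" and w: "fo N E k om" and E: "mopen N E"
 and fD: "!!p. p:D ==> f p:E"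
 shows "fo M D k (pb M N f om)" unfolding fo_def
proof (intro ballI impI conjI allI)
 interpret MN: atlas2 M N by standard (use at in auto)
 fix p c assume p: "p:D" and c: "c:M" "p:cdom c"
 obtain d where d: "d:N" "f p:cdom d" using MN.smap_car[OF smapsD[OF f p]] by (auto simp: car_def)
 note eq = pb_eq[OF at f w]
 have z: "pb M N f om c x vs = 0" if "~ set vs <= Rn (cdim c)" for vs x using that by (simp add: pb_def)
 have "pb M N f om c (cmap c p) = (%vs. if set vs <= Rn (cdim c) then om d (cmap d (f p)) (map (rtan f c d (cmap c p)) vs) else 0)"
 using eq[OF fD[OF p] p c d] z by auto
 moreover have "alt_form (cdim c) k \<dots>" by (rule alt_map[OF MN.B.foD(1)[OF w fD[OF p] d]]) (use MN.rtan_Rn[OF f p c d] in auto)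
 ultimately show "alt_form (cdim c) k (pb M N f om c (cmap c p))" by simp
 fix vs
 show "smpt (cdim c) (cim c) (%x. pb M N f om c x vs) (cmap c p)"
 proof (cases "set vs <= Rn (cdim c)")
 case True
 have oE: "ropen (cim d) (cmap d ` (E Int cdom d))" by (rule MN.B.open_chart[OF E d(1)])
 obtain S' where S': "ropen (cim c) S'" "cmap c p:S'" "S' <= cmap c ` (D Int cdom c)"
 "ALL x:S'. f (cinv c x):cdom d & lrep f c d x:cmap d ` (E Int cdom d)"
 "coord_map (cdim c) S' (cdim d) (cim d) (lrep f c d)"
 "ALL x:S'. ALL v. tangent_map (cdim c) S' (lrep f c d) x v = rtan f c d x v" using MN.pull_local[OF f p c d oE] fD[OF p] d by blast
 interpret C: coord_map "cdim c" S' "cdim d" "cim d" "lrep f c d" by (rule S')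
 have "smpt (cdim c) S' (%y. om d (lrep f c d y) (map (C.T y) vs)) (cmap c p)"
 proof (rule C.smooth_pull[OF _ S'(2)])
 fix y assume "y:S'"
 thus "alt_form (cdim d) k (om d (lrep f c d y))" using MN.B.fo_open_chart(2)[OF w E d(1)] S'(4) by blast
 next
 show "smpt (cdim d) (cim d) (%z. om d z us) (lrep f c d (cmap c p))" for us using MN.B.foD(2)[OF w fD[OF p] d] c by (simp add: lrep_def)
 qed
 hence "smpt (cdim c) S' (%x. pb M N f om c x vs) (cmap c p)"
 proof (rule smpt_cR)
 fix y assume y: "y:S'"
 then obtain q where q: "q:D" "q:cdom c" "y = cmap c q" using S'(3) by blast
 have fq: "f q:cdom d" using S'(4) y q c by auto
 have T: "C.T y = rtan f c d y" using S'(6) y by auto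
 show "pb M N f om c y vs = om d (lrep f c d y) (map (C.T y) vs)"
 unfolding T using eq[OF fD[OF q(1)] q(1) c(1) q(2) d(1) fq True] q c by (simp add: lrep_def)
 qed (use MN.A.cmap_Rn c in auto)
 thus ?thesis by (rule smpt_local[OF _ S'(1) MN.A.cim_Rn[OF c(1)] S'(2)])
 next
 case False
 thus ?thesis using z MN.A.cmap_Rn[OF c] by simp
 qed
 fix c' assume c': "c':M" "p:cdom c'" and vs: "set vs <= Rn (cdim c)"
 have idD: "smaps M M D id" by (rule smaps_id[OF at(1) smaps_open[OF f]])
 have vs': "set (map (rtan id c c' (cmap c p)) vs) <= Rn (cdim c')"
 proof -
 interpret MM: atlas2 M M ..
 show ?thesis using MM.rtan_Rn(1)[OF idD p c c'(1)] c' by auto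
 qed
 have "rtan f c d (cmap c p) = rtan f c' d (cmap c' p) o rtan id c c' (cmap c p)"
 using rtan_chain[OF at(1,1,2) idD f _ p c c'(1) _ d(1)] p c' d by (simp add: fun_eq_iff)
 thus "pb M N f om c (cmap c p) vs = pb M N f om c' (cmap c' p) (map (rtan id c c' (cmap c p)) vs)"
 unfolding eq[OF fD[OF p] p c d vs] eq[OF fD[OF p] p c' d vs'] by simp
qed

lemma pb_compose:
 assumes at: "atl M" "atl N" "atl P"
 and f: "smaps M N D f" and g: "smaps N P E g" and w: "fo P G k om" "mopen P G"
 and fD: "!!p. p:D ==> f p:E" and gE: "!!p. p:E ==> g p:G"
 shows "agree M D (pb M N f (pb N P g om)) (pb M P (%q. g (f q)) om)" unfolding agree_def
proof (intro ballI impI)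
 interpret MN: atlas2 M N by standard (use at in auto)
 interpret NP: atlas2 N P by standard (use at in auto)
 fix p c assume p: "p:D" and c: "c:M" "p:cdom c"
 obtain d where d: "d:N" "f p:cdom d" using MN.smap_car[OF smapsD[OF f p]] by (auto simp: car_def)
 obtain e where e: "e:P" "g (f p):cdom e" using NP.smap_car[OF smapsD[OF g fD[OF p]]] by (auto simp: car_def)
 have gw: "fo N E k (pb N P g om)" by (rule pb_fo[OF at(2,3) g w gE])
 have gf: "smaps M P D (%q. g (f q))" by (rule smaps_compose[OF at f g fD])
 have chain: "rtan (%q. g (f q)) c e (cmap c p) = rtan g d e (cmap d (f p)) o rtan f c d (cmap c p)"
 using rtan_chain[OF at f g fD[OF p] p c d e] by (simp add: fun_eq_iff)
 show "pb M N f (pb N P g om) c (cmap c p) = pb M P (%q. g (f q)) om c (cmap c p)"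
 proof
 fix vs
 show "pb M N f (pb N P g om) c (cmap c p) vs = pb M P (%q. g (f q)) om c (cmap c p) vs"
 proof (cases "set vs <= Rn (cdim c)")
 case True
 have vs': "set (map (rtan f c d (cmap c p)) vs) <= Rn (cdim d)" using MN.rtan_Rn(1)[OF f p c d] by auto
 show ?thesis using chain unfolding pb_eq[OF at(1,2) f gw fD[OF p] p c d True] pb_eq[OF at(2,3) g w(1) gE[OF fD[OF p]] fD[OF p] d e vs']
 pb_eq[OF at(1,3) gf w(1) gE[OF fD[OF p]] p c e True] by simp
 qed (simp add: pb_def)
 qed
qed

lemma ext_d_eq: "c:M ==> x:cim c ==> ext_d M om c x = (%vs. if set vs <= Rn (cdim c) then ddr (cdim c) (cim c) (om c) x vs else 0)"
 by (auto simp: ext_d_def ddr_def)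

lemma ext_d_pull_chart:
 assumes at: "atl M" "atl N" and f: "smaps M N D f" and w: "fo N E k om" and E: "mopen N E"
 and fD: "!!p. p:D ==> f p:E" and p: "p:D" and c: "c:M" "p:cdom c" and d: "d:N" "f p:cdom d"
 and vs: "set vs <= Rn (cdim c)"
 shows "ext_d M (pb M N f om) c (cmap c p) vs = ext_d N om d (cmap d (f p)) (map (rtan f c d (cmap c p)) vs)"
proof -
 interpret MN: atlas2 M N by standard (use at in auto)
 have oE: "ropen (cim d) (cmap d ` (E Int cdom d))" by (rule MN.B.open_chart[OF E d(1)])
 obtain S' where S': "ropen (cim c) S'" "cmap c p:S'" "S' <= cmap c ` (D Int cdom c)"
 "ALL x:S'. f (cinv c x):cdom d & lrep f c d x:cmap d ` (E Int cdom d)"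
 and C: "coord_map (cdim c) S' (cdim d) (cim d) (lrep f c d)"
 and T: "ALL x:S'. ALL v. tangent_map (cdim c) S' (lrep f c d) x v = rtan f c d x v" using MN.pull_local[OF f p c d oE] fD[OF p] d by blast
 interpret C: coord_map "cdim c" S' "cdim d" "cim d" "lrep f c d" by (rule C)
 have Fx: "lrep f c d (cmap c p) = cmap d (f p)" using c by (simp add: lrep_def)
 have Tx: "C.T (cmap c p) = rtan f c d (cmap c p)" using T S'(2) by auto
 have vs': "set (map (rtan f c d (cmap c p)) vs) <= Rn (cdim d)" using MN.rtan_Rn(1)[OF f p c d] by auto
 have "ext_d M (pb M N f om) c (cmap c p) vs = ddr (cdim c) S' (pb M N f om c) (cmap c p) vs"
 using ddr_local[OF S'(1,2) MN.A.cim_Rn[OF c(1)]] vs c by (simp add: ext_d_eq)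
 also have "\<dots> = ddr (cdim c) S' (%y us. om d (lrep f c d y) (map (C.T y) us)) (cmap c p) vs"
 proof (rule ddr_cong[OF S'(2), of _ "Rn (cdim c)"])
 fix y us assume y: "y:S'" and us: "set us <= set vs"
 then obtain q where q: "q:D" "q:cdom c" "y = cmap c q" using S'(3) by blast
 have fq: "f q:cdom d" using S'(4) y q c by auto
 have Ty: "C.T y = rtan f c d y" using T y by auto
 show "pb M N f om c y us = om d (lrep f c d y) (map (C.T y) us)"
 unfolding Ty using pb_eq[OF at f w fD[OF q(1)] q(1) c(1) q(2) d(1) fq, of us] us vs q c by (simp add: lrep_def)
 qed (use MN.A.cmap_Rn[OF c] in auto)
 also have "\<dots> = ddr (cdim d) (cim d) (om d) (lrep f c d (cmap c p)) (map (C.T (cmap c p)) vs)"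
 proof (rule C.ddr_pull[OF _ S'(2) _ vs])
 fix y assume "y:S'"
 thus "alt_form (cdim d) k (om d (lrep f c d y))" using MN.B.fo_open_chart(2)[OF w E d(1)] S'(4) by blast
 next
 show "smpt (cdim d) (cim d) (%z. om d z us) (lrep f c d (cmap c p))" for us unfolding Fx using MN.B.foD(2)[OF w fD[OF p] d] by simp
 qed
 also have "\<dots> = ext_d N om d (cmap d (f p)) (map (rtan f c d (cmap c p)) vs)" unfolding Fx Tx using vs' d by (simp add: ext_d_eq)
 finally show ?thesis .
qed

lemma ext_d_pb:
 assumes at: "atl M" "atl N" and f: "smaps M N D f" and w: "fo N E k om" and E: "mopen N E"
 and fD: "!!p. p:D ==> f p:E"
 shows "agree M D (ext_d M (pb M N f om)) (pb M N f (ext_d N om))" unfolding agree_def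
proof (intro ballI impI)
 interpret MN: atlas2 M N by standard (use at in auto)
 fix p c assume p: "p:D" and c: "c:M" "p:cdom c"
 define e where "e = (SOME d. d:N & f p:cdom d)"
 have e: "e:N" "f p:cdom e" using MN.smap_car[OF smapsD[OF f p]] someI_ex[of "%d. d:N & f p:cdom d"] by (auto simp: e_def car_def)
 show "ext_d M (pb M N f om) c (cmap c p) = pb M N f (ext_d N om) c (cmap c p)"
 proof
 fix vs
 show "ext_d M (pb M N f om) c (cmap c p) vs = pb M N f (ext_d N om) c (cmap c p) vs"
 proof (cases "set vs <= Rn (cdim c)")
 case True
 have "pb M N f (ext_d N om) c (cmap c p) vs = ext_d N om e (cmap e (f p)) (map (rtan f c e (cmap c p)) vs)"
 using c True by (simp add: pb_def Let_def e_def[symmetric] lrep_def)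
 thus ?thesis using ext_d_pull_chart[OF at f w E fD p c e True] by simp
 qed (simp add: pb_def ext_d_def)
 qed
qed

lemma pb_id:
 assumes at: "atl M" and D: "mopen M D" and w: "fo M D k om"
 shows "agree M D (pb M M id om) om"
proof (rule agreeI)
 interpret atlas M by standard (use at in auto)
 fix p c vs assume p: "p:D" and c: "c:M" "p:cdom c"
 show "pb M M id om c (cmap c p) vs = om c (cmap c p) vs"
 proof (cases "set vs <= Rn (cdim c)")
 case True
 have "map (rtan id c c (cmap c p)) vs = map id vs" using True rtan_id[OF at c] by (intro map_cong) auto
 thus ?thesis using pb_eq[OF at at smaps_id[OF at D] w _ p c, of c vs] p c True by simp
 next
 case False
 thus ?thesis using alt_zero[OF foD(1)[OF w p c]] by (auto simp: pb_def)
 qed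
qed

context atlas
begin

lemma ext_d_agree:
 assumes D: "mopen M D" and a: "agree M D om om'"
 shows "agree M D (ext_d M om) (ext_d M om')"
proof (rule agreeI)
 fix p c vs assume p: "p:D" and c: "c:M" "p:cdom c"
 let ?S = "cmap c ` (D Int cdom c)"
 have x: "cmap c p:?S" using p c by auto
 note l = ddr_local[OF open_chart[OF D c(1)] x cim_Rn[OF c(1)], symmetric]
 have "ddr (cdim c) ?S (om c) (cmap c p) vs = ddr (cdim c) ?S (om' c) (cmap c p) vs"
 by (rule ddr_cong[OF x, of _ "Rn (cdim c)"]) (use agreeD[OF a] c cmap_Rn in auto)
 thus "ext_d M om c (cmap c p) vs = ext_d M om' c (cmap c p) vs" using c by (simp add: ext_d_eq l)
qed

lemma ext_d_fo:
 assumes D: "mopen M D" and w: "fo M D k om"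
 shows "fo M D (k + 1) (ext_d M om)" unfolding fo_def
proof (intro ballI impI conjI allI)
 fix p c assume p: "p:D" and c: "c:M" "p:cdom c"
 let ?S = "cmap c ` (D Int cdom c)"
 have x: "cmap c p:?S" using p c by auto
 have o: "ropen (cim c) ?S" using open_chart[OF D c(1)] .
 have q: "qopen (cdim c) ?S" using qopen_openin[OF cim_qopen[OF c(1)] o] .
 have "alt_form (cdim c) (k + 1) (%vs. if set vs <= Rn (cdim c) then ddr (cdim c) ?S (om c) (cmap c p) vs else 0)"
 by (rule alt_ddr[OF q x fo_open_chart(2)[OF w D c(1)] smpt_mono[OF foD(2)[OF w p c]]]) auto
 thus "alt_form (cdim c) (k + 1) (ext_d M om c (cmap c p))" using ddr_local[OF o x cim_Rn[OF c(1)]] c by (simp add: ext_d_eq cong: if_cong)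
 fix vs
 show "smpt (cdim c) (cim c) (%x. ext_d M om c x vs) (cmap c p)"
 proof (cases "set vs <= Rn (cdim c)")
 case True
 have "smpt (cdim c) (cim c) (%y. ddr (cdim c) (cim c) (om c) y vs) (cmap c p)"
 by (rule smpt_ddr[OF cim_qopen[OF c(1)]]) (use foD(2)[OF w p c] c in auto)
 thus ?thesis by (rule smpt_cR) (use cmap_Rn[OF c] True c in "auto simp: ext_d_eq")
 qed (use cmap_Rn[OF c] in "simp add: ext_d_def")
 fix d assume d: "d:M" "p:cdom d" and vs: "set vs <= Rn (cdim c)"
 have "ext_d M (pb M M id om) c (cmap c p) vs = ext_d M om d (cmap d (id p)) (map (rtan id c d (cmap c p)) vs)"
 by (rule ext_d_pull_chart[OF atlas atlas smaps_id[OF atlas D] w D _ p c d(1) _ vs]) (use d in auto)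
 thus "ext_d M om c (cmap c p) vs = ext_d M om d (cmap d p) (map (rtan id c d (cmap c p)) vs)"
 using agreeD[OF ext_d_agree[OF D pb_id[OF atlas D w]] p c] by simp
qed

lemma ext_d_ext_d:
 assumes w: "fo M D k om"
 shows "agree M D (ext_d M (ext_d M om)) 0"
proof (rule agreeI)
 fix p c vs assume p: "p:D" and c: "c:M" "p:cdom c"
 have x: "cmap c p:cim c" using c by auto
 have "ddr (cdim c) (cim c) (ext_d M om c) (cmap c p) vs = 0" if vs: "set vs <= Rn (cdim c)"
 proof -
 have "ddr (cdim c) (cim c) (ext_d M om c) (cmap c p) vs =
 ddr (cdim c) (cim c) (%y us. ddr (cdim c) (cim c) (om c) y us) (cmap c p) vs"
 by (rule ddr_cong[OF x, of _ "Rn (cdim c)"]) (use vs c cmap_Rn in "auto simp: ext_d_eq")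
 also have "\<dots> = 0" by (rule ddr_ddr[OF cim_qopen[OF c(1)] x foD(2)[OF w p c]])
 finally show ?thesis .
 qed
 thus "ext_d M (ext_d M om) c (cmap c p) vs = (0 :: 'a form) c (cmap c p) vs" using c x by (simp add: ext_d_eq)
qed

lemma ext_d_add:
 assumes "fo M D k om" "fo M D l om'"
 shows "agree M D (ext_d M (om + om')) (ext_d M om + ext_d M om')"
proof (rule agreeI)
 fix p c vs assume p: "p:D" and c: "c:M" "p:cdom c"
 have "ddr (cdim c) (cim c) (%y us. om c y us + om' c y us) (cmap c p) vs =
 ddr (cdim c) (cim c) (om c) (cmap c p) vs + ddr (cdim c) (cim c) (om' c) (cmap c p) vs"
 by (rule ddr_add[OF cim_qopen[OF c(1)] _ foD(2)[OF assms(1) p c] foD(2)[OF assms(2) p c]]) (use c in auto)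
 thus "ext_d M (om + om') c (cmap c p) vs = (ext_d M om + ext_d M om') c (cmap c p) vs" using c by (simp add: ext_d_eq plus_fun_def)
qed

lemma ext_d_cmult:
 assumes "fo M D k om"
 shows "agree M D (ext_d M (a *R om)) (a *R ext_d M om)"
proof (rule agreeI)
 fix p c vs assume p: "p:D" and c: "c:M" "p:cdom c"
 have "ddr (cdim c) (cim c) (%y us. a * om c y us) (cmap c p) vs = a * ddr (cdim c) (cim c) (om c) (cmap c p) vs"
 by (rule ddr_cmult[OF cim_qopen[OF c(1)] _ foD(2)[OF assms(1) p c]]) (use c in auto)
 thus "ext_d M (a *R om) c (cmap c p) vs = (a *R ext_d M om) c (cmap c p) vs" using c by (simp add: ext_d_eq sfun_def)
qed

lemma zero_out_add: "zero_out M om ==> zero_out M om' ==> zero_out M (om + om')" by (auto simp: zero_out_def)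
lemma zero_out_diff: "zero_out M om ==> zero_out M om' ==> zero_out M (om - om')" by (auto simp: zero_out_def)
lemma zero_out_uminus: "zero_out M om ==> zero_out M (- om)" by (auto simp: zero_out_def)
lemma zero_out_cmult: "zero_out M om ==> zero_out M (a *R om)" by (simp add: zero_out_def sfun_def zfun_def)
lemma zero_out_fmul: "zero_out M om ==> zero_out M (fmul h om)" by (simp add: zero_out_def fmul_def zfun_def)
lemma zero_out_0: "zero_out M 0" by (simp add: zero_out_def)
lemma open_car: "mopen M (car M)" by (metis tsp openin_topspace)

lemma formsI: "zero_out M om ==> fo M (car M) k om ==> om:forms M k" by (simp add: forms_fo)
lemma fo_car: "om:forms M k ==> fo M (car M) k om" by (simp add: forms_fo)
lemma forms_zo: "om:forms M k ==> zero_out M om" by (simp add: forms_fo)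

lemma forms_add: "om:forms M k ==> om':forms M k ==> om + om':forms M k" by (simp add: forms_fo fo_add zero_out_add)
lemma forms_diff: "om:forms M k ==> om':forms M k ==> om - om':forms M k" by (simp add: forms_fo fo_diff zero_out_diff)
lemma forms_uminus: "om:forms M k ==> - om:forms M k" by (simp add: forms_fo fo_uminus zero_out_uminus)
lemma forms_cmult: "om:forms M k ==> a *R om:forms M k" by (simp add: forms_fo fo_cmult zero_out_cmult)
lemma forms_0: "0:forms M k" by (simp add: forms_fo fo_zero zero_out_0)
lemma forms_ext_d: "om:forms M k ==> ext_d M om:forms M (k + 1)" by (simp add: forms_fo ext_d_fo[OF open_car] ext_d_zero_out)
lemma d_add: "om:forms M k ==> om':forms M k ==> ext_d M (om + om') = ext_d M om + ext_d M om'"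
 by (rule agree_eq[OF ext_d_add[OF fo_car fo_car]]) (auto intro: ext_d_zero_out zero_out_add)
lemma d_cmult: "om:forms M k ==> ext_d M (a *R om) = a *R ext_d M om"
 by (rule agree_eq[OF ext_d_cmult[OF fo_car]]) (auto intro: ext_d_zero_out zero_out_cmult)
lemma d_uminus: "om:forms M k ==> ext_d M (- om) = - ext_d M om" using d_cmult[of om k "-1"] by simp
lemma d_diff: "om:forms M k ==> om':forms M k ==> ext_d M (om - om') = ext_d M om - ext_d M om'"
 using d_add[OF _ forms_uminus, of om k om'] d_uminus[of om' k] by simp
lemma d_d: "om:forms M k ==> ext_d M (ext_d M om) = 0"
 by (rule agree_eq[OF ext_d_ext_d[OF fo_car]]) (auto intro: ext_d_zero_out zero_out_0)

end

lemma pb_add: "pb M N f (om + om') = pb M N f om + pb M N f om'" by (auto simp: pb_def fun_eq_iff Let_def)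
lemma pb_diff: "pb M N f (om - om') = pb M N f om - pb M N f om'" by (auto simp: pb_def fun_eq_iff Let_def)
lemma pb_uminus: "pb M N f (- om) = - pb M N f om" by (auto simp: pb_def fun_eq_iff Let_def)
lemma pb_cmult: "pb M N f (a *R om) = a *R pb M N f om" by (auto simp: pb_def fun_eq_iff Let_def sfun_def)
lemma pb_0: "pb M N f 0 = 0" by (auto simp: pb_def fun_eq_iff Let_def)

section \<open>Products with the line and the homotopy operator\<close>

definition lchart :: "'a chart => ('a \<times> real) chart" where
 "lchart c = \<lparr> cdim = Suc (cdim c), ccor = ccor c, cdom = cdom c \<times> UNIV,
 cmap = (%(p, t). (cmap c p)(cdim c := t)) \<rparr>"

definition lmfd :: "'a chart set => ('a \<times> real) chart set" where
 "lmfd M = lchart ` M"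

definition hop :: "'a chart set => 'b chart set => ('a \<times> real => 'b) => real => real => 'b form => 'a form" where
 "hop M N H a b om = (%c x vs. if c:M & x:cim c & set vs <= Rn (cdim c)
 then integral {a..b} (%t. pb (lmfd M) N H om (lchart c) (x(cdim c := t)) (bvec (cdim c) # vs)) else 0)"

lemma lchart_simps [simp]:
 "cdim (lchart c) = Suc (cdim c)" "ccor (lchart c) = ccor c" "cdom (lchart c) = cdom c \<times> UNIV"
 "cmap (lchart c) (p, t) = (cmap c p)(cdim c := t)" by (simp_all add: lchart_def)

lemma Rn_Suc: "v:Rn n ==> v:Rn (Suc n)" by (auto simp: Rn_iff)

lemma Rn_reset: "z:Rn (Suc n) ==> z(n := 0):Rn n" by (auto simp: Rn_iff)

lemma continuous_on_upd_const: "continuous_on A (%z::rvec. z(n := a))"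
proof (rule cont_prodI)
 fix j show "continuous_on A (%z::rvec. (z(n := a)) j)" by (cases "j = n") (auto intro: cont_crd)
qed

context atlas
begin

lemma cmap_reset: "c:M ==> p:cdom c ==> (cmap c p)(cdim c := 0) = cmap c p" using cmap_Rn[of c p] by (auto simp: Rn_iff fun_eq_iff)

lemma cmap_line_mem: "p:cdom c ==> (cmap c p)(cdim c := t):cim (lchart c)" by (rule image_eqI[of _ _ "(p, t)"]) auto

lemma line_image: "c:M ==> cim (lchart c) = {z:Rn (Suc (cdim c)). z(cdim c := 0):cim c}"
proof safe
 fix p t assume c: "c:M" and "(p, t):cdom (lchart c)"
 hence p: "p:cdom c" by simp
 have "(cmap c p)(cdim c := 0) = cmap c p" using cmap_Rn[OF c p] by (auto simp: Rn_iff)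
 thus "cmap (lchart c) (p, t):Rn (Suc (cdim c))" "(cmap (lchart c) (p, t))(cdim c := 0):cim c"
 using cmap_Rn[OF c p] p by (auto simp: Rn_iff)
next
 fix z p assume "z:Rn (Suc (cdim c))" "z(cdim c := 0) = cmap c p" "p:cdom c"
 hence "z = cmap (lchart c) (p, z (cdim c))" by (simp flip: `z(cdim c := 0) = cmap c p`)
 thus "z:cim (lchart c)" using `p:cdom c` by (metis SigmaI UNIV_I imageI lchart_simps(3))
qed

lemma line_upd: "c:M ==> x:cim c ==> x(cdim c := t):cim (lchart c)"
proof -
 assume c: "c:M" "x:cim c"
 then obtain p where "p:cdom c" "x = cmap c p" by blast
 hence "x(cdim c := t) = cmap (lchart c) (p, t)" "(p, t):cdom (lchart c)" by auto
 thus ?thesis by blast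
qed

lemma line_inj: "c:M ==> inj_on (cmap (lchart c)) (cdom (lchart c))"
proof (rule inj_onI)
 fix a b assume c: "c:M" and ab: "a:cdom (lchart c)" "b:cdom (lchart c)" "cmap (lchart c) a = cmap (lchart c) b"
 obtain p s q t where pq: "a = (p, s)" "b = (q, t)" by (cases a; cases b)
 have e: "(cmap c p)(cdim c := s) = (cmap c q)(cdim c := t)" using ab pq by simp
 have "s = t" using fun_cong[OF e, of "cdim c"] by simp
 moreover have "cmap c p j = cmap c q j" for j
 using fun_cong[OF e, of j] cmap_Rn[OF c, of p] cmap_Rn[OF c, of q] ab pq by (cases "j = cdim c") (auto simp: Rn_iff)
 ultimately show "a = b" using inj[OF c] ab pq by (auto dest: inj_onD)
qed

lemma line_cinv: "c:M ==> z:cim (lchart c) ==> cinv (lchart c) z = (cinv c (z(cdim c := 0)), z (cdim c))"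
proof -
 assume c: "c:M" and z: "z:cim (lchart c)"
 then obtain p t where p: "p:cdom c" "z = (cmap c p)(cdim c := t)" by auto
 have "(cmap c p)(cdim c := 0) = cmap c p" using cmap_Rn[OF c p(1)] by (auto simp: Rn_iff)
 moreover have "cinv (lchart c) (cmap (lchart c) (p, t)) = (p, t)" using line_inj[OF c] p by (intro inv_into_f_f) auto
 ultimately show ?thesis using p c by simp
qed

lemma line_open:
 assumes c: "c:M" and W: "ropen (cim c) W"
 shows "ropen (cim (lchart c)) {z:cim (lchart c). z(cdim c := 0):W}"
proof -
 have "ropen (cim (lchart c)) (cim (lchart c) Int (%z. z(cdim c := 0)) -` W)"
 by (rule cont_pre[OF continuous_on_upd_const _ W]) (use line_image[OF c] in auto)
 moreover have "cim (lchart c) Int (%z. z(cdim c := 0)) -` W = {z:cim (lchart c). z(cdim c := 0):W}" by auto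
 ultimately show ?thesis by simp
qed

lemma line_quad: "c:M ==> ropen (quad (Suc (cdim c)) (ccor c)) (cim (lchart c))"
proof -
 assume c: "c:M"
 have cc: "ccor c <= cdim c" using atlas c by (simp add: atl_def)
 have "ropen (quad (Suc (cdim c)) (ccor c)) (quad (Suc (cdim c)) (ccor c) Int (%z. z(cdim c := 0)) -` cim c)"
 by (rule cont_pre[OF continuous_on_upd_const _ cim_quad[OF c]]) (use cc Rn_reset in "auto simp: quad_def")
 moreover have "quad (Suc (cdim c)) (ccor c) Int (%z. z(cdim c := 0)) -` cim c = cim (lchart c)"
 proof -
 have "0 <= z i" if z: "z(cdim c := 0):cim c" "i < ccor c" for z i
 proof -
 have "z(cdim c := 0):quad (cdim c) (ccor c)" using z op_sub[OF cim_quad[OF c]] by blast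
 thus ?thesis using z(2) cc by (auto simp: quad_def)
 qed
 thus ?thesis unfolding line_image[OF c] by (auto simp: quad_def)
 qed
 ultimately show ?thesis by simp
qed

lemma line_qopen: "c:M ==> qopen (Suc (cdim c)) (cim (lchart c))" using line_quad by (auto simp: qopen_def)

lemma smpt_line:
 assumes c: "c:M" and z: "z:cim (lchart c)" and S: "ropen (cim c) S" "z(cdim c := 0):S"
 and h: "smpt (cdim c) S h (z(cdim c := 0))"
 shows "smpt (Suc (cdim c)) {z:cim (lchart c). z(cdim c := 0):S} (%z. h (z(cdim c := 0))) z"
proof (rule smpt_compose[where F = "%z. z(cdim c := 0)" and h = h, OF _ _ _ _ _ h])
 show "qopen (Suc (cdim c)) {z:cim (lchart c). z(cdim c := 0):S}" by (rule qopen_openin[OF line_qopen[OF c] line_open[OF c S(1)]])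
 show "qopen (cdim c) S" by (rule qopen_openin[OF cim_qopen[OF c] S(1)])
 have zR: "z:Rn (Suc (cdim c))" using z line_image[OF c] by auto
 show "smpt (Suc (cdim c)) {z:cim (lchart c). z(cdim c := 0):S} (%y. (y(cdim c := 0)) j) z" for j using zR by (cases "j = cdim c") auto
qed (use z S in auto)

lemma latlas: "atl (lmfd M)" unfolding atl_def lmfd_def
proof (intro conjI ballI allI)
 fix lc assume "lc:lchart ` M"
 then obtain c where c: "c:M" "lc = lchart c" by blast
 show "ccor lc <= cdim lc" using atlas c by (auto simp: atl_def intro: le_SucI)
 show "inj_on (cmap lc) (cdom lc)" using line_inj c by blast
 show "openin (cmodel lc) (cim lc)" unfolding cmodel_top c(2) using line_quad[OF c(1)] by simp
next
 fix lc ld i assume "lc:lchart ` M" "ld:lchart ` M"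
 then obtain c d where c: "c:M" "lc = lchart c" and d: "d:M" "ld = lchart d" by blast
 let ?S = "cmap c ` (cdom c Int cdom d)"
 let ?R = "{z:cim (lchart c). z(cdim c := 0):?S}"
 have R: "rep_dom id lc ld = ?R"
 proof safe
 fix z assume "z:rep_dom id lc ld"
 then obtain p t where p: "p:cdom c" "p:cdom d" "z = (cmap c p)(cdim c := t)" by (auto simp: rep_dom_def c d)
 have "(cmap c p)(cdim c := 0) = cmap c p" using cmap_Rn[OF c(1) p(1)] by (auto simp: Rn_iff)
 thus "z(cdim c := 0):?S" using p by auto
 show "z:cim (lchart c)" using p by (force simp: image_iff)
 next
 fix p t q assume *: "(p, t):cdom (lchart c)" "(cmap (lchart c) (p, t))(cdim c := 0) = cmap c q" "q:cdom c" "q:cdom d"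
 hence "(cmap c p)(cdim c := 0) = cmap c q" by simp
 moreover have "(cmap c p)(cdim c := 0) = cmap c p" using cmap_reset[OF c(1)] * by simp
 ultimately have "p = q" using inj[OF c(1)] * by (auto dest: inj_onD)
 thus "cmap (lchart c) (p, t):rep_dom id lc ld" using * unfolding rep_dom_def c d by (intro imageI) auto
 qed
 have Ro: "ropen (cim lc) ?R" unfolding c(2) using line_open[OF c(1) overlap_open[OF c(1) d(1)]] .
 show "openin (cmodel lc) (rep_dom id lc ld)" unfolding R cmodel_top using openin_trans[OF Ro] line_quad[OF c(1)] c(2) by simp
 show "smooth_fun (cdim lc) (rep_dom id lc ld) (%x. lrep id lc ld x i)" unfolding smooth_fun_pt R
 proof
 fix z assume z: "z:?R"
 then obtain q where q: "q:cdom c" "q:cdom d" "z(cdim c := 0) = cmap c q" by auto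
 have zR: "z:Rn (Suc (cdim c))" using z line_image[OF c(1)] by auto
 have lr: "lrep id lc ld y = (cmap d (cinv c (y(cdim c := 0))))(cdim d := y (cdim c))" if "y:?R" for y
 using that line_cinv[OF c(1)] by (simp add: lrep_def c d)
 show "smpt (cdim lc) ?R (%x. lrep id lc ld x i) z"
 proof (cases "i = cdim d")
 case True
 show ?thesis by (rule smpt_cR[of _ _ "%y. y (cdim c)"]) (use zR c lr True in auto)
 next
 case False
 have "smpt (cdim c) ?S (%x. cmap d (cinv c x) i) (z(cdim c := 0))" unfolding q(3) by (rule transition_smooth[OF c(1) d(1) q(1,2)])
 note h = this
 have zz: "z:cim (lchart c)" "z(cdim c := 0):?S" using z by blast+
 note t = smpt_line[OF c(1) zz(1) overlap_open[OF c(1) d(1)] zz(2) h]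
 have dl: "cdim lc = Suc (cdim c)" by (simp add: c(2))
 show ?thesis unfolding dl by (rule smpt_cR[OF t zR]) (simp only: lr fun_upd_other[OF False])
 qed
 qed
qed

lemma lcar: "car (lmfd M) = car M \<times> UNIV" by (auto simp: car_def lmfd_def)

lemma line_openI:
 assumes D: "mopen M D"
 shows "mopen (lmfd M) (D \<times> UNIV)"
proof -
 interpret L: atlas "lmfd M" by standard (rule latlas)
 show ?thesis
 proof (rule L.openin_mfdI)
 show "D \<times> UNIV <= car (lmfd M)" using opn_car[OF D] lcar by auto
 fix q assume "q:D \<times> (UNIV::real set)"
 then obtain p t where q: "q = (p, t)" "p:D" by auto
 then obtain c where c: "c:M" "p:cdom c" using opn_car[OF D] by (auto simp: car_def)
 let ?S = "{z:cim (lchart c). z(cdim c := 0):cmap c ` (D Int cdom c)}"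
 have "mopen (lmfd M) {q:cdom (lchart c). cmap (lchart c) q:?S}"
 by (rule L.chart_openI[OF _ line_open[OF c(1) open_chart[OF D c(1)]]]) (use c in "auto simp: lmfd_def")
 moreover have "{q:cdom (lchart c). cmap (lchart c) q:?S} = (D Int cdom c) \<times> UNIV"
 proof -
 have "cmap (lchart c) (p, t):?S <-> p:D" if p: "p:cdom c" for p and t :: real
 proof -
 have "(cmap c p)(cdim c := t, cdim c := 0) = cmap c p" using cmap_reset[OF c(1) p] by simp
 moreover have "cmap c p:cmap c ` (D Int cdom c) <-> p:D" using inj[OF c(1)] p by (auto dest: inj_onD)
 ultimately show ?thesis using cmap_line_mem[OF p, of t] by simp
 qed
 note mem = this
 show ?thesis
 proof (rule set_eqI)
 fix q :: "'a \<times> real"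
 obtain p t where q: "q = (p, t)" by (cases q)
 show "q:{q:cdom (lchart c). cmap (lchart c) q:?S} <-> q:(D Int cdom c) \<times> UNIV"
 using mem[of p t] unfolding q lchart_simps(3) by blast
 qed
 qed
 ultimately show "EX A. mopen (lmfd M) A & q:A & A <= D \<times> UNIV" using q c by (intro exI[of _ "(D Int cdom c) \<times> UNIV"]) auto
 qed
qed

lemma sfn_line_fst: "sfn M p h ==> sfn (lmfd M) (p, t) (%q. h (fst q))"
proof -
 assume h: "sfn M p h"
 interpret L: atlas "lmfd M" by standard (rule latlas)
 show ?thesis unfolding sfn_def
 proof (intro ballI impI)
 fix lc assume "lc:lmfd M" "(p, t):cdom lc"
 then obtain c where c: "c:M" "lc = lchart c" "p:cdom c" by (auto simp: lmfd_def)
 have z: "cmap lc (p, t):cim (lchart c)" using c cmap_line_mem by simp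
 have e: "(cmap lc (p, t))(cdim c := 0) = cmap c p" using cmap_Rn[OF c(1,3)] c(2) by (auto simp: Rn_iff)
 have "smpt (Suc (cdim c)) {z:cim (lchart c). z(cdim c := 0):cim c} (%z. h (cinv c (z(cdim c := 0)))) (cmap lc (p, t))"
 by (rule smpt_line[OF c(1) z openin_subtopology_self]) (use e sfnD[OF h c(1,3)] c in auto)
 moreover have "{z:cim (lchart c). z(cdim c := 0):cim c} = cim (lchart c)" using line_image[OF c(1)] by blast
 ultimately have 1: "smpt (Suc (cdim c)) (cim (lchart c)) (%z. h (cinv c (z(cdim c := 0)))) (cmap lc (p, t))" by simp
 have zR: "cmap lc (p, t):Rn (Suc (cdim c))" using z line_image[OF c(1)] by blast
 have "smpt (Suc (cdim c)) (cim (lchart c)) (%x. h (fst (cinv (lchart c) x))) (cmap lc (p, t))"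
 by (rule smpt_cR[OF 1 zR]) (simp only: line_cinv[OF c(1)] fst_conv)
 thus "smpt (cdim lc) (cim lc) (%x. h (fst (cinv lc x))) (cmap lc (p, t))" using c(2) by simp
 qed
qed

lemma sfn_line_snd: "sfn (lmfd M) (p, t) snd" unfolding sfn_def
proof (intro ballI impI)
 fix lc assume "lc:lmfd M" "(p, t):cdom lc"
 then obtain c where c: "c:M" "lc = lchart c" "p:cdom c" by (auto simp: lmfd_def)
 have z: "cmap lc (p, t):cim (lchart c)" using c cmap_line_mem by simp
 have zR: "cmap lc (p, t):Rn (Suc (cdim c))" using z line_image[OF c(1)] by blast
 have "smpt (Suc (cdim c)) (cim (lchart c)) (%x. snd (cinv (lchart c) x)) (cmap lc (p, t))"
 by (rule smpt_cR[OF smpt_coord[OF zR, of _ "cdim c"] zR]) (simp only: line_cinv[OF c(1)] snd_conv)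
 thus "smpt (cdim lc) (cim lc) (%x. snd (cinv lc x)) (cmap lc (p, t))" using c(2) by simp
qed

lemma smap_line_fst: "p:car M ==> smap (lmfd M) M (p, t) fst"
proof -
 assume "p:car M"
 then obtain c where c: "c:M" "p:cdom c" by (auto simp: car_def)
 show ?thesis unfolding smap_def
 proof (intro exI[of _ "cdom c \<times> UNIV"] conjI bexI[of _ c] allI)
 show "sfn (lmfd M) (p, t) (%q. cmap c (fst q) j)" for j by (rule sfn_line_fst[OF sfn_coord[OF c]])
 qed (use c line_openI[OF cdom_open] in auto)
qed

end

lemma smap_into_line:
 assumes at: "atl M" "atl N" and f: "smap M N p f" and h: "sfn M p h"
 shows "smap M (lmfd N) p (%q. (f q, h q))"
proof -
 interpret MN: atlas2 M N by standard (use at in auto)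
 obtain d where d: "d:N" "f p:cdom d" using MN.smap_car[OF f] by (auto simp: car_def)
 obtain V where V: "mopen M V" "p:V" "f ` V <= cdom d" using MN.smap_chart(1)[OF f d] by blast
 show ?thesis unfolding smap_def
 proof (intro exI[of _ V] conjI bexI[of _ "lchart d"] allI)
 fix j show "sfn M p (%q. cmap (lchart d) (f q, h q) j)" using h MN.smap_chart(2)[OF f d, of j] by (cases "j = cdim d") auto
 qed (use V d in "auto simp: lmfd_def")
qed

lemma smap_lmap:
 assumes at: "atl M" "atl N" and f: "smap M N p f"
 shows "smap (lmfd M) (lmfd N) (p, t) (%q. (f (fst q), snd q))"
proof -
 interpret MN: atlas2 M N by standard (use at in auto)
 have "smap (lmfd M) N (p, t) (%q. f (fst q))"
 using smap_compose[OF MN.A.latlas at MN.A.smap_line_fst, of p t f] f MN.smap_car[OF f] by simp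
 thus ?thesis by (rule smap_into_line[OF MN.A.latlas at(2) _ MN.A.sfn_line_snd])
qed

lemma smaps_lmap:
 assumes at: "atl M" "atl N" and f: "smaps M N D f"
 shows "smaps (lmfd M) (lmfd N) (D \<times> UNIV) (%q. (f (fst q), snd q))"
proof -
 interpret atlas M by standard (rule at)
 show ?thesis unfolding smaps_def using line_openI[OF smaps_open[OF f]] smap_lmap[OF at smapsD[OF f]] by auto
qed

lemma smaps_slice:
 assumes at: "atl M" and D: "mopen M D"
 shows "smaps M (lmfd M) D (%p. (p, t))"
proof -
 interpret atlas M by standard (rule at)
 show ?thesis unfolding smaps_def using D smap_into_line[OF at at smap_id[OF at] sfn_const] opn_car[OF D] by auto
qed

lemma smaps_line_fst:
 assumes at: "atl M" and D: "mopen M D"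
 shows "smaps (lmfd M) M (D \<times> UNIV) fst"
proof -
 interpret atlas M by standard (rule at)
 show ?thesis unfolding smaps_def using line_openI[OF D] smap_line_fst opn_car[OF D] by auto
qed

lemma rtan_cong:
 assumes at: "atl M" "atl N" and f: "smaps M N D f" and fg: "!!q. q:D ==> f q = g q"
 and p: "p:D" and c: "c:M" "p:cdom c" and d: "d:N" "f p:cdom d"
 shows "rtan f c d (cmap c p) v = rtan g c d (cmap c p) v"
proof -
 interpret MN: atlas2 M N by standard (use at in auto)
 obtain S' where S': "ropen (cim c) S'" "cmap c p:S'" "S' <= cmap c ` (D Int cdom c)"
 "ALL x:S'. f (cinv c x):cdom d"
 and T: "ALL x:S'. ALL v. tangent_map (cdim c) S' (lrep f c d) x v = rtan f c d x v"
 using MN.pull_local[OF f p c d openin_subtopology_self] d by blast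
 have eq: "g (cinv c x) = f (cinv c x)" if "x:S'" for x using S'(3) that fg c by auto
 have sub: "S' <= rep_dom g c d" using S'(3,4) eq c by (force simp: rep_dom_def)
 have o: "ropen (rep_dom g c d) S'" by (rule openin_subset_trans[OF S'(1) sub]) (auto simp: rep_dom_def)
 have R: "rep_dom g c d <= Rn (cdim c)" using MN.A.cim_Rn[OF c(1)] by (auto simp: rep_dom_def)
 have "rtan f c d (cmap c p) v = tangent_map (cdim c) S' (lrep f c d) (cmap c p) v" using T S'(2) by simp
 also have "\<dots> = tangent_map (cdim c) S' (lrep g c d) (cmap c p) v" unfolding tmap_def
 by (intro ext ddv_cong'[OF S'(2)]) (use eq sub R in "auto simp: lrep_def")
 also have "\<dots> = rtan g c d (cmap c p) v" unfolding rep_tangent_def by (rule tangent_map_local[OF o S'(2) R])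
 finally show ?thesis .
qed

lemma pb_cong:
 assumes at: "atl M" "atl N" and f: "smaps M N D f" and fg: "!!q. q:D ==> f q = g q"
 shows "agree M D (pb M N f om) (pb M N g om)"
proof (rule agreeI)
 interpret MN: atlas2 M N by standard (use at in auto)
 fix p c vs assume p: "p:D" and c: "c:M" "p:cdom c"
 define e where "e = (SOME d. d:N & f p:cdom d)"
 have e: "e:N" "f p:cdom e" using MN.smap_car[OF smapsD[OF f p]] someI_ex[of "%d. d:N & f p:cdom d"] by (auto simp: e_def car_def)
 have "rtan f c e (cmap c p) = rtan g c e (cmap c p)" using rtan_cong[OF at f fg p c e] by blast
 moreover have "(SOME d. d:N & g p:cdom d) = e" by (simp add: e_def fg[OF p])
 ultimately show "pb M N f om c (cmap c p) vs = pb M N g om c (cmap c p) vs" using c fg[OF p] by (simp add: pb_def Let_def lrep_def)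
qed

lemma rtan_slice:
 assumes at: "atl M" and c: "c:M" "p:cdom c" and v: "v:Rn (cdim c)"
 shows "rtan (%p. (p, t)) c (lchart c) (cmap c p) v = v"
proof
 interpret atlas M by standard (rule at)
 fix i
 have r: "rep_dom (%p. (p, t)) c (lchart c) = cim c" by (auto simp: rep_dom_def)
 note S = cim_qopen[OF c(1)]
 have x: "cmap c p:cim c" using c by blast
 have "ddv (cdim c) (cim c) v (%y. lrep (%p. (p, t)) c (lchart c) y i) (cmap c p) =
 ddv (cdim c) (cim c) v (%y. if i = cdim c then t else y i) (cmap c p)"
 by (rule ddv_cong'[OF x]) (use c cim_Rn in "auto simp: lrep_def f_inv_into_f")
 also have "\<dots> = v i" using ddv_coord[OF S x v] ddv_const[OF S x] v by (cases "i = cdim c") (auto simp: Rn_iff)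
 finally show "rtan (%p. (p, t)) c (lchart c) (cmap c p) v i = v i" by (simp add: rep_tangent_def tmap_def r)
qed

lemma ddv_bvec: "i < n ==> ddv n S (bvec i) f x = pd S i f x" by (simp add: ddv_def bvec_def if_distrib[of "%a. a * _"] cong: if_cong)

lemma rtan_lmap:
 assumes at: "atl M" "atl N" and f: "smaps M N D f" and p: "p:D"
 and c: "c:M" "p:cdom c" and d: "d:N" "f p:cdom d"
 defines "F \<equiv> %q. (f (fst q), snd q)"
 shows "rtan F (lchart c) (lchart d) ((cmap c p)(cdim c := t)) (bvec (cdim c)) = bvec (cdim d)"
 and "v:Rn (cdim c) ==> rtan F (lchart c) (lchart d) ((cmap c p)(cdim c := t)) v = rtan f c d (cmap c p) v"
proof -
 interpret MN: atlas2 M N by standard (use at in auto)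
 note lM = MN.A.latlas and lN = MN.B.latlas
 interpret L: atlas2 "lmfd M" "lmfd N" by standard (use lM lN in auto)
 have F: "smaps (lmfd M) (lmfd N) (D \<times> UNIV) F" unfolding F_def by (rule smaps_lmap[OF at f])
 have lc: "lchart c:lmfd M" "(p, t):cdom (lchart c)" and ld: "lchart d:lmfd N" "F (p, t):cdom (lchart d)"
 using c d by (auto simp: lmfd_def F_def)
 have pD: "(p, t):D \<times> UNIV" using p by simp
 obtain S' where S': "ropen (cim (lchart c)) S'" "cmap (lchart c) (p, t):S'"
 "S' <= cmap (lchart c) ` (D \<times> UNIV Int cdom (lchart c))"
 "ALL x:S'. F (cinv (lchart c) x):cdom (lchart d)"
 and C: "coord_map (cdim (lchart c)) S' (cdim (lchart d)) (cim (lchart d)) (lrep F (lchart c) (lchart d))"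
 and T: "ALL x:S'. ALL v. tangent_map (cdim (lchart c)) S' (lrep F (lchart c) (lchart d)) x v = rtan F (lchart c) (lchart d) x v"
 using L.pull_local[OF F pD lc ld openin_subtopology_self] ld by blast
 interpret C: coord_map "cdim (lchart c)" S' "cdim (lchart d)" "cim (lchart d)" "lrep F (lchart c) (lchart d)" by (rule C)
 let ?z = "(cmap c p)(cdim c := t)"
 have z: "?z:S'" using S'(2) by simp
 have lr: "lrep F (lchart c) (lchart d) y = (cmap d (f (cinv c (y(cdim c := 0)))))(cdim d := y (cdim c))" if "y:S'" for y
 proof -
 have "cinv (lchart c) y = (cinv c (y(cdim c := 0)), y (cdim c))" by (rule MN.A.line_cinv[OF c(1)]) (use that op_sub[OF S'(1)] in blast)
 thus ?thesis by (simp only: lrep_def o_def F_def fst_conv snd_conv lchart_simps)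
 qed
 have pdn: "pd S' (cdim c) (%y. lrep F (lchart c) (lchart d) y i) ?z = bvec (cdim d) i" for i
 proof (rule pd_eqI[OF C.S z])
 let ?g = "%s. if i = cdim d then s else cmap d (f (cinv c (?z(cdim c := 0)))) i"
 have g: "(?g hrd bvec (cdim d) i) (at t)" by (cases "i = cdim d") (auto simp: bvec_def)
 have "((%s. lrep F (lchart c) (lchart d) (?z(cdim c := s)) i) hrd bvec (cdim d) i) (at t within {s. ?z(cdim c := s):S'})"
 by (subst hrd_cong[OF refl _ refl refl, where g = ?g])
 (use z lr hrd_within[OF g] in "auto intro!: always_eventually")
 thus "has_pdw S' (%y. lrep F (lchart c) (lchart d) y i) (cdim c) ?z (bvec (cdim d) i)" by simp
 qed simp
 show "rtan F (lchart c) (lchart d) ?z (bvec (cdim c)) = bvec (cdim d)"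
 proof
 fix i
 have "rtan F (lchart c) (lchart d) ?z (bvec (cdim c)) i = tangent_map (Suc (cdim c)) S' (lrep F (lchart c) (lchart d)) ?z (bvec (cdim c)) i"
 using T z by simp
 also have "\<dots> = bvec (cdim d) i" unfolding tmap_def using ddv_bvec[of "cdim c" "Suc (cdim c)"] pdn by simp
 finally show "rtan F (lchart c) (lchart d) ?z (bvec (cdim c)) i = bvec (cdim d) i" .
 qed
 assume v: "v:Rn (cdim c)"
 let ?j = "%p. (p, t)"
 have jM: "smaps M (lmfd M) D ?j" by (rule smaps_slice[OF at(1) smaps_open[OF f]])
 have jN: "smaps N (lmfd N) (car N) ?j" by (rule smaps_slice[OF at(2) MN.B.open_car])
 have fN: "f p:car N" using d by (auto simp: car_def)
 have 1: "rtan (%q. F (q, t)) c (lchart d) (cmap c p) v = rtan F (lchart c) (lchart d) ?z v"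
 using rtan_chain[OF at(1) lM lN jM F, of p c "lchart c" "lchart d" v] p c lc ld rtan_slice[OF at(1) c v, of t] by simp
 have vd: "rtan f c d (cmap c p) v:Rn (cdim d)" by (rule MN.rtan_Rn(1)[OF f p c d])
 have 2: "rtan (%q. (f q, t)) c (lchart d) (cmap c p) v = rtan f c d (cmap c p) v"
 using rtan_chain[OF at lN f jN fN p c d ld(1), of v] d rtan_slice[OF at(2) d vd, of t] by simp
 show "rtan F (lchart c) (lchart d) ?z v = rtan f c d (cmap c p) v" using 1 2 by (simp add: F_def)
qed

lemma rtan_fst:
 assumes at: "atl M" and c: "c:M" "p:cdom c"
 shows "rtan fst (lchart c) c ((cmap c p)(cdim c := t)) (bvec (cdim c)) = 0"
proof
 interpret atlas M by standard (rule at)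
 fix i
 let ?z = "(cmap c p)(cdim c := t)" and ?S = "cim (lchart c)"
 have r: "rep_dom fst (lchart c) c = ?S" by (auto simp: rep_dom_def)
 have x: "cmap c p:cim c" using c by blast
 have z: "?z:?S" by (rule line_upd[OF c(1) x])
 have "pd ?S (cdim c) (%y. lrep fst (lchart c) c y i) ?z = 0"
 proof (rule pd_eqI[OF line_qopen[OF c(1)] z])
 have g: "((%s. cmap c p i) hrd 0) (at t within {s. ?z(cdim c := s):?S})" by simp
 have "((%s. lrep fst (lchart c) c (?z(cdim c := s)) i) hrd 0) (at t within {s. ?z(cdim c := s):?S})"
 proof (subst hrd_cong[OF refl _ refl refl, where g = "%s. cmap c p i"])
 have "(cmap c p)(cdim c := 0) = cmap c p" using cmap_Rn[OF c] by (auto simp: Rn_iff)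
 thus "\<forall>\<^sub>F s in nhds t. s:{s. ?z(cdim c := s):?S} --> lrep fst (lchart c) c (?z(cdim c := s)) i = cmap c p i"
 using line_cinv[OF c(1)] c by (auto simp: lrep_def intro!: always_eventually)
 qed (use z g in auto)
 thus "has_pdw ?S (%y. lrep fst (lchart c) c y i) (cdim c) ?z 0" by simp
 qed simp
 thus "rtan fst (lchart c) c ?z (bvec (cdim c)) i = 0 i"
 using ddv_bvec[of "cdim c" "Suc (cdim c)"] by (simp add: rep_tangent_def tmap_def r)
qed

lemma ddv_Rn_Suc: "v:Rn n ==> ddv (Suc n) S v f x = (\<Sum>i<n. v i * pd S i f x)" by (simp add: ddv_def Rn_iff)

locale hop_map =
 fixes M :: "'a chart set" and N :: "'b chart set" and D E H om k and a b :: real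
 assumes M: "atl M" and N: "atl N" and D: "mopen M D"
 and H: "smaps (lmfd M) N (D \<times> UNIV) H" and w: "fo N E k om" and E: "mopen N E"
 and HE: "!!p t. p:D ==> H (p, t):E" and ab: "a <= b"
begin

sublocale atlas M by standard (rule M)
sublocale L: atlas "lmfd M" by standard (rule latlas)
sublocale NN: atlas N by standard (rule N)

definition et where "et = pb (lmfd M) N H om"

lemma et_fo: "fo (lmfd M) (D \<times> UNIV) k et" unfolding et_def by (rule pb_fo[OF latlas N H w E]) (use HE in auto)

context
 fixes c p assumes c: "c:M" "p:cdom c" and p: "p:D"
begin

abbreviation "n \<equiv> cdim c"
abbreviation "S \<equiv> cim c"
abbreviation "S' \<equiv> cim (lchart c)"
abbreviation "x \<equiv> cmap c p"

lemma lc: "lchart c:lmfd M" "(p, t):cdom (lchart c)" "(p, t):D \<times> UNIV" using c p by (auto simp: lmfd_def)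

lemma et_at:
 "alt_form (Suc n) k (et (lchart c) (x(n := t)))"
 "smpt (Suc n) S' (%z. et (lchart c) z vs) (x(n := t))" using L.foD(1,2)[OF et_fo lc(3) lc(1,2)] by simp_all

lemma hop_eq: "set vs <= Rn n ==> hop M N H a b om c x vs = integral {a..b} (%t. et (lchart c) (x(n := t)) (bvec n # vs))"
 using c by (simp add: hop_def et_def)

lemma int_line:
 assumes "!!t. smpt (Suc n) S' G (x(n := t))"
 shows "smpt n S (%y. integral {a..b} (%t. G (y(n := t)))) x"
 "(%t. G (x(n := t))) integrable_on {a..b}"
 "i < n ==> ((%t. pd S' i G (x(n := t))) has_integral pd S i (%y. integral {a..b} (%t. G (y(n := t)))) x) {a..b}"
proof -
 have xS: "x:S" using c by blast
 note I = integral_line[OF cim_qopen[OF c(1)] xS line_qopen[OF c(1)] line_upd[OF c(1)] assms ab]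
 show "smpt n S (%y. integral {a..b} (%t. G (y(n := t)))) x"
 "(%t. G (x(n := t))) integrable_on {a..b}"
 "i < n ==> ((%t. pd S' i G (x(n := t))) has_integral pd S i (%y. integral {a..b} (%t. G (y(n := t)))) x) {a..b}" by (rule I, assumption)+
qed

lemma et_integrable: "(%t. et (lchart c) (x(n := t)) vs) integrable_on {a..b}" by (rule int_line(2)[OF et_at(2)])

lemma hop_alt: "alt_form n (k - 1) (hop M N H a b om c x)"
proof -
 let ?h = "%vs. integral {a..b} (%t. et (lchart c) (x(n := t)) (bvec n # vs))"
 have bv: "bvec n:Rn (Suc n)" by (rule bvec_Rn) simp
 note C = alt_contract[OF et_at(1) bv]
 have "alt_form (Suc n) (k - 1) ?h"
 by (rule alt_op[OF C, where T = "integral {a..b}"]) (auto simp: et_integrable integral_add integrable_on_mult_right cong: integral_cong intro: integral_cong)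
 from alt_map[OF this, of n id]
 have "alt_form n (k - 1) (%vs. if set vs <= Rn n then ?h vs else 0)" using Rn_Suc by (simp only: list.map_id id_apply)
 moreover have "hop M N H a b om c x = (%vs. if set vs <= Rn n then ?h vs else 0)" using hop_eq by (auto simp: hop_def)
 ultimately show ?thesis by simp
qed

lemma hop_smooth: "smpt n S (%y. hop M N H a b om c y vs) x"
proof (cases "set vs <= Rn n")
 case True
 show ?thesis by (rule smpt_cR[OF int_line(1)[OF et_at(2)[where vs = "bvec n # vs"]]])
 (use cmap_Rn[OF c] True c in "auto simp: hop_def et_def")
next
 case False
 thus ?thesis using cmap_Rn[OF c] by (simp add: hop_def)
qed

lemma slice_eq:
 assumes vs: "set vs <= Rn n"
 shows "et (lchart c) (x(n := t)) vs = pb M N (%p. H (p, t)) om c x vs"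
proof -
 have j: "smaps M (lmfd M) D (%p. (p, t))" by (rule smaps_slice[OF M D])
 have "pb M (lmfd M) (%p. (p, t)) et c x vs = et (lchart c) (cmap (lchart c) (p, t)) (map (rtan (%p. (p, t)) c (lchart c) x) vs)"
 by (rule pb_eq[OF M latlas j et_fo lc(3) p c lc(1,2) vs])
 also have "map (rtan (%p. (p, t)) c (lchart c) x) vs = map id vs" using vs rtan_slice[OF M c] by (intro map_cong) auto
 finally have "pb M (lmfd M) (%p. (p, t)) et c x vs = et (lchart c) (x(n := t)) vs" by (simp only: list.map_id lchart_simps)
 moreover have "agree M D (pb M (lmfd M) (%p. (p, t)) et) (pb M N (%q. H (q, t)) om)"
 unfolding et_def by (rule pb_compose[OF M latlas N j H w E]) (use HE in auto)
 ultimately show ?thesis using agreeD[of M D _ _ p c] p c by metis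
qed

lemma hop_formula_at:
 assumes vs: "set vs <= Rn n"
 shows "ext_d M (hop M N H a b om) c x vs + hop M N H a b (ext_d N om) c x vs =
 pb M N (%p. H (p, b)) om c x vs - pb M N (%p. H (p, a)) om c x vs"
proof -
 let ?g = "et (lchart c)"
 have bv: "bvec n:Rn (Suc n)" by (rule bvec_Rn) simp
 have zS: "x(n := t):S'" for t by (rule cmap_line_mem[OF c(2)])
 have xS: "x:S" using c by blast
 note q = line_qopen[OF c(1)] and q0 = cim_qopen[OF c(1)]
 have rs: "set (rem_at l vs) <= Rn n" for l using vs set_take_subset[of l vs] set_drop_subset[of "Suc l" vs] by auto
 have vl: "vs ! l:Rn n" if "l < length vs" for l using vs that nth_mem by blast
 have I1: "((%t. ddr (Suc n) S' (%y us. ?g y (bvec n # us)) (x(n := t)) vs) has_integral ext_d M (hop M N H a b om) c x vs) {a..b}"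
 proof -
 have D1: "((%t. ddv (Suc n) S' (vs ! l) (%y. ?g y (bvec n # rem_at l vs)) (x(n := t))) has_integral
 ddv n S (vs ! l) (%y. hop M N H a b om c y (rem_at l vs)) x) {a..b}" if l: "l < length vs" for l
 proof -
 have e: "ddv n S (vs ! l) (%y. hop M N H a b om c y (rem_at l vs)) x =
 (\<Sum>i<n. (vs ! l) i * pd S i (%y. integral {a..b} (%t. ?g (y(n := t)) (bvec n # rem_at l vs))) x)" unfolding ddv_def[symmetric]
 by (rule ddv_cong'[OF xS]) (use rs[of l] c cim_Rn in "auto simp: hop_def et_def")
 show ?thesis unfolding e ddv_Rn_Suc[OF vl[OF l]] by (intro has_integral_sum has_integral_mult_right int_line(3) et_at(2)) auto
 qed
 have "ext_d M (hop M N H a b om) c x vs = (\<Sum>l<length vs. (- 1) ^ l * ddv n S (vs ! l) (%y. hop M N H a b om c y (rem_at l vs)) x)"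
 using c vs by (simp add: ext_d_eq ddr_def)
 thus ?thesis unfolding ddr_def
 using has_integral_sum[OF _ has_integral_mult_right[OF D1], of "{..<length vs}" "%l. l" "%l. (-1) ^ l"] by simp
 qed
 have I2: "((%t. ddv (Suc n) S' (bvec n) (%y. ?g y vs) (x(n := t))) has_integral ?g (x(n := b)) vs - ?g (x(n := a)) vs) {a..b}"
 proof (rule fundamental_theorem_of_calculus[OF ab])
 fix t assume "t:{a..b}"
 have U: "{s. (x(n := t))(n := s):S'} = UNIV" using zS by simp
 have "has_pdw S' (%y. ?g y vs) n (x(n := t)) (pd S' n (%y. ?g y vs) (x(n := t)))" by (rule has_pdw[OF q zS _ et_at(2)]) simp
 hence "((%s. ?g (x(n := s)) vs) hrd pd S' n (%y. ?g y vs) (x(n := t))) (at t)" unfolding U by simp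
 thus "((%s. ?g (x(n := s)) vs) has_vector_derivative ddv (Suc n) S' (bvec n) (%y. ?g y vs) (x(n := t))) (at t within {a..b})"
 using ddv_bvec[of n "Suc n"] hrd_iff has_vector_derivative_at_within by (metis lessI)
 qed
 have e: "pb (lmfd M) N H (ext_d N om) (lchart c) (x(n := t)) (bvec n # vs) =
 ddv (Suc n) S' (bvec n) (%y. ?g y vs) (x(n := t)) - ddr (Suc n) S' (%y us. ?g y (bvec n # us)) (x(n := t)) vs" for t
 proof -
 have "agree (lmfd M) (D \<times> UNIV) (ext_d (lmfd M) et) (pb (lmfd M) N H (ext_d N om))"
 unfolding et_def by (rule ext_d_pb[OF latlas N H w E]) (use HE in auto)
 from agreeD[OF this lc(3,1,2)]
 have "pb (lmfd M) N H (ext_d N om) (lchart c) (x(n := t)) (bvec n # vs) = ext_d (lmfd M) et (lchart c) (x(n := t)) (bvec n # vs)" by simp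
 also have "\<dots> = ddr (Suc n) S' (et (lchart c)) (x(n := t)) (bvec n # vs)"
 proof -
 have "set (bvec n # vs) <= Rn (cdim (lchart c))" using bv vs Rn_Suc by auto
 thus ?thesis using ext_d_eq[OF lc(1) zS, of et t] by simp
 qed
 finally show ?thesis unfolding ddr_Cons .
 qed
 have "((%t. pb (lmfd M) N H (ext_d N om) (lchart c) (x(n := t)) (bvec n # vs)) has_integral
 (?g (x(n := b)) vs - ?g (x(n := a)) vs) - ext_d M (hop M N H a b om) c x vs) {a..b}" unfolding e by (rule has_integral_diff[OF I2 I1])
 hence "hop M N H a b (ext_d N om) c x vs = (?g (x(n := b)) vs - ?g (x(n := a)) vs) - ext_d M (hop M N H a b om) c x vs"
 using c vs by (simp add: hop_def integral_unique)
 thus ?thesis using slice_eq[OF vs] by simp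
qed

end

lemma hop_formula:
 "agree M D (ext_d M (hop M N H a b om) + hop M N H a b (ext_d N om))
 (pb M N (%p. H (p, b)) om - pb M N (%p. H (p, a)) om)"
proof (rule agreeI)
 fix p c vs assume "p:D" "c:M" "p:cdom c"
 thus "(ext_d M (hop M N H a b om) + hop M N H a b (ext_d N om)) c (cmap c p) vs =
 (pb M N (%p. H (p, b)) om - pb M N (%p. H (p, a)) om) c (cmap c p) vs"
 using hop_formula_at[of c p vs] by (cases "set vs <= Rn (cdim c)") (auto simp: ext_d_def hop_def pb_def)
qed

lemma hop_pull_source:
 assumes M': "atl M'" and f: "smaps M' M D' f" and fD: "!!p. p:D' ==> f p:D"
 and c: "c:M'" "p:cdom c" and p: "p:D'" and d: "d:M" "f p:cdom d" and vs: "set vs <= Rn (cdim c)"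
 shows "hop M' N (%q. H (f (fst q), snd q)) a b om c (cmap c p) vs = hop M N H a b om d (cmap d (f p)) (map (rtan f c d (cmap c p)) vs)"
proof -
 interpret MM: atlas2 M' M by standard (use M' M in auto)
 let ?F = "%q. (f (fst q), snd q)"
 have F: "smaps (lmfd M') (lmfd M) (D' \<times> UNIV) ?F" by (rule smaps_lmap[OF M' M f])
 have lc: "lchart c:lmfd M'" "(p, t):cdom (lchart c)" and ld: "lchart d:lmfd M" "?F (p, t):cdom (lchart d)" for t
 using c d by (auto simp: lmfd_def)
 have vs': "set (map (rtan f c d (cmap c p)) vs) <= Rn (cdim d)" using MM.rtan_Rn(1)[OF f p c d] by auto
 have "pb (lmfd M') N (%q. H (?F q)) om (lchart c) ((cmap c p)(cdim c := t)) (bvec (cdim c) # vs) =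
 et (lchart d) ((cmap d (f p))(cdim d := t)) (bvec (cdim d) # map (rtan f c d (cmap c p)) vs)" for t
 proof -
 have ag: "agree (lmfd M') (D' \<times> UNIV) (pb (lmfd M') (lmfd M) ?F et) (pb (lmfd M') N (%q. H (?F q)) om)"
 unfolding et_def by (rule pb_compose[OF MM.A.latlas latlas N F H w E]) (use fD HE in auto)
 have vl: "set (bvec (cdim c) # vs) <= Rn (cdim (lchart c))" using bvec_Rn[of "cdim c" "Suc (cdim c)"] vs Rn_Suc by auto
 have pD: "(p, t):D' \<times> UNIV" "?F (p, t):D \<times> UNIV" using p fD by auto
 have "pb (lmfd M') (lmfd M) ?F et (lchart c) (cmap (lchart c) (p, t)) (bvec (cdim c) # vs) =
 et (lchart d) (cmap (lchart d) (?F (p, t))) (map (rtan ?F (lchart c) (lchart d) (cmap (lchart c) (p, t))) (bvec (cdim c) # vs))"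
 by (rule pb_eq[OF MM.A.latlas latlas F et_fo pD(2,1) lc ld vl])
 moreover have "map (rtan ?F (lchart c) (lchart d) (cmap (lchart c) (p, t))) (bvec (cdim c) # vs) =
 bvec (cdim d) # map (rtan f c d (cmap c p)) vs" using rtan_lmap[OF M' M f p c d] vs by (auto intro!: map_cong)
 ultimately show ?thesis using agreeD[OF ag pD(1) lc] by (simp only: lchart_simps fst_conv snd_conv)
 qed
 thus ?thesis using c d vs vs' by (simp add: hop_def et_def)
qed

lemma hop_fo: "fo M D (k - 1) (hop M N H a b om)" unfolding fo_def
proof (intro ballI impI conjI allI)
 fix p c assume p: "p:D" and c: "c:M" "p:cdom c"
 show "alt_form (cdim c) (k - 1) (hop M N H a b om c (cmap c p))" by (rule hop_alt[OF c p])
 show "smpt (cdim c) (cim c) (%x. hop M N H a b om c x vs) (cmap c p)" for vs by (rule hop_smooth[OF c p])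
 fix d vs assume d: "d:M" "p:cdom d" and vs: "set vs <= Rn (cdim c)"
 show "hop M N H a b om c (cmap c p) vs = hop M N H a b om d (cmap d p) (map (rtan id c d (cmap c p)) vs)"
 using hop_pull_source[OF M smaps_id[OF M D] _ c p d(1) _ vs] d by simp
qed

lemma hop_pb_source:
 assumes M': "atl M'" and f: "smaps M' M D' f" and fD: "!!p. p:D' ==> f p:D"
 shows "agree M' D' (hop M' N (%q. H (f (fst q), snd q)) a b om) (pb M' M f (hop M N H a b om))"
proof (rule agreeI)
 interpret MM: atlas2 M' M by standard (use M' M in auto)
 fix p c vs assume p: "p:D'" and c: "c:M'" "p:cdom c"
 obtain d where d: "d:M" "f p:cdom d" using MM.smap_car[OF smapsD[OF f p]] by (auto simp: car_def)
 show "hop M' N (%q. H (f (fst q), snd q)) a b om c (cmap c p) vs = pb M' M f (hop M N H a b om) c (cmap c p) vs"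
 proof (cases "set vs <= Rn (cdim c)")
 case True
 show ?thesis using hop_pull_source[OF M' f fD c p d True] pb_eq[OF M' M f hop_fo fD[OF p] p c d True] by simp
 qed (simp add: hop_def pb_def)
qed

lemma hop_const:
 assumes "!!p t. p:D ==> H (p, t) = f p" and f: "smaps M N D f"
 shows "agree M D (hop M N H a b om) 0"
proof (rule agreeI)
 interpret MN: atlas2 M N ..
 interpret LN: atlas2 "lmfd M" N ..
 fix p c vs assume p: "p:D" and c: "c:M" "p:cdom c"
 obtain d where d: "d:N" "f p:cdom d" using MN.smap_car[OF smapsD[OF f p]] by (auto simp: car_def)
 have fs: "smaps (lmfd M) M (D \<times> UNIV) fst" by (rule smaps_line_fst[OF M D])
 have "et (lchart c) ((cmap c p)(cdim c := t)) (bvec (cdim c) # vs) = 0" if vs: "set vs <= Rn (cdim c)" for t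
 proof -
 have l: "lchart c:lmfd M" "(p, t):cdom (lchart c)" "(p, t):D \<times> UNIV" "H (p, t):E" "H (p, t):cdom d"
 using c p d assms(1) HE by (auto simp: lmfd_def)
 have vl: "set (bvec (cdim c) # vs) <= Rn (cdim (lchart c))" using bvec_Rn[of "cdim c" "Suc (cdim c)"] vs Rn_Suc by auto
 have "rtan H (lchart c) d (cmap (lchart c) (p, t)) v = rtan (%q. f (fst q)) (lchart c) d (cmap (lchart c) (p, t)) v" for v
 by (rule rtan_cong[OF latlas N H _ l(3,1,2) d(1) l(5)]) (use assms(1) in auto)
 also have "!!v. rtan (%q. f (fst q)) (lchart c) d (cmap (lchart c) (p, t)) v =
 rtan f c d (cmap c p) (rtan fst (lchart c) c (cmap (lchart c) (p, t)) v)"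
 using rtan_chain[OF latlas M N fs f _ l(3,1,2) c(1) _ d(1)] p c d by simp
 finally have "rtan H (lchart c) d (cmap (lchart c) (p, t)) (bvec (cdim c)) = rtan f c d (cmap c p) 0" using rtan_fst[OF M c] by simp
 also have "\<dots> = 0" using MN.rtan_Rn(2)[OF f p c d, of 1 0 0] by simp
 finally have z: "rtan H (lchart c) d (cmap (lchart c) (p, t)) (bvec (cdim c)) = 0" .
 show ?thesis using pb_eq[OF latlas N H w l(4,3,1,2) d(1) l(5) vl] alt_zero_vec[OF NN.foD(1)[OF w l(4) d(1) l(5)]] z by (simp add: et_def)
 qed
 thus "hop M N H a b om c (cmap c p) vs = (0 :: 'a form) c (cmap c p) vs" by (simp add: hop_def et_def[symmetric])
qed

end

lemma hop_pb_target:
 assumes at: "atl M" "atl N" "atl P" and D: "mopen M D"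
 and H: "smaps (lmfd M) N (D \<times> UNIV) H" and g: "smaps N P E g" and w: "fo P G k om" "mopen P G"
 and HE: "!!p t. p:D ==> H (p, t):E" and gE: "!!p. p:E ==> g p:G"
 shows "agree M D (hop M N H a b (pb N P g om)) (hop M P (%q. g (H q)) a b om)"
proof (rule agreeI)
 interpret atlas M by standard (rule at)
 fix p c vs assume p: "p:D" and c: "c:M" "p:cdom c"
 have "agree (lmfd M) (D \<times> UNIV) (pb (lmfd M) N H (pb N P g om)) (pb (lmfd M) P (%q. g (H q)) om)"
 by (rule pb_compose[OF latlas at(2,3) H g w]) (use HE gE in auto)
 hence "pb (lmfd M) N H (pb N P g om) (lchart c) (cmap (lchart c) (p, t)) =
 pb (lmfd M) P (%q. g (H q)) om (lchart c) (cmap (lchart c) (p, t))" for t by (rule agreeD) (use p c in "auto simp: lmfd_def")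
 thus "hop M N H a b (pb N P g om) c (cmap c p) vs = hop M P (%q. g (H q)) a b om c (cmap c p) vs" using c by (simp add: hop_def)
qed

lemma hop_zero_out: "zero_out M (hop M N H a b om)" by (auto simp: zero_out_def hop_def fun_eq_iff)

text \<open>The homotopy operator only sees the values of the form on the track of the homotopy.\<close>

lemma hop_agree:
 assumes at: "atl M" "atl N" and D: "mopen M D"
 and H: "smaps (lmfd M) N (D \<times> UNIV) H" and a: "agree N E om om'"
 and HE: "!!p t. p:D ==> t:{a..b} ==> H (p, t):E"
 shows "agree M D (hop M N H a b om) (hop M N H a b om')"
proof (rule agreeI)
 interpret atlas M by standard (rule at)
 interpret LN: atlas2 "lmfd M" N by standard (use latlas at in auto)
 fix p c vs assume p: "p:D" and c: "c:M" "p:cdom c"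
 have "pb (lmfd M) N H om (lchart c) (cmap (lchart c) (p, t)) us =
 pb (lmfd M) N H om' (lchart c) (cmap (lchart c) (p, t)) us" if t: "t:{a..b}" for t us
 proof -
 have l: "lchart c:lmfd M" "(p, t):cdom (lchart c)" "(p, t):D \<times> UNIV" using c p by (auto simp: lmfd_def)
 define e where "e = (SOME d. d:N & H (p, t):cdom d)"
 have e: "e:N" "H (p, t):cdom e"
 using LN.smap_car[OF smapsD[OF H l(3)]] someI_ex[of "%d. d:N & H (p, t):cdom d"] by (auto simp: e_def car_def)
 show ?thesis using agreeD[OF a HE[OF p t] e] LN.A.cinv_cmap[OF l(1,2)]
 by (simp add: pb_def Let_def e_def[symmetric] lrep_def del: lchart_simps)
 qed
 thus "hop M N H a b om c (cmap c p) vs = hop M N H a b om' c (cmap c p) vs" using c by (auto simp: hop_def intro!: integral_cong)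
qed

section \<open>Constructing atlases\<close>

text \<open>The charts of \<open>N\<close> need only be smooth through a manifold \<open>P\<close>: \<open>L\<close> lifts the domain of one chart
 smoothly to \<open>P\<close>, and \<open>Ph\<close> expresses the other chart on \<open>P\<close>.\<close>

lemma atlas_from_lifts:
 assumes P: "atl P"
 and N: "!!e. e:N ==> ccor e <= cdim e & inj_on (cmap e) (cdom e) & ropen (quad (cdim e) (ccor e)) (cim e)"
 and L: "!!e d. e:N ==> d:N ==> EX m:P. EX L D Ph. L ` cdom e <= cdom m &
 (ALL j. ALL y:cim e. smpt (cdim e) (cim e) (%y. cmap m (L (cinv e y)) j) y) &
 mopen P D & (ALL r:D. ALL j. sfn P r (%r. Ph r j)) &
 (ALL q:cdom e. q:cdom d <-> L q:D) & (ALL q:cdom e Int cdom d. Ph (L q) = cmap d q)"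
 shows "atl N"
proof -
 interpret P: atlas P by standard (rule P)
 have main: "ropen (cim e) (rep_dom id e d) & (ALL i. smooth_fun (cdim e) (rep_dom id e d) (%x. lrep id e d x i))"
 if e: "e:N" and d: "d:N" for e d
 proof -
 from L[OF e d] obtain m L D Ph where m: "m:P" "L ` cdom e <= cdom m"
 and Ls': "ALL j. ALL y:cim e. smpt (cdim e) (cim e) (%y. cmap m (L (cinv e y)) j) y"
 and D: "mopen P D" and Ph': "ALL r:D. ALL j. sfn P r (%r. Ph r j)"
 and LD': "ALL q:cdom e. q:cdom d <-> L q:D" and PhL': "ALL q:cdom e Int cdom d. Ph (L q) = cmap d q" by blast
 have Ls: "!!j y. y:cim e ==> smpt (cdim e) (cim e) (%y. cmap m (L (cinv e y)) j) y" using Ls' by blast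
 have Ph: "!!r j. r:D ==> sfn P r (%r. Ph r j)" using Ph' by blast
 have LD: "!!q. q:cdom e ==> q:cdom d <-> L q:D" using LD' by blast
 have PhL: "!!q. q:cdom e ==> q:cdom d ==> Ph (L q) = cmap d q" using PhL' by blast
 have inj: "inj_on (cmap e) (cdom e)" and qo: "ropen (quad (cdim e) (ccor e)) (cim e)" using N[OF e] by auto
 have q: "qopen (cdim e) (cim e)" using qo by (auto simp: qopen_def)
 have R: "cim e <= Rn (cdim e)" by (rule qopen_Rn[OF q])
 have ci: "cinv e (cmap e q) = q" if "q:cdom e" for q using inj that by (rule inv_into_f_f)
 have rd: "rep_dom id e d = cmap e ` (cdom e Int cdom d)" by (simp add: rep_dom_def)
 let ?F = "%y. cmap m (L (cinv e y))"
 have Fm: "?F y:cim m" if "y:cim e" for y using that ci m by auto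
 have op: "ropen (cim e) (rep_dom id e d)"
 proof (rule openin_nbhdI)
 fix x assume "x:rep_dom id e d"
 then obtain p where p: "p:cdom e" "p:cdom d" "x = cmap e p" unfolding rd by blast
 have "EX S'. ropen (cim e) S' & x:S' & ?F ` S' <= cmap m ` (D Int cdom m)"
 proof (rule smpts_preimage[OF R _ _ _ P.cim_Rn[OF m(1)] P.open_chart[OF D m(1)]])
 show "?F x:cmap m ` (D Int cdom m)" using p ci m LD by auto
 qed (use p Ls Fm in auto)
 then obtain S' where S': "ropen (cim e) S'" "x:S'" "?F ` S' <= cmap m ` (D Int cdom m)" by blast
 have "S' <= rep_dom id e d"
 proof
 fix y assume y: "y:S'"
 then obtain q where q: "q:cdom e" "y = cmap e q" using op_sub[OF S'(1)] by blast
 have "?F y:cmap m ` (D Int cdom m)" using S'(3) y by blast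
 hence "cmap m (L q):cmap m ` (D Int cdom m)" using q ci by simp
 hence "L q:D" using P.inj[OF m(1)] m(2) q(1) by (auto dest: inj_onD)
 thus "y:rep_dom id e d" using LD q rd by auto
 qed
 thus "EX S'. ropen (cim e) S' & x:S' & S' <= rep_dom id e d" using S' by blast
 qed (auto simp: rd)
 moreover have "smooth_fun (cdim e) (rep_dom id e d) (%x. lrep id e d x i)" for i unfolding smooth_fun_pt
 proof
 fix x assume x: "x:rep_dom id e d"
 then obtain p where p: "p:cdom e" "p:cdom d" "x = cmap e p" unfolding rd by blast
 have Lp: "L p:D" "L p:cdom m" using p LD m by auto
 have "smpt (cdim e) (rep_dom id e d) (%y. (%z. Ph (cinv m z) i) (?F y)) x"
 proof (rule smpt_compose[where F = ?F and h = "%z. Ph (cinv m z) i", OF qopen_openin[OF q op] x P.cim_qopen[OF m(1)]])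
 show "smpt (cdim m) (cim m) (%z. Ph (cinv m z) i) (?F x)" using P.sfnD[OF Ph[OF Lp(1)] m(1) Lp(2)] p ci by simp
 show "smpt (cdim e) (rep_dom id e d) (%y. ?F y j) x" if "j < cdim m" for j by (rule smpt_mono[OF Ls]) (use p rd in auto)
 qed (use Fm rd in auto)
 thus "smpt (cdim e) (rep_dom id e d) (%x. lrep id e d x i) x"
 proof (rule smpt_cR)
 fix y assume "y:rep_dom id e d"
 then obtain q where q: "q:cdom e" "q:cdom d" "y = cmap e q" unfolding rd by blast
 hence "L q:cdom m" using m by auto
 thus "lrep id e d y i = Ph (cinv m (cmap m (L (cinv e y)))) i" using q ci PhL m(1) by (simp add: lrep_def)
 qed (use R p in auto)
 qed
 ultimately show ?thesis by blast
 qed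
 show ?thesis unfolding atl_def cmodel_top
 proof (intro conjI ballI allI)
 fix c d i assume c: "c:N" and d: "d:N"
 show "ropen (quad (cdim c) (ccor c)) (rep_dom id c d)" using main[OF c d] N[OF c] openin_trans by blast
 show "smooth_fun (cdim c) (rep_dom id c d) (%x. lrep id c d x i)" using main[OF c d] by blast
 qed (use N in auto)
qed

lemma smap_lift:
 assumes N: "atl N" and e: "e:N" "q:cdom e" and m: "m:P" "L ` cdom e <= cdom m"
 and Ls: "!!j. smpt (cdim e) (cim e) (%y. cmap m (L (cinv e y)) j) (cmap e q)"
 shows "smap N P q L"
proof -
 interpret atlas N by standard (rule N)
 show ?thesis unfolding smap_def by (intro exI[of _ "cdom e"] conjI bexI[of _ m] allI sfnI[OF e Ls]) (use e m cdom_open in auto)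
qed

lemma smap_intoI:
 assumes "mopen M V" "p:V" "d:N" "f ` V <= cdom d" "!!j. sfn M p (%q. cmap d (f q) j)"
 shows "smap M N p f" using assms unfolding smap_def by blast

section \<open>The boundary of a manifold with boundary\<close>

definition bchart :: "'a chart set => 'a chart => 'a chart" where
 "bchart M c = \<lparr> cdim = cdim c - 1, ccor = 0, cdom = cdom c Int bdry M, cmap = (%p i. cmap c p (Suc i)) \<rparr>"

lemma bchart_simps [simp]: "cdim (bchart M c) = cdim c - 1" "ccor (bchart M c) = 0" "cdom (bchart M c) = cdom c Int bdry M"
 "cmap (bchart M c) = (%p i. cmap c p (Suc i))" by (simp_all add: bchart_def)

lemma bmf_eq: "bmf M = {bchart M c |c. c:M & ccor c = 1}" by (simp add: boundary_mfd_def bchart_def)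

lemma continuous_on_case_nat: "continuous_on A (%y::rvec. case_nat a y)"
proof (rule cont_prodI)
 fix j show "continuous_on A (%y::rvec. case_nat a y j)" by (cases j) (auto intro: cont_crd)
qed

lemma case_nat_Rn: "y:Rn n ==> case_nat a y:Rn (Suc n)" by (auto simp: Rn_iff split: nat.split)

locale bmfd = atlas M for M :: "'a chart set" +
 assumes ccor1: "!!c. c:M ==> ccor c <= 1"
begin

lemma transition_Fermat:
 assumes c: "c:M" "p:cdom c" and d: "d:M" "p:cdom d" "ccor d = 1" "cmap d p 0 = 0"
 and ne: "~ (ccor c = 1 & cmap c p 0 = 0)" and i: "i < cdim c"
 shows "pd (cmap c ` (cdom c Int cdom d)) i (%y. cmap d (cinv c y) 0) (cmap c p) = 0"
proof -
 let ?S = "cmap c ` (cdom c Int cdom d)" and ?f = "%y. cmap d (cinv c y) 0" and ?x = "cmap c p"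
 have o: "ropen (quad (cdim c) (ccor c)) ?S" using overlap_open[OF c(1) d(1)] cim_quad[OF c(1)] openin_trans by blast
 have qS: "qopen (cdim c) ?S" using o by (auto simp: qopen_def)
 have x: "?x:?S" using c d by blast
 have xq: "?x:quad (cdim c) (ccor c)" using op_sub[OF o] x by blast
 obtain dl where dl: "dl > 0" "cube (cdim c) ?x dl Int quad (cdim c) (ccor c) <= ?S"
 using openin_cubeD[OF o _ x, of "cdim c"] by (auto simp: quad_def)
 define e where "e = (if ccor c = 1 then min dl (?x 0) else dl)"
 have xpos: "?x 0 > 0" if "ccor c = 1" using xq ne that by (auto simp: quad_def less_le)
 have e: "e > 0" "e <= dl" using dl(1) xpos by (auto simp: e_def)
 have inS: "?x(i := t):?S" if "\<bar>t - ?x i\<bar> < e" for t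
 proof -
 have xR: "?x:Rn (cdim c)" using cmap_Rn[OF c] .
 have "?x(i := t):cube (cdim c) ?x dl" using xR that e dl(1) i by (auto simp: cube_def)
 moreover have "0 <= (?x(i := t)) 0" if c1: "ccor c = 1"
 proof -
 have "e <= ?x 0" using c1 by (simp add: e_def)
 thus ?thesis using `\<bar>t - ?x i\<bar> < e` xpos[OF c1] by (cases "i = 0") auto
 qed
 moreover have "ccor c = 0 | ccor c = 1" using ccor1[OF c(1)] by linarith
 ultimately have "?x(i := t):cube (cdim c) ?x dl Int quad (cdim c) (ccor c)" using xR i by (auto simp: quad_def cube_def)
 thus ?thesis using dl(2) by blast
 qed
 have pos: "0 <= ?f y" if "y:?S" for y
 proof -
 obtain q where q: "q:cdom c" "q:cdom d" "y = cmap c q" using `y:?S` by blast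
 have "cmap d q:quad (cdim d) (ccor d)" using op_sub[OF cim_quad[OF d(1)]] q by blast
 thus ?thesis using d(3) q c by (simp add: quad_def)
 qed
 have f0: "?f ?x = 0" using c d by simp
 have "has_pdw ?S ?f i ?x (pd ?S i ?f ?x)" by (rule has_pdw[OF qS x i transition_smooth[OF c(1) d(1) c(2) d(2)]])
 moreover have "at (?x i) within {t. ?x(i := t):?S} = at (?x i)"
 proof (rule at_within_interior, rule interiorI[of "ball (?x i) e"])
 show "ball (?x i) e <= {t. ?x(i := t):?S}" using inS by (auto simp: dist_real_def abs_minus_commute)
 qed (use e in auto)
 ultimately have "((%t. ?f (?x(i := t))) hrd pd ?S i ?f ?x) (at (?x i))" by simp
 thus ?thesis
 proof (rule DERIV_local_min[OF _ e(1)])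
 show "ALL t. \<bar>?x i - t\<bar> < e --> ?f (?x(i := ?x i)) <= ?f (?x(i := t))"
 proof (intro allI impI)
 fix t assume "\<bar>?x i - t\<bar> < e"
 hence "?x(i := t):?S" using inS[of t] by (simp add: abs_minus_commute)
 from pos[OF this] show "?f (?x(i := ?x i)) <= ?f (?x(i := t))" unfolding fun_upd_triv f0 .
 qed
 qed
qed

lemma bdry_chart:
 assumes p: "p:bdry M" and c: "c:M" "p:cdom c"
 shows "ccor c = 1 & cmap c p 0 = 0"
proof (rule ccontr)
 assume ne: "~ (ccor c = 1 & cmap c p 0 = 0)"
 obtain d i where d: "d:M" "p:cdom d" "i < ccor d" "cmap d p i = 0" using p by (auto simp: bdry_def)
 hence d1: "ccor d = 1" "cmap d p 0 = 0" using ccor1[OF d(1)] by (auto simp: less_Suc_eq_le dest: le_antisym)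
 have n: "0 < cdim d" using atlas d(1) d1 by (force simp: atl_def)
 have bR: "bvec 0:Rn (cdim d)" by (rule bvec_Rn[OF n])
 have idM: "smaps M M (car M) id" by (rule smaps_id[OF atlas open_car])
 have pM: "p:car M" using c by (auto simp: car_def)
 have "rtan id d d (cmap d p) (bvec 0) = rtan id c d (cmap c p) (rtan id d c (cmap d p) (bvec 0))"
 using rtan_chain[OF atlas atlas atlas idM idM _ pM d(1,2) c(1) _ d(1), of "bvec 0"] pM c d by (simp add: id_def)
 hence "bvec 0 = rtan id c d (cmap c p) (rtan id d c (cmap d p) (bvec 0))" using rtan_id[OF atlas d(1,2) bR] by simp
 moreover have "rtan id c d (cmap c p) v 0 = 0" for v
 proof -
 have "rep_dom id c d = cmap c ` (cdom c Int cdom d)" "lrep id c d = (%y. cmap d (cinv c y))" by (auto simp: rep_dom_id lrep_def)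
 thus ?thesis using transition_Fermat[OF c d(1,2) d1 ne] by (simp add: rep_tangent_def tmap_def ddv_def)
 qed
 ultimately show False by (metis bvec_def zero_neq_one)
qed

lemma bdry_iff: "c:M ==> p:cdom c ==> p:bdry M <-> ccor c = 1 & cmap c p 0 = 0" using bdry_chart by (auto simp: bdry_def)

lemma bdry_car: "bdry M <= car M" by (auto simp: bdry_def car_def)

lemma cmap_bdry: "c:M ==> p:cdom c ==> p:bdry M ==> case_nat 0 (%i. cmap c p (Suc i)) = cmap c p"
 using bdry_chart by (auto simp: fun_eq_iff split: nat.split)

lemma bchart_ok:
 assumes c: "c:M" "ccor c = 1"
 shows "inj_on (cmap (bchart M c)) (cdom (bchart M c))"
 and "ropen (Rn (cdim c - 1)) (cim (bchart M c))"
 and "p:cdom c ==> p:bdry M ==> cinv (bchart M c) (%i. cmap c p (Suc i)) = p"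
proof -
 have n: "cdim c = Suc (cdim c - 1)" using atlas c by (force simp: atl_def)
 show inj': "inj_on (cmap (bchart M c)) (cdom (bchart M c))"
 proof (rule inj_onI)
 fix p q assume pq: "p:cdom (bchart M c)" "q:cdom (bchart M c)" "cmap (bchart M c) p = cmap (bchart M c) q"
 have "cmap c p = case_nat 0 (%i. cmap c p (Suc i))" by (rule cmap_bdry[OF c(1), symmetric]) (use pq in auto)
 also have "\<dots> = case_nat 0 (%i. cmap c q (Suc i))" using pq(3) by simp
 also have "\<dots> = cmap c q" by (rule cmap_bdry[OF c(1)]) (use pq in auto)
 finally have "cmap c p = cmap c q" .
 thus "p = q" using inj[OF c(1)] pq by (auto dest: inj_onD)
 qed
 have "ropen (Rn (cdim c - 1)) (Rn (cdim c - 1) Int case_nat 0 -` cim c)"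
 proof (rule cont_pre[OF continuous_on_case_nat _ cim_quad[OF c(1)]])
 show "case_nat 0:Rn (cdim c - 1) \<rightarrow> quad (cdim c) (ccor c)"
 using case_nat_Rn[of _ "cdim c - 1" 0] n c(2) by (auto simp: quad_def)
 qed
 moreover have "Rn (cdim c - 1) Int case_nat 0 -` cim c = cim (bchart M c)"
 proof (intro equalityI subsetI)
 fix y assume "y:Rn (cdim c - 1) Int case_nat 0 -` cim c"
 then obtain p where y: "y:Rn (cdim c - 1)" "case_nat 0 y = cmap c p" "p:cdom c" by blast
 have "cmap c p 0 = 0" "y = (%i. cmap c p (Suc i))" using fun_cong[OF y(2), of 0] fun_cong[OF y(2), of "Suc i" for i] by (auto simp: fun_eq_iff)
 thus "y:cim (bchart M c)" using bdry_iff[OF c(1) y(3)] c(2) y(3) by auto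
 next
 fix y assume "y:cim (bchart M c)"
 then obtain p where p: "p:cdom c" "p:bdry M" "y = (%i. cmap c p (Suc i))" by auto
 have "y:Rn (cdim c - 1)" using cmap_Rn[OF c(1) p(1)] p(3) n by (auto simp: Rn_iff)
 moreover have "case_nat 0 y:cim c" using cmap_bdry[OF c(1) p(1,2)] p by simp
 ultimately show "y:Rn (cdim c - 1) Int case_nat 0 -` cim c" by blast
 qed
 ultimately show "ropen (Rn (cdim c - 1)) (cim (bchart M c))" by simp
 show "p:cdom c ==> p:bdry M ==> cinv (bchart M c) (%i. cmap c p (Suc i)) = p" using inv_into_f_f[OF inj', of p] by simp
qed

lemma quad_0: "quad n 0 = Rn n" by (simp add: quad_def)

lemma bchart_lift:
 assumes c: "c:M" "ccor c = 1" and y: "y:cim (bchart M c)"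
 shows "smpt (cdim c - 1) (cim (bchart M c)) (%y. cmap c (cinv (bchart M c) y) j) y"
proof -
 have yR: "y:Rn (cdim c - 1)" using y op_sub[OF bchart_ok(2)[OF c]] by blast
 have e: "cmap c (cinv (bchart M c) z) = case_nat 0 z" if "z:cim (bchart M c)" for z
 proof -
 obtain p where p: "p:cdom c" "p:bdry M" "z = (%i. cmap c p (Suc i))" using `z:cim (bchart M c)` by auto
 thus ?thesis using bchart_ok(3)[OF c p(1,2)] cmap_bdry[OF c(1) p(1,2)] by simp
 qed
 show ?thesis
 proof (cases j)
 case 0
 show ?thesis by (rule smpt_cR[OF smpt_const[OF yR, of _ 0] yR]) (simp only: e 0 nat.case)
 next
 case (Suc i)
 show ?thesis by (rule smpt_cR[OF smpt_coord[OF yR, of _ i] yR]) (simp only: e Suc nat.case)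
 qed
qed

lemma batlas: "atl (bmf M)"
proof (rule atlas_from_lifts[OF atlas])
 fix e assume "e:bmf M"
 then obtain c where c: "e = bchart M c" "c:M" "ccor c = 1" by (auto simp: bmf_eq)
 thus "ccor e <= cdim e & inj_on (cmap e) (cdom e) & ropen (quad (cdim e) (ccor e)) (cim e)" using bchart_ok(1,2)[OF c(2,3)] quad_0 by simp
 fix d assume "d:bmf M"
 then obtain c' where c': "d = bchart M c'" "c':M" "ccor c' = 1" by (auto simp: bmf_eq)
 show "EX m:M. EX L D Ph. L ` cdom e <= cdom m &
 (ALL j. ALL y:cim e. smpt (cdim e) (cim e) (%y. cmap m (L (cinv e y)) j) y) &
 mopen M D & (ALL r:D. ALL j. sfn M r (%r. Ph r j)) &
 (ALL q:cdom e. q:cdom d <-> L q:D) & (ALL q:cdom e Int cdom d. Ph (L q) = cmap d q)"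
 by (intro bexI[of _ c] exI[of _ "%q. q"] exI[of _ "cdom c'"] exI[of _ "%r i. cmap c' r (Suc i)"])
 (use c c' cdom_open bchart_lift[OF c(2,3)] sfn_coord in auto)
qed

lemma bcar: "car (bmf M) = bdry M"
proof safe
 fix p assume p: "p:bdry M"
 then obtain c where c: "c:M" "p:cdom c" using bdry_car by (auto simp: car_def)
 hence "bchart M c:bmf M" "p:cdom (bchart M c)" using bdry_chart[OF p c] p by (auto simp: bmf_eq)
 thus "p:car (bmf M)" unfolding car_def by blast
qed (auto simp: car_def bmf_eq)

lemma smap_bincl: "p:bdry M ==> smap (bmf M) M p id"
proof -
 assume p: "p:bdry M"
 then obtain c where c: "c:M" "p:cdom c" using bdry_car by (auto simp: car_def)
 have c1: "ccor c = 1" using bdry_chart[OF p c] by simp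
 have e: "bchart M c:bmf M" using c c1 by (auto simp: bmf_eq)
 show ?thesis by (rule smap_lift[OF batlas e _ c(1)]) (use p c c1 bchart_lift[OF c(1) c1] in auto)
qed

lemma smaps_bincl: "smaps (bmf M) M (bdry M) id"
proof -
 interpret B: atlas "bmf M" by standard (rule batlas)
 show ?thesis unfolding smaps_def using smap_bincl B.open_car bcar by simp
qed

lemma smap_bfactor:
 assumes P: "atl P" and f: "smap P M p f" and V: "mopen P V" "p:V" "f ` V <= bdry M"
 shows "smap P (bmf M) p f"
proof -
 interpret PM: atlas2 P M by standard (use P atlas in auto)
 have fp: "f p:bdry M" using V by auto
 then obtain c where c: "c:M" "f p:cdom c" using bdry_car by (auto simp: car_def)
 have c1: "ccor c = 1" using bdry_chart[OF fp c] by simp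
 obtain W where W: "mopen P W" "p:W" "f ` W <= cdom c" using PM.smap_chart(1)[OF f c] by blast
 show ?thesis by (rule smap_intoI[of P "V Int W" p "bchart M c"])
 (use V W c c1 PM.smap_chart(2)[OF f c] in "auto simp: bmf_eq")
qed

lemma smaps_bfactor:
 assumes P: "atl P" and f: "smaps P M D f" and fD: "f ` D <= bdry M"
 shows "smaps P (bmf M) D f" unfolding smaps_def using smap_bfactor[OF P smapsD[OF f] smaps_open[OF f] _ fD] smaps_open[OF f] by blast

lemma interior_open: "mopen M (interior_pts M)"
proof (rule openin_mfdI)
 fix p assume p: "p:interior_pts M"
 then obtain c where c: "c:M" "p:cdom c" by (auto simp: car_def)
 show "EX A. mopen M A & p:A & A <= interior_pts M"
 proof (cases "ccor c = 1")
 case True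
 have "mopen M {q:cdom c. cmap c q 0:{0<..}}" by (rule sfn_pre[OF sfn_coord[OF c(1)] cdom_open[OF c(1)]]) auto
 moreover have "cmap c p 0 > 0"
 proof -
 have "cmap c p:quad (cdim c) (ccor c)" using op_sub[OF cim_quad[OF c(1)]] c by blast
 thus ?thesis using True p bdry_iff[OF c] by (auto simp: quad_def less_le)
 qed
 ultimately show ?thesis using c bdry_iff[OF c(1)] by (intro exI[of _ "{q:cdom c. cmap c q 0:{0<..}}"]) (auto simp: car_def)
 next
 case False
 thus ?thesis using c bdry_iff[OF c(1)] cdom_open[OF c(1)] by (intro exI[of _ "cdom c"]) (auto simp: car_def)
 qed
qed auto

end

section \<open>Open submanifolds\<close>

context atlas
begin

lemma restrict_charts: "c:M ==> c\<lparr>cdom := cdom c Int A\<rparr>:restrict_mfd M A" by (auto simp: rm_def)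

lemma restrict_atlas:
 assumes A: "mopen M A"
 shows "atl (restrict_mfd M A)"
proof (rule atlas_from_lifts[OF atlas])
 fix e assume "e:restrict_mfd M A"
 then obtain c where c: "c:M" "e = c\<lparr>cdom := cdom c Int A\<rparr>" by (auto simp: rm_def)
 have o: "ropen (cim c) (cim e)" using open_chart[OF A c(1)] c(2) by (simp add: Int_commute)
 have ie: "inj_on (cmap e) (cdom e)" using inj[OF c(1)] c(2) by (auto intro: inj_on_subset)
 show "ccor e <= cdim e & inj_on (cmap e) (cdom e) & ropen (quad (cdim e) (ccor e)) (cim e)"
 using ie atlas c openin_trans[OF o cim_quad[OF c(1)]] by (simp add: atl_def)
 fix d assume "d:restrict_mfd M A"
 then obtain c' where c': "c':M" "d = c'\<lparr>cdom := cdom c' Int A\<rparr>" by (auto simp: rm_def)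
 have "smpt (cdim e) (cim e) (%y. cmap c (cinv e y) j) y" if y: "y:cim e" for y j
 proof -
 have yR: "y:Rn (cdim e)" using y cim_Rn[OF c(1)] c(2) by auto
 have "cmap c (cinv e z) = z" if "z:cim e" for z
 proof -
 obtain q where "q:cdom e" "z = cmap e q" using `z:cim e` by blast
 thus ?thesis using inv_into_f_f[OF ie] c(2) by simp
 qed
 thus ?thesis using smpt_cR[OF smpt_coord[OF yR, of _ j] yR] by simp
 qed
 thus "EX m:M. EX L D Ph. L ` cdom e <= cdom m &
 (ALL j. ALL y:cim e. smpt (cdim e) (cim e) (%y. cmap m (L (cinv e y)) j) y) &
 mopen M D & (ALL r:D. ALL j. sfn M r (%r. Ph r j)) &
 (ALL q:cdom e. q:cdom d <-> L q:D) & (ALL q:cdom e Int cdom d. Ph (L q) = cmap d q)"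
 by (intro bexI[of _ c] exI[of _ "%q. q"] exI[of _ "cdom c'"] exI[of _ "cmap c'"])
 (use c c' cdom_open sfn_coord in auto)
qed

lemma restrict_carrier: "A <= car M ==> car (restrict_mfd M A) = A" by (auto simp: car_def rm_def)

lemma smaps_restrict_incl:
 assumes A: "mopen M A"
 shows "smaps (restrict_mfd M A) M A id"
proof -
 interpret R: atlas "restrict_mfd M A" by standard (rule restrict_atlas[OF A])
 have cA: "car (restrict_mfd M A) = A" by (rule restrict_carrier[OF opn_car[OF A]])
 have "smap (restrict_mfd M A) M p id" if p: "p:A" for p
 proof -
 obtain c where c: "c:M" "p:cdom c" using opn_car[OF A] p by (auto simp: car_def)
 have e: "c\<lparr>cdom := cdom c Int A\<rparr>:restrict_mfd M A" "p:cdom (c\<lparr>cdom := cdom c Int A\<rparr>)" using c p restrict_charts by auto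
 show ?thesis by (rule smap_intoI[OF R.cdom_open[OF e(1)] e(2) c(1)]) (use R.sfn_coord[OF e] in auto)
 qed
 thus ?thesis unfolding smaps_def using R.open_car cA by simp
qed

lemma smaps_restrict_into:
 assumes A: "mopen M A"
 shows "smaps M (restrict_mfd M A) A id"
proof -
 have "smap M (restrict_mfd M A) p id" if p: "p:A" for p
 proof -
 obtain c where c: "c:M" "p:cdom c" using opn_car[OF A] p by (auto simp: car_def)
 show ?thesis by (rule smap_intoI[of M "cdom c Int A" p "c\<lparr>cdom := cdom c Int A\<rparr>"])
 (use c p A cdom_open[OF c(1)] restrict_charts sfn_coord[OF c] in auto)
 qed
 thus ?thesis unfolding smaps_def using A by simp
qed

end

section \<open>Vector bundles\<close>

lemma append_vec_simps [simp]: "i < n ==> append_vec n x y i = x i" "append_vec n x y (n + i) = y i"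
 "~ i < n ==> append_vec n x y i = y (i - n)" by (simp_all add: append_vec_def)

lemma total_chart_simps [simp]:
 "cdim (total_chart E c t) = cdim c + trank t" "ccor (total_chart E c t) = ccor c"
 "cdom (total_chart E c t) = {w:total E. proj E w:cdom c Int tdom t}"
 "cmap (total_chart E c t) = (%w. append_vec (cdim c) (cmap c (proj E w)) (tmap t w))" by (simp_all add: total_chart_def)

locale vbun = bmfd M for M :: "'a chart set" +
 fixes E :: "('a, 'w) vbundle"
 assumes vb: "vector_bundle M E"
begin

abbreviation "PE == proj E"
abbreviation "TE == total E"
abbreviation "vE == vscale E"
abbreviation "NE == nonzero E"
abbreviation "tE == trivs E"
abbreviation "sch == sphere_chart E"
abbreviation "tch == total_chart E"
abbreviation "ich == infinity_chart E"

abbreviation T :: "'w chart set" where "T \<equiv> total_mfd M E"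

lemma proj_car: "w:TE ==> PE w:car M" using vb by (auto simp: vb_def)

lemma triv_ex: "p:car M ==> EX t:tE. p:tdom t" using vb unfolding vb_def by blast

lemma tdom_open: "t:tE ==> mopen M (tdom t)" using vb unfolding vb_def by blast

lemma T_atlas: "atl T" using vb unfolding vb_def by blast

lemma tmap_bij: "t:tE ==> p:tdom t ==> bij_betw (tmap t) (fibre E p) (Rn (trank t))" using vb unfolding vb_def by blast

lemma in_fibre: "w:TE ==> w:fibre E (PE w)" by (simp add: fibre_def)

lemma tmap_Rn: "t:tE ==> w:TE ==> PE w:tdom t ==> tmap t w:Rn (trank t)"
 using bij_betw_imp_surj_on[OF tmap_bij[of t "PE w"]] in_fibre[of w] by blast

lemma tmap_inj: "t:tE ==> w:TE ==> w':TE ==> PE w = PE w' ==> PE w:tdom t ==>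
 tmap t w = tmap t w' ==> w = w'" by (rule inj_onD[OF bij_betw_imp_inj_on[OF tmap_bij[of t "PE w"]]]) (auto simp: fibre_def)

lemma tmap_surj: "t:tE ==> p:tdom t ==> v:Rn (trank t) ==> EX w:TE. PE w = p & tmap t w = v"
 using bij_betw_imp_surj_on[OF tmap_bij[of t p]] by (force simp: fibre_def)

lemma vs_tot:
 assumes "w:TE"
 shows "vE a w:TE" "PE (vE a w) = PE w"
proof -
 obtain t where t: "t:tE" "PE w:tdom t" using triv_ex[OF proj_car[OF assms]] by blast
 hence "vE a w:fibre E (PE w)" using vb in_fibre[OF assms] unfolding vb_def by blast
 thus "vE a w:TE" "PE (vE a w) = PE w" by (auto simp: fibre_def)
qed

lemma tmap_vscale:
 assumes "t:tE" "w:TE" "PE w:tdom t"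
 shows "tmap t (vE a w) = a *R tmap t w" using vb in_fibre[OF assms(2)] assms unfolding vb_def by blast

lemma vs_vs: "w:TE ==> vE a (vE b w) = vE (a * b) w"
proof -
 assume w: "w:TE"
 obtain t where t: "t:tE" "PE w:tdom t" using triv_ex[OF proj_car[OF w]] by blast
 show ?thesis by (rule tmap_inj[OF t(1)]) (use w t in "auto simp: vs_tot tmap_vscale")
qed

lemma vscale_1: "w:TE ==> vE 1 w = w"
proof -
 assume w: "w:TE"
 obtain t where t: "t:tE" "PE w:tdom t" using triv_ex[OF proj_car[OF w]] by blast
 show ?thesis by (rule tmap_inj[OF t(1)]) (use w t in "auto simp: vs_tot tmap_vscale")
qed

lemma zero_iff: "t:tE ==> w:TE ==> PE w:tdom t ==> vE 0 w = w <-> tmap t w = 0"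
 using tmap_vscale[of t w 0] tmap_inj[of t "vE 0 w" w] vs_tot[of w 0] by auto

lemma nonzero_iff: "t:tE ==> w:TE ==> PE w:tdom t ==> w:NE <-> tmap t w ~= 0" using zero_iff by (auto simp: nonzero_def)

lemma nz_total: "w:NE ==> w:TE" by (simp add: nonzero_def)

lemma nonzero_vscale: "w:NE ==> a ~= 0 ==> vE a w:NE"
proof -
 assume w: "w:NE" "a ~= 0"
 obtain t where t: "t:tE" "PE w:tdom t" using triv_ex[OF proj_car[OF nz_total[OF w(1)]]] by blast
 show ?thesis using w t nz_total[OF w(1)] nonzero_iff[OF t(1)] by (simp add: tmap_vscale vs_tot)
qed

definition zsec :: "'a => 'w" where
 "zsec p = (SOME w. w:fibre E p & vE 0 w = w)"

lemma zsec:
 assumes "p:car M"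
 shows "zsec p:TE" "PE (zsec p) = p" "vE 0 (zsec p) = zsec p"
 "t:tE ==> p:tdom t ==> tmap t (zsec p) = 0"
proof -
 obtain t where t: "t:tE" "p:tdom t" using triv_ex[OF assms] by blast
 obtain w where w: "w:TE" "PE w = p" "tmap t w = 0" using tmap_surj[OF t Rn_zero] by blast
 hence "w:fibre E p & vE 0 w = w" using zero_iff[OF t(1) w(1)] t by (auto simp: fibre_def)
 hence z: "zsec p:fibre E p & vE 0 (zsec p) = zsec p" unfolding zsec_def by (rule someI)
 thus 1: "zsec p:TE" "PE (zsec p) = p" and 2: "vE 0 (zsec p) = zsec p" by (auto simp: fibre_def)
 show "t:tE ==> p:tdom t ==> tmap t (zsec p) = 0" for t using zero_iff[of t "zsec p"] 1 2 by simp
qed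

lemma zsec_vscale0: "w:TE ==> zsec (PE w) = vE 0 w"
proof -
 assume w: "w:TE"
 obtain t where t: "t:tE" "PE w:tdom t" using triv_ex[OF proj_car[OF w]] by blast
 show ?thesis by (rule tmap_inj[OF t(1)]) (use w t zsec[OF proj_car[OF w]] in "auto simp: vs_tot tmap_vscale")
qed

lemma T_chart: "c:M ==> t:tE ==> tch c t:T" by (auto simp: tot_def)

lemma chart_at: "w:TE ==> EX c:M. EX t:tE. PE w:cdom c & PE w:tdom t" using proj_car[of w] triv_ex[of "PE w"] by (auto simp: car_def)

lemma T_car: "car T = TE" using chart_at by (force simp: car_def tot_def)

sublocale TT: atlas T by standard (rule T_atlas)
sublocale TM: atlas2 T M ..

lemma T_bmfd: "bmfd T" by standard (auto simp: tot_def dest: ccor1)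

sublocale TB: bmfd T by (rule T_bmfd)

lemma sfn_tmap:
 assumes "t:tE" "w:TE" "PE w:tdom t"
 shows "sfn T w (%w. tmap t w i)"
proof -
 obtain c where c: "c:M" "PE w:cdom c" using proj_car[OF assms(2)] by (auto simp: car_def)
 have "sfn T w (%w. cmap (tch c t) w (cdim c + i))" by (rule TT.sfn_coord[OF T_chart[OF c(1) assms(1)]]) (use assms c in auto)
 thus ?thesis by simp
qed

lemma smap_proj: "w:TE ==> smap T M w (PE)"
proof -
 assume w: "w:TE"
 obtain c t where c: "c:M" "t:tE" "PE w:cdom c" "PE w:tdom t" using chart_at[OF w] by blast
 let ?m = "tch c t"
 have m: "?m:T" "w:cdom ?m" using T_chart[OF c(1,2)] c w by auto
 show ?thesis
 proof (rule smap_intoI[OF TT.cdom_open[OF m(1)] m(2) c(1)])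
 fix j show "sfn T w (%q. cmap c (PE q) j)"
 proof (cases "j < cdim c")
 case True
 thus ?thesis using TT.sfn_coord[OF m, of j] by simp
 next
 case False
 have "sfn T w (%q. 0)" by simp
 thus ?thesis by (rule TT.sfn_cong[OF _ TT.cdom_open[OF m(1)] m(2)]) (use False cmap_Rn[OF c(1)] in "auto simp: Rn_iff")
 qed
 qed auto
qed

lemma smap_intoT:
 assumes P: "atl P" and V: "mopen P V" "p:V" "!!q. q:V ==> f q:TE"
 and pf: "smap P M p (%q. PE (f q))" and t: "t:tE" "PE (f p):tdom t"
 and tf: "!!i. sfn P p (%q. tmap t (f q) i)"
 shows "smap P T p f"
proof -
 interpret PM: atlas2 P M by standard (use P atlas in auto)
 obtain c where c: "c:M" "PE (f p):cdom c" using V proj_car by (force simp: car_def)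
 obtain W where W: "mopen P W" "p:W" "(%q. PE (f q)) ` W <= cdom c Int tdom t"
 using PM.smap_cont[OF pf openin_Int[OF cdom_open[OF c(1)] tdom_open[OF t(1)]]] c t by auto
 show ?thesis
 proof (rule smap_intoI[OF openin_Int[OF V(1) W(1)] _ T_chart[OF c(1) t(1)]])
 fix j show "sfn P p (%q. cmap (tch c t) (f q) j)" using PM.smap_chart(2)[OF pf c, of j] tf[of "j - cdim c"] by (cases "j < cdim c") auto
 qed (use V W in auto)
qed

lemma smap_vscale:
 assumes P: "atl P" and f: "smap P T p f" and h: "sfn P p h"
 shows "smap P T p (%q. vE (h q) (f q))"
proof -
 interpret PT: atlas2 P T by standard (use P T_atlas in auto)
 have fp: "f p:TE" using PT.smap_car[OF f] T_car by simp
 obtain c t where c: "c:M" "t:tE" "PE (f p):cdom c" "PE (f p):tdom t" using chart_at[OF fp] by blast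
 let ?m = "tch c t"
 have m: "?m:T" "f p:cdom ?m" using T_chart[OF c(1,2)] c fp by auto
 obtain V where V: "mopen P V" "p:V" "f ` V <= cdom ?m" using PT.smap_chart(1)[OF f m] by blast
 have Vt: "f q:TE" "PE (f q):tdom t" if "q:V" for q using V(3) that by auto
 show ?thesis
 proof (rule smap_intoT[OF P V(1,2) _ _ c(2)])
 have "smap P M p (%q. PE (f q))" by (rule smap_compose[OF P T_atlas atlas f smap_proj[OF fp]])
 thus "smap P M p (%q. PE (vE (h q) (f q)))"
 proof -
 interpret PM: atlas2 P M by standard (use P atlas in auto)
 show ?thesis by (rule PM.smap_cong[OF `smap P M p (%q. PE (f q))` V(1,2)]) (use Vt vs_tot in auto)
 qed
 fix i
 have "sfn P p (%q. h q * tmap t (f q) i)" using PT.A.sfn_mult[OF h PT.sfn_compose[OF f sfn_tmap[OF c(2) fp c(4)]]] .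
 thus "sfn P p (%q. tmap t (vE (h q) (f q)) i)" by (rule PT.A.sfn_cong[OF _ V(1,2)]) (use Vt c in "simp add: tmap_vscale sfun_def")
 qed (use Vt c V(2) in "auto simp: vs_tot")
qed

lemma smap_zsec: "p:car M ==> smap M T p zsec"
proof -
 assume p: "p:car M"
 obtain t where t: "t:tE" "p:tdom t" using triv_ex[OF p] by blast
 have tM: "q:car M" if "q:tdom t" for q using opn_car[OF tdom_open[OF t(1)]] that by blast
 interpret MM: atlas2 M M ..
 show ?thesis
 proof (rule smap_intoT[OF atlas tdom_open[OF t(1)] t(2) _ _ t(1)])
 show "smap M M p (%q. PE (zsec q))" by (rule MM.smap_cong[OF smap_id[OF atlas p] tdom_open[OF t(1)] t(2)]) (use zsec tM in auto)
 show "sfn M p (%q. tmap t (zsec q) i)" for i by (rule sfn_cong[OF sfn_const[of p 0] tdom_open[OF t(1)] t(2)]) (use zsec tM t in auto)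
 qed (use zsec tM t in auto)
qed

lemma proj_open: "mopen M V ==> mopen T {w:TE. PE w:V}"
proof (rule TT.openin_mfdI)
 fix w assume V: "mopen M V" and w: "w:{w:TE. PE w:V}"
 obtain A where "mopen T A" "w:A" "PE ` A <= V" using TM.smap_cont[OF smap_proj V] w by blast
 thus "EX A. mopen T A & w:A & A <= {w:TE. PE w:V}" using TT.opn_car T_car by (intro exI[of _ A]) auto
qed (auto simp: T_car)

lemma nonzero_open: "mopen T (NE)"
proof (rule TT.openin_mfdI)
 show "NE <= car T" using nz_total T_car by auto
 fix w assume w: "w:NE"
 obtain t where t: "t:tE" "PE w:tdom t" using triv_ex[OF proj_car[OF nz_total[OF w]]] by blast
 let ?D = "{w:TE. PE w:tdom t}"
 obtain i where i: "tmap t w i ~= 0" using nonzero_iff[OF t(1) nz_total[OF w] t(2)] w by (auto simp: fun_eq_iff)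
 have "mopen T {v:?D. tmap t v i:- {0}}" by (rule TT.sfn_pre[OF _ proj_open[OF tdom_open[OF t(1)]]]) (auto intro: sfn_tmap[OF t(1)])
 thus "EX A. mopen T A & w:A & A <= NE"
 using i w t nz_total[OF w] nonzero_iff[OF t(1)] by (intro exI[of _ "{v:?D. tmap t v i:- {0}}"]) auto
qed

lemma T_bdry: "bdry T = {w:TE. PE w:bdry M}"
proof safe
 fix w assume w: "w:bdry T"
 show wt: "w:TE" using w TB.bdry_car T_car by auto
 obtain c t where c: "c:M" "t:tE" "PE w:cdom c" "PE w:tdom t" using chart_at[OF wt] by blast
 have n: "ccor c = 1 ==> 0 < cdim c" using atlas c(1) by (force simp: atl_def)
 have "ccor (tch c t) = 1 & cmap (tch c t) w 0 = 0" by (rule TB.bdry_chart[OF w T_chart[OF c(1,2)]]) (use c wt in auto)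
 thus "PE w:bdry M" using bdry_iff[OF c(1,3)] n by simp
next
 fix w assume w: "w:TE" "PE w:bdry M"
 obtain c t where c: "c:M" "t:tE" "PE w:cdom c" "PE w:tdom t" using chart_at[OF w(1)] by blast
 have n: "ccor c = 1 ==> 0 < cdim c" using atlas c(1) by (force simp: atl_def)
 have wm: "w:cdom (tch c t)" using c w by auto
 show "w:bdry T" unfolding TB.bdry_iff[OF T_chart[OF c(1,2)] wm] using bdry_iff[OF c(1,3)] w n by simp
qed

section \<open>The sphere bundle\<close>

lemma ray_self: "w:TE ==> w:ray E w" unfolding ray_def using vscale_1[of w] by (metis (mono_tags, lifting) mem_Collect_eq zero_less_one)

lemma ray_vscale: "w:TE ==> 0 < b ==> ray E (vE b w) = ray E w"
proof (intro equalityI subsetI)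
 assume w: "w:TE" and b: "0 < b"
 fix x
 { assume "x:ray E (vE b w)"
 then obtain a where "a > 0" "x = vE (a * b) w" using vs_vs[OF w] by (auto simp: ray_def)
 thus "x:ray E w" using b by (auto simp: ray_def intro!: exI[of _ "a * b"]) }
 assume "x:ray E w"
 then obtain a where "a > 0" "x = vE a w" by (auto simp: ray_def)
 thus "x:ray E (vE b w)" using b vs_vs[OF w, of "a / b" b] by (auto simp: ray_def intro!: exI[of _ "a / b"])
qed

lemma ray_rep:
 assumes "w:TE"
 shows "EX a>0. ray_rep (ray E w) = vE a w"
proof -
 have "ray_rep (ray E w):ray E w" unfolding ray_rep_def using ray_self[OF assms] by (rule someI)
 thus ?thesis by (auto simp: ray_def)
qed

lemma sphere_proj_ray [simp]: "w:TE ==> sphere_proj E (ray E w) = PE w" using ray_rep[of w] vs_tot by (auto simp: sphere_proj_def)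

abbreviation SS :: "'w set chart set" where "SS \<equiv> sphere_mfd M E"

definition scond :: "'a chart => ('a, 'w) triv => nat => real => 'w set" where
 "scond c t j sg = {w:NE. PE w:cdom c Int tdom t & 0 < sg * tmap t w j}"

definition scoord :: "'a chart => ('a, 'w) triv => nat => real => 'w => rvec" where
 "scoord c t j sg w = append_vec (cdim c) (cmap c (PE w)) (drop_coord j ((1 / (sg * tmap t w j)) *R tmap t w))"

definition slift :: "('a, 'w) triv => nat => real => 'w set => 'w" where
 "slift t j sg R = vE (1 / (sg * tmap t (ray_rep R) j)) (ray_rep R)"

definition sins :: "nat => nat => real => rvec => rvec" where
 "sins n j sg y = (%i. if i < n + j then y i else if i = n + j then sg else y (i - 1))"

lemma sphere_cdom:
 assumes t: "t:tE"
 shows "R:cdom (sch c t j sg) <-> (EX w:scond c t j sg. R = ray E w)"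
 and "w:NE ==> ray E w:cdom (sch c t j sg) <-> w:scond c t j sg"
proof -
 show *: "ray E w:cdom (sch c t j sg) <-> w:scond c t j sg" if w: "w:NE" for w
 proof -
 have wt: "w:TE" using nz_total[OF w] .
 obtain a where a: "a > 0" "ray_rep (ray E w) = vE a w" using ray_rep[OF wt] by blast
 have "0 < sg * tmap t (ray_rep (ray E w)) j <-> 0 < sg * tmap t w j" if "PE w:tdom t"
 proof -
 have "sg * tmap t (ray_rep (ray E w)) j = a * (sg * tmap t w j)" using a(2) tmap_vscale[OF t wt that, of a] by (simp add: sfun_def)
 thus ?thesis using a(1) by (metis mult_pos_pos zero_less_mult_pos)
 qed
 thus ?thesis using w sphere_proj_ray[OF wt] by (auto simp: sch_def scond_def)
 qed
 show "R:cdom (sch c t j sg) <-> (EX w:scond c t j sg. R = ray E w)"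
 proof
 assume R: "R:cdom (sch c t j sg)"
 then obtain w where "w:NE" "R = ray E w" by (auto simp: sch_def)
 thus "EX w:scond c t j sg. R = ray E w" using * R by blast
 next
 assume "EX w:scond c t j sg. R = ray E w"
 thus "R:cdom (sch c t j sg)" using * by (auto simp: scond_def)
 qed
qed

lemma sphere_cmap:
 assumes t: "t:tE" and w: "w:scond c t j sg"
 shows "cmap (sch c t j sg) (ray E w) = scoord c t j sg w"
 and "slift t j sg (ray E w) = vE (1 / (sg * tmap t w j)) w"
proof -
 have wn: "w:NE" "PE w:tdom t" using w by (auto simp: scond_def)
 have wt: "w:TE" using nz_total[OF wn(1)] .
 obtain a where a: "a > 0" "ray_rep (ray E w) = vE a w" using ray_rep[OF wt] by blast
 have tv: "tmap t (vE a w) = a *R tmap t w" by (rule tmap_vscale[OF t wt wn(2)])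
 have "(1 / (sg * (a *R tmap t w) j)) *R (a *R tmap t w) = (1 / (sg * tmap t w j)) *R tmap t w"
 using a(1) by (simp add: sfun_def fun_eq_iff)
 thus "cmap (sch c t j sg) (ray E w) = scoord c t j sg w"
 using sphere_proj_ray[OF wt] a tv by (simp add: sch_def scoord_def del: scaleR_scaleR)
 show "slift t j sg (ray E w) = vE (1 / (sg * tmap t w j)) w" using a tv by (simp add: slift_def vs_vs[OF wt] sfun_def)
qed

lemma sphere_chart_simps [simp]:
 "cdim (sch c t j sg) = cdim c + trank t - 1" "ccor (sch c t j sg) = ccor c" by (simp_all add: sch_def)

lemma slift_props:
 assumes t: "t:tE" and j: "j < trank t" and sg: "sg = 1 | sg = -1" and R: "R:cdom (sch c t j sg)"
 shows "slift t j sg R:scond c t j sg" "ray E (slift t j sg R) = R" "tmap t (slift t j sg R) j = sg"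
 "cmap (tch c t) (slift t j sg R) = sins (cdim c) j sg (cmap (sch c t j sg) R)"
proof -
 obtain w where w: "w:scond c t j sg" "R = ray E w" using R sphere_cdom(1)[OF t] by blast
 have wn: "w:NE" "PE w:tdom t" "PE w:cdom c" "0 < sg * tmap t w j" using w by (auto simp: scond_def)
 have wt: "w:TE" using nz_total[OF wn(1)] .
 let ?a = "1 / (sg * tmap t w j)"
 have L: "slift t j sg R = vE ?a w" using sphere_cmap(2)[OF t w(1)] w(2) by simp
 have a: "?a > 0" using wn(4) by simp
 have tv: "tmap t (vE ?a w) = ?a *R tmap t w" by (rule tmap_vscale[OF t wt wn(2)])
 show tj: "tmap t (slift t j sg R) j = sg" unfolding L tv using wn(4) sg by (auto simp: sfun_def)
 show Ls: "slift t j sg R:scond c t j sg" using nonzero_vscale[OF wn(1), of ?a] a wn vs_tot[OF wt] tj sg unfolding scond_def L by auto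
 show "ray E (slift t j sg R) = R" unfolding L using ray_vscale[OF wt a] w(2) by simp
 have cR: "cmap (sch c t j sg) R = scoord c t j sg w" using sphere_cmap(1)[OF t w(1)] w(2) by simp
 show "cmap (tch c t) (slift t j sg R) = sins (cdim c) j sg (cmap (sch c t j sg) R)"
 proof
 fix i
 show "cmap (tch c t) (slift t j sg R) i = sins (cdim c) j sg (cmap (sch c t j sg) R) i"
 proof (cases "i < cdim c")
 case True
 thus ?thesis using vs_tot[OF wt] by (simp add: L cR sins_def scoord_def)
 next
 case False
 then obtain l where l: "i = cdim c + l" using le_Suc_ex by (metis not_less)
 have 1: "cmap (tch c t) (slift t j sg R) i = tmap t (slift t j sg R) l" using l by simp
 consider "l < j" | "l = j" | "j < l" by linarith
 thus ?thesis
 proof cases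
 case 1
 thus ?thesis using l tv by (simp add: L cR sins_def scoord_def drop_coord_def)
 next
 case 2
 thus ?thesis using 1 tj l by (simp add: sins_def)
 next
 case 3
 hence "cdim c + l - 1 = cdim c + (l - 1)" "~ l - 1 < j" "Suc (l - 1) = l" by auto
 thus ?thesis using l tv 3 by (simp add: L cR sins_def scoord_def drop_coord_def)
 qed
 qed
 qed
qed

lemma sphere_inj:
 assumes c: "c:M" and t: "t:tE" and j: "j < trank t" and sg: "sg = 1 | sg = -1"
 shows "inj_on (cmap (sch c t j sg)) (cdom (sch c t j sg))"
proof (rule inj_onI)
 fix R R' assume R: "R:cdom (sch c t j sg)" and R': "R':cdom (sch c t j sg)"
 and eq: "cmap (sch c t j sg) R = cmap (sch c t j sg) R'"
 note L = slift_props[OF t j sg R] and L' = slift_props[OF t j sg R']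
 have "cmap (tch c t) (slift t j sg R) = cmap (tch c t) (slift t j sg R')" using L(4) L'(4) eq by simp
 moreover have "slift t j sg R:cdom (tch c t)" "slift t j sg R':cdom (tch c t)" using L(1) L'(1) nz_total by (auto simp: scond_def)
 ultimately have "slift t j sg R = slift t j sg R'" using TT.inj[OF T_chart[OF c t]] by (meson inj_onD)
 thus "R = R'" using L(2) L'(2) by metis
qed

lemma continuous_on_sins: "continuous_on A (sins n j sg)"
proof (rule cont_prodI)
 fix i show "continuous_on A (%y. sins n j sg y i)" unfolding sins_def by (cases "i < n + j"; cases "i = n + j") (auto intro: cont_crd)
qed

lemma sphere_image:
 assumes c: "c:M" and t: "t:tE" and j: "j < trank t" and sg: "sg = 1 | sg = -1"
 shows "cim (sch c t j sg) = {y:Rn (cdim c + trank t - 1). sins (cdim c) j sg y:cim (tch c t)}"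
proof (intro equalityI subsetI)
 fix y assume "y:cim (sch c t j sg)"
 then obtain R where R: "R:cdom (sch c t j sg)" "y = cmap (sch c t j sg) R" by blast
 note L = slift_props[OF t j sg R(1)]
 have Lm: "slift t j sg R:cdom (tch c t)" using L(1) nz_total by (auto simp: scond_def)
 have s: "sins (cdim c) j sg y:cim (tch c t)" using L(4) Lm unfolding R(2) by (metis imageI)
 hence sR: "sins (cdim c) j sg y:Rn (cdim c + trank t)" using TT.cim_Rn[OF T_chart[OF c t]] by auto
 have "y i = 0" if "i >= cdim c + trank t - 1" for i
 proof -
 have "sins (cdim c) j sg y (Suc i) = 0" using sR that by (simp add: Rn_iff)
 thus ?thesis using that j by (auto simp: sins_def split: if_splits)
 qed
 thus "y:{y:Rn (cdim c + trank t - 1). sins (cdim c) j sg y:cim (tch c t)}" using s by (simp add: Rn_iff)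
next
 fix y assume y: "y:{y:Rn (cdim c + trank t - 1). sins (cdim c) j sg y:cim (tch c t)}"
 then obtain w where w: "w:cdom (tch c t)" "sins (cdim c) j sg y = cmap (tch c t) w" by blast
 have wt: "w:TE" "PE w:cdom c" "PE w:tdom t" using w by auto
 have tj: "tmap t w j = sg" using fun_cong[OF w(2), of "cdim c + j"] by (simp add: sins_def)
 hence "w:NE" using nonzero_iff[OF t wt(1,3)] sg by auto
 hence ws: "w:scond c t j sg" using wt tj sg by (auto simp: scond_def)
 have one: "(1 / (sg * tmap t w j)) *R tmap t w = tmap t w" using tj sg by auto
 have "scoord c t j sg w i = y i" for i
 proof (cases "i < cdim c")
 case True
 thus ?thesis using fun_cong[OF w(2), of i] by (simp add: scoord_def sins_def)
 next
 case False
 then obtain l where l: "i = cdim c + l" using le_Suc_ex by (metis not_less)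
 show ?thesis using fun_cong[OF w(2), of "cdim c + l"] fun_cong[OF w(2), of "cdim c + Suc l"] l
 unfolding scoord_def one by (auto simp: sins_def drop_coord_def)
 qed
 hence "y = cmap (sch c t j sg) (ray E w)" using sphere_cmap(1)[OF t ws] by auto
 moreover have "ray E w:cdom (sch c t j sg)" using sphere_cdom(1)[OF t] ws by blast
 ultimately show "y:cim (sch c t j sg)" by blast
qed

lemma sphere_open:
 assumes c: "c:M" and t: "t:tE" and j: "j < trank t" and sg: "sg = 1 | sg = -1"
 shows "ropen (quad (cdim c + trank t - 1) (ccor c)) (cim (sch c t j sg))"
proof -
 have cc: "ccor c <= cdim c" using atlas c by (simp add: atl_def)
 have "ropen (quad (cdim c + trank t - 1) (ccor c)) (quad (cdim c + trank t - 1) (ccor c) Int sins (cdim c) j sg -` cim (tch c t))"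
 proof (rule cont_pre[OF continuous_on_sins _ TT.cim_quad[OF T_chart[OF c t]]])
 show "sins (cdim c) j sg:quad (cdim c + trank t - 1) (ccor c) \<rightarrow> quad (cdim (tch c t)) (ccor (tch c t))"
 using cc j by (auto simp: quad_def Rn_iff sins_def)
 qed
 moreover have "quad (cdim c + trank t - 1) (ccor c) Int sins (cdim c) j sg -` cim (tch c t) = cim (sch c t j sg)"
 proof -
 have "0 <= y i" if y: "sins (cdim c) j sg y:cim (tch c t)" and i: "i < ccor c" for y i
 proof -
 have "sins (cdim c) j sg y:quad (cdim c + trank t) (ccor c)" using y op_sub[OF TT.cim_quad[OF T_chart[OF c t]]] by auto
 hence "0 <= sins (cdim c) j sg y i" using i by (simp add: quad_def)
 thus ?thesis using i cc by (simp add: sins_def)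
 qed
 thus ?thesis unfolding sphere_image[OF c t j sg] by (auto simp: quad_def)
 qed
 ultimately show ?thesis by simp
qed

lemma slift_smooth:
 assumes c: "c:M" and t: "t:tE" and j: "j < trank t" and sg: "sg = 1 | sg = -1"
 and y: "y:cim (sch c t j sg)"
 shows "smpt (cdim c + trank t - 1) (cim (sch c t j sg))
 (%y. cmap (tch c t) (slift t j sg (cinv (sch c t j sg) y)) i) y"
proof -
 have yR: "y:Rn (cdim c + trank t - 1)" using y sphere_image[OF c t j sg] by auto
 have e: "cmap (tch c t) (slift t j sg (cinv (sch c t j sg) z)) i = sins (cdim c) j sg z i"
 if "z:cim (sch c t j sg)" for z
 proof -
 obtain R where R: "R:cdom (sch c t j sg)" "z = cmap (sch c t j sg) R" using `z:cim (sch c t j sg)` by blast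
 show ?thesis using slift_props(4)[OF t j sg R(1)] inv_into_f_f[OF sphere_inj[OF c t j sg] R(1)] R(2) by simp
 qed
 have "smpt (cdim c + trank t - 1) (cim (sch c t j sg)) (%z. sins (cdim c) j sg z i) y"
 unfolding sins_def using yR by (cases "i < cdim c + j"; cases "i = cdim c + j") auto
 thus ?thesis by (rule smpt_cR[OF _ yR e])
qed

lemma scond_open: "c:M ==> t:tE ==> mopen T (scond c t j sg)"
proof -
 assume c: "c:M" and t: "t:tE"
 let ?D = "NE Int {w:TE. PE w:cdom c Int tdom t}"
 have D: "mopen T ?D" by (intro openin_Int nonzero_open proj_open cdom_open[OF c] tdom_open[OF t])
 have "mopen T {w:?D. sg * tmap t w j:{0<..}}" by (rule TT.sfn_pre[OF _ D]) (auto intro!: TT.sfn_mult sfn_tmap[OF t])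
 moreover have "{w:?D. sg * tmap t w j:{0<..}} = scond c t j sg" using nz_total by (auto simp: scond_def)
 ultimately show ?thesis by simp
qed

lemma scoord_smooth: "c:M ==> t:tE ==> w:scond c t j sg ==> sfn T w (%w. scoord c t j sg w i)"
proof -
 assume c: "c:M" and t: "t:tE" and w: "w:scond c t j sg"
 have wn: "w:TE" "PE w:tdom t" "PE w:cdom c" "0 < sg * tmap t w j" using w nz_total by (auto simp: scond_def)
 show ?thesis
 proof (cases "i < cdim c")
 case True
 thus ?thesis using TM.smap_chart(2)[OF smap_proj[OF wn(1)] c wn(3), of i] by (simp add: scoord_def)
 next
 case False
 thus ?thesis using wn unfolding scoord_def append_vec_simps(3)[OF False] drop_coord_def sfun_def real_scaleR_def
 by (intro TT.sfn_mult TT.sfn_divide TT.sfn_const sfn_tmap[OF t]) auto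
 qed
qed

lemma SS_chartE:
 assumes "e:SS"
 obtains c t j sg where "e = sch c t j sg" "c:M" "t:tE" "j < trank t" "sg = 1 | sg = -1" using assms by (auto simp: sphere_mfd_def)

lemma S_atlas: "atl SS"
proof (rule atlas_from_lifts[OF T_atlas])
 fix e assume "e:SS"
 then obtain c t j sg where e: "e = sch c t j sg" and c: "c:M" "t:tE" "j < trank t" "sg = 1 | sg = -1" by (rule SS_chartE)
 have cc: "ccor c <= cdim c" using atlas c by (simp add: atl_def)
 show "ccor e <= cdim e & inj_on (cmap e) (cdom e) & ropen (quad (cdim e) (ccor e)) (cim e)"
 unfolding e using cc c(3) sphere_inj[OF c] sphere_open[OF c] by simp
 fix d assume "d:SS"
 then obtain c' t' j' sg' where d: "d = sch c' t' j' sg'" and c': "c':M" "t':tE" "j' < trank t'" "sg' = 1 | sg' = -1" by (rule SS_chartE)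
 show "EX m:T. EX L D Ph. L ` cdom e <= cdom m &
 (ALL j. ALL y:cim e. smpt (cdim e) (cim e) (%y. cmap m (L (cinv e y)) j) y) &
 mopen T D & (ALL r:D. ALL j. sfn T r (%r. Ph r j)) &
 (ALL q:cdom e. q:cdom d <-> L q:D) & (ALL q:cdom e Int cdom d. Ph (L q) = cmap d q)"
 proof (intro bexI[of _ "tch c t"] exI[of _ "slift t j sg"] exI[of _ "scond c' t' j' sg'"] exI[of _ "scoord c' t' j' sg'"] conjI ballI allI)
 show "slift t j sg ` cdom e <= cdom (tch c t)" using slift_props(1)[OF c(2-4)] nz_total unfolding e by (fastforce simp: scond_def)
 show "smpt (cdim e) (cim e) (%y. cmap (tch c t) (slift t j sg (cinv e y)) i) y" if "y:cim e" for i y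
 using slift_smooth[OF c] that unfolding e by simp
 fix q assume q: "q:cdom e"
 have L: "slift t j sg q:NE" "ray E (slift t j sg q) = q" using slift_props(1,2)[OF c(2-4)] q unfolding e by (auto simp: scond_def)
 show qd: "q:cdom d <-> slift t j sg q:scond c' t' j' sg'" using sphere_cdom(2)[OF c'(2) L(1)] unfolding d L(2) .
 next
 fix q assume q: "q:cdom e Int cdom d"
 have L: "slift t j sg q:NE" "ray E (slift t j sg q) = q" using slift_props(1,2)[OF c(2-4)] q unfolding e by (auto simp: scond_def)
 have "slift t j sg q:scond c' t' j' sg'" using sphere_cdom(2)[OF c'(2) L(1)] q unfolding d L(2) by simp
 from sphere_cmap(1)[OF c'(2) this] show "scoord c' t' j' sg' (slift t j sg q) = cmap d q" unfolding d L(2) by simp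
 qed (use c c' T_chart scond_open scoord_smooth in auto)
qed

lemma S_carrier: "car SS = ray E ` NE"
proof (intro equalityI subsetI)
 fix R assume "R:car SS"
 then obtain e where "e:SS" "R:cdom e" by (auto simp: car_def)
 thus "R:ray E ` NE" by (auto simp: sphere_mfd_def sch_def)
next
 fix R assume "R:ray E ` NE"
 then obtain w where w: "w:NE" "R = ray E w" by blast
 obtain c t where c: "c:M" "t:tE" "PE w:cdom c" "PE w:tdom t" using chart_at[OF nz_total[OF w(1)]] by blast
 obtain j where j: "tmap t w j ~= 0" using nonzero_iff[OF c(2) nz_total[OF w(1)] c(4)] w by (auto simp: fun_eq_iff)
 hence jr: "j < trank t" using tmap_Rn[OF c(2) nz_total[OF w(1)] c(4)] by (metis Rn_iff not_less)
 define sg :: real where "sg = (if tmap t w j > 0 then 1 else -1)"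
 have "w:scond c t j sg" using w c j by (auto simp: scond_def sg_def)
 hence "R:cdom (sch c t j sg)" using sphere_cdom(1)[OF c(2)] w by blast
 moreover have "sch c t j sg:SS" using c jr by (auto simp: sphere_mfd_def sg_def)
 ultimately show "R:car SS" by (auto simp: car_def)
qed

sublocale S: atlas SS by standard (rule S_atlas)

lemma S_chart_at:
 assumes "R:car SS"
 obtains c t j sg where "c:M" "t:tE" "j < trank t" "sg = 1 | sg = -1" "R:cdom (sch c t j sg)"
 "sch c t j sg:SS"
proof -
 obtain e where e: "e:SS" "R:cdom e" using assms by (auto simp: car_def)
 show ?thesis by (rule SS_chartE[OF e(1)]) (use e that in auto)
qed

lemma smap_ray: "w:NE ==> smap T SS w (ray E)"
proof -
 assume w: "w:NE"
 hence "ray E w:car SS" by (simp add: S_carrier)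
 then obtain c t j sg where c: "c:M" "t:tE" "j < trank t" "sg = 1 | sg = -1" "ray E w:cdom (sch c t j sg)"
 "sch c t j sg:SS" by (rule S_chart_at)
 have ws: "w:scond c t j sg" using sphere_cdom(2)[OF c(2) w] c(5) by simp
 show ?thesis
 proof (rule smap_intoI[OF scond_open[OF c(1,2), of j sg] ws c(6)])
 show "ray E ` scond c t j sg <= cdom (sch c t j sg)" using sphere_cdom(1)[OF c(2)] by blast
 show "sfn T w (%q. cmap (sch c t j sg) (ray E q) i)" for i
 by (rule TT.sfn_cong[OF scoord_smooth[OF c(1,2) ws] scond_open[OF c(1,2)] ws]) (use sphere_cmap(1)[OF c(2)] in auto)
 qed
qed

lemma smaps_ray: "smaps T SS (NE) (ray E)" unfolding smaps_def using nonzero_open smap_ray by blast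

lemma smap_slift:
 assumes "c:M" "t:tE" "j < trank t" "sg = 1 | sg = -1" "R:cdom (sch c t j sg)" "sch c t j sg:SS"
 shows "smap SS T R (slift t j sg)"
proof (rule smap_lift[OF S_atlas assms(6,5) T_chart[OF assms(1,2)]])
 show "slift t j sg ` cdom (sch c t j sg) <= cdom (tch c t)" using slift_props(1)[OF assms(2-4)] nz_total by (fastforce simp: scond_def)
 show "smpt (cdim (sch c t j sg)) (cim (sch c t j sg))
 (%y. cmap (tch c t) (slift t j sg (cinv (sch c t j sg) y)) i) (cmap (sch c t j sg) R)" for i
 using slift_smooth[OF assms(1-4)] assms(5) by simp
qed

lemma S_bmfd: "bmfd SS" by standard (auto simp: sphere_mfd_def dest: ccor1)

end

locale vmet = vbun M E for M :: "'a chart set" and E :: "('a, 'w) vbundle" +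
 fixes g :: "'w => real"
 assumes g_smooth: "!!w. w:TE ==> sfn (total_mfd M E) w g"
 and g_scale: "!!w a. w:TE ==> g (vE a w) = a ^ 2 * g w"
 and g_pos: "!!w. w:NE ==> g w > 0"
begin

lemma g_zero: "w:TE ==> w ~: NE ==> g w = 0" using g_scale[of w 0] by (simp add: nonzero_def)

lemma g_nonneg: "w:TE ==> g w >= 0" using g_zero g_pos by (cases "w:NE") (auto intro: less_imp_le)

lemma nonzero_g: "w:TE ==> w:NE <-> g w > 0" using g_zero[of w] g_pos[of w] by (metis less_irrefl)

definition sig :: "'w set => 'w" where
 "sig R = vE (1 / sqrt (g (ray_rep R))) (ray_rep R)"

lemma sig_ray: "w:NE ==> sig (ray E w) = vE (1 / sqrt (g w)) w"
proof -
 assume w: "w:NE"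
 have wt: "w:TE" using nz_total[OF w] .
 obtain a where a: "a > 0" "ray_rep (ray E w) = vE a w" using ray_rep[OF wt] by blast
 have "sqrt (g (vE a w)) = a * sqrt (g w)" using a g_scale[OF wt] by (simp add: real_sqrt_mult)
 thus ?thesis using a by (simp add: sig_def vs_vs[OF wt])
qed

lemma sig_props:
 assumes "R:car SS"
 shows "sig R:NE" "g (sig R) = 1" "ray E (sig R) = R" "PE (sig R) = sphere_proj E R"
proof -
 obtain w where w: "w:NE" "R = ray E w" using assms S_carrier by blast
 have wt: "w:TE" using nz_total[OF w(1)] .
 have gw: "g w > 0" using g_pos[OF w(1)] .
 have s: "sig R = vE (1 / sqrt (g w)) w" using sig_ray[OF w(1)] w(2) by simp
 show "sig R:NE" unfolding s using nonzero_vscale[OF w(1)] gw by simp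
 show "g (sig R) = 1" unfolding s g_scale[OF wt] using gw by (simp add: power_divide)
 show "ray E (sig R) = R" unfolding s using ray_vscale[OF wt, of "1 / sqrt (g w)"] gw w(2) by simp
 show "PE (sig R) = sphere_proj E R" unfolding s using vs_tot[OF wt] sphere_proj_ray[OF wt] w(2) by simp
qed

lemma smap_sig: "R:car SS ==> smap SS T R sig"
proof -
 assume R: "R:car SS"
 obtain c t j sg where c: "c:M" "t:tE" "j < trank t" "sg = 1 | sg = -1" "R:cdom (sch c t j sg)"
 "sch c t j sg:SS" using R by (rule S_chart_at)
 let ?L = "slift t j sg"
 interpret ST: atlas2 SS T ..
 have L: "smap SS T R ?L" by (rule smap_slift[OF c])
 have Ln: "?L q:NE" "ray E (?L q) = q" if "q:cdom (sch c t j sg)" for q using slift_props(1,2)[OF c(2-4) that] by (auto simp: scond_def)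
 have gL: "sfn SS R (%q. g (?L q))" by (rule ST.sfn_compose[OF L g_smooth[OF nz_total[OF Ln(1)[OF c(5)]]]])
 have "smap SS T R (%q. vE (1 / sqrt (g (?L q))) (?L q))"
 using g_pos[OF Ln(1)[OF c(5)]] by (intro smap_vscale[OF S_atlas L] S.sfn_divide S.sfn_const S.sfn_sqrt gL) auto
 thus ?thesis by (rule ST.smap_cong[OF _ S.cdom_open[OF c(6)] c(5)]) (use sig_ray Ln in metis)
qed

lemma smaps_sphere_proj: "smaps SS M (car SS) (sphere_proj E)"
proof -
 interpret SM: atlas2 SS M ..
 have "smap SS M R (sphere_proj E)" if R: "R:car SS" for R
 proof -
 have "smap SS M R (%q. PE (sig q))"
 by (rule smap_compose[OF S_atlas T_atlas atlas smap_sig[OF R] smap_proj[OF nz_total[OF sig_props(1)[OF R]]]])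
 thus ?thesis by (rule SM.smap_cong[OF _ S.open_car R]) (use sig_props in auto)
 qed
 thus ?thesis unfolding smaps_def using S.open_car by blast
qed

end

section \<open>Bump functions, fibre metrics and pushing towards the boundary\<close>

lemma compact_quad_box: "compact {y:quad n m. ALL i<n. \<bar>y i - x i\<bar> <= r}"
proof -
 let ?A = "%i. if i < n then (if i < m then {x i - r..x i + r} Int {0..} else {x i - r..x i + r}) else {0::real}"
 have "compactin (product_topology (%i. euclidean) UNIV) (PiE UNIV ?A)"
 unfolding compactin_PiE by (auto simp: cpt_iff intro!: compact_Int_closed)
 hence c: "compact (PiE UNIV ?A Int {y. ALL i<m. 0 <= y i})"
 proof (intro compact_Int_closed)
 have "{y::rvec. ALL i<m. 0 <= y i} = (\<Inter>i\<in>{..<m}. {y. 0 <= y i})" by auto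
 moreover have "closed {y::rvec. 0 <= y i}" for i by (rule closed_Collect_le) (auto intro: cont_crd)
 ultimately show "closed {y::rvec. ALL i<m. 0 <= y i}" by auto
 qed (simp only: cpt_iff euclidean_product_topology)
 have "{y:quad n m. ALL i<n. \<bar>y i - x i\<bar> <= r} = PiE UNIV ?A Int {y. ALL i<m. 0 <= y i}"
 proof (intro set_eqI iffI)
 fix y assume y: "y:{y:quad n m. ALL i<n. \<bar>y i - x i\<bar> <= r}"
 have "y i:?A i" for i using y by (auto simp: quad_def Rn_iff abs_le_iff dest!: spec[of _ i])
 thus "y:PiE UNIV ?A Int {y. ALL i<m. 0 <= y i}" using y by (auto simp: quad_def)
 next
 fix y assume y: "y:PiE UNIV ?A Int {y. ALL i<m. 0 <= y i}"
 hence "y i:?A i" for i by blast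
 hence "i < n ==> \<bar>y i - x i\<bar> <= r" "n <= i ==> y i = 0" for i
 by (force simp: abs_le_iff split: if_splits dest!: meta_spec[of _ i])+
 thus "y:{y:quad n m. ALL i<n. \<bar>y i - x i\<bar> <= r}" using y by (auto simp: quad_def Rn_iff)
 qed
 thus ?thesis using c by simp
qed

lemma (in atlas) cinv_continuous: "c:M ==> continuous_map (tos (cim c)) (mtop M) (cinv c)" unfolding continuous_map_def
proof (intro conjI allI impI)
 assume c: "c:M"
 thus "cinv c:topspace (tos (cim c)) \<rightarrow> topspace (mtop M)" by (auto simp: tsp car_def)
 fix U assume "mopen M U"
 moreover have "{x:topspace (tos (cim c)). cinv c x:U} = cmap c ` (U Int cdom c)" using c by auto
 ultimately show "ropen (cim c) {x:topspace (tos (cim c)). cinv c x:U}" using open_chart[OF _ c] by simp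
qed

locale hmfd = bmfd M for M :: "'a chart set" +
 assumes hausdorff: "Hausdorff_space (mtop M)" and compact: "compact_space (mtop M)"
begin

lemma chart_box:
 assumes V: "mopen M V" "p:V" and c: "c:M" "p:cdom c"
 obtains dl where "dl > 0" "cube (cdim c) (cmap c p) dl Int quad (cdim c) (ccor c) <= cmap c ` (V Int cdom c)"
proof -
 have "ropen (quad (cdim c) (ccor c)) (cmap c ` (V Int cdom c))" by (rule openin_trans[OF open_chart[OF V(1) c(1)] cim_quad[OF c(1)]])
 from openin_cubeD[OF this _, of "cdim c" "cmap c p"] show ?thesis using that V(2) c(2) by (auto simp: quad_def)
qed

lemma bump:
 assumes V: "mopen M V" "p:V"
 obtains b Q K where "!!q. q:car M ==> sfn M q b" "!!q. 0 <= b q" "!!q. b q <= 1" "mopen M Q" "p:Q"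
 "!!q. q:Q ==> b q = 1" "compactin (mtop M) K" "closedin (mtop M) K" "K <= V" "Q <= K" "!!q. b q ~= 0 ==> q:K"
proof -
 obtain c where c: "c:M" "p:cdom c" using opn_car[OF V(1)] V(2) by (auto simp: car_def)
 obtain dl where d: "dl > 0" "cube (cdim c) (cmap c p) dl Int quad (cdim c) (ccor c) <= cmap c ` (V Int cdom c)"
 by (rule chart_box[OF V c])
 let ?n = "cdim c" and ?x = "cmap c p"
 define C where "C = {y:quad ?n (ccor c). ALL i<?n. \<bar>y i - ?x i\<bar> <= dl / 2}"
 define s where "s q = (\<Sum>i<?n. (cmap c q i - ?x i)^2)" for q
 define b where "b q = (if q:cdom c then step (2 - 8 / dl^2 * s q) else 0)" for q
 define K where "K = cinv c ` C"
 define Q where "Q = {q:cdom c. s q:{..<dl^2 / 8}}"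
 have s_smooth: "sfn M q s" if "q:cdom c" for q unfolding s_def by (intro sfn_sum sfn_power sfn_diff sfn_const sfn_coord[OF c(1) that])
 have s_ge: "\<bar>cmap c q i - ?x i\<bar>^2 <= s q" if "i < ?n" for q i
 unfolding s_def power2_abs using that by (intro member_le_sum) auto
 have CV: "C <= cmap c ` (V Int cdom c)" using d by (intro subset_trans[OF _ d(2)]) (force simp: C_def cube_def quad_def)
 have qK: "q:K" if q: "q:cdom c" "s q <= dl^2 / 4" for q
 proof -
 have "\<bar>cmap c q i - ?x i\<bar> <= dl / 2" if i: "i < ?n" for i
 by (rule power2_le_imp_le) (use s_ge[OF i, of q] q(2) d(1) in "auto simp: power_divide")
 moreover have "cmap c q:quad ?n (ccor c)" using op_sub[OF cim_quad[OF c(1)]] q(1) by blast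
 ultimately have "cmap c q:C" by (simp add: C_def)
 thus ?thesis unfolding K_def using cinv_cmap[OF c(1) q(1)] by force
 qed
 have Kc: "compactin (mtop M) K" unfolding K_def
 proof (rule image_compactin)
 show "compactin (tos (cim c)) C" using CV compact_quad_box[of ?n "ccor c" ?x "dl / 2"]
 unfolding C_def[symmetric] compactin_subtopology cpt_iff by auto
 qed (rule cinv_continuous[OF c(1)])
 have Kcl: "closedin (mtop M) K" by (rule compactin_imp_closedin[OF hausdorff Kc])
 have KV: "K <= V" "K <= cdom c" unfolding K_def using CV c(1) by (auto dest!: subsetD)
 have bK: "q:K" if "b q ~= 0" for q
 proof (rule qK)
 show q: "q:cdom c" using that by (auto simp: b_def split: if_splits)
 have "step (2 - 8 / dl^2 * s q) ~= 0" using that q by (simp add: b_def)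
 hence "8 / dl^2 * s q < 2" using step_props(1)[of "2 - 8 / dl^2 * s q"] by force
 thus "s q <= dl^2 / 4" using d(1) by (simp add: field_simps)
 qed
 show ?thesis
 proof (rule that)
 fix q assume q: "q:car M"
 show "sfn M q b"
 proof (cases "q:cdom c")
 case True
 have "sfn M q (%q. step (2 - 8 / dl^2 * s q))" by (intro sfn_step sfn_diff sfn_mult sfn_const s_smooth True)
 thus ?thesis by (rule sfn_cong[OF _ cdom_open[OF c(1)] True]) (simp add: b_def)
 next
 case False
 show ?thesis by (rule sfn_cong[OF sfn_const[of q 0] openin_diff[OF open_car Kcl]]) (use False KV q bK in auto)
 qed
 next
 show "mopen M Q" unfolding Q_def by (rule sfn_pre[OF s_smooth cdom_open[OF c(1)]]) auto
 show "p:Q" using c d by (simp add: Q_def s_def)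
 show "b q = 1" if "q:Q" for q
 proof -
 have "8 / dl^2 * s q <= 1" using that d(1) by (simp add: Q_def field_simps)
 thus ?thesis using that step_props(2)[of "2 - 8 / dl^2 * s q"] by (simp add: b_def Q_def)
 qed
 show "Q <= K"
 proof
 fix q assume "q:Q"
 thus "q:K" using qK[of q] zero_le_power2[of dl] unfolding Q_def by simp
 qed
 qed (use bK KV Kc Kcl step_props in "auto simp: b_def")
qed

lemma closed_bdry: "closedin (mtop M) (bdry M)" using interior_open bdry_car by (auto simp: closedin_def tsp)

lemma finite_subcover:
 assumes "closedin (mtop M) A" "!!p. p:A ==> mopen M (Q p) & p:Q p"
 obtains P where "finite P" "P <= A" "A <= (\<Union>p\<in>P. Q p)"
proof -
 have "compactin (mtop M) A" using closedin_compact_space[OF compact assms(1)] .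
 hence "EX FF. finite FF & FF <= Q ` A & A <= \<Union>FF" by (elim compactinD) (use assms in auto)
 thus ?thesis using that by (metis finite_subset_image)
qed

lemma bdry_cutoff:
 assumes N: "mopen M N" "bdry M <= N"
 obtains h K where "!!q. q:car M ==> sfn M q h" "!!q. q:bdry M ==> h q = 1" "closedin (mtop M) K" "K <= N"
 "!!q. h q ~= 0 ==> q:K"
proof -
 define R where "R p b K Q <-> (ALL q:car M. sfn M q b) & mopen M Q & p:Q & (ALL q:Q. b q = 1) &
 closedin (mtop M) K & K <= N & (ALL q. b q ~= 0 --> q:K)" for p b K Q
 have "EX b K Q. R p b K Q" if p: "p:bdry M" for p
 unfolding R_def by (rule bump[OF N(1) subsetD[OF N(2) p]]) (intro exI conjI ballI allI impI; assumption)
 then obtain b K Q where "!!p. p:bdry M ==> R p (b p) (K p) (Q p)" by metis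
 hence b: "!!p q. p:bdry M ==> q:car M ==> sfn M q (b p)"
 and Q: "!!p. p:bdry M ==> mopen M (Q p) & p:Q p" "!!p q. p:bdry M ==> q:Q p ==> b p q = 1"
 and K: "!!p. p:bdry M ==> closedin (mtop M) (K p) & K p <= N"
 and bK: "!!p q. p:bdry M ==> b p q ~= 0 ==> q:K p" unfolding R_def by blast+
 obtain P where P: "finite P" "P <= bdry M" "bdry M <= (\<Union>p\<in>P. Q p)" by (rule finite_subcover[OF closed_bdry Q(1)])
 define h where "h q = 1 - (\<Prod>p\<in>P. 1 - b p q)" for q
 have "sfn M q (%q. \<Prod>p\<in>P'. 1 - b p q)" if q: "q:car M" and P': "P' <= bdry M" "finite P'" for q P'
 using P'(2,1) by (induction) (auto intro!: sfn_mult sfn_diff b q)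
 hence "sfn M q h" if "q:car M" for q unfolding h_def using that P by (intro sfn_diff) auto
 moreover have "h q = 1" if q: "q:bdry M" for q
 proof -
 obtain p where "p:P" "q:Q p" using P(3) q by blast
 thus ?thesis using Q(2)[of p q] P(1,2) by (auto simp: h_def prod_zero_iff)
 qed
 moreover have "q:\<Union>(K ` P)" if "h q ~= 0" for q
 proof (rule ccontr)
 assume "q ~: \<Union>(K ` P)"
 hence "1 - b p q = 1" if "p:P" for p using that bK[of p q] P(2) by auto
 thus False using that by (simp add: h_def)
 qed
 moreover have "closedin (mtop M) (\<Union>(K ` P))" using K P by (intro closedin_Union) auto
 moreover have "\<Union>(K ` P) <= N" using K P by blast
 ultimately show ?thesis using that[of h] by blast
qed

end

locale hvbun = hmfd M + vbun M E for M :: "'a chart set" and E :: "('a, 'w) vbundle"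
begin

lemma metric_exists:
 obtains g where "vmet M E g"
 "!!p. p:car M ==> EX c:M. EX t:tE. EX K Q. mopen M Q & p:Q & compactin (mtop M) K & Q <= K &
 K <= cdom c Int tdom t & (ALL w:TE. PE w:Q --> (\<Sum>i<trank t. (tmap t w i)^2) <= g w)"
proof -
 define R where "R p t c b K Q <-> t:tE & c:M & (ALL q:car M. sfn M q b) & (ALL q. 0 <= b q) & mopen M Q & p:Q & (ALL q:Q. b q = 1) &
 compactin (mtop M) K & closedin (mtop M) K & K <= cdom c Int tdom t & Q <= K & (ALL q. b q ~= 0 --> q:K)" for p t c b K Q
 have "EX t c b K Q. R p t c b K Q" if p: "p:car M" for p
 proof -
 obtain t where t: "t:tE" "p:tdom t" using triv_ex[OF p] by blast
 obtain c where c: "c:M" "p:cdom c" using p by (auto simp: car_def)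
 show ?thesis by (rule bump[OF openin_Int[OF cdom_open[OF c(1)] tdom_open[OF t(1)]] IntI[OF c(2) t(2)]])
 (unfold R_def, intro exI conjI ballI allI impI, (rule t c | assumption)+)
 qed
 then obtain t c b K Q where "!!p. p:car M ==> R p (t p) (c p) (b p) (K p) (Q p)" by metis
 note R = this[unfolded R_def]
 have t: "t p:tE" and c: "c p:M" and b2: "0 <= b p q" and Q1: "mopen M (Q p) & p:Q p"
 and K: "compactin (mtop M) (K p) & closedin (mtop M) (K p) & K p <= cdom (c p) Int tdom (t p) & Q p <= K p"
 if "p:car M" for p q using R[OF that] by - (elim conjE; (intro conjI)?; (elim spec | assumption))+
 have b1: "sfn M q (b p)" if "p:car M" "q:car M" for p q using R[OF that(1)] that(2) by (elim conjE) (rule bspec)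
 have Q2: "b p q = 1" if "p:car M" "q:Q p" for p q using R[OF that(1)] that(2) by (elim conjE) (rule bspec)
 have bK: "q:K p" if "p:car M" "b p q ~= 0" for p q using R[OF that(1)] that(2) by (elim conjE) (erule allE, erule mp)
 obtain P where P: "finite P" "P <= car M" "car M <= (\<Union>p\<in>P. Q p)"
 by (rule finite_subcover[of "car M", OF _ Q1]) (use closedin_topspace[of "mtop M", unfolded tsp] in assumption)
 define h where "h p w = b p (PE w) * (\<Sum>i<trank (t p). (tmap (t p) w i)^2)" for p w
 define g where "g w = (\<Sum>p\<in>P. h p w)" for w
 have h0: "0 <= h p w" if "p:P" for p w using that P b2 by (auto simp: h_def intro!: mult_nonneg_nonneg sum_nonneg)
 have hs: "sfn T w (h p)" if w: "w:TE" and p: "p:P" for w p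
 proof (cases "PE w:tdom (t p)")
 case True
 thus ?thesis using p P w unfolding h_def
 by (intro TT.sfn_mult TT.sfn_sum TT.sfn_power sfn_tmap TM.sfn_compose[OF smap_proj] b1 t) (auto simp: proj_car)
 next
 case False
 have "mopen T {w:TE. PE w:car M - K p}" by (rule proj_open[OF openin_diff[OF open_car]]) (use K p P in auto)
 thus ?thesis
 proof (rule TT.sfn_cong[OF TT.sfn_const[of w 0]])
 have "p:car M" using p P by blast
 thus "w:{w:TE. PE w:car M - K p}" using K[of p] False w proj_car[OF w] by blast
 show "0 = h p v" if "v:{w:TE. PE w:car M - K p}" for v using that bK[OF `p:car M`, of "PE v"] unfolding h_def by fastforce
 qed
 qed
 have gQ: "(\<Sum>i<trank (t p). (tmap (t p) w i)^2) <= g w" if "p:P" "PE w:Q p" for p w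
 proof -
 have "h p w <= g w" unfolding g_def using P(1) that(1) h0 by (intro member_le_sum) auto
 thus ?thesis using Q2[of p "PE w"] that P by (auto simp: h_def)
 qed
 have "vmet M E g"
 proof standard
 show "sfn (total_mfd M E) w g" if "w:TE" for w unfolding g_def using hs[OF that] by (rule TT.sfn_sum)
 next
 fix w a assume w: "w:TE"
 have "h p (vE a w) = a^2 * h p w" if p: "p:P" for p
 proof (cases "b p (PE w) = 0")
 case True
 thus ?thesis using vs_tot[OF w] by (simp add: h_def)
 next
 case False
 hence "PE w:tdom (t p)" using bK[OF subsetD[OF P(2) p]] K[OF subsetD[OF P(2) p]] by blast
 hence "tmap (t p) (vE a w) = a *R tmap (t p) w" using p P t w by (intro tmap_vscale) auto
 thus ?thesis using vs_tot[OF w] by (simp add: h_def sfun_def power_mult_distrib sum_distrib_left algebra_simps)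
 qed
 thus "g (vE a w) = a^2 * g w" by (simp add: g_def sum_distrib_left)
 next
 fix w assume w: "w:NE"
 have wt: "w:TE" by (rule nz_total[OF w])
 obtain p where p: "p:P" "PE w:Q p" using P(3) proj_car[OF wt] by blast
 hence pt: "t p:tE" "PE w:tdom (t p)" using t[OF subsetD[OF P(2) p(1)]] K[OF subsetD[OF P(2) p(1)]] by auto
 obtain i where i: "tmap (t p) w i ~= 0" using nonzero_iff[OF pt(1) wt pt(2)] w by (auto simp: fun_eq_iff)
 moreover have "i < trank (t p)" using tmap_Rn[OF pt(1) wt pt(2)] i by (metis Rn_iff not_less)
 ultimately have "0 < (\<Sum>i<trank (t p). (tmap (t p) w i)^2)" by (intro sum_pos2[of _ i]) auto
 thus "0 < g w" using gQ[OF p] by linarith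
 qed
 thus ?thesis
 proof (rule that)
 fix q assume "q:car M"
 then obtain p where p: "p:P" "q:Q p" using P(3) by blast
 thus "EX c:M. EX t:tE. EX K Q. mopen M Q & q:Q & compactin (mtop M) K & Q <= K &
 K <= cdom c Int tdom t & (ALL w:TE. PE w:Q --> (\<Sum>i<trank t. (tmap t w i)^2) <= g w)"
 using c[OF subsetD[OF P(2) p(1)]] t[OF subsetD[OF P(2) p(1)]] K[OF subsetD[OF P(2) p(1)]] Q1[OF subsetD[OF P(2) p(1)]] gQ[OF p(1)]
 by (intro bexI[of _ "c p"] bexI[of _ "t p"] exI[of _ "K p"] exI[of _ "Q p"] conjI ballI impI) simp_all
 qed
qed

definition push :: "('w \<times> real => 'w) => bool" where
 "push F <-> (ALL w:TE. ALL s. smap (lmfd T) T (w, s) F & F (w, 0) = w & (PE w:bdry M --> F (w, s) = w) &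
 (ALL a. F (vE a w, s) = vE a (F (w, s))) & (w:NE --> F (w, s):NE) &
 (ALL v:TE. PE v = PE w --> PE (F (v, s)) = PE (F (w, s))))"

lemma push_total: "push F ==> w:TE ==> F (w, s):TE"
proof -
 interpret LT: atlas2 "lmfd T" T by standard (rule TT.latlas)
 show "push F ==> w:TE ==> F (w, s):TE" using LT.smap_car T_car unfolding push_def by metis
qed

lemma pushD:
 assumes "push F" "w:TE"
 shows "smap (lmfd T) T (w, s) F" "F (w, 0) = w" "PE w:bdry M ==> F (w, s) = w" "F (vE a w, s) = vE a (F (w, s))"
 "w:NE ==> F (w, s):NE" "v:TE ==> PE v = PE w ==> PE (F (v, s)) = PE (F (w, s))"
proof -
 note * = bspec[OF assms(1)[unfolded push_def] assms(2)]
 show "smap (lmfd T) T (w, s) F" "F (w, 0) = w" "PE w:bdry M ==> F (w, s) = w" "F (vE a w, s) = vE a (F (w, s))"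
 "w:NE ==> F (w, s):NE" using spec[OF *, of s] by - (elim conjE; (elim spec | (erule mp, assumption) | assumption))+
 show "v:TE ==> PE v = PE w ==> PE (F (v, s)) = PE (F (w, s))" using spec[OF *, of s] by (elim conjE) (drule (1) bspec, erule (1) mp)
qed

lemma push_compose:
 assumes F: "push F" and G: "push G"
 shows "push (%(w, s). F (G (w, s), s))" unfolding push_def
proof (intro ballI allI conjI impI, goal_cases)
 case (1 w s)
 interpret L: atlas "lmfd T" by standard (rule TT.latlas)
 have "smap (lmfd T) (lmfd T) (w, s) (%q. (G q, snd q))"
 by (rule smap_into_line[OF L.atlas T_atlas _ TT.sfn_line_snd]) (rule pushD(1)[OF G 1])
 moreover have "smap (lmfd T) T (G (w, s), snd (w, s)) F" using pushD(1)[OF F push_total[OF G 1]] by simp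
 ultimately have "smap (lmfd T) T (w, s) (%q. F (G q, snd q))" by (rule smap_compose[OF L.atlas L.atlas T_atlas])
 thus ?case by (simp add: case_prod_beta')
next
 case (2 w s) thus ?case using pushD(2)[OF F 2] pushD(2)[OF G 2] by simp
next
 case (3 w s) thus ?case using pushD(3)[OF F 3] pushD(3)[OF G 3] by simp
next
 case (4 w s a) thus ?case using pushD(4)[OF G 4] pushD(4)[OF F push_total[OF G 4]] by simp
next
 case (5 w s) thus ?case using pushD(5)[OF F push_total[OF G 5(1)]] pushD(5)[OF G 5] by simp
next
 case (6 w s v) show ?case using pushD(6)[OF F push_total[OF G 6(1)] push_total[OF G 6(2)] pushD(6)[OF G 6]] by (simp only: prod.case)
qed

lemma push_local:
 assumes p: "p:bdry M"
 obtains F Q where "push F" "mopen M Q" "p:Q" "!!w. w:TE ==> PE w:Q ==> PE (F (w, pi / 2)):bdry M"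
proof -
 have pM: "p:car M" using bdry_car p by blast
 obtain t where t: "t:tE" "p:tdom t" using triv_ex[OF pM] by blast
 obtain c where c: "c:M" "p:cdom c" using pM by (auto simp: car_def)
 have cb: "ccor c = 1" "cmap c p 0 = 0" using bdry_chart[OF p c] by auto
 have n0: "0 < cdim c" using atlas c(1) cb by (force simp: atl_def)
 obtain dl where d: "dl > 0" "cube (cdim c) (cmap c p) dl Int quad (cdim c) (ccor c) <= cmap c ` (tdom t Int cdom c)"
 by (rule chart_box[OF tdom_open[OF t(1)] t(2) c])
 let ?B = "cube (cdim c) (cmap c p) dl Int quad (cdim c) (ccor c)" and ?e = "tch c t"
 define V where "V = {q:cdom c. cmap c q:?B}"
 have BR: "?B = {y:quad (cdim c) (ccor c). ALL i<cdim c. \<bar>y i - cmap c p i\<bar> < dl}" by (auto simp: cube_def quad_def)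
 have "V = {q:cdom c. cmap c q:cim c Int {y. ALL i<cdim c. \<bar>y i - cmap c p i\<bar> < dl}}"
 unfolding V_def BR using op_sub[OF cim_quad[OF c(1)]] by auto
 hence Vo: "mopen M V" using chart_openI[OF c(1) openin_open_Int[OF open_box]] by simp
 have VB: "cmap c ` V = ?B" unfolding V_def using d(2) by blast
 have Vt: "V <= tdom t"
 proof
 fix q assume "q:V"
 hence q: "q:cdom c" and "cmap c q:cmap c ` (tdom t Int cdom c)" using subsetD[OF d(2)] by (simp_all add: V_def)
 then obtain q' where "q':tdom t Int cdom c" "cmap c q' = cmap c q" by (elim imageE) simp
 thus "q:tdom t" using inj_onD[OF inj[OF c(1)], of q' q] q by auto
 qed
 have pV: "p:V" using c d op_sub[OF cim_quad[OF c(1)]] unfolding V_def BR by auto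
 obtain b K Q where b: "!!q. q:car M ==> sfn M q b" "!!q. 0 <= b q" "!!q. b q <= 1" and Q: "mopen M Q" "p:Q"
 "!!q. q:Q ==> b q = 1" and K: "compactin (mtop M) K" "closedin (mtop M) K" "K <= V" "Q <= K" "!!q. b q ~= 0 ==> q:K"
 proof (rule bump[OF Vo pV], goal_cases)
 case (1 b Q K) show ?case by (rule 1(1)[OF 1(2-)])
 qed
 define m where "m q s = 1 - (sin s)^2 * b q" for q s
 have m01: "0 <= m q s" "m q s <= 1" for q s
 proof -
 have "(sin s)^2 * b q <= 1 * 1" using b(2,3) sin_squared_eq[of s] by (intro mult_mono) auto
 thus "0 <= m q s" by (simp add: m_def)
 show "m q s <= 1" using b(2)[of q] by (simp add: m_def)
 qed
 define F where "F = (%(w, s). if w:TE & PE w:V then cinv ?e ((cmap ?e w)(0 := m (PE w) s * cmap ?e w 0)) else w)"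
 have F_V: "F (w, s):TE & PE (F (w, s)):V & tmap t (F (w, s)) = tmap t w &
 cmap c (PE (F (w, s))) = (cmap c (PE w))(0 := m (PE w) s * cmap c (PE w) 0)"
 if w: "w:TE" "PE w:V" for w s
 proof -
 let ?y = "(cmap c (PE w))(0 := m (PE w) s * cmap c (PE w) 0)"
 have z: "cmap c (PE w):?B" using w(2) by (simp add: V_def)
 hence z0: "0 <= cmap c (PE w) 0" "cmap c (PE w) 0 < dl" using cb n0 by (auto simp: quad_def cube_def)
 have "m (PE w) s * cmap c (PE w) 0 <= cmap c (PE w) 0" using m01 z0 by (simp add: mult_left_le_one_le)
 hence "?y:?B" using z z0 m01 n0 cb unfolding BR by (auto simp: quad_def Rn_iff)
 then obtain q where q: "q:V" "cmap c q = ?y" using VB by (metis imageE)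
 have wt: "PE w:tdom t" "PE w:cdom c" using w Vt by (auto simp: V_def)
 obtain w' where w': "w':TE" "PE w' = q" "tmap t w' = tmap t w" using tmap_surj[OF t(1) _ tmap_Rn[OF t(1) w(1) wt(1)]] q Vt by blast
 have "cmap ?e w' = (cmap ?e w)(0 := m (PE w) s * cmap ?e w 0)" using w' q n0 by (auto simp: append_vec_def)
 moreover have "w':cdom ?e" using w' q Vt by (auto simp: V_def)
 ultimately have "F (w, s) = w'" using TT.cinv_cmap[OF T_chart[OF c(1) t(1)], of w'] w by (simp add: F_def)
 thus ?thesis using w' q by simp
 qed
 have F_out: "F (w, s) = w" if "PE w ~: V | m (PE w) s * cmap c (PE w) 0 = cmap c (PE w) 0" "w:TE" for w s
 proof (cases "PE w:V")
 case True
 have cV: "V <= cdom c" by (auto simp: V_def)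
 note f = F_V[OF that(2) True, of s]
 have "cmap c (PE (F (w, s))) = cmap c (PE w)" using f that True by (simp add: fun_upd_idem)
 hence "PE (F (w, s)) = PE w" using inj_onD[OF inj[OF c(1)]] f True cV by blast
 thus ?thesis using tmap_inj[OF t(1), of "F (w, s)" w] f that(2) Vt by auto
 qed (simp add: F_def)
 interpret L: atlas "lmfd T" by standard (rule TT.latlas)
 interpret LM: atlas2 "lmfd T" M ..
 interpret LT: atlas2 "lmfd T" T ..
 have VT: "mopen (lmfd T) ({w:TE. PE w:V} \<times> UNIV)" by (rule TT.line_openI[OF proj_open[OF Vo]])
 have F_smap: "smap (lmfd T) T (w, s) F" if w: "w:TE" for w s
 proof (cases "PE w:V")
 case True
 have wL: "(w, s):{w:TE. PE w:V} \<times> UNIV" using w True by simp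
 have pr: "smap (lmfd T) M (w, s) (%q. PE (fst q))"
 by (rule smap_compose[OF L.atlas T_atlas atlas TT.smap_line_fst]) (use w T_car smap_proj in auto)
 have cV: "PE w:cdom c" using True by (simp add: V_def)
 have mm: "sfn (lmfd T) (w, s) (%q. m (PE (fst q)) (snd q))" unfolding m_def
 by (intro L.sfn_diff L.sfn_const L.sfn_mult L.sfn_power L.sfn_sin TT.sfn_line_snd LM.sfn_compose[OF pr])
 (use b(1) proj_car[OF w] in simp)
 show ?thesis
 proof (rule smap_intoT[OF L.atlas VT wL _ _ t(1)])
 show "smap (lmfd T) M (w, s) (%q. PE (F q))"
 proof (rule smap_intoI[OF VT wL c(1)])
 show "(%q. PE (F q)) ` ({w:TE. PE w:V} \<times> UNIV) <= cdom c" using F_V by (auto simp: V_def)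
 fix j
 have "sfn (lmfd T) (w, s) (%q. if j = 0 then m (PE (fst q)) (snd q) * cmap c (PE (fst q)) 0 else cmap c (PE (fst q)) j)"
 using LM.smap_chart(2)[OF pr c(1)] cV mm by (cases "j = 0") (auto intro!: L.sfn_mult)
 thus "sfn (lmfd T) (w, s) (%q. cmap c (PE (F q)) j)" by (rule L.sfn_cong[OF _ VT wL]) (use F_V in auto)
 qed
 show "sfn (lmfd T) (w, s) (%q. tmap t (F q) i)" for i
 by (rule L.sfn_cong[OF TT.sfn_line_fst[OF sfn_tmap[OF t(1) w, of i]] VT wL]) (use F_V True Vt in auto)
 show "F q:TE" if "q:{w:TE. PE w:V} \<times> UNIV" for q using F_V that by auto
 show "PE (F (w, s)):tdom t" using F_V[OF w True] Vt by blast
 qed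
 next
 case False
 have O: "mopen (lmfd T) ({w:TE. PE w:car M - K} \<times> UNIV)" by (rule TT.line_openI[OF proj_open[OF openin_diff[OF open_car K(2)]]])
 show ?thesis
 proof (rule LT.smap_cong[OF TT.smap_line_fst O])
 fix q :: "'w \<times> real" assume q: "q:{w:TE. PE w:car M - K} \<times> UNIV"
 hence "b (PE (fst q)) = 0" using K(5)[of "PE (fst q)"] by force
 thus "fst q = F q" using F_out[of "fst q" "snd q"] q by (auto simp: m_def)
 qed (use w False K(3) proj_car T_car in auto)
 qed
 have "push F" unfolding push_def
 proof (intro ballI allI conjI impI, goal_cases)
 case (1 w s) thus ?case by (rule F_smap)
 next
 case (2 w s) thus ?case using F_out[of w 0] by (simp add: m_def)
 next
 case (3 w s)
 hence "PE w:V ==> cmap c (PE w) 0 = 0" using bdry_chart[OF 3(2) c(1)] by (auto simp: V_def)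
 thus ?case using F_out[of w s] 3 by (cases "PE w:V") auto
 next
 case (4 w s a)
 note v = vs_tot[OF 4(1), of a]
 show ?case
 proof (cases "PE w:V")
 case True
 note f = F_V[OF 4(1) True, of s] and fv = F_V[OF v(1), of s, unfolded v(2), OF True]
 have cV: "V <= cdom c" by (auto simp: V_def)
 have "cmap c (PE (F (vE a w, s))) = cmap c (PE (F (w, s)))" using f fv by metis
 hence pe: "PE (F (vE a w, s)) = PE (F (w, s))" using inj_onD[OF inj[OF c(1)]] f fv cV by blast
 have "PE w:tdom t" "PE (F (w, s)):tdom t" using True f Vt by auto
 hence "tmap t (F (vE a w, s)) = tmap t (vE a (F (w, s)))"
 using f fv tmap_vscale[OF t(1) 4(1), of a] tmap_vscale[OF t(1), of "F (w, s)" a] by simp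
 thus ?thesis using tmap_inj[OF t(1), of "F (vE a w, s)" "vE a (F (w, s))"] pe f fv vs_tot[of "F (w, s)" a] Vt by auto
 qed (use F_out[of w s] F_out[of "vE a w" s] v 4 in auto)
 next
 case (5 w s)
 show ?case
 proof (cases "PE w:V")
 case True
 thus ?thesis using F_V[OF 5(1) True, of s] 5 Vt nonzero_iff[OF t(1), of w] nonzero_iff[OF t(1), of "F (w, s)"] by auto
 qed (use F_out 5 in auto)
 next
 case (6 w s v)
 show ?case
 proof (cases "PE w:V")
 case True
 note f = F_V[OF 6(1) True, of s] and fv = F_V[OF 6(2), of s, unfolded 6(3), OF True]
 have cV: "V <= cdom c" by (auto simp: V_def)
 have "cmap c (PE (F (v, s))) = cmap c (PE (F (w, s)))" using f fv by metis
 thus ?thesis using inj_onD[OF inj[OF c(1)]] f fv cV by blast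
 qed (use F_out[of w s] F_out[of v s] 6 in auto)
 qed
 moreover have "PE (F (w, pi / 2)):bdry M" if "w:TE" "PE w:Q" for w
 proof -
 have V: "PE w:V" using that K by blast
 note f = F_V[OF that(1) V, of "pi / 2"]
 have "cmap c (PE (F (w, pi / 2))) 0 = 0" using f Q(3)[OF that(2)] by (simp add: m_def)
 thus ?thesis using bdry_iff[OF c(1)] f cb by (auto simp: V_def)
 qed
 ultimately show ?thesis using that Q(1,2) by blast
qed

lemma push_exists:
 obtains F N where "push F" "mopen M N" "bdry M <= N" "!!w. w:TE ==> PE w:N ==> PE (F (w, pi / 2)):bdry M"
proof -
 have "EX F Q. push F & mopen M Q & p:Q & (ALL w:TE. PE w:Q --> PE (F (w, pi / 2)):bdry M)" if p: "p:bdry M" for p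
 by (rule push_local[OF p]) (intro exI conjI ballI impI; assumption)
 then obtain F Q where F: "!!p. p:bdry M ==> push (F p)" and Q: "!!p. p:bdry M ==> mopen M (Q p) & p:Q p"
 and FQ: "!!p w. p:bdry M ==> w:TE ==> PE w:Q p ==> PE (F p (w, pi / 2)):bdry M" by metis
 obtain P where P: "finite P" "P <= bdry M" "bdry M <= (\<Union>p\<in>P. Q p)" by (rule finite_subcover[OF closed_bdry Q])
 have "EX G N. push G & mopen M N & bdry M Int (\<Union>p\<in>P. Q p) <= N & (ALL w:TE. PE w:N --> PE (G (w, pi / 2)):bdry M)" using P(1,2)
 proof induction
 case empty
 have "push fst" unfolding push_def using TT.smap_line_fst T_car by auto
 thus ?case by (intro exI[of _ fst] exI[of _ "{}"]) auto
 next
 case (insert p P)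
 then obtain G N where G: "push G" "mopen M N" "bdry M Int (\<Union>p\<in>P. Q p) <= N"
 "!!w. w:TE ==> PE w:N ==> PE (G (w, pi / 2)):bdry M" by auto
 have p: "p:bdry M" using insert by auto
 let ?H = "%(w, s). F p (G (w, s), s)"
 let ?G = "%q. PE (G (zsec q, pi / 2))"
 have Gt: "G (zsec q, s):TE" if "q:car M" for q s using push_total[OF G(1)] zsec(1)[OF that] .
 have Gs: "smap M M q ?G" if q: "q:car M" for q
 proof -
 have "smap M (lmfd T) q (%q. (zsec q, pi / 2))" by (rule smap_into_line[OF atlas T_atlas smap_zsec[OF q]]) simp
 moreover have "smap (lmfd T) T (zsec q, pi / 2) G" by (rule pushD(1)[OF G(1) zsec(1)[OF q]])
 ultimately have "smap M T q (%q. G (zsec q, pi / 2))" by (rule smap_compose[OF atlas TT.latlas T_atlas])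
 thus ?thesis by (rule smap_compose[OF atlas T_atlas atlas]) (rule smap_proj[OF Gt[OF q]])
 qed
 interpret MM: atlas2 M M ..
 define N' where "N' = N Un {q:car M. ?G q:Q p}"
 have "mopen M {q:car M. ?G q:Q p}"
 proof (rule openin_mfdI)
 fix q assume "q:{q:car M. ?G q:Q p}"
 then obtain A where "mopen M A" "q:A" "?G ` A <= Q p" using MM.smap_cont[OF Gs] Q[OF p] by blast
 thus "EX A. mopen M A & q:A & A <= {q:car M. ?G q:Q p}" using opn_car by (intro exI[of _ A]) auto
 qed auto
 hence N': "mopen M N'" unfolding N'_def using G(2) by (rule openin_Un[rotated])
 have "bdry M Int (\<Union>p\<in>insert p P. Q p) <= N'"
 proof
 fix q assume q: "q:bdry M Int (\<Union>p\<in>insert p P. Q p)"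
 hence qM: "q:car M" using bdry_car by blast
 hence "?G q = q" using pushD(3)[OF G(1) zsec(1)[OF qM]] zsec(2)[OF qM] q by simp
 thus "q:N'" using q G(3) qM by (auto simp: N'_def)
 qed
 moreover have "PE (?H (w, pi / 2)):bdry M" if w: "w:TE" "PE w:N'" for w
 proof (cases "PE w:N")
 case True
 thus ?thesis using G(4)[OF w(1) True] pushD(3)[OF F[OF p] push_total[OF G(1) w(1)]] by simp
 next
 case False
 hence "?G (PE w):Q p" using w by (auto simp: N'_def)
 moreover have "?G (PE w) = PE (G (w, pi / 2))" using pushD(6)[OF G(1) w(1) zsec(1)] zsec(2) proj_car[OF w(1)] by simp
 ultimately show ?thesis using FQ[OF p push_total[OF G(1) w(1)]] by simp
 qed
 ultimately show ?case using push_compose[OF F[OF p] G(1)] N' by blast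
 qed
 thus ?thesis using that P(3) by (metis (no_types, lifting) inf.absorb1)
qed

end

section \<open>The radial compactification\<close>

context vbun
begin

abbreviation RB :: "('w + 'w set) chart set" where "RB \<equiv> radial_compactification M E"

definition rays :: "'w + 'w set => 'w set" where "rays = case_sum (ray E) id"

definition ilift :: "('a, 'w) triv => nat => real => 'w + 'w set => 'w \<times> real" where
 "ilift t j sg q = (slift t j sg (rays q), case_sum (%w. 1 / (sg * tmap t w j)) (%R. 0) q)"

text \<open>The point with homogeneous coordinates \<open>(w, a)\<close>, for \<open>a >= 0\<close>.\<close>

definition cl :: "'w => real => 'w + 'w set" where
 "cl w a = (if a > 0 then Inl (vE (1 / a) w) else Inr (ray E w))"

definition hdom :: "'w => real => bool" where "hdom w a <-> w:TE & a >= 0 & (a > 0 | w:NE)"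

lemma cl_scale: "w:TE ==> 0 < b ==> cl (vE b w) (b * a) = cl w a" by (simp add: cl_def vs_vs ray_vscale zero_less_mult_iff)

lemma ich_simps:
 "cdim (ich c t j sg) = Suc (cdim c + trank t - 1)" "ccor (ich c t j sg) = Suc (ccor c)"
 "cdom (ich c t j sg) = Inl ` {w:NE. ray E w:cdom (sch c t j sg)} Un Inr ` cdom (sch c t j sg)"
 by (simp_all add: infinity_chart_def Let_def)

lemma finite_chart_simps [simp]:
 "cdim (finite_chart c) = cdim c" "ccor (finite_chart c) = ccor c" "cdom (finite_chart c) = Inl ` cdom c" "cmap (finite_chart c) = cmap c o projl"
 by (simp_all add: finite_chart_def)

lemma cl_infinity:
 assumes t: "t:tE" and w: "w:TE" "hdom w a"
 shows "cl w a:cdom (ich c t j sg) <-> w:scond c t j sg"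
 and "w:scond c t j sg ==> cmap (ich c t j sg) (cl w a) = case_nat (a / (sg * tmap t w j)) (scoord c t j sg w)"
proof -
 show 1: "cl w a:cdom (ich c t j sg) <-> w:scond c t j sg"
 proof (cases "a > 0")
 case True
 have "vE (1 / a) w:NE <-> w:NE"
 using nonzero_vscale[of w "1 / a"] nonzero_vscale[of "vE (1 / a) w" a] True by (auto simp: vs_vs[OF w(1)] vscale_1[OF w(1)])
 thus ?thesis using sphere_cdom(2)[OF t, of w c j sg] ray_vscale[OF w(1), of "1 / a"] True by (auto simp: cl_def ich_simps scond_def)
 next
 case False
 thus ?thesis using sphere_cdom(2)[OF t, of w c j sg] w by (auto simp: cl_def ich_simps hdom_def)
 qed
 assume s: "w:scond c t j sg"
 have pt: "PE w:tdom t" using s by (simp add: scond_def)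
 show "cmap (ich c t j sg) (cl w a) = case_nat (a / (sg * tmap t w j)) (scoord c t j sg w)"
 proof (cases "a > 0")
 case True
 thus ?thesis using sphere_cmap(1)[OF t s] ray_vscale[OF w(1), of "1 / a"] tmap_vscale[OF t w(1) pt, of "1 / a"]
 by (simp add: cl_def infinity_chart_def Let_def sfun_def)
 next
 case False
 hence "a = 0" using w(2) by (simp add: hdom_def)
 thus ?thesis using sphere_cmap(1)[OF t s] by (simp add: cl_def infinity_chart_def Let_def)
 qed
qed

lemma ilift_props:
 assumes t: "t:tE" and j: "j < trank t" and sg: "sg = 1 | sg = -1" and q: "q:cdom (ich c t j sg)"
 and L: "ilift t j sg q = (w, a)"
 shows "cl w a = q" "hdom w a" "w:scond c t j sg" "tmap t w j = sg" "a = cmap (ich c t j sg) q 0"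
 "rays q:cdom (sch c t j sg)" "w = slift t j sg (rays q)" "cmap (ich c t j sg) q = case_nat a (cmap (sch c t j sg) (rays q))"
proof -
 show rq: "rays q:cdom (sch c t j sg)" using q by (auto simp: ich_simps rays_def)
 show w: "w = slift t j sg (rays q)" using L by (simp add: ilift_def)
 note S = slift_props[OF t j sg rq, folded w]
 show "w:scond c t j sg" "tmap t w j = sg" by (rule S)+
 have wn: "w:NE" using S(1) by (simp add: scond_def)
 show "cmap (ich c t j sg) q = case_nat a (cmap (sch c t j sg) (rays q))" "a = cmap (ich c t j sg) q 0"
 using L by (cases q; auto simp: ilift_def infinity_chart_def Let_def rays_def)+
 show "cl w a = q" "hdom w a"
 proof (atomize (full), cases q)
 case (Inl v)
 hence v: "v:scond c t j sg" using q sphere_cdom(2)[OF t] by (auto simp: ich_simps)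
 hence a: "a > 0" "a = 1 / (sg * tmap t v j)" using L Inl by (auto simp: ilift_def scond_def)
 have vt: "v:TE" using v nz_total by (simp add: scond_def)
 have "w = vE a v" using sphere_cmap(2)[OF t v] a w Inl by (simp add: rays_def)
 hence "vE (1 / a) w = v" using a(1) vs_vs[OF vt] vscale_1[OF vt] by simp
 thus "cl w a = q & hdom w a" using a(1) Inl wn nz_total by (simp add: cl_def hdom_def)
 next
 case (Inr R)
 hence "a = 0" "ray E w = R" using L S(2) by (auto simp: ilift_def rays_def)
 thus "cl w a = q & hdom w a" using Inr wn nz_total by (simp add: cl_def hdom_def)
 qed
qed

lemma infinity_inj:
 assumes c: "c:M" and t: "t:tE" and j: "j < trank t" and sg: "sg = 1 | sg = -1"
 shows "inj_on (cmap (ich c t j sg)) (cdom (ich c t j sg))"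
proof (rule inj_onI)
 fix q q' assume q: "q:cdom (ich c t j sg)" and q': "q':cdom (ich c t j sg)"
 and eq: "cmap (ich c t j sg) q = cmap (ich c t j sg) q'"
 obtain w a where L: "ilift t j sg q = (w, a)" by fastforce
 obtain w' a' where L': "ilift t j sg q' = (w', a')" by fastforce
 note i = ilift_props[OF t j sg q L] and i' = ilift_props[OF t j sg q' L']
 have "cmap (sch c t j sg) (rays q) i = cmap (sch c t j sg) (rays q') i" for i
 using fun_cong[OF eq, of "Suc i"] unfolding i(8) i'(8) by simp
 hence "rays q = rays q'" using inj_onD[OF sphere_inj[OF c t j sg]] i(6) i'(6) by blast
 hence "w = w'" "a = a'" using i(7,5) i'(7,5) eq by auto
 thus "q = q'" using i(1) i'(1) by simp
qed

lemma infinity_image: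
 assumes c: "c:M" and t: "t:tE" and j: "j < trank t" and sg: "sg = 1 | sg = -1"
 shows "cim (ich c t j sg) = {z. 0 <= z 0 & (%i. z (Suc i)):cim (sch c t j sg)}"
proof (intro equalityI subsetI)
 fix z assume "z:cim (ich c t j sg)"
 then obtain q where q: "q:cdom (ich c t j sg)" "z = cmap (ich c t j sg) q" by blast
 obtain w a where L: "ilift t j sg q = (w, a)" by fastforce
 note i = ilift_props[OF t j sg q(1) L]
 show "z:{z. 0 <= z 0 & (%i. z (Suc i)):cim (sch c t j sg)}" using i(2,6) unfolding q(2) i(8) by (simp add: hdom_def)
next
 fix z assume z: "z:{z. 0 <= z 0 & (%i. z (Suc i)):cim (sch c t j sg)}"
 then obtain R where R: "R:cdom (sch c t j sg)" "(%i. z (Suc i)) = cmap (sch c t j sg) R" by blast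
 note S = slift_props[OF t j sg R(1)]
 let ?w = "slift t j sg R"
 have wn: "?w:NE" using S(1) by (simp add: scond_def)
 have h: "hdom ?w (z 0)" using z wn nz_total by (simp add: hdom_def)
 have "cmap (ich c t j sg) (cl ?w (z 0)) = case_nat (z 0 / (sg * sg)) (scoord c t j sg ?w)"
 using cl_infinity(2)[OF t nz_total[OF wn] h S(1)] S(3) by simp
 also have "scoord c t j sg ?w = (%i. z (Suc i))" using sphere_cmap(1)[OF t S(1)] S(2) R(2) by simp
 also have "case_nat (z 0 / (sg * sg)) (%i. z (Suc i)) = z" using sg by (auto simp: fun_eq_iff split: nat.split)
 finally show "z:cim (ich c t j sg)" using cl_infinity(1)[OF t nz_total[OF wn] h] S(1) by force
qed

lemma infinity_open:
 assumes c: "c:M" and t: "t:tE" and j: "j < trank t" and sg: "sg = 1 | sg = -1"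
 shows "ropen (quad (Suc (cdim c + trank t - 1)) (Suc (ccor c))) (cim (ich c t j sg))"
proof -
 let ?n = "cdim c + trank t - 1" and ?f = "%z::rvec. %i. z (Suc i)"
 have q: "cim (sch c t j sg) <= quad ?n (ccor c)" by (rule op_sub[OF sphere_open[OF assms]])
 have "ropen (quad (Suc ?n) (Suc (ccor c))) (quad (Suc ?n) (Suc (ccor c)) Int ?f -` cim (sch c t j sg))"
 proof (rule cont_pre[OF _ _ sphere_open[OF assms]])
 show "continuous_on (quad (Suc ?n) (Suc (ccor c))) ?f" by (rule cont_prodI) (rule cont_crd)
 qed (auto simp: quad_def Rn_iff)
 moreover have "quad (Suc ?n) (Suc (ccor c)) Int ?f -` cim (sch c t j sg) = cim (ich c t j sg)"
 proof -
 have "z:quad (Suc ?n) (Suc (ccor c))" if "0 <= z 0" "?f z:cim (sch c t j sg)" for z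
 proof -
 have f: "?f z:quad ?n (ccor c)" using that(2) q by blast
 have "z i = 0" if "Suc ?n <= i" for i using f that by (cases i) (auto simp: quad_def Rn_iff)
 moreover have "0 <= z i" if "i < Suc (ccor c)" for i using f that `0 <= z 0` by (cases i) (auto simp: quad_def)
 ultimately show ?thesis by (simp add: quad_def Rn_iff)
 qed
 moreover have "0 <= z 0" if "z:quad (Suc ?n) (Suc (ccor c))" for z using that by (simp add: quad_def)
 ultimately show ?thesis unfolding infinity_image[OF assms] by blast
 qed
 ultimately show ?thesis by simp
qed

lemma ilift_smooth:
 assumes c: "c:M" and t: "t:tE" and j: "j < trank t" and sg: "sg = 1 | sg = -1"
 and z: "z:cim (ich c t j sg)"
 shows "smpt (Suc (cdim c + trank t - 1)) (cim (ich c t j sg))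
 (%z. cmap (lchart (tch c t)) (ilift t j sg (cinv (ich c t j sg) z)) i) z"
proof -
 let ?e = "ich c t j sg" and ?n = "cdim c" and ?N = "cdim c + trank t"
 have zR: "z:Rn (Suc (?N - 1))" using z op_sub[OF infinity_open[OF assms(1-4)]] by (auto simp: quad_def)
 have e: "cmap (lchart (tch c t)) (ilift t j sg (cinv ?e z)) i =
 (if i = ?N then z 0 else if i < ?n + j then z (Suc i) else if i = ?n + j then sg else z i)" if z: "z:cim ?e" for z
 proof -
 obtain q where q: "q:cdom ?e" "z = cmap ?e q" using z by blast
 obtain w a where L: "ilift t j sg q = (w, a)" by fastforce
 note p = ilift_props[OF t j sg q(1) L]
 have "cinv ?e z = q" using inv_into_f_f[OF infinity_inj[OF c t j sg] q(1)] q(2) by simp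
 moreover have "cmap (tch c t) w i = sins ?n j sg (%i. z (Suc i)) i" using slift_props(4)[OF t j sg p(6)] unfolding p(7) q(2) p(8) by simp
 ultimately show ?thesis using L p(5) q(2) by (auto simp: sins_def)
 qed
 have "smpt (Suc (?N - 1)) (cim ?e) (%z. if i = ?N then z 0 else if i < ?n + j then z (Suc i) else if i = ?n + j then sg else z i) z"
 using zR by (cases "i = ?N"; cases "i < ?n + j"; cases "i = ?n + j") auto
 thus ?thesis by (rule smpt_cR[OF _ zR e])
qed

lemma RB_chartE:
 assumes "e:RB"
 obtains (fin) c t where "c:M" "t:tE" "e = finite_chart (tch c t)"
 | (inf) c t j sg where "c:M" "t:tE" "j < trank t" "sg = 1 | sg = -1" "e = ich c t j sg"
proof -
 consider c t where "e = finite_chart (tch c t)" "c:M" "t:tE"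
 | c t j sg where "e = ich c t j sg" "c:M" "t:tE" "j < trank t" "sg:{1, -1}"
 using assms unfolding radial_compactification_def tot_def by blast
 thus ?thesis using fin inf by cases simp_all
qed

lemma finite_image: "cim (finite_chart c) = cim c" by (force simp: image_image)

lemma finite_cinv: "inj_on (cmap c) (cdom c) ==> w:cdom c ==> cinv (finite_chart c) (cmap c w) = Inl w"
 using inv_into_f_f[of "cmap (finite_chart c)" "cdom (finite_chart c)" "Inl w"] by (auto simp: inj_on_def)

definition RD :: "('w + 'w set) chart => ('w \<times> real) set => ('w \<times> real => rvec) => bool" where
 "RD d D Ph <-> mopen (lmfd T) D & (ALL r:D. ALL j. sfn (lmfd T) r (%r. Ph r j)) &
 (ALL w a. hdom w a --> (cl w a:cdom d <-> (w, a):D) & ((w, a):D --> Ph (w, a) = cmap d (cl w a)))"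

lemma RD_ex:
 assumes "d:RB"
 shows "EX D Ph. RD d D Ph" using assms
proof (cases rule: RB_chartE)
 case (fin c t)
 interpret L: atlas "lmfd T" by standard (rule TT.latlas)
 interpret LT: atlas2 "lmfd T" T ..
 let ?D = "{r:{w:TE. PE w:cdom c Int tdom t} \<times> UNIV. snd r:{0<..}}" and ?Ph = "%r. cmap (tch c t) (vE (1 / snd r) (fst r))"
 have "RD d ?D ?Ph" unfolding RD_def
 proof (intro conjI ballI allI impI)
 have o: "mopen (lmfd T) ({w:TE. PE w:cdom c Int tdom t} \<times> UNIV)"
 by (rule TT.line_openI[OF proj_open[OF openin_Int[OF cdom_open[OF fin(1)] tdom_open[OF fin(2)]]]])
 show "mopen (lmfd T) ?D" by (rule L.sfn_pre[OF _ o]) (auto intro: TT.sfn_line_snd)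
 fix r :: "'w \<times> real" and j assume r: "r:?D"
 have s: "smap (lmfd T) T r (%r. vE (1 / snd r) (fst r))"
 using r T_car by (cases r) (auto intro!: smap_vscale L.atlas TT.smap_line_fst L.sfn_divide TT.sfn_line_snd)
 show "sfn (lmfd T) r (%r. ?Ph r j)" by (rule LT.smap_chart(2)[OF s T_chart[OF fin(1,2)]]) (use r vs_tot in auto)
 next
 fix w a assume h: "hdom w a"
 show "cl w a:cdom d <-> (w, a):?D" using h vs_tot[of w "1 / a"] by (auto simp: fin cl_def hdom_def)
 assume "(w, a):?D"
 thus "?Ph (w, a) = cmap d (cl w a)" by (simp add: fin cl_def)
 qed
 thus ?thesis by blast
next
 case (inf c t j sg)
 interpret L: atlas "lmfd T" by standard (rule TT.latlas)
 let ?D = "scond c t j sg \<times> (UNIV :: real set)" and ?Ph = "%r. case_nat (snd r / (sg * tmap t (fst r) j)) (scoord c t j sg (fst r))"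
 have "RD d ?D ?Ph" unfolding RD_def
 proof (intro conjI ballI allI impI)
 show "mopen (lmfd T) ?D" by (rule TT.line_openI[OF scond_open[OF inf(1,2)]])
 fix r :: "'w \<times> real" and i assume r: "r:?D"
 obtain w a where wa: "r = (w, a)" by fastforce
 have w: "w:scond c t j sg" "w:TE" "PE w:tdom t" "sg * tmap t w j > 0" using r wa nz_total by (auto simp: scond_def)
 show "sfn (lmfd T) r (%r. ?Ph r i)"
 proof (cases i)
 case 0
 thus ?thesis using w(4) unfolding wa
 by (auto intro!: L.sfn_divide L.sfn_mult TT.sfn_line_snd TT.sfn_line_fst[OF sfn_tmap[OF inf(2) w(2,3)]])
 next
 case (Suc l)
 thus ?thesis unfolding wa using TT.sfn_line_fst[OF scoord_smooth[OF inf(1,2) w(1)]] by simp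
 qed
 next
 fix w a assume h: "hdom w a"
 hence wt: "w:TE" by (simp add: hdom_def)
 show "cl w a:cdom d <-> (w, a):?D" using cl_infinity(1)[OF inf(2) wt h] by (simp add: inf)
 assume "(w, a):?D"
 thus "?Ph (w, a) = cmap d (cl w a)" using cl_infinity(2)[OF inf(2) wt h] by (simp add: inf)
 qed
 thus ?thesis by blast
qed

definition RL :: "('w + 'w set) chart => ('w \<times> real) chart => ('w + 'w set => 'w \<times> real) => bool" where
 "RL e m L <-> m:lmfd T & L ` cdom e <= cdom m & (ALL j. ALL y:cim e. smpt (cdim e) (cim e) (%y. cmap m (L (cinv e y)) j) y) &
 (ALL q:cdom e. hdom (fst (L q)) (snd (L q)) & cl (fst (L q)) (snd (L q)) = q)"

lemma RL_ex:
 assumes "e:RB"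
 shows "EX m L. RL e m L" using assms
proof (cases rule: RB_chartE)
 case (fin c t)
 let ?c = "tch c t" and ?L = "%q. (projl q, 1)"
 have cT: "?c:T" by (rule T_chart[OF fin(1,2)])
 have "RL e (lchart ?c) ?L" unfolding RL_def
 proof (intro conjI ballI allI)
 fix j y assume y: "y:cim e"
 hence yR: "y:Rn (cdim ?c)" using TT.cim_Rn[OF cT] by (auto simp: fin finite_image simp del: total_chart_simps finite_chart_simps)
 have "smpt (cdim ?c) (cim e) (%y. if j = cdim ?c then 1 else y j) y" using yR by (cases "j = cdim ?c") auto
 hence "smpt (cdim ?c) (cim e) (%y. cmap (lchart ?c) (?L (cinv e y)) j) y"
 proof (rule smpt_cR[OF _ yR])
 fix z assume "z:cim e"
 then obtain w where w: "w:cdom ?c" "z = cmap ?c w" unfolding fin finite_image by blast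
 show "cmap (lchart ?c) (?L (cinv e z)) j = (if j = cdim ?c then 1 else z j)" unfolding fin w(2) finite_cinv[OF TT.inj[OF cT] w(1)] by simp
 qed
 thus "smpt (cdim e) (cim e) (%y. cmap (lchart ?c) (?L (cinv e y)) j) y" by (simp add: fin)
 next
 fix q assume "q:cdom e"
 then obtain w where w: "q = Inl w" "w:TE" by (auto simp: fin)
 show "hdom (fst (?L q)) (snd (?L q))" "cl (fst (?L q)) (snd (?L q)) = q" using w by (auto simp: hdom_def cl_def vscale_1)
 qed (use cT in "auto simp: lmfd_def fin")
 thus ?thesis by blast
next
 case (inf c t j sg)
 have "RL e (lchart (tch c t)) (ilift t j sg)" unfolding RL_def
 proof (intro conjI ballI allI)
 show "lchart (tch c t):lmfd T" using T_chart[OF inf(1,2)] by (simp add: lmfd_def)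
 show "smpt (cdim e) (cim e) (%y. cmap (lchart (tch c t)) (ilift t j sg (cinv e y)) i) y" if "y:cim e" for i y
 using ilift_smooth[OF inf(1-4)] that unfolding inf ich_simps .
 have p: "cl (fst (ilift t j sg q)) (snd (ilift t j sg q)) = q & hdom (fst (ilift t j sg q)) (snd (ilift t j sg q)) & fst (ilift t j sg q):scond c t j sg"
 if "q:cdom e" for q using ilift_props(1-3)[OF inf(2-4) that[unfolded inf], of "fst (ilift t j sg q)" "snd (ilift t j sg q)"] by simp
 show "ilift t j sg ` cdom e <= cdom (lchart (tch c t))"
 proof
 fix r assume "r:ilift t j sg ` cdom e"
 then obtain q where q: "q:cdom e" "r = ilift t j sg q" by blast
 show "r:cdom (lchart (tch c t))" using p[OF q(1)] nz_total unfolding q(2) by (auto simp: mem_Times_iff scond_def)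
 qed
 show "hdom (fst (ilift t j sg q)) (snd (ilift t j sg q))" "cl (fst (ilift t j sg q)) (snd (ilift t j sg q)) = q" if "q:cdom e" for q using p[OF that] by simp_all
 qed
 thus ?thesis by blast
qed

lemma RB_atlas: "atl RB"
proof (rule atlas_from_lifts[OF TT.latlas])
 fix e assume e: "e:RB"
 thus "ccor e <= cdim e & inj_on (cmap e) (cdom e) & ropen (quad (cdim e) (ccor e)) (cim e)"
 proof (cases rule: RB_chartE)
 case (fin c t)
 note cT = T_chart[OF fin(1,2)]
 have "ccor (tch c t) <= cdim (tch c t)" using T_atlas cT unfolding atl_def by blast
 moreover have "inj_on (cmap e) (cdom e)" using TT.inj[OF cT] unfolding fin inj_on_def by simp
 ultimately show ?thesis using TT.cim_quad[OF cT] unfolding fin finite_image by simp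
 next
 case (inf c t j sg)
 have "ccor c <= cdim c" using atlas inf(1) by (simp add: atl_def)
 thus ?thesis using infinity_inj[OF inf(1-4)] infinity_open[OF inf(1-4)] inf(3) unfolding inf ich_simps by auto
 qed
 fix d assume d: "d:RB"
 obtain m L where L: "RL e m L" using RL_ex[OF e] by blast
 obtain D Ph where D: "RD d D Ph" using RD_ex[OF d] by blast
 have q: "(q:cdom d <-> L q:D) & (q:cdom d --> Ph (L q) = cmap d q)" if "q:cdom e" for q
 proof -
 have "hdom (fst (L q)) (snd (L q))" "cl (fst (L q)) (snd (L q)) = q" using L that unfolding RL_def by blast+
 thus ?thesis using D unfolding RD_def by (metis prod.collapse)
 qed
 show "EX m:lmfd T. EX L D Ph. L ` cdom e <= cdom m &
 (ALL j. ALL y:cim e. smpt (cdim e) (cim e) (%y. cmap m (L (cinv e y)) j) y) &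
 mopen (lmfd T) D & (ALL r:D. ALL j. sfn (lmfd T) r (%r. Ph r j)) &
 (ALL q:cdom e. q:cdom d <-> L q:D) & (ALL q:cdom e Int cdom d. Ph (L q) = cmap d q)"
 using L D q unfolding RL_def RD_def by (intro bexI[of _ m] exI[of _ L] exI[of _ D] exI[of _ Ph] conjI) (elim conjE; blast)+
qed

lemma RB_cover: "q:car RB <-> (EX w a. hdom w a & q = cl w a)"
proof
 assume "q:car RB"
 then obtain e where e: "e:RB" "q:cdom e" by (auto simp: car_def)
 obtain m L where "RL e m L" using RL_ex[OF e(1)] by blast
 hence "hdom (fst (L q)) (snd (L q))" "cl (fst (L q)) (snd (L q)) = q" using e(2) unfolding RL_def by blast+
 thus "EX w a. hdom w a & q = cl w a" by metis
next
 assume "EX w a. hdom w a & q = cl w a"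
 then obtain w a where h: "hdom w a" "q = cl w a" by blast
 show "q:car RB"
 proof (cases "a > 0")
 case True
 hence "q = Inl (vE (1 / a) w)" "vE (1 / a) w:TE" using h vs_tot by (auto simp: cl_def hdom_def)
 moreover obtain c t where "c:M" "t:tE" "PE (vE (1 / a) w):cdom c" "PE (vE (1 / a) w):tdom t" using chart_at[OF calculation(2)] by blast
 ultimately show ?thesis unfolding car_def radial_compactification_def
 by (intro UN_I[of "finite_chart (tch c t)"] UnI1 imageI T_chart) auto
 next
 case False
 hence w: "w:NE" "w:TE" using h by (auto simp: hdom_def)
 hence "ray E w:car SS" by (simp add: S_carrier)
 then obtain c t j sg where c: "c:M" "t:tE" "j < trank t" "sg = 1 | sg = -1" "ray E w:cdom (sch c t j sg)" by (rule S_chart_at)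
 have "q:cdom (ich c t j sg)" using c(5) sphere_cdom(2)[OF c(2) w(1)] cl_infinity(1)[OF c(2) w(2) h(1)] h(2) by simp
 thus ?thesis using c unfolding car_def radial_compactification_def by (intro UN_I[of "ich c t j sg"] UnI2) auto
 qed
qed

sublocale RR: atlas RB by standard (rule RB_atlas)

lemma RB_lift:
 assumes "q:car RB"
 obtains V f h where "mopen RB V" "q:V" "smap RB T q f" "sfn RB q h" "ALL r:V. hdom (f r) (h r) & cl (f r) (h r) = r"
proof -
 obtain e where e: "e:RB" "q:cdom e" using assms by (auto simp: car_def)
 obtain m L where L: "RL e m L" using RL_ex[OF e(1)] by blast
 interpret L: atlas "lmfd T" by standard (rule TT.latlas)
 interpret RL: atlas2 RB "lmfd T" ..
 have "smap RB (lmfd T) q L" by (rule smap_lift[OF RB_atlas e]) (use L e(2) in "auto simp: RL_def")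
 hence s: "smap RB (lmfd T) q L" .
 have Lq: "fst (L q):car T" using RL.smap_car[OF s] by (cases "L q") (simp add: TT.lcar)
 have "smap (lmfd T) T (L q) fst" using TT.smap_line_fst[OF Lq, of "snd (L q)"] by simp
 hence 1: "smap RB T q (%q. fst (L q))" by (rule smap_compose[OF RB_atlas L.atlas T_atlas s])
 have "sfn (lmfd T) (L q) snd" using TT.sfn_line_snd[of "fst (L q)" "snd (L q)"] by simp
 hence 2: "sfn RB q (%q. snd (L q))" by (rule RL.sfn_compose[OF s])
 show ?thesis by (rule that[OF RR.cdom_open[OF e(1)] e(2) 1 2]) (use L in "auto simp: RL_def")
qed

lemma smap_cl:
 assumes P: "atl P" and V: "mopen P V" "p:V" and f: "smap P T p f" and h: "sfn P p h"
 and d: "!!q. q:V ==> hdom (f q) (h q)"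
 shows "smap P RB p (%q. cl (f q) (h q))"
proof -
 interpret L: atlas "lmfd T" by standard (rule TT.latlas)
 interpret PL: atlas2 P "lmfd T" by standard (rule P)
 have "cl (f p) (h p):car RB" using RB_cover d V by blast
 then obtain e where e: "e:RB" "cl (f p) (h p):cdom e" by (auto simp: car_def)
 obtain D Ph where D: "mopen (lmfd T) D" "!!r j. r:D ==> sfn (lmfd T) r (%r. Ph r j)"
 "!!w a. hdom w a ==> cl w a:cdom e <-> (w, a):D" "!!w a. hdom w a ==> (w, a):D ==> Ph (w, a) = cmap e (cl w a)"
 using RD_ex[OF e(1)] unfolding RD_def by blast
 have s: "smap P (lmfd T) p (%q. (f q, h q))" by (rule smap_into_line[OF P T_atlas f h])
 have pD: "(f p, h p):D" using D(3) d V(2) e(2) by blast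
 obtain U where U: "mopen P U" "p:U" "(%q. (f q, h q)) ` U <= D" using PL.smap_cont[OF s D(1) pD] by blast
 have UV: "mopen P (U Int V)" "p:U Int V" using U V by auto
 show ?thesis
 proof (rule smap_intoI[OF UV e(1)])
 show "(%q. cl (f q) (h q)) ` (U Int V) <= cdom e" using D(3) d U(3) by blast
 show "sfn P p (%q. cmap e (cl (f q) (h q)) j)" for j
 by (rule PL.A.sfn_cong[OF PL.sfn_compose[OF s D(2)[OF pD]] UV]) (use D(4) d U(3) in fastforce)
 qed
qed

lemma radial_proj_cl: "hdom w a ==> radial_proj E (cl w a) = PE w" using vs_tot by (auto simp: hdom_def cl_def radial_proj_def)

lemma smaps_radial_proj: "smaps RB M (car RB) (radial_proj E)" unfolding smaps_def
proof (intro conjI ballI RR.open_car)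
 fix q assume "q:car RB"
 then obtain V f h where L: "mopen RB V" "q:V" "smap RB T q f" "sfn RB q h" "ALL r:V. hdom (f r) (h r) & cl (f r) (h r) = r"
 by (rule RB_lift)
 interpret RM: atlas2 RB M ..
 have "f q:TE" using bspec[OF L(5) L(2)] by (simp add: hdom_def)
 hence "smap RB M q (%q. PE (f q))" using smap_compose[OF RB_atlas T_atlas atlas L(3) smap_proj] by blast
 thus "smap RB M q (radial_proj E)" by (rule RM.smap_cong[OF _ L(1,2)]) (use L(5) radial_proj_cl in metis)
qed

lemma smaps_zero: "smaps M RB (car M) (%p. Inl (zsec p))" unfolding smaps_def
proof (intro conjI ballI open_car)
 fix p assume p: "p:car M"
 interpret MR: atlas2 M RB ..
 have "smap M RB p (%q. cl (zsec q) 1)" by (rule smap_cl[OF atlas open_car p smap_zsec[OF p]]) (use zsec(1) in "auto simp: hdom_def")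
 thus "smap M RB p (%p. Inl (zsec p))" by (rule MR.smap_cong[OF _ open_car p]) (use zsec(1) in "simp add: cl_def vscale_1")
qed

end

context vmet
begin

lemma smaps_Inr: "smaps SS RB (car SS) Inr" unfolding smaps_def
proof (intro conjI ballI S.open_car)
 fix R assume R: "R:car SS"
 interpret SR: atlas2 SS RB ..
 have "smap SS RB R (%R. cl (sig R) 0)"
 by (rule smap_cl[OF S_atlas S.open_car R smap_sig[OF R]]) (use sig_props(1) nz_total in "auto simp: hdom_def")
 thus "smap SS RB R Inr" by (rule SR.smap_cong[OF _ S.open_car R]) (use sig_props(3) in "simp add: cl_def")
qed

text \<open>In homogeneous coordinates \<open>(w, a)\<close> the compactified fibres contract to the zero section by
 \<open>((1 - s) w, (1 - s) a + s \<surd>(a^2 + g w))\<close>, \<open>0 <= s <= 1\<close>.\<close>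

definition con :: "'w => real => real => 'w + 'w set" where
 "con w a s = cl (vE (1 - s) w) ((1 - s) * a + s * sqrt (a^2 + g w))"

definition contr :: "('w + 'w set) \<times> real => 'w + 'w set" where
 "contr = (%(q, x). case_sum (%w. con w 1 ((sin x)^2)) (%R. con (sig R) 0 ((sin x)^2)) q)"

lemma con_pos: "hdom w a ==> a^2 + g w > 0" using g_pos g_nonneg by (cases "a > 0") (auto simp: hdom_def intro: add_pos_nonneg)

lemma con_hdom:
 assumes h: "hdom w a" and s: "0 <= s" "s <= 1"
 shows "hdom (vE (1 - s) w) ((1 - s) * a + s * sqrt (a^2 + g w))"
proof (cases "s = 0")
 case True
 thus ?thesis using h by (simp add: hdom_def vscale_1)
next
 case False
 hence "0 < s * sqrt (a^2 + g w)" using s con_pos[OF h] by simp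
 moreover have "0 <= (1 - s) * a" using h s by (simp add: hdom_def)
 ultimately show ?thesis using h vs_tot by (simp add: hdom_def)
qed

lemma con_scale:
 assumes h: "hdom w a" and b: "b > 0"
 shows "con (vE b w) (b * a) s = con w a s"
proof -
 have wt: "w:TE" using h by (simp add: hdom_def)
 have "(b * a)^2 + g (vE b w) = b^2 * (a^2 + g w)" by (simp add: g_scale[OF wt] power_mult_distrib algebra_simps)
 hence "sqrt ((b * a)^2 + g (vE b w)) = b * sqrt (a^2 + g w)" using b by (simp add: real_sqrt_mult)
 hence "con (vE b w) (b * a) s = cl (vE b (vE (1 - s) w)) (b * ((1 - s) * a + s * sqrt (a^2 + g w)))"
 by (simp add: con_def vs_vs[OF wt] algebra_simps)
 thus ?thesis using cl_scale[OF _ b] vs_tot[OF wt] by (simp add: con_def)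
qed

lemma contr_cl:
 assumes h: "hdom w a"
 shows "contr (cl w a, x) = con w a ((sin x)^2)"
proof (cases "a > 0")
 case True
 thus ?thesis using con_scale[OF h, of "1 / a"] by (simp add: contr_def cl_def)
next
 case False
 hence a: "a = 0" and w: "w:NE" using h by (auto simp: hdom_def)
 show ?thesis using con_scale[OF h, of "1 / sqrt (g w)"] sig_ray[OF w] g_pos[OF w] by (simp add: contr_def cl_def a)
qed

lemma sin2: "0 <= (sin x)^2" "(sin x)^2 <= (1::real)" by (simp_all add: abs_square_le_1)

lemma contr_props:
 assumes "q:car RB"
 shows "contr (q, 0) = q" "contr (q, pi / 2) = Inl (zsec (radial_proj E q))" "contr (q, x):car RB" "radial_proj E (contr (q, x)) = radial_proj E q"
proof -
 obtain w a where h: "hdom w a" "q = cl w a" using assms RB_cover by blast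
 have wt: "w:TE" using h by (simp add: hdom_def)
 have q: "contr (q, x) = con w a ((sin x)^2)" for x using contr_cl[OF h(1)] h(2) by simp
 show "contr (q, 0) = q" using q[of 0] h(2) by (simp add: con_def vscale_1[OF wt])
 show "contr (q, pi / 2) = Inl (zsec (radial_proj E q))"
 using q[of "pi / 2"] h(2) con_pos[OF h(1)] radial_proj_cl[OF h(1)] zsec_vscale0[OF wt] by (simp add: con_def cl_def vs_vs[OF wt])
 show "contr (q, x):car RB" unfolding q con_def using con_hdom[OF h(1) sin2] RB_cover by blast
 show "radial_proj E (contr (q, x)) = radial_proj E q"
 unfolding q con_def using radial_proj_cl[OF con_hdom[OF h(1) sin2]] radial_proj_cl[OF h(1)] h(2) vs_tot[OF wt] by simp
qed

lemma smaps_contr: "smaps (lmfd RB) RB (car RB \<times> UNIV) contr" unfolding smaps_def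
proof (intro conjI ballI)
 show "mopen (lmfd RB) (car RB \<times> UNIV)" by (rule RR.line_openI[OF RR.open_car])
 fix r :: "('w + 'w set) \<times> real" assume "r:car RB \<times> UNIV"
 then obtain q x where r: "r = (q, x)" "q:car RB" by auto
 obtain V f h where L: "mopen RB V" "q:V" "smap RB T q f" "sfn RB q h" "ALL r:V. hdom (f r) (h r) & cl (f r) (h r) = r"
 by (rule RB_lift[OF r(2)])
 interpret LR: atlas "lmfd RB" by standard (rule RR.latlas)
 interpret LT: atlas2 "lmfd RB" T ..
 interpret LL: atlas2 "lmfd RB" RB ..
 let ?s = "%r::('w + 'w set) \<times> real. (sin (snd r))^2"
 have V: "mopen (lmfd RB) (V \<times> UNIV)" "(q, x):V \<times> UNIV" using RR.line_openI[OF L(1)] L(2) by auto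
 have f: "smap (lmfd RB) T (q, x) (%r. f (fst r))"
 by (rule smap_compose[OF LR.atlas RB_atlas T_atlas RR.smap_line_fst[OF r(2)]]) (simp add: L(3))
 have h: "sfn (lmfd RB) (q, x) (%r. h (fst r))" by (rule RR.sfn_line_fst[OF L(4)])
 have s: "sfn (lmfd RB) (q, x) ?s" by (intro LR.sfn_power LR.sfn_sin RR.sfn_line_snd)
 have hq: "hdom (f q) (h q)" using L(2,5) by blast
 hence ft: "f (fst (q, x)):TE" by (simp add: hdom_def)
 have "smap (lmfd RB) RB (q, x) (%r. cl (vE (1 - ?s r) (f (fst r))) ((1 - ?s r) * h (fst r) + ?s r * sqrt ((h (fst r))^2 + g (f (fst r)))))"
 proof (rule smap_cl[OF LR.atlas V])
 show "smap (lmfd RB) T (q, x) (%r. vE (1 - ?s r) (f (fst r)))" by (intro smap_vscale LR.atlas f LR.sfn_diff LR.sfn_const s)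
 show "sfn (lmfd RB) (q, x) (%r. (1 - ?s r) * h (fst r) + ?s r * sqrt ((h (fst r))^2 + g (f (fst r))))"
 using con_pos[OF hq] by (intro LR.sfn_add LR.sfn_mult LR.sfn_diff LR.sfn_const s h LR.sfn_sqrt LR.sfn_power LT.sfn_compose[OF f] g_smooth[OF ft]) auto
 show "hdom (vE (1 - ?s r) (f (fst r))) ((1 - ?s r) * h (fst r) + ?s r * sqrt ((h (fst r))^2 + g (f (fst r))))" if "r:V \<times> UNIV" for r
 using con_hdom[OF _ sin2] L(5) that by auto
 qed
 hence "smap (lmfd RB) RB (q, x) contr"
 proof (rule LL.smap_cong[OF _ V])
 fix r :: "('w + 'w set) \<times> real" assume "r:V \<times> UNIV"
 hence "hdom (f (fst r)) (h (fst r))" "cl (f (fst r)) (h (fst r)) = fst r" using L(5) by auto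
 hence "contr (fst r, snd r) = con (f (fst r)) (h (fst r)) (?s r)" using contr_cl by metis
 thus "cl (vE (1 - ?s r) (f (fst r))) ((1 - ?s r) * h (fst r) + ?s r * sqrt ((h (fst r))^2 + g (f (fst r)))) = contr r"
 by (simp add: con_def)
 qed
 thus "smap (lmfd RB) RB r contr" by (simp add: r)
qed

end

section \<open>Cohomology of a complex of subspaces\<close>

definition quot_vs :: "'v::real_vector set => 'v set => 'v set real_vs" where
 "quot_vs Z B = \<lparr> vs_carrier = Z // {(x, y). y - x:B}, vs_add = (%A B. {a + b | a b. a:A & b:B}),
 vs_scale = (%c A. {c *R a + b | a b. a:A & b:B}) \<rparr>"

lemma cohomology_quot: "cohomology C d k = quot_vs {z:C k. d z = 0} (d ` C (k - 1))" by (simp add: cohomology_def quot_vs_def)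

lemma coset: "{(x, y). y - x:B} `` {x} = (+) x ` B" for B :: "'v::real_vector set"
 by (auto simp: image_iff) (metis add_diff_cancel_left' diff_add_cancel add.commute)

lemma quot_carrier: "vs_carrier (quot_vs Z B) = (%x. (+) x ` B) ` Z" for Z :: "'v::real_vector set"
 unfolding quot_vs_def quotient_def coset by auto

lemma coset_eq: "subspace B ==> (+) x ` B = (+) y ` B <-> x - y:B" for B :: "'v::real_vector set"
proof
 assume B: "subspace B" and e: "(+) x ` B = (+) y ` B"
 have "x:(+) y ` B" using subspace_0[OF B] unfolding e[symmetric] by force
 thus "x - y:B" by auto
next
 assume B: "subspace B" and d: "x - y:B"
 have "(+) x ` B <= (+) y ` B" if "x - y:B" for x y
 proof safe
 fix b assume "b:B"
 hence "(x - y) + b:B" using subspace_add[OF B that] by blast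
 thus "x + b:(+) y ` B" by (rule image_eqI[rotated]) simp
 qed
 thus "(+) x ` B = (+) y ` B" using d subspace_neg[OF B d] by (simp add: subset_antisym)
qed

lemma coset_add: "subspace B ==> {a + b |a b. a:(+) x ` B & b:(+) y ` B} = (+) (x + y) ` B" for B :: "'v::real_vector set"
proof (intro equalityI subsetI)
 fix z assume B: "subspace B" and "z:{a + b |a b. a:(+) x ` B & b:(+) y ` B}"
 then obtain b b' where b: "b:B" "b':B" "z = (x + b) + (y + b')" by blast
 thus "z:(+) (x + y) ` B" using subspace_add[OF B b(1,2)] by (intro image_eqI[of _ _ "b + b'"]) (auto simp: algebra_simps)
next
 fix z assume B: "subspace B" and "z:(+) (x + y) ` B"
 then obtain b where b: "b:B" "z = (x + b) + (y + 0)" by (auto simp: algebra_simps)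
 thus "z:{a + b |a b. a:(+) x ` B & b:(+) y ` B}" using subspace_0[OF B] by blast
qed

lemma coset_scale: "subspace B ==> {c *R a + b |a b. a:(+) x ` B & b:B} = (+) (c *R x) ` B" for B :: "'v::real_vector set"
proof (intro equalityI subsetI)
 fix z assume B: "subspace B" and "z:{c *R a + b |a b. a:(+) x ` B & b:B}"
 then obtain b b' where b: "b:B" "b':B" "z = c *R (x + b) + b'" by blast
 thus "z:(+) (c *R x) ` B" using subspace_add[OF B subspace_scale[OF B b(1), of c] b(2)]
 by (intro image_eqI[of _ _ "c *R b + b'"]) (auto simp: algebra_simps)
next
 fix z assume B: "subspace B" and "z:(+) (c *R x) ` B"
 then obtain b where b: "b:B" "z = c *R (x + 0) + b" by (auto simp: algebra_simps)
 thus "z:{c *R a + b |a b. a:(+) x ` B & b:B}" using subspace_0[OF B] by blast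
qed

definition vs_closed :: "'v real_vs => bool" where
 "vs_closed V <-> (ALL x:vs_carrier V. ALL y:vs_carrier V. vs_add V x y:vs_carrier V) & (ALL c. ALL x:vs_carrier V. vs_scale V c x:vs_carrier V)"

lemma quot_ops:
 assumes "subspace B"
 shows "vs_add (quot_vs Z B) ((+) x ` B) ((+) y ` B) = (+) (x + y) ` B" "vs_scale (quot_vs Z B) c ((+) x ` B) = (+) (c *R x) ` B"
 using coset_add[OF assms] coset_scale[OF assms] by (simp_all add: quot_vs_def)

lemma quot_closed: "subspace Z ==> subspace B ==> vs_closed (quot_vs Z B)" for Z :: "'v::real_vector set"
 unfolding vs_closed_def quot_carrier by (auto simp: quot_ops subspace_add subspace_scale)

lemma quot_iso:
 fixes Z B :: "'v::real_vector set" and Z' B' :: "'w::real_vector set"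
 assumes s: "subspace Z" "subspace B" "subspace B'" and BZ: "B <= Z" and Z: "!!z. z:Z ==> ph z:Z'"
 and add: "!!x y. x:Z ==> y:Z ==> ph (x + y) = ph x + ph y" and sc: "!!x c. x:Z ==> ph (c *R x) = c *R ph x"
 and B: "!!b. b:B ==> ph b:B'" and inj: "!!z. z:Z ==> ph z:B' ==> z:B"
 and surj: "!!z'. z':Z' ==> EX z:Z. z' - ph z:B'"
 shows "vs_iso (quot_vs Z B) (quot_vs Z' B')"
proof -
 have diff: "ph (x - y) = ph x - ph y" if "x:Z" "y:Z" for x y
 using add[OF that(1) subspace_scale[OF s(1) that(2), of "-1"]] sc[OF that(2), of "-1"] by simp
 define Ph where "Ph A = (+) (ph (SOME x. x:Z & A = (+) x ` B)) ` B'" for A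
 have Ph: "Ph ((+) x ` B) = (+) (ph x) ` B'" if x: "x:Z" for x
 proof -
 let ?y = "SOME y. y:Z & (+) x ` B = (+) y ` B"
 have y: "?y:Z & (+) x ` B = (+) ?y ` B" by (rule someI[of _ x]) (use x in simp)
 hence "?y - x:B" using coset_eq[OF s(2), of ?y x] by simp
 hence "ph ?y - ph x:B'" using B diff y x by metis
 thus ?thesis unfolding Ph_def using coset_eq[OF s(3)] by blast
 qed
 show ?thesis unfolding vs_iso_def
 proof (intro exI[of _ Ph] conjI ballI allI)
 show "bij_betw Ph (vs_carrier (quot_vs Z B)) (vs_carrier (quot_vs Z' B'))" unfolding bij_betw_def quot_carrier
 proof (intro conjI; (rule inj_onI)?)
 fix A A' assume "A:(%x. (+) x ` B) ` Z" "A':(%x. (+) x ` B) ` Z" and e: "Ph A = Ph A'"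
 then obtain x y where x: "x:Z" "A = (+) x ` B" and y: "y:Z" "A' = (+) y ` B" by blast
 have "ph (x - y):B'" using e unfolding x(2) y(2) Ph[OF x(1)] Ph[OF y(1)] coset_eq[OF s(3)] diff[OF x(1) y(1)] .
 thus "A = A'" unfolding x(2) y(2) coset_eq[OF s(2)] using inj subspace_diff[OF s(1) x(1) y(1)] by blast
 next
 show "Ph ` (%x. (+) x ` B) ` Z = (%x. (+) x ` B') ` Z'"
 proof (intro equalityI subsetI)
 fix A' assume "A':Ph ` (%x. (+) x ` B) ` Z"
 then obtain x where x: "x:Z" "A' = Ph ((+) x ` B)" by blast
 show "A':(%x. (+) x ` B') ` Z'" unfolding x(2) Ph[OF x(1)] using Z[OF x(1)] by blast
 next
 fix A' assume "A':(%x. (+) x ` B') ` Z'"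
 then obtain z' where z': "z':Z'" "A' = (+) z' ` B'" by blast
 obtain z where z: "z:Z" "z' - ph z:B'" using surj[OF z'(1)] by blast
 have "A' = Ph ((+) z ` B)" unfolding z'(2) Ph[OF z(1)] coset_eq[OF s(3)] by (rule z(2))
 thus "A':Ph ` (%x. (+) x ` B) ` Z" using z(1) by blast
 qed
 qed
 fix x assume "x:vs_carrier (quot_vs Z B)"
 then obtain a where a: "a:Z" "x = (+) a ` B" unfolding quot_carrier by blast
 { fix y assume "y:vs_carrier (quot_vs Z B)"
 then obtain b where b: "b:Z" "y = (+) b ` B" unfolding quot_carrier by blast
 show "Ph (vs_add (quot_vs Z B) x y) = vs_add (quot_vs Z' B') (Ph x) (Ph y)"
 using a b Ph add subspace_add[OF s(1)] by (simp add: quot_ops s) }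
 show "Ph (vs_scale (quot_vs Z B) c x) = vs_scale (quot_vs Z' B') c (Ph x)" for c
 using a Ph sc subspace_scale[OF s(1)] by (simp add: quot_ops s)
 qed
qed

lemma vs_iso_span:
 assumes c: "vs_closed V" and "vs_iso V V1" "vs_iso V V2"
 shows "vs_iso V1 V2"
proof -
 obtain Ph where Ph: "bij_betw Ph (vs_carrier V) (vs_carrier V1)"
 "!!x y. x:vs_carrier V ==> y:vs_carrier V ==> Ph (vs_add V x y) = vs_add V1 (Ph x) (Ph y)"
 "!!c x. x:vs_carrier V ==> Ph (vs_scale V c x) = vs_scale V1 c (Ph x)" using assms(2) unfolding vs_iso_def by blast
 obtain Ps where Ps: "bij_betw Ps (vs_carrier V) (vs_carrier V2)"
 "!!x y. x:vs_carrier V ==> y:vs_carrier V ==> Ps (vs_add V x y) = vs_add V2 (Ps x) (Ps y)"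
 "!!c x. x:vs_carrier V ==> Ps (vs_scale V c x) = vs_scale V2 c (Ps x)" using assms(3) unfolding vs_iso_def by blast
 let ?i = "inv_into (vs_carrier V) Ph"
 have i: "?i x:vs_carrier V" "Ph (?i x) = x" if "x:vs_carrier V1" for x
 using that Ph(1) inv_into_into[of x Ph "vs_carrier V"] f_inv_into_f[of x Ph "vs_carrier V"] by (auto simp: bij_betw_def)
 have i': "?i (Ph x) = x" if "x:vs_carrier V" for x using inv_into_f_f[OF bij_betw_imp_inj_on[OF Ph(1)] that] .
 have 1: "?i (vs_add V1 x y) = vs_add V (?i x) (?i y)" if "x:vs_carrier V1" "y:vs_carrier V1" for x y
 using i'[of "vs_add V (?i x) (?i y)"] Ph(2)[of "?i x" "?i y"] i that c unfolding vs_closed_def by simp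
 have 2: "?i (vs_scale V1 a x) = vs_scale V a (?i x)" if "x:vs_carrier V1" for x a
 using i'[of "vs_scale V a (?i x)"] Ph(3)[of "?i x" a] i that c unfolding vs_closed_def by simp
 show ?thesis unfolding vs_iso_def by (intro exI[of _ "Ps o ?i"] conjI ballI allI bij_betw_trans[OF bij_betw_inv_into[OF Ph(1)] Ps(1)])
 (simp_all add: 1 2 Ps i)
qed

lemma vs_iso_trans:
 assumes "vs_iso V1 V2" "vs_iso V2 V3"
 shows "vs_iso V1 V3"
proof -
 obtain Ph where Ph: "bij_betw Ph (vs_carrier V1) (vs_carrier V2)"
 "!!x y. x:vs_carrier V1 ==> y:vs_carrier V1 ==> Ph (vs_add V1 x y) = vs_add V2 (Ph x) (Ph y)"
 "!!c x. x:vs_carrier V1 ==> Ph (vs_scale V1 c x) = vs_scale V2 c (Ph x)" using assms(1) unfolding vs_iso_def by blast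
 obtain Ps where Ps: "bij_betw Ps (vs_carrier V2) (vs_carrier V3)"
 "!!x y. x:vs_carrier V2 ==> y:vs_carrier V2 ==> Ps (vs_add V2 x y) = vs_add V3 (Ps x) (Ps y)"
 "!!c x. x:vs_carrier V2 ==> Ps (vs_scale V2 c x) = vs_scale V3 c (Ps x)" using assms(2) unfolding vs_iso_def by blast
 have "Ph x:vs_carrier V2" if "x:vs_carrier V1" for x using that Ph(1) by (auto simp: bij_betw_def)
 thus ?thesis unfolding vs_iso_def by (intro exI[of _ "Ps o Ph"] conjI ballI allI bij_betw_trans[OF Ph(1) Ps(1)]) (simp_all add: Ph Ps)
qed

section \<open>The boundary of the bundle\<close>

lemma (in atlas) cmap_continuous: "c:M ==> continuous_map (subtopology (mtop M) (cdom c)) euclidean (cmap c)" unfolding continuous_map_def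
proof (intro conjI allI impI)
 fix U :: "rvec set" assume c: "c:M" and "openin euclidean U"
 hence "ropen (cim c) (cim c Int U)" by (simp add: openin_open_Int)
 from chart_openI[OF c this] show "openin (subtopology (mtop M) (cdom c)) {x:topspace (subtopology (mtop M) (cdom c)). cmap c x:U}"
 using c by (intro openin_subtopology[THEN iffD2] exI conjI) (auto simp: tsp car_def)
qed auto

lemma (in atlas) tube:
 assumes W: "mopen (lmfd M) W" and p: "p:car M" "{p} \<times> {a..b} <= W"
 obtains V where "mopen M V" "p:V" "V \<times> {a..b} <= W"
proof -
 obtain c where c: "c:M" "p:cdom c" using p(1) by (auto simp: car_def)
 interpret L: atlas "lmfd M" by standard (rule latlas)
 let ?n = "cdim c" and ?l = "lchart c"
 have l: "?l:lmfd M" using c by (simp add: lmfd_def)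
 have o: "ropen (cim ?l) (cmap ?l ` (W Int cdom ?l))" by (rule L.open_chart[OF W l])
 have "EX dl>0. cube (Suc ?n) ((cmap c p)(?n := t)) dl Int cim ?l <= cmap ?l ` (W Int cdom ?l)" if "t:{a..b}" for t
 proof (rule openin_cubeD[OF o])
 show "cim ?l <= Rn (Suc ?n)" using L.cim_Rn[OF l] by simp
 show "(cmap c p)(?n := t):cmap ?l ` (W Int cdom ?l)" by (rule image_eqI[of _ _ "(p, t)"]) (use p(2) that c in auto)
 qed
 then obtain dl where d: "!!t. t:{a..b} ==> dl t > 0 & cube (Suc ?n) ((cmap c p)(?n := t)) (dl t) Int cim ?l <= cmap ?l ` (W Int cdom ?l)"
 by metis
 have cov: "{a..b} <= (\<Union>t\<in>{a..b}. {t - dl t<..<t + dl t})" using d by fastforce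
 obtain C where C: "C <= {a..b}" "finite C" "{a..b} <= (\<Union>t\<in>C. {t - dl t<..<t + dl t})"
 by (rule compactE_image[OF compact_Icc[of a b] _ cov]) auto
 define ep where "ep = Min (insert 1 (dl ` C))"
 have e: "ep > 0" "!!t. t:C ==> ep <= dl t" using C d unfolding ep_def by (auto simp: subset_iff)
 define V where "V = {q:cdom c. cmap c q:cim c Int {y. ALL i<?n. \<bar>y i - cmap c p i\<bar> < ep}}"
 have "mopen M V" unfolding V_def by (intro chart_openI[OF c(1)] openin_open_Int open_box)
 moreover have "p:V" using c e by (simp add: V_def)
 moreover have "V \<times> {a..b} <= W"
 proof clarify
 fix q s assume q: "q:V" and s: "s:{a..b}"
 obtain t where t: "t:C" "\<bar>s - t\<bar> < dl t" using C(3) s by (auto simp: abs_less_iff)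
 have qc: "q:cdom c" using q by (simp add: V_def)
 have "cmap ?l (q, s):cube (Suc ?n) ((cmap c p)(?n := t)) (dl t) Int cim ?l"
 proof -
 have "\<bar>cmap c q i - cmap c p i\<bar> < dl t" if "i < ?n" for i using q e(2)[OF t(1)] that by (force simp: V_def)
 thus ?thesis using t(2) cmap_line_mem[OF qc, of s] cmap_Rn[OF c(1) qc] by (auto simp: cube_def Rn_iff)
 qed
 hence "cmap ?l (q, s):cmap ?l ` (W Int cdom ?l)" using d C(1) t(1) by blast
 then obtain r where r: "r:W" "r:cdom ?l" "cmap ?l r = cmap ?l (q, s)" by auto
 hence "r = (q, s)" using inj_onD[OF L.inj[OF l] r(3,2)] qc by simp
 thus "(q, s):W" using r by simp
 qed
 ultimately show ?thesis using that by blast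
qed

lemma (in bmfd) boundary_open:
 assumes "mopen M V"
 shows "mopen (bmf M) (V Int bdry M)"
proof -
 interpret BM: atlas2 "bmf M" M by standard (rule batlas)
 show ?thesis
 proof (rule BM.A.openin_mfdI)
 fix p assume p: "p:V Int bdry M"
 obtain U where "mopen (bmf M) U" "p:U" "id ` U <= V" using BM.smap_cont[OF smap_bincl assms] p by auto
 thus "EX A. mopen (bmf M) A & p:A & A <= V Int bdry M" using BM.A.opn_car bcar by (intro exI[of _ U]) auto
 qed (simp add: bcar)
qed

text \<open>A smooth retraction \<open>F\<close> of a neighbourhood \<open>N\<close> of the boundary extends forms from the boundary.\<close>

lemma (in bmfd) extend_form:
 assumes F: "smaps M M (car M) F" and N: "mopen M N" "F ` N <= bdry M" "bdry M <= N"
 and Fb: "!!p. p:bdry M ==> F p = p" and h: "!!p. p:car M ==> sfn M p h" "!!p. p:bdry M ==> h p = 1"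
 and K: "closedin (mtop M) K" "K <= N" "!!p. h p ~= 0 ==> p:K" and w: "om:forms (bmf M) k"
 shows "EX om':forms M k. pb (bmf M) M id om' = om"
proof -
 let ?B = "bmf M"
 interpret B: atlas ?B by standard (rule batlas)
 have bo: "mopen ?B (bdry M)" using B.open_car bcar by simp
 have wf: "fo ?B (bdry M) k om" using B.fo_car[OF w] bcar by simp
 have FN: "smaps M ?B N F" by (rule smaps_bfactor[OF atlas smaps_subset[OF F N(1) opn_car[OF N(1)]] N(2)])
 define et where "et = pb M ?B F om"
 have et: "fo M N k et" unfolding et_def by (rule pb_fo[OF atlas batlas FN wf bo]) (use N(2) in blast)
 have het: "fo M N k (fmul h et)" by (rule fo_fmul[OF et h(1)]) (use opn_car[OF N(1)] in blast)
 have "fo M (car M - K) k (fmul h et)"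
 proof (rule fo_zero'[OF openin_diff[OF open_car K(1)]])
 fix p c assume p: "p:car M - K" "c:M" "p:cdom c"
 hence "h p = 0" using K(3) by blast
 thus "fmul h et c (cmap c p) = 0" using p by (simp add: fmul_def zfun_def)
 qed
 hence "fo M (car M) k (fmul h et)" by (rule fo_mono[OF fo_Un[OF het]]) (use K(2) in blast)
 hence form: "fmul h et:forms M k" unfolding et_def by (intro formsI zero_out_fmul pb_zo)
 have "agree ?B (bdry M) (pb ?B M id (fmul h et)) (pb ?B M id et)"
proof (rule agreeI)
 fix p c vs assume p: "p:bdry M" and c: "c:?B" "p:cdom c"
 show "pb ?B M id (fmul h et) c (cmap c p) vs = pb ?B M id et c (cmap c p) vs"
 proof (cases "set vs <= Rn (cdim c)")
 case True
 obtain d where d: "d:M" "p:cdom d" using p bdry_car by (auto simp: car_def)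
 note e = pb_eq[OF batlas atlas smaps_bincl _ _ p c d(1) _ True]
 have pN: "p:N" using p N by blast
 show ?thesis using e[OF het] e[OF et] pN d h(2)[OF p] by (simp add: fmul_def)
 qed (simp add: pb_def)
 qed
 moreover have "agree ?B (bdry M) (pb ?B M id et) (pb ?B ?B (%p. F (id p)) om)"
 unfolding et_def by (rule pb_compose[OF batlas atlas batlas smaps_bincl FN wf bo]) (use N in auto)
 moreover have "agree ?B (bdry M) (pb ?B ?B id om) (pb ?B ?B (%p. F (id p)) om)"
 by (rule pb_cong[OF batlas batlas smaps_id[OF batlas bo]]) (simp add: Fb)
 ultimately have "agree ?B (car ?B) (pb ?B M id (fmul h et)) om" using pb_id[OF batlas bo wf] unfolding bcar agree_def by simp
 from agree_eq[OF this pb_zo B.forms_zo[OF w]] show ?thesis using form by blast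
qed

lemma rb_simps [simp]:
 "proj (restrict_bundle E A) = proj E" "vadd (restrict_bundle E A) = vadd E" "vscale (restrict_bundle E A) = vscale E"
 "total (restrict_bundle E A) = {w:total E. proj E w:A}" "trivs (restrict_bundle E A) = (%t. t\<lparr>tdom := tdom t Int A\<rparr>) ` trivs E"
 "ray (restrict_bundle E A) = ray E" "sphere_proj (restrict_bundle E A) = sphere_proj E" "radial_proj (restrict_bundle E A) = radial_proj E"
 by (simp_all add: restrict_bundle_def ray_def sphere_proj_def radial_proj_def fun_eq_iff split: sum.split)

lemma restrict_nonzero: "nonzero (restrict_bundle E A) = {w:nonzero E. proj E w:A}" by (auto simp: nonzero_def)

context vbun
begin

abbreviation "EB \<equiv> restrict_bundle E (bdry M)"

lemma boundary_total: "total_mfd (bmf M) EB = bmf T"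
proof -
 have *: "total_chart EB (bchart M c) (t\<lparr>tdom := tdom t Int bdry M\<rparr>) = bchart T (tch c t)" if c: "c:M" "ccor c = 1" for c t
 proof -
 have "cdim c > 0" using atlas c by (force simp: atl_def)
 thus ?thesis by (auto simp: bchart_def total_chart_def T_bdry append_vec_def fun_eq_iff)
 qed
 show ?thesis
 proof (intro equalityI subsetI)
 fix e assume "e:total_mfd (bmf M) EB"
 then obtain c t where e: "c:M" "ccor c = 1" "t:tE" "e = total_chart EB (bchart M c) (t\<lparr>tdom := tdom t Int bdry M\<rparr>)"
 unfolding tot_def bmf_eq by auto
 thus "e:bmf T" unfolding bmf_eq e(4) *[OF e(1,2)] by (intro CollectI exI[of _ "tch c t"]) (auto simp: T_chart)
 next
 fix e assume "e:bmf T"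
 then obtain d where d: "d:T" "ccor d = 1" "e = bchart T d" unfolding bmf_eq[of T] by blast
 then obtain c t where e: "c:M" "ccor c = 1" "t:tE" "e = bchart T (tch c t)" unfolding tot_def[of M E] by force
 thus "e:total_mfd (bmf M) EB" unfolding tot_def[of "bmf M"] e(4) *[OF e(1,2), symmetric]
 by (intro CollectI exI[of _ "bchart M c"] exI[of _ "t\<lparr>tdom := tdom t Int bdry M\<rparr>"]) (auto simp: bmf_eq)
 qed
qed

lemma S_bdry: "bdry SS = {R:car SS. sphere_proj E R:bdry M}"
proof -
 have "R:bdry SS <-> sphere_proj E R:bdry M" if R: "R:car SS" for R
 proof -
 obtain c t j sg where c: "c:M" "t:tE" "j < trank t" "sg = 1 | sg = -1" "R:cdom (sch c t j sg)"
 "sch c t j sg:SS" using R by (rule S_chart_at)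
 have n: "ccor c = 1 ==> 0 < cdim c" using atlas c(1) by (force simp: atl_def)
 have sc: "sphere_proj E R:cdom c" using c(5) by (simp add: sch_def)
 have "cmap (sch c t j sg) R 0 = cmap c (sphere_proj E R) 0" if "ccor c = 1" using n[OF that] by (simp add: sch_def)
 thus ?thesis unfolding bmfd.bdry_iff[OF S_bmfd c(6,5)] bdry_iff[OF c(1) sc] by auto
 qed
 thus ?thesis using bmfd.bdry_car[OF S_bmfd] by blast
qed

lemma boundary_sphere: "sphere_mfd (bmf M) EB = bmf SS"
proof -
 have *: "sphere_chart EB (bchart M c) (t\<lparr>tdom := tdom t Int bdry M\<rparr>) j sg = bchart SS (sch c t j sg)"
 if c: "c:M" "ccor c = 1" "j < trank t" for c t j sg
 proof -
 have n: "cdim c > 0" using atlas c by (force simp: atl_def)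
 have "{R:ray E ` {w:NE. PE w:bdry M}. sphere_proj E R:A} = {R:ray E ` NE. sphere_proj E R:A} Int bdry SS" if "A <= bdry M" for A
 using that nz_total unfolding S_bdry S_carrier by auto
 thus ?thesis using n c(3) unfolding bchart_def sch_def restrict_nonzero rb_simps
 by (auto simp: S_bdry S_carrier append_vec_def fun_eq_iff nz_total)
 qed
 show ?thesis
 proof (intro equalityI subsetI)
 fix e assume "e:sphere_mfd (bmf M) EB"
 then obtain c t j sg where e: "c:M" "ccor c = 1" "t:tE" "j < trank t" "sg:{1, -1}"
 "e = sphere_chart EB (bchart M c) (t\<lparr>tdom := tdom t Int bdry M\<rparr>) j sg" unfolding sphere_mfd_def bmf_eq rb_simps by fastforce
 moreover have "sch c t j sg:SS" using e unfolding sphere_mfd_def by blast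
 ultimately show "e:bmf SS" unfolding bmf_eq e(6) *[OF e(1,2,4)] by (intro CollectI exI[of _ "sch c t j sg"]) simp
 next
 fix e assume "e:bmf SS"
 then obtain c t j sg where e: "c:M" "ccor c = 1" "t:tE" "j < trank t" "sg:{1, -1}" "e = bchart SS (sch c t j sg)"
 proof -
 obtain d where d: "d:SS" "ccor d = 1" "e = bchart SS d" using `e:bmf SS` unfolding bmf_eq[of SS] by blast
 show ?thesis by (rule SS_chartE[OF d(1)]) (use d that in auto)
 qed
 thus "e:sphere_mfd (bmf M) EB" unfolding sphere_mfd_def[of "bmf M"] e(6) *[OF e(1,2,4), symmetric]
 by (intro CollectI exI[of _ "bchart M c"] exI[of _ "t\<lparr>tdom := tdom t Int bdry M\<rparr>"] exI[of _ j] exI[of _ sg]) (auto simp: bmf_eq)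
 qed
qed

lemma boundary_bundle: "vector_bundle (bmf M) EB"
proof -
 have f: "fibre EB p = fibre E p" if "p:bdry M" for p using that by (auto simp: fibre_def)
 have o: "mopen (bmf M) (tdom t Int bdry M)" if "t:tE" for t by (rule boundary_open[OF tdom_open[OF that]])
 have u: "(\<Union>t\<in>tE. tdom t Int bdry M) = bdry M" using triv_ex bdry_car by blast
 have "bij_betw (tmap t) (fibre E p) (Rn (trank t)) &
 (ALL v:fibre E p. ALL w:fibre E p. vadd E v w:fibre E p & tmap t (vadd E v w) = tmap t v + tmap t w) &
 (ALL a. ALL v:fibre E p. vE a v:fibre E p & tmap t (vE a v) = a *R tmap t v)" if "t:tE" "p:tdom t" for t p
 using vb that unfolding vb_def by (elim conjE) (drule (1) bspec, drule (1) bspec, assumption)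
 thus ?thesis unfolding vb_def rb_simps boundary_total bcar using f o u TB.batlas by (auto simp del: rb_simps)
qed

lemma boundary_bmfd: "bmfd (bmf M)" by standard (rule batlas, auto simp: bmf_eq)

lemma interior_total: "interior_total M E = restrict_mfd T {w:TE. PE w:interior_pts M}"
proof -
 let ?A = "interior_pts M" and ?A' = "{w:TE. PE w:interior_pts M}"
 have *: "total_chart (restrict_bundle E ?A) (c\<lparr>cdom := cdom c Int ?A\<rparr>) (t\<lparr>tdom := tdom t Int ?A\<rparr>) = (tch c t)\<lparr>cdom := cdom (tch c t) Int ?A'\<rparr>" for c t
 by (auto simp: total_chart_def)
 show ?thesis
 proof (intro equalityI subsetI)
 fix e assume "e:interior_total M E"
 then obtain c t where e: "c:M" "t:tE" "e = total_chart (restrict_bundle E ?A) (c\<lparr>cdom := cdom c Int ?A\<rparr>) (t\<lparr>tdom := tdom t Int ?A\<rparr>)"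
 unfolding interior_total_def tot_def rm_def rb_simps by blast
 thus "e:restrict_mfd T ?A'" unfolding e(3) * rm_def by (intro imageI T_chart)
 next
 fix e assume "e:restrict_mfd T ?A'"
 then obtain c t where e: "c:M" "t:tE" "e = (tch c t)\<lparr>cdom := cdom (tch c t) Int ?A'\<rparr>" by (auto simp: tot_def rm_def)
 thus "e:interior_total M E" unfolding e(3) *[symmetric] interior_total_def tot_def rm_def rb_simps
 by (intro CollectI exI[of _ "c\<lparr>cdom := cdom c Int ?A\<rparr>"] exI[of _ "t\<lparr>tdom := tdom t Int ?A\<rparr>"] conjI refl imageI)
 qed
qed

end

lemma (in vmet) boundary_vmet: "vmet (bmf M) EB g"
proof -
 interpret B: vbun "bmf M" EB by (intro vbun.intro boundary_bmfd vbun_axioms.intro boundary_bundle)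
 show ?thesis
 proof standard
 fix w assume w: "w:total EB"
 hence wb: "w:bdry T" by (simp add: T_bdry)
 interpret BT: atlas2 "bmf T" T by standard (rule TB.batlas)
 have "sfn (bmf T) w (%q. g (id q))" by (rule BT.sfn_compose[OF TB.smap_bincl[OF wb]]) (use w g_smooth in simp)
 thus "sfn (total_mfd (bmf M) EB) w g" unfolding boundary_total by simp
 qed (auto simp: g_scale g_pos restrict_nonzero)
qed

section \<open>Smooth maps between manifolds\<close>

definition smo :: "'a chart set => 'b chart set => ('a => 'b) => bool" where
 "smo M N f <-> atl M & atl N & smaps M N (car M) f"

lemma smoD: "smo M N f ==> atl M" "smo M N f ==> atl N" "smo M N f ==> smaps M N (car M) f" by (auto simp: smo_def)

lemma smoI: "atl M ==> atl N ==> (!!p. p:car M ==> smap M N p f) ==> smo M N f"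
 by (simp add: smo_def smaps_def atlas.open_car[OF atlas.intro])

lemma sm_car: "smo M N f ==> p:car M ==> f p:car N" using atlas2.smap_car[of M N] by (simp add: smo_def smaps_def atlas2_def atlas_def)

lemma sm_id: "atl M ==> smo M M (%p. p)" by (intro smoI smap_id)

lemma sm_comp:
 assumes f: "smo M N f" and g: "smo N P g"
 shows "smo M P (%p. g (f p))" using smaps_compose[OF smoD(1)[OF f] smoD(1,2)[OF g] smoD(3)[OF f] smoD(3)[OF g] sm_car[OF f]] f g
 by (simp add: smo_def)

lemma sm_pair:
 assumes f: "smo M N f"
 shows "smo M (lmfd N) (%p. (f p, t))" using f smap_into_line[of M N _ f "%_. t"] atlas.sfn_const[OF atlas.intro, of M]
 by (intro smoI) (auto simp: smo_def smaps_def intro: atlas.latlas atlas.intro)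

lemma sm_lmap:
 assumes f: "smo M N f"
 shows "smo (lmfd M) (lmfd N) (%q. (f (fst q), snd q))" using smaps_lmap[OF smoD[OF f]] f atlas.lcar[OF atlas.intro, of M]
 by (auto simp: smo_def intro: atlas.latlas atlas.intro)

lemma sm_slice: "smo (lmfd M) N H ==> atl M ==> smo M N (%p. H (p, t))" using sm_comp[OF sm_pair[OF sm_id]] by blast

lemma sm_preimage:
 assumes f: "smo M N f" and V: "mopen N V"
 shows "mopen M {p:car M. f p:V}"
proof -
 interpret atlas2 M N using smoD[OF f] by unfold_locales
 show ?thesis
 proof (rule A.openin_mfdI)
 fix p assume p: "p:{p:car M. f p:V}"
 then obtain A where "mopen M A" "p:A" "f ` A <= V" using smap_cont[OF smapsD[OF smoD(3)[OF f]] V] by blast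
 thus "EX A. mopen M A & p:A & A <= {p:car M. f p:V}" using A.opn_car by (intro exI[of _ A]) auto
 qed auto
qed

lemma carrier_fo: "atl M ==> om:forms M k ==> fo M (car M) k om" by (rule atlas.fo_car[OF atlas.intro])

lemma car_opn: "atl M ==> mopen M (car M)" by (rule atlas.open_car[OF atlas.intro])

lemma pull_forms:
 assumes f: "smo M N f" and w: "om:forms N k"
 shows "pb M N f om:forms M k" using pb_fo[OF smoD[OF f] carrier_fo[OF smoD(2)[OF f] w] car_opn[OF smoD(2)[OF f]] sm_car[OF f]]
 by (intro atlas.formsI atlas.intro smoD(1)[OF f] pb_zo)

lemma pull_d:
 assumes f: "smo M N f" and w: "om:forms N k"
 shows "ext_d M (pb M N f om) = pb M N f (ext_d N om)"
 using ext_d_pb[OF smoD[OF f] carrier_fo[OF smoD(2)[OF f] w] car_opn[OF smoD(2)[OF f]] sm_car[OF f]]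
 by (rule agree_eq) (assumption | rule ext_d_zero_out pb_zo)+

lemma pull_comp:
 assumes f: "smo M N f" and g: "smo N P g" and w: "om:forms P k"
 shows "pb M N f (pb N P g om) = pb M P (%p. g (f p)) om" using pb_compose[OF smoD(1)[OF f] smoD(1,2)[OF g] smoD(3)[OF f] smoD(3)[OF g]
 carrier_fo[OF smoD(2)[OF g] w] car_opn[OF smoD(2)[OF g]] sm_car[OF f] sm_car[OF g]] by (rule agree_eq) (assumption | rule pb_zo)+

lemma pull_cong:
 assumes f: "smo M N f" and e: "!!p. p:car M ==> f p = f' p"
 shows "pb M N f om = pb M N f' om" using pb_cong[OF smoD[OF f] e] by (rule agree_eq) (assumption | rule pb_zo)+

lemma pull_idf:
 assumes M: "atl M" and e: "!!p. p:car M ==> f p = p" and w: "om:forms M k"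
 shows "pb M M f om = om"
proof -
 have "pb M M id om = om" using pb_id[OF M car_opn[OF M] carrier_fo[OF M w]]
 by (rule agree_eq) (use w atlas.forms_zo[OF atlas.intro[OF M]] pb_zo in blast)+
 thus ?thesis using pull_cong[OF sm_id[OF M], of f om] e by (simp add: id_def)
qed

lemma pull_agree:
 assumes M: "atl M" and a: "agree N E om om'" and f: "!!p. p:D ==> f p:E Int car N"
 shows "agree M D (pb M N f om) (pb M N f om')"
proof (rule agreeI)
 interpret atlas M by standard (rule M)
 fix p c vs assume p: "p:D" and c: "c:M" "p:cdom c"
 have "EX d. d:N & f p:cdom d" using f[OF p] by (auto simp: car_def)
 hence "(SOME d. d:N & f p:cdom d):N & f p:cdom (SOME d. d:N & f p:cdom d)" by (rule someI_ex)
 thus "pb M N f om c (cmap c p) vs = pb M N f om' c (cmap c p) vs"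
 using agreeD[OF a, of "f p"] f[OF p] c by (simp add: pb_def Let_def lrep_def)
qed

lemma hop_map_forms:
 assumes "smo (lmfd M) N H" "atl M" "om:forms N k" "a <= b"
 shows "hop_map M N (car M) (car N) H om k a b" using assms smoD[OF assms(1)] sm_car[OF assms(1)] atlas.lcar[OF atlas.intro, of M]
 by unfold_locales (auto simp: car_opn carrier_fo)

lemma hop_forms:
 assumes "smo (lmfd M) N H" "atl M" "om:forms N k" "a <= b"
 shows "hop M N H a b om:forms M (k - 1)"
 using hop_map.hop_fo[OF hop_map_forms[OF assms]] by (intro atlas.formsI atlas.intro assms hop_zero_out)

lemma hop_d:
 assumes "smo (lmfd M) N H" "atl M" "om:forms N k" "a <= b"
 shows "ext_d M (hop M N H a b om) = pb M N (%p. H (p, b)) om - pb M N (%p. H (p, a)) om - hop M N H a b (ext_d N om)"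
proof -
 have "ext_d M (hop M N H a b om) + hop M N H a b (ext_d N om) = pb M N (%p. H (p, b)) om - pb M N (%p. H (p, a)) om"
 using hop_map.hop_formula[OF hop_map_forms[OF assms]]
 by (rule agree_eq) (intro atlas.zero_out_add[OF atlas.intro[OF assms(2)]] atlas.zero_out_diff[OF atlas.intro[OF assms(2)]] ext_d_zero_out hop_zero_out pb_zo)+
 thus ?thesis by (simp add: eq_diff_eq)
qed

lemma hop_cong_local:
 assumes M: "atl M" "atl N" and D: "mopen M D" and H: "smaps (lmfd M) N (D \<times> UNIV) H"
 and e: "!!p t. p:D ==> H (p, t) = H' (p, t)"
 shows "agree M D (hop M N H a b om) (hop M N H' a b om)"
proof (rule agreeI)
 interpret atlas M by standard (rule M)
 fix p c vs assume p: "p:D" "c:M" "p:cdom c"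
 have "agree (lmfd M) (D \<times> UNIV) (pb (lmfd M) N H om) (pb (lmfd M) N H' om)" by (rule pb_cong[OF latlas M(2) H]) (use e in auto)
 from agreeD[OF this, of "(p, t)" "lchart c" for t] p
 have "pb (lmfd M) N H om (lchart c) ((cmap c p)(cdim c := t)) = pb (lmfd M) N H' om (lchart c) ((cmap c p)(cdim c := t))" for t
 by (simp add: lmfd_def)
 thus "hop M N H a b om c (cmap c p) vs = hop M N H' a b om c (cmap c p) vs" by (simp add: hop_def)
qed

lemma hop_cong:
 assumes H: "smo (lmfd M) N H" and M: "atl M" and e: "!!p t. p:car M ==> H (p, t) = H' (p, t)"
 shows "hop M N H a b om = hop M N H' a b om"
 using hop_cong_local[OF M smoD(2)[OF H] car_opn[OF M], of H H'] smoD(3)[OF H] e atlas.lcar[OF atlas.intro[OF M]]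
 by (intro agree_eq[OF _ hop_zero_out hop_zero_out]) simp

lemma smaps_continuous:
 assumes M: "atl M" "atl N" and f: "smaps M N D f"
 shows "continuous_map (subtopology (mtop M) D) (mtop N) f" unfolding continuous_map_def
proof (intro conjI allI impI)
 interpret atlas2 M N by standard (rule M)+
 have D: "D <= car M" by (rule A.opn_car[OF smaps_open[OF f]])
 show "f:topspace (subtopology (mtop M) D) \<rightarrow> topspace (mtop N)" using smap_car smapsD[OF f] by (auto simp: A.tsp B.tsp)
 fix V assume V: "mopen N V"
 have "mopen M {p:D. f p:V}"
 proof (rule A.openin_mfdI)
 fix p assume p: "p:{p:D. f p:V}"
 then obtain U where U: "mopen M U" "p:U" "f ` U <= V" using smap_cont[OF smapsD[OF f] V] by blast
 thus "EX A. mopen M A & p:A & A <= {p:D. f p:V}" using p openin_Int[OF U(1) smaps_open[OF f]] by (intro exI[of _ "U Int D"]) auto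
 qed (use D in auto)
 thus "openin (subtopology (mtop M) D) {x:topspace (subtopology (mtop M) D). f x:V}"
 using D by (intro openin_subtopology[THEN iffD2] exI[of _ "{p:D. f p:V}"]) (auto simp: A.tsp)
qed

lemma hop_src:
 assumes H: "smo (lmfd M) N H" and f: "smo M' M f" and w: "om:forms N k" and ab: "a <= b"
 shows "pb M' M f (hop M N H a b om) = hop M' N (%q. H (f (fst q), snd q)) a b om"
 using hop_map.hop_pb_source[OF hop_map_forms[OF H smoD(2)[OF f] w ab] smoD(1)[OF f] smoD(3)[OF f] sm_car[OF f], THEN agree_sym]
 by (rule agree_eq) (assumption | rule pb_zo hop_zero_out)+

lemma hop_tgt:
 assumes H: "smo (lmfd M) N H" and M: "atl M" and g: "smo N P g" and w: "om:forms P k"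
 shows "hop M N H a b (pb N P g om) = hop M P (%q. g (H q)) a b om"
 using hop_pb_target[OF M smoD(1,2)[OF g] car_opn[OF M] _ smoD(3)[OF g] carrier_fo[OF smoD(2)[OF g] w] car_opn[OF smoD(2)[OF g]]
 _ sm_car[OF g]] smoD(3)[OF H] sm_car[OF H] atlas.lcar[OF atlas.intro[OF M]] by (intro agree_eq[OF _ hop_zero_out hop_zero_out]) auto

lemma hop_constant:
 assumes H: "smo (lmfd M) N H" and M: "atl M" and w: "om:forms N k" and ab: "a <= b"
 and c: "!!p t. p:car M ==> H (p, t) = f p"
 shows "hop M N H a b om = 0"
proof -
 have "smap M N p f" if p: "p:car M" for p
 using atlas2.smap_cong[OF _ smapsD[OF smoD(3)[OF sm_slice[OF H M, of 0]] p] car_opn[OF M] p] c M smoD(2)[OF H]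
 by (simp add: atlas2_def atlas_def)
 hence f: "smaps M N (car M) f" by (simp add: smaps_def car_opn[OF M])
 from hop_map.hop_const[OF hop_map_forms[OF H M w ab] c f] show ?thesis
 by (rule agree_eq) (simp_all add: hop_zero_out atlas.zero_out_0[OF atlas.intro[OF M]])
qed

lemma hop_uminus: "hop M N H a b (- om) = - hop M N H a b om" by (simp add: hop_def pb_uminus fun_eq_iff)

lemma hop_0: "hop M N H a b 0 = 0" by (simp add: hop_def pb_0 fun_eq_iff)

lemma hop_local:
 assumes H: "smo (lmfd M) N H" and M: "atl M" and D: "mopen M D" and e: "agree N E om om'"
 and HE: "!!p t. p:D ==> t:{a..b} ==> H (p, t):E"
 shows "agree M D (hop M N H a b om) (hop M N H a b om')"
proof (rule hop_agree[where E = E])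
 interpret atlas M by standard (rule M)
 show "smaps (lmfd M) N (D \<times> UNIV) H" by (rule smaps_subset[OF smoD(3)[OF H] line_openI[OF D]]) (use opn_car[OF D] lcar in auto)
qed (use assms smoD(2)[OF H] in auto)

lemma (in atlas) ext_d_zero: "mopen M D ==> agree M D om 0 ==> agree M D (ext_d M om) 0"
 using ext_d_agree[of D om 0] d_cmult[OF forms_0, of 0] by simp

context bmfd
begin

lemma sm_bincl: "smo (bmf M) M (%p. p)" using smap_bincl by (intro smoI batlas atlas) (auto simp: bcar id_def)

lemma pull_bincl: "pb (bmf M) M id = pb (bmf M) M (%p. p)" by (simp add: id_def)

lemma push_kill:
 assumes f: "smo M M f" and N: "mopen M N" "f ` N <= bdry M" and u: "u:forms M k"
 and i: "pb (bmf M) M id u = 0"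
 shows "agree M N (pb M M f u) 0"
proof -
 have s: "smaps M (bmf M) N f" by (rule smaps_bfactor[OF atlas smaps_subset[OF smoD(3)[OF f] N(1) opn_car[OF N(1)]] N(2)])
 have "agree M N (pb M (bmf M) f (pb (bmf M) M id u)) (pb M M (%p. id (f p)) u)"
 by (rule pb_compose[OF atlas batlas atlas s smaps_bincl fo_car[OF u] open_car]) (use N(2) bdry_car in auto)
 thus ?thesis by (simp add: i pb_0 agree_sym)
qed

lemma hop_bdry:
 assumes F: "smo (lmfd M) M F" and b: "!!p t. p:bdry M ==> F (p, t) = p" and u: "u:forms M k" and ab: "a <= b"
 shows "pb (bmf M) M id (hop M M F a b u) = 0"
proof -
 have "pb (bmf M) M id (hop M M F a b u) = hop (bmf M) M (%q. F (fst q, snd q)) a b u"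
 unfolding pull_bincl by (rule hop_src[OF F sm_bincl u ab])
 also have "\<dots> = 0" by (rule hop_constant[OF sm_comp[OF sm_lmap[OF sm_bincl] F] batlas u ab, of id]) (simp add: b bcar)
 finally show ?thesis .
qed

end

section \<open>Complexes\<close>

locale cplx =
 fixes C :: "int => 'v::real_vector set" and d :: "'v => 'v"
 assumes C: "subspace (C k)" and add: "x:C k ==> y:C k ==> d (x + y) = d x + d y" and sc: "x:C k ==> d (c *R x) = c *R d x"
 and dC: "x:C k ==> d x:C (k + 1)" and dd: "x:C k ==> d (d x) = 0"
begin

lemma d_0: "d 0 = 0" using sc[OF subspace_0[OF C], of 0] by simp

lemma Z_sub: "subspace {z:C k. d z = 0}" using C[of k] add sc d_0 by (auto simp: subspace_def)

lemma B_sub: "subspace (d ` C k)" unfolding subspace_def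
proof (intro conjI ballI allI)
 show "0:d ` C k" using d_0 subspace_0[OF C] by (metis imageI)
 fix x assume "x:d ` C k"
 then obtain a where a: "a:C k" "x = d a" by blast
 show "c *R x:d ` C k" for c using sc[OF a(1), of c] subspace_scale[OF C a(1)] a(2) by (metis imageI)
 fix y assume "y:d ` C k"
 then obtain b where b: "b:C k" "y = d b" by blast
 show "x + y:d ` C k" using add[OF a(1) b(1)] subspace_add[OF C a(1) b(1)] a(2) b(2) by (metis imageI)
qed

lemma B_Z: "d ` C (k - 1) <= {z:C k. d z = 0}" using dC[of _ "k - 1"] dd by auto

lemma closed: "vs_closed (cohomology C d k)" unfolding cohomology_quot by (rule quot_closed[OF Z_sub B_sub])

end

lemma cohomology_iso:
 assumes C: "cplx C d" and C': "cplx C' d'" and Z: "!!z. z:C k ==> d z = 0 ==> ph z:C' k & d' (ph z) = 0"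
 and add: "!!x y. x:C k ==> y:C k ==> ph (x + y) = ph x + ph y" and sc: "!!x c. x:C k ==> ph (c *R x) = c *R ph x"
 and B: "!!x. x:C (k - 1) ==> ph (d x):d' ` C' (k - 1)"
 and inj: "!!z y. z:C k ==> d z = 0 ==> y:C' (k - 1) ==> ph z = d' y ==> z:d ` C (k - 1)"
 and surj: "!!z'. z':C' k ==> d' z' = 0 ==> EX z:C k. d z = 0 & z' - ph z:d' ` C' (k - 1)"
 shows "vs_iso (cohomology C d k) (cohomology C' d' k)" unfolding cohomology_quot
 by (rule quot_iso[OF cplx.Z_sub[OF C] cplx.B_sub[OF C] cplx.B_sub[OF C'] cplx.B_Z[OF C], where ph = ph])
 (use Z add sc B inj surj in "blast+")

section \<open>Reduction to cochains vanishing near the boundary\<close>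

locale pushed = hmfd M + vmet M E g for M :: "'a chart set" and E :: "('a, 'w) vbundle" and g +
 fixes F :: "'w \<times> real => 'w" and N h K
 assumes F: "hvbun.push M E F" and N: "mopen M N" "bdry M <= N"
 and FN: "!!w. w:TE ==> PE w:N ==> PE (F (w, pi / 2)):bdry M"
 and h: "!!q. q:car M ==> sfn M q h" "!!q. q:bdry M ==> h q = 1"
 and K: "closedin (mtop M) K" "K <= N" "!!q. h q ~= 0 ==> q:K"
begin

sublocale hvbun M E ..
sublocale SB: bmfd SS by (rule S_bmfd)
sublocale B: vmet "bmf M" EB g by (rule boundary_vmet)

abbreviation "BM \<equiv> bmf M"
abbreviation "CS \<equiv> bmf SS"
abbreviation "RC \<equiv> radial_compactification BM EB"
abbreviation "sp \<equiv> sphere_proj E"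
abbreviation "rp \<equiv> radial_proj E"

definition FX :: "'a \<times> real => 'a" where "FX q = PE (F (zsec (fst q), snd q))"
definition FS :: "'w set \<times> real => 'w set" where "FS q = ray E (F (sig (fst q), snd q))"

lemma sm_proj: "smo T M (PE)" using smap_proj by (intro smoI T_atlas atlas) (simp add: T_car)
lemma sm_zsec: "smo M T zsec" using smap_zsec by (intro smoI T_atlas atlas)
lemma sm_sig: "smo SS T sig" using smap_sig by (intro smoI T_atlas S_atlas)
lemma sm_sp: "smo SS M sp" using smaps_sphere_proj by (simp add: smo_def S_atlas atlas)
lemma sm_F: "smo (lmfd T) T F" using pushD(1)[OF F] by (intro smoI TT.latlas T_atlas) (auto simp: TT.lcar T_car)
lemma sm_rp: "smo RC BM rp" using B.smaps_radial_proj by (simp add: smo_def B.RB_atlas batlas)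
lemma sm_z: "smo BM RC (%p. Inl (B.zsec p))" using B.smaps_zero by (simp add: smo_def B.RB_atlas batlas)
lemma sm_Inr: "smo CS RC Inr" using B.smaps_Inr by (simp add: smo_def B.RB_atlas boundary_sphere SB.batlas)
lemma sm_contr: "smo (lmfd RC) RC B.contr" using B.smaps_contr by (simp add: smo_def B.RB_atlas B.RR.latlas B.RR.lcar)

lemma sm_FX: "smo (lmfd M) M FX" using sm_comp[OF sm_comp[OF sm_lmap[OF sm_zsec] sm_F] sm_proj] unfolding FX_def .

lemma sm_FS: "smo (lmfd SS) SS FS"
proof (rule smoI[OF S.latlas S_atlas])
 fix q assume "q:car (lmfd SS)"
 hence q: "q:car SS \<times> UNIV" by (simp add: S.lcar)
 note s = sm_comp[OF sm_lmap[OF sm_sig] sm_F]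
 have "F (sig (fst q), snd q):NE" using q sig_props(1) pushD(5)[OF F nz_total] by auto
 thus "smap (lmfd SS) SS q FS" unfolding FS_def
 by (intro smap_compose[OF S.latlas T_atlas S_atlas _ smap_ray] smapsD[OF smoD(3)[OF s]]) (use q S.lcar in auto)
qed

lemma FX_props:
 assumes p: "p:car M"
 shows "FX (p, 0) = p" "p:bdry M ==> FX (p, t) = p" "p:N ==> FX (p, pi / 2):bdry M"
 using pushD(2,3)[OF F zsec(1)[OF p]] zsec[OF p] FN[OF zsec(1)[OF p]] by (auto simp: FX_def)

lemma FS_props:
 assumes R: "R:car SS"
 shows "FS (R, 0) = R" "R:bdry SS ==> FS (R, t) = R" "sp (FS (R, t)) = FX (sp R, t)" "sp R:N ==> FS (R, pi / 2):bdry SS"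
proof -
 note sg = sig_props[OF R] and st = nz_total[OF sig_props(1)[OF R]]
 have pc: "sp R:car M" using sm_car[OF sm_sp R] .
 show "FS (R, 0) = R" using pushD(2)[OF F st] sg by (simp add: FS_def)
 show "FS (R, t) = R" if "R:bdry SS" using pushD(3)[OF F st] sg that by (simp add: FS_def S_bdry)
 have "sp (FS (R, t)) = PE (F (sig R, t))" for t using push_total[OF F st] by (simp add: FS_def)
 also have "PE (F (sig R, t)) = FX (sp R, t)" for t using pushD(6)[OF F zsec(1)[OF pc] st, of t] zsec(2)[OF pc] sg(4) by (simp add: FX_def)
 finally show e: "sp (FS (R, t)) = FX (sp R, t)" for t .
 have "FS (R, t):car SS" for t by (rule sm_car[OF sm_FS]) (use R S.lcar in auto)
 thus "FS (R, pi / 2):bdry SS" if "sp R:N" using e[of "pi / 2"] FX_props(3)[OF pc that] by (simp add: S_bdry)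
qed

definition over :: "'a set => 'w set set" where "over A = {R:car SS. sp R:A}"

lemma over_open: "mopen M A ==> mopen SS (over A)" unfolding over_def by (rule sm_preimage[OF sm_sp])

definition near :: "'a form => 'w set form => bool" where
 "near u a <-> (EX A. mopen M A & bdry M <= A & agree M A u 0 & agree SS (over A) a 0)"

definition C0 :: "int => ('a, 'w) cochain set" where
 "C0 k = {(u, (a, b)). u:forms M k & a:forms SS (k - 1) & b = 0 & near u a}"

abbreviation D :: "('a, 'w) cochain => ('a, 'w) cochain" where "D \<equiv> cochain_D M E"
abbreviation CC :: "int => ('a, 'w) cochain set" where "CC \<equiv> cochains M E"

lemma CC_iff: "(u, (a, b)):CC k <-> u:forms M k & a:forms SS (k - 1) & b:forms RC (k - 1) & pb CS SS id a = pb CS RC Inr b"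
 by (simp add: cochains_def corner_mfd_def boundary_face_def boundary_sphere)

lemma D_eq: "D (u, (a, b)) = (ext_d M u, (- pb SS M sp u - ext_d SS a, - pb RC BM rp (pb BM M id u) - ext_d RC b))"
 by (simp add: cochain_D_def boundary_face_def)

lemma ext_d_0: "atl P ==> ext_d P 0 = 0" using atlas.d_cmult[OF atlas.intro atlas.forms_0[OF atlas.intro], of P 0] by simp

lemma D0: "D (u, (a, 0)) = (ext_d M u, (- pb SS M sp u - ext_d SS a, - pb RC BM rp (pb BM M id u)))" by (simp add: D_eq ext_d_0 B.RB_atlas)

lemma near_bdry:
 assumes "near u a"
 shows "pb BM M id u = 0" "pb CS SS id a = 0"
proof -
 obtain A where A: "bdry M <= A" "agree M A u 0" "agree SS (over A) a 0" using assms by (auto simp: near_def)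
 have "agree BM (car BM) (pb BM M id u) (pb BM M id 0)" by (rule pull_agree[OF batlas A(2)]) (use A(1) bdry_car bcar in auto)
 thus "pb BM M id u = 0" unfolding pb_0 by (rule agree_eq) (simp_all add: pb_zo B.zero_out_0)
 have "agree CS (car CS) (pb CS SS id a) (pb CS SS id 0)"
 by (rule pull_agree[OF SB.batlas A(3)]) (use A(1) in "auto simp: SB.bcar S_bdry over_def")
 thus "pb CS SS id a = 0" unfolding pb_0 by (rule agree_eq) (simp_all add: pb_zo atlas.zero_out_0[OF atlas.intro[OF SB.batlas]])
qed

lemma near_lin: "near u a ==> near u' a' ==> near (u + c *R u') (a + c *R a')"
proof -
 assume "near u a" "near u' a'"
 then obtain A A' where A: "mopen M A" "bdry M <= A" "agree M A u 0" "agree SS (over A) a 0"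
 "mopen M A'" "bdry M <= A'" "agree M A' u' 0" "agree SS (over A') a' 0" by (auto simp: near_def)
 thus ?thesis unfolding near_def by (intro exI[of _ "A Int A'"]) (auto simp: over_def agree_def sfun_def zfun_def plus_fun_def fun_eq_iff)
qed

lemma subspace_lin: "0:S ==> (!!x y c. x:S ==> y:S ==> x + c *R y:S) ==> subspace S" for S :: "'v::real_vector set"
 unfolding subspace_def by (metis add_0 scaleR_one)

lemma CC_sub: "subspace (CC k)"
proof (rule subspace_lin)
 show "0:CC k" by (simp add: zero_prod_def CC_iff forms_0 S.forms_0 B.RR.forms_0 pb_0)
 fix x y :: "('a, 'w) cochain" and c assume x: "x:CC k" and y: "y:CC k"
 obtain u a b u' a' b' where "x = (u, (a, b))" "y = (u', (a', b'))" by (metis prod.collapse)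
 thus "x + c *R y:CC k" using x y
 by (simp add: CC_iff forms_add forms_cmult S.forms_add S.forms_cmult B.RR.forms_add B.RR.forms_cmult pb_add pb_cmult)
qed

lemma D_lin:
 assumes x: "x:CC k" and y: "y:CC k"
 shows "D (x + y) = D x + D y" "D (c *R x) = c *R D x"
proof -
 obtain u a b u' a' b' where e: "x = (u, (a, b))" "y = (u', (a', b'))" by (metis prod.collapse)
 have f: "u:forms M k" "a:forms SS (k - 1)" "b:forms RC (k - 1)" "u':forms M k" "a':forms SS (k - 1)" "b':forms RC (k - 1)"
 using x y unfolding e CC_iff by auto
 show "D (x + y) = D x + D y" "D (c *R x) = c *R D x" unfolding e
 by (simp_all add: D_eq d_add[OF f(1,4)] S.d_add[OF f(2,5)] B.RR.d_add[OF f(3,6)] d_cmult[OF f(1)]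
 S.d_cmult[OF f(2)] B.RR.d_cmult[OF f(3)] pb_add pb_cmult scaleR_diff_right)
qed

lemmas pf = pull_forms[OF sm_sp] pull_forms[OF sm_rp] pull_forms[OF sm_bincl, folded pull_bincl]

lemma D_CC:
 assumes x: "x:CC k"
 shows "D x:CC (k + 1)" "D (D x) = 0"
proof -
 obtain u a b where e: "x = (u, (a, b))" by (metis prod.collapse)
 have f: "u:forms M k" "a:forms SS (k - 1)" "b:forms RC (k - 1)" "pb CS SS id a = pb CS RC Inr b" using x unfolding e CC_iff by auto
 have da: "ext_d SS a:forms SS k" using S.forms_ext_d[OF f(2)] by simp
 have db: "ext_d RC b:forms RC k" using B.RR.forms_ext_d[OF f(3)] by simp
 have iu: "pb BM M id u:forms BM k" using pf f by blast
 have "pb CS SS id (pb SS M sp u) = pb CS M sp u" unfolding SB.pull_bincl by (rule pull_comp[OF SB.sm_bincl sm_sp f(1)])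
 moreover have "pb CS RC Inr (pb RC BM rp (pb BM M id u)) = pb CS BM sp (pb BM M id u)"
 using pull_comp[OF sm_Inr sm_rp iu] by (simp add: radial_proj_def)
 moreover have "pb CS BM sp (pb BM M id u) = pb CS M sp u"
 unfolding pull_bincl using sm_comp[OF sm_Inr sm_rp] by (intro pull_comp[OF _ sm_bincl f(1)]) (simp add: radial_proj_def)
 moreover have "pb CS SS id (ext_d SS a) = pb CS RC Inr (ext_d RC b)"
 using pull_d[OF SB.sm_bincl f(2)] pull_d[OF sm_Inr f(3)] f(4) unfolding SB.pull_bincl by simp
 ultimately show "D x:CC (k + 1)" unfolding e D_eq CC_iff using f(1) da db iu pf
 by (simp add: forms_ext_d S.forms_diff S.forms_uminus B.RR.forms_diff B.RR.forms_uminus pb_diff pb_uminus)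
 have "pb SS M sp (ext_d M u) = ext_d SS (pb SS M sp u)" by (rule pull_d[OF sm_sp f(1), symmetric])
 moreover have "pb RC BM rp (pb BM M id (ext_d M u)) = ext_d RC (pb RC BM rp (pb BM M id u))"
 unfolding pull_d[OF sm_rp iu] pull_d[OF sm_bincl f(1), folded pull_bincl] ..
 ultimately show "D (D x) = 0" unfolding e D_eq
 by (simp add: d_d[OF f(1)] zero_prod_def S.d_diff[OF S.forms_uminus[OF pf(1)[OF f(1)]] da] S.d_uminus[OF pf(1)[OF f(1)]]
 S.d_d[OF f(2)] B.RR.d_diff[OF B.RR.forms_uminus[OF pf(2)[OF iu]] db] B.RR.d_uminus[OF pf(2)[OF iu]] B.RR.d_d[OF f(3)])
qed

lemma CC_cplx: "cplx CC D" by standard (rule CC_sub D_lin D_CC; assumption)+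

lemma C0_CC: "x:C0 k ==> x:CC k" using near_bdry(2) by (auto simp: C0_def CC_iff pb_0 B.RR.forms_0)

lemma C0_iff: "(u, (a, b)):C0 k <-> u:forms M k & a:forms SS (k - 1) & b = 0 & near u a" by (simp add: C0_def)

lemma C0_D:
 assumes x: "x:C0 k"
 shows "D x:C0 (k + 1)"
proof -
 obtain u a where e: "x = (u, (a, 0))" "near u a" using x by (auto simp: C0_def)
 obtain A where A: "mopen M A" "bdry M <= A" "agree M A u 0" "agree SS (over A) a 0" using e(2) by (auto simp: near_def)
 have "agree M A (ext_d M u) 0" by (rule ext_d_zero[OF A(1,3)])
 moreover have "agree SS (over A) (- pb SS M sp u - ext_d SS a) (0 - 0)"
 using pull_agree[OF S_atlas A(3), of "over A" sp] S.ext_d_zero[OF over_open[OF A(1)] A(4)] sm_car[OF sm_sp]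
 by (auto simp: over_def agree_def pb_0)
 ultimately have "near (ext_d M u) (- pb SS M sp u - ext_d SS a)" unfolding near_def using A(1,2) by auto
 moreover have "D x:CC (k + 1)" by (rule D_CC[OF C0_CC[OF x]])
 ultimately show ?thesis using near_bdry(1)[OF e(2)] unfolding e(1) D0 by (simp add: CC_iff C0_iff pb_0)
qed

lemma C0_sub: "subspace (C0 k)"
proof (rule subspace_lin)
 have "near 0 0" unfolding near_def by (intro exI[of _ "car M"]) (simp add: open_car bdry_car agree_refl)
 thus "0:C0 k" by (simp add: zero_prod_def C0_iff forms_0 S.forms_0)
 fix x y :: "('a, 'w) cochain" and c assume x: "x:C0 k" and y: "y:C0 k"
 obtain u a b u' a' b' where "x = (u, (a, b))" "y = (u', (a', b'))" by (metis prod.collapse)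
 thus "x + c *R y:C0 k" using x y by (simp add: C0_iff forms_add forms_cmult S.forms_add S.forms_cmult near_lin)
qed

lemma C0_cplx: "cplx C0 D"
proof
 fix x y :: "('a, 'w) cochain" and c k assume x: "x:C0 k"
 note D_lin = D_lin[OF C0_CC[OF x]] and D_CC = D_CC[OF C0_CC[OF x]]
 show "D (c *R x) = c *R D x" by (rule D_lin(2)[OF C0_CC[OF x]])
 show "D x:C0 (k + 1)" by (rule C0_D[OF x])
 show "D (D x) = 0" by (rule D_CC(2))
 assume "y:C0 k"
 thus "D (x + y) = D x + D y" by (rule D_lin(1)[OF C0_CC])
qed (rule C0_sub)

text \<open>The cochains over \<open>\<partial>X\<close> form the cone of an isomorphism in cohomology, since the compactified fibres are contractible.\<close>

lemma kill_boundary: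
 assumes y: "(u, (a, b)):CC k" and Db: "- pb RC BM rp (pb BM M id u) - ext_d RC b = 0"
 shows "EX x:CC (k - 1). EX u' a'. (u, (a, b)) + D x = (u', (a', 0)) & pb BM M id u' = 0"
proof -
 have f: "u:forms M k" "a:forms SS (k - 1)" "b:forms RC (k - 1)" using y unfolding CC_iff by auto
 let ?z = "%p. Inl (B.zsec p)" and ?P = "hop RC RC B.contr 0 (pi / 2)"
 define v where "v = pb BM RC ?z b"
 have iu: "pb BM M id u:forms BM k" using pf f by blast
 have v: "v:forms BM (k - 1)" unfolding v_def by (rule pull_forms[OF sm_z f(3)])
 have pi: "(0::real) <= pi / 2" by simp
 have db: "ext_d RC b = - pb RC BM rp (pb BM M id u)" using Db by (simp add: algebra_simps)
 have dv: "ext_d BM v = - pb BM M id u"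
 proof -
 have "pb BM RC ?z (pb RC BM rp (pb BM M id u)) = pb BM BM (%p. rp (?z p)) (pb BM M id u)" by (rule pull_comp[OF sm_z sm_rp iu])
 also have "\<dots> = pb BM M id u" by (rule pull_idf[OF batlas _ iu]) (use B.zsec(2) in "simp add: radial_proj_def")
 finally show ?thesis unfolding v_def pull_d[OF sm_z f(3)] db pb_uminus by simp
 qed
 have P: "?P b:forms RC (k - 1 - 1)" by (rule hop_forms[OF sm_contr B.RB_atlas f(3) pi])
 have "?P (ext_d RC b) = 0"
 proof -
 have "?P (pb RC BM rp (pb BM M id u)) = hop RC BM (%q. rp (B.contr q)) 0 (pi / 2) (pb BM M id u)"
 by (rule hop_tgt[OF sm_contr B.RB_atlas sm_rp iu])
 also have "\<dots> = 0" by (rule hop_constant[OF sm_comp[OF sm_contr sm_rp] B.RB_atlas iu pi, of rp]) (use B.contr_props(4) in simp)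
 finally show ?thesis unfolding db hop_uminus by simp
 qed
 moreover have "pb RC RC (%q. B.contr (q, pi / 2)) b = pb RC BM rp v" unfolding v_def pull_comp[OF sm_rp sm_z f(3)]
 by (rule pull_cong[OF sm_slice[OF sm_contr B.RB_atlas]]) (use B.contr_props(2) in simp)
 moreover have "pb RC RC (%q. B.contr (q, 0)) b = b" by (rule pull_idf[OF B.RB_atlas _ f(3)]) (rule B.contr_props(1))
 ultimately have dP: "ext_d RC (?P b) = pb RC BM rp v - b" using hop_d[OF sm_contr B.RB_atlas f(3) pi] by simp
 have X: "EX v':forms M (k - 1). pb BM M id v' = v"
 by (rule extend_form[where F = "%p. FX (p, pi / 2)" and h = h, OF smoD(3)[OF sm_slice[OF sm_FX atlas]] N(1) _ N(2) _ h K v])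
 (use FX_props opn_car[OF N(1)] bdry_car in auto)
 have Nov: "FS (R, pi / 2):bdry SS" if "R:over N" for R using that FS_props(4) by (auto simp: over_def)
 have hs: "sfn SS R (%R. h (sp R))" if "R:car SS" for R
 proof -
 interpret SM: atlas2 SS M ..
 show ?thesis by (rule SM.sfn_compose[OF smapsD[OF smoD(3)[OF sm_sp] that]]) (rule h(1)[OF sm_car[OF sm_sp that]])
 qed
 have KS: "closedin (mtop SS) (over K)"
 proof -
 have "mopen SS (over (car M - K))" by (rule over_open[OF openin_diff[OF open_car K(1)]])
 moreover have "over (car M - K) = car SS - over K" using sm_car[OF sm_sp] by (auto simp: over_def)
 ultimately show ?thesis by (auto simp: closedin_def S.tsp over_def)
 qed
 have nP: "pb CS RC Inr (- ?P b):forms CS (k - 1 - 1)" by (rule pull_forms[OF sm_Inr B.RR.forms_uminus[OF P]])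
 define h' where "h' R = (if R:car SS then h (sp R) else 0)" for R
 have Y: "EX c:forms SS (k - 1 - 1). pb CS SS id c = pb CS RC Inr (- ?P b)"
 proof (rule SB.extend_form[where F = "%R. FS (R, pi / 2)" and h = h' and N = "over N", OF smoD(3)[OF sm_slice[OF sm_FS S_atlas]] over_open[OF N(1)] _ _ _ _ _ KS _ _ nP])
 show "sfn SS p h'" if "p:car SS" for p by (rule S.sfn_cong[OF hs[OF that] S.open_car that]) (simp add: h'_def)
 show "bdry SS <= over N" using N(2) by (auto simp: S_bdry over_def)
 show "over K <= over N" using K(2) by (auto simp: over_def)
 show "p:over K" if "h' p ~= 0" for p using that K(3) by (auto simp: h'_def over_def split: if_splits)
 show "h' p = 1" if "p:bdry SS" for p using that h(2) by (auto simp: h'_def S_bdry)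
 qed (use Nov FS_props(2) SB.bdry_car in auto)
 obtain v' c where v': "v':forms M (k - 1)" "pb BM M id v' = v" and c: "c:forms SS (k - 1 - 1)" "pb CS SS id c = pb CS RC Inr (- ?P b)"
 using X Y by blast
 have "(v', (c, - ?P b)):CC (k - 1)" unfolding CC_iff using v' c B.RR.forms_uminus[OF P] by simp
 moreover have "pb BM M id (ext_d M v') = ext_d BM v" unfolding v'(2)[symmetric] pull_bincl by (rule pull_d[OF sm_bincl v'(1), symmetric])
 moreover have "(u, (a, b)) + D (v', (c, - ?P b)) = (u + ext_d M v', (a + (- pb SS M sp v' - ext_d SS c), 0))"
 unfolding D_eq v'(2) B.RR.d_uminus[OF P] dP by simp
 moreover have "pb BM M id (u + ext_d M v') = 0" using calculation(2) by (simp add: pb_add dv)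
 ultimately show ?thesis by blast
qed

lemma push_vanish:
 assumes u: "u:forms M k" and a: "a:forms SS (k - 1)" and iu: "pb BM M id u = 0" and ja: "pb CS SS id a = 0"
 and D: "near (ext_d M u) (- pb SS M sp u - ext_d SS a)"
 shows "EX x:CC (k - 1). (u, (a, 0)) + D x:C0 k"
proof -
 let ?h = "hop M M FX 0 (pi / 2)" and ?k = "hop SS SS FS 0 (pi / 2)"
 have pi: "(0::real) <= pi / 2" by simp
 obtain A where A: "mopen M A" "bdry M <= A" "agree M A (ext_d M u) 0" "agree SS (over A) (- pb SS M sp u - ext_d SS a) 0"
 using D by (auto simp: near_def)
 define U where "U = \<Union>{V. mopen M V & (ALL q:V. ALL t:{0..pi / 2}. FX (q, t):A)}"
 have Uo: "mopen M U" unfolding U_def by (rule openin_Union) blast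
 have UA: "FX (q, t):A" if "q:U" "t:{0..pi / 2}" for q t using that unfolding U_def by blast
 have Ub: "bdry M <= U"
 proof
 fix p assume p: "p:bdry M"
 hence pM: "p:car M" using bdry_car by blast
 have "{p} \<times> {0..pi / 2} <= {q:car (lmfd M). FX q:A}" using FX_props(2)[OF pM p] A(2) p pM lcar by auto
 then obtain V where "mopen M V" "p:V" "V \<times> {0..pi / 2} <= {q:car (lmfd M). FX q:A}"
 by (rule tube[OF sm_preimage[OF sm_FX A(1)] pM])
 thus "p:U" unfolding U_def by blast
 qed
 have pu: "pb SS M sp u:forms SS k" using pf u by blast
 have hu: "?h u:forms M (k - 1)" by (rule hop_forms[OF sm_FX atlas u pi])
 have ka: "?k a:forms SS (k - 1 - 1)" by (rule hop_forms[OF sm_FS S_atlas a pi])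
 have jk: "pb CS SS id (- ?k a) = 0" using SB.hop_bdry[OF sm_FS _ a pi] FS_props(2) SB.bdry_car by (simp add: pb_uminus subset_iff)
 have ih: "pb BM M id (?h u) = 0" using hop_bdry[OF sm_FX _ u pi] FX_props(2) bdry_car by (simp add: subset_iff)
 have ph: "pb SS M sp (?h u) = ?k (pb SS M sp u)" unfolding hop_src[OF sm_FX sm_sp u pi] hop_tgt[OF sm_FS S_atlas sm_sp u]
 by (rule hop_cong[OF sm_comp[OF sm_lmap[OF sm_sp] sm_FX] S_atlas]) (simp add: FS_props(3))
 have "(?h u, (- ?k a, 0)):CC (k - 1)" unfolding CC_iff using hu S.forms_uminus[OF ka] jk B.RR.forms_0 by (simp add: pb_0)
 moreover have "(u, (a, 0)) + D (?h u, (- ?k a, 0)):C0 k"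
 proof -
 let ?u = "u + ext_d M (?h u)" and ?a = "a + (- pb SS M sp (?h u) - ext_d SS (- ?k a))"
 have e: "(u, (a, 0)) + D (?h u, (- ?k a, 0)) = (?u, (?a, 0))" unfolding D0 ih by (simp add: pb_0)
 have "?u:forms M k" using forms_ext_d[OF hu] u by (simp add: forms_add)
 moreover have "?a:forms SS (k - 1)" using S.forms_ext_d[OF ka] a pf(1)[OF hu]
 by (simp add: S.forms_add S.forms_diff S.forms_uminus S.d_uminus[OF ka])
 moreover have "near ?u ?a" unfolding near_def
 proof (intro exI conjI)
 show "mopen M (N Int U)" "bdry M <= N Int U" using N Uo Ub by auto
 have 1: "agree M N (pb M M (%p. FX (p, pi / 2)) u) 0"
 by (rule push_kill[OF sm_slice[OF sm_FX atlas] N(1) _ u iu]) (use FX_props(3) opn_car[OF N(1)] in auto)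
 have 2: "agree M U (?h (ext_d M u)) 0" using hop_local[OF sm_FX atlas Uo A(3) UA] by (simp add: hop_0)
 have "?u = pb M M (%p. FX (p, pi / 2)) u - ?h (ext_d M u)" using hop_d[OF sm_FX atlas u pi] pull_idf[OF atlas FX_props(1) u] by simp
 thus "agree M (N Int U) ?u 0" using 1 2 by (simp add: agree_def)
 have 3: "agree SS (over N) (pb SS SS (%p. FS (p, pi / 2)) a) 0"
 by (rule SB.push_kill[OF sm_slice[OF sm_FS S_atlas] over_open[OF N(1)] _ a ja]) (use FS_props(4) in "auto simp: over_def")
 have 4: "agree SS (over U) (?k (ext_d SS a)) (?k (- pb SS M sp u))"
 proof (rule hop_local[OF sm_FS S_atlas over_open[OF Uo]])
 show "agree SS (over A) (ext_d SS a) (- pb SS M sp u)" using A(4) by (simp add: agree_def diff_eq_eq)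
 show "FS (p, t):over A" if "p:over U" "t:{0..pi / 2}" for p t
 using that UA FS_props(3) sm_car[OF sm_FS, of "(p, t)"] by (auto simp: over_def S.lcar)
 qed
 have "?a = pb SS SS (%p. FS (p, pi / 2)) a - ?k (ext_d SS a) - ?k (pb SS M sp u)"
 using hop_d[OF sm_FS S_atlas a pi] pull_idf[OF S_atlas FS_props(1) a] ph by (simp add: S.d_uminus[OF ka])
 thus "agree SS (over (N Int U)) ?a 0" using 3 4 by (simp add: agree_def over_def hop_uminus)
 qed
 ultimately show ?thesis unfolding e C0_iff by simp
 qed
 ultimately show ?thesis by blast
qed

lemma into_C0:
 assumes y: "y:CC k" and Dy: "D y:C0 (k + 1)"
 shows "EX x:CC (k - 1). y + D x:C0 k"
proof -
 interpret CX: cplx CC D by (rule CC_cplx)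
 obtain u a b where e: "y = (u, (a, b))" by (metis prod.collapse)
 have "- pb RC BM rp (pb BM M id u) - ext_d RC b = 0" using Dy unfolding e D_eq C0_iff by simp
 then obtain x u' a' where x: "x:CC (k - 1)" "y + D x = (u', (a', 0))" "pb BM M id u' = 0" using kill_boundary y unfolding e by blast
 have Dx: "D x:CC k" using D_CC(1)[OF x(1)] by simp
 have y': "(u', (a', 0)):CC k" using CX.C[of k] y Dx unfolding x(2)[symmetric] by (rule subspace_add)
 have "D (u', (a', 0)) = D y" unfolding x(2)[symmetric] using D_lin(1)[OF y Dx] D_CC(2)[OF x(1)] by simp
 hence "near (ext_d M u') (- pb SS M sp u' - ext_d SS a')" using Dy unfolding D0 by (auto simp: C0_def)
 then obtain x' where x': "x':CC (k - 1)" "(u', (a', 0)) + D x':C0 k" using push_vanish[of u' k a'] y' x(3) unfolding CC_iff pb_0 by blast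
 have "y + D (x + x'):C0 k" using x'(2) unfolding D_lin(1)[OF x(1) x'(1)] x(2)[symmetric] by (simp add: add.assoc)
 thus ?thesis using subspace_add[OF CX.C x(1) x'(1)] by blast
qed

lemma iso_C0: "vs_iso (cohomology C0 D k) (cohomology CC D k)"
proof (rule cohomology_iso[OF C0_cplx CC_cplx, where ph = "%x. x"])
 show "D x:D ` CC (k - 1)" if "x:C0 (k - 1)" for x using C0_CC[OF that] by blast
 show "z:D ` C0 (k - 1)" if z: "z:C0 k" "y:CC (k - 1)" "z = D y" for z y
 proof -
 have "D y:C0 (k - 1 + 1)" using z by simp
 then obtain x where x: "x:CC (k - 1 - 1)" "y + D x:C0 (k - 1)" using into_C0[OF z(2)] by blast
 have "D (y + D x) = z" using D_lin(1)[OF z(2), of "D x"] D_CC[OF x(1)] z(3) by simp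
 thus ?thesis using x(2) by blast
 qed
 fix z' assume z': "z':CC k" "D z' = 0"
 have "D z':C0 (k + 1)" using z'(2) subspace_0[OF C0_sub] by simp
 then obtain x where x: "x:CC (k - 1)" "z' + D x:C0 k" using into_C0[OF z'(1)] by blast
 have "D (z' + D x) = 0" using D_lin(1)[OF z'(1), of "D x"] D_CC[OF x(1)] z'(2) by simp
 moreover have "z' - (z' + D x) = D (- x)" using D_lin(2)[OF x(1) x(1), of "-1"] by simp
 ultimately show "EX z:C0 k. D z = 0 & z' - z:D ` CC (k - 1)" using x subspace_neg[OF CC_sub x(1)] by (intro bexI[of _ "z' + D x"]) auto
qed (use C0_CC in auto)

end

section \<open>Forms on the total space with fibrewise bounded support\<close>

lemma fmul_lin: "fmul h (om + om') = fmul h om + fmul h om'" "fmul h (c *R om) = c *R fmul h om"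
 by (simp_all add: fmul_def fun_eq_iff sfun_def algebra_simps)

locale proper = pushed M E g F N h K for M :: "'a chart set" and E :: "('a, 'w) vbundle" and g F N h K +
 assumes proper: "p:car M ==> EX c:M. EX t:trivs E. EX K Q. mopen M Q & p:Q & compactin (mtop M) K & Q <= K &
 K <= cdom c Int tdom t & (ALL w:total E. proj E w:Q --> (\<Sum>i<trank t. (tmap t w i)^2) <= g w)"

context pushed
begin

definition tover :: "'a set => 'w set" where "tover A = {w:TE. PE w:A}"
definition gt :: "real => 'w set" where "gt m = {w:TE. g w:{m<..}}"
definition lt :: "real => 'w set" where "lt m = {w:TE. g w:{..<m}}"

lemma gt_open: "mopen T (gt m)" and lt_open: "mopen T (lt m)"
 unfolding gt_def lt_def by (rule TT.sfn_pre[OF g_smooth]; auto simp: TT.open_car simp flip: T_car)+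

lemma tover_open: "mopen M A ==> mopen T (tover A)" unfolding tover_def by (rule proj_open)

lemma gt_nonzero: "0 <= m ==> gt m <= NE" using nonzero_g by (auto simp: gt_def)

definition cut :: "'w => real" where "cut w = step (2 * g w - 1)"
definition Cm :: "'w set form => 'w form" where "Cm al = fmul cut (pb T SS (ray E) al)"

lemma ray_carrier: "w:NE ==> ray E w:car SS" by (simp add: S_carrier)

lemma ray_fo: "al:forms SS k ==> fo T (NE) k (pb T SS (ray E) al)"
 by (rule pb_fo[OF T_atlas S_atlas smaps_ray S.fo_car S.open_car ray_carrier])

lemma Cm_at: "c:T ==> w:cdom c ==> Cm al c (cmap c w) = (%vs. cut w * pb T SS (ray E) al c (cmap c w) vs)" by (simp add: Cm_def fmul_def)

lemma cut_lt: "g w < 1 / 2 ==> cut w = 0" and cut_gt: "1 < g w ==> cut w = 1"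
 using step_props(1,2)[of "2 * g w - 1"] by (simp_all add: cut_def)

lemma Cm_in: "agree T (lt (1 / 2)) (Cm al) 0" by (auto simp: agree_def Cm_at cut_lt lt_def zfun_def)

lemma Cm_out: "agree T (gt 1) (Cm al) (pb T SS (ray E) al)" by (auto simp: agree_def Cm_at cut_gt gt_def)

lemma Cm_forms:
 assumes "al:forms SS k"
 shows "Cm al:forms T k"
proof (rule TT.formsI)
 show "zero_out T (Cm al)" unfolding Cm_def by (intro TT.zero_out_fmul pb_zo)
 have "fo T (NE) k (Cm al)" unfolding Cm_def cut_def
 by (intro TT.fo_fmul ray_fo assms TT.sfn_step TT.sfn_diff TT.sfn_mult TT.sfn_const g_smooth nz_total)
 moreover have "fo T (lt (1 / 2)) k (Cm al)" by (rule TT.fo_agree[OF TT.fo_zero lt_open agree_sym[OF Cm_in]])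
 ultimately have "fo T (NE Un lt (1 / 2)) k (Cm al)" by (rule fo_Un)
 thus "fo T (car T) k (Cm al)" by (rule fo_mono) (use g_zero T_car in "auto simp: lt_def")
qed

lemma Cm_lin: "Cm (al + be) = Cm al + Cm be" "Cm (c *R al) = c *R Cm al" by (simp_all add: Cm_def pb_add pb_cmult fmul_lin)

lemma Cm_over:
 assumes "agree SS (over A) al 0"
 shows "agree T (tover A) (Cm al) 0" unfolding agree_def
proof (intro ballI impI)
 have a: "agree T (tover A Int NE) (pb T SS (ray E) al) 0"
 unfolding pb_0[of T SS "ray E", symmetric] by (rule pull_agree[OF T_atlas assms]) (use ray_carrier in "auto simp: tover_def over_def")
 fix w c assume w: "w:tover A" "c:T" "w:cdom c"
 show "Cm al c (cmap c w) = 0 c (cmap c w)"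
 proof (cases "w:NE")
 case True
 thus ?thesis using agreeD[OF a, of w c] w by (simp add: Cm_at zfun_def)
 next
 case False
 thus ?thesis using w g_zero cut_lt by (simp add: Cm_at zfun_def tover_def)
 qed
qed

lemma dCm_out:
 assumes "al:forms SS k"
 shows "agree T (gt 1) (ext_d T (Cm al)) (pb T SS (ray E) (ext_d SS al))" using TT.ext_d_agree[OF gt_open Cm_out]
 agree_mono[OF ext_d_pb[OF T_atlas S_atlas smaps_ray S.fo_car[OF assms] S.open_car ray_carrier] gt_nonzero[of 1]]
 by (auto intro: agree_trans)

lemma ray_sp:
 assumes "u:forms M k"
 shows "agree T (gt 1) (pb T SS (ray E) (pb SS M sp u)) (pb T M (PE) u)"
proof -
 have 1: "agree T (NE) (pb T SS (ray E) (pb SS M sp u)) (pb T M (%w. sp (ray E w)) u)"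
 by (rule pb_compose[OF T_atlas S_atlas atlas smaps_ray smoD(3)[OF sm_sp] fo_car[OF assms] open_car ray_carrier sm_car[OF sm_sp]])
 have "agree T (NE) (pb T M (PE) u) (pb T M (%w. sp (ray E w)) u)"
 by (rule pb_cong[OF T_atlas atlas smaps_subset[OF smoD(3)[OF sm_proj] nonzero_open]]) (use nz_total T_car in auto)
 from agree_mono[OF agree_trans[OF 1 agree_sym[OF this]] gt_nonzero] show ?thesis by simp
qed

definition small :: "'w form => bool" where
 "small om <-> (EX A. mopen M A & bdry M <= A & agree T (tover A) om 0) & (EX m. agree T (gt m) om 0)"

definition AA :: "int => 'w form set" where "AA k = {om:forms T k. small om}"

lemma small_lin: "small om ==> small om' ==> small (om + c *R om')"
proof -
 assume "small om" "small om'"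
 then obtain A A' m m' where A: "mopen M A" "bdry M <= A" "agree T (tover A) om 0" "agree T (gt m) om 0"
 "mopen M A'" "bdry M <= A'" "agree T (tover A') om' 0" "agree T (gt m') om' 0" by (auto simp: small_def)
 have "agree T (tover (A Int A')) (om + c *R om') 0" "agree T (gt (max m m')) (om + c *R om') 0"
 using A by (auto simp: agree_def tover_def gt_def sfun_def zfun_def plus_fun_def fun_eq_iff)
 moreover have "mopen M (A Int A')" "bdry M <= A Int A'" using A by auto
 ultimately show ?thesis unfolding small_def by blast
qed

lemma small_d: "small om ==> small (ext_d T om)" unfolding small_def using TT.ext_d_zero gt_open tover_open by blast

lemma AA_cplx: "cplx AA (ext_d T)"
proof
 have "small 0" unfolding small_def using open_car bdry_car agree_refl by blast
 thus "subspace (AA k)" for k by (intro subspace_lin) (auto simp: AA_def TT.forms_0 TT.forms_add TT.forms_cmult small_lin)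
 fix x y k and c :: real assume x: "x:AA k"
 hence f: "x:forms T k" by (simp add: AA_def)
 show "ext_d T (c *R x) = c *R ext_d T x" by (rule TT.d_cmult[OF f])
 show "ext_d T x:AA (k + 1)" using TT.forms_ext_d[OF f] x small_d by (simp add: AA_def)
 show "ext_d T (ext_d T x) = 0" by (rule TT.d_d[OF f])
 assume "y:AA k"
 thus "ext_d T (x + y) = ext_d T x + ext_d T y" using TT.d_add[OF f] by (simp add: AA_def)
qed

definition Ps :: "('a, 'w) cochain => 'w form" where "Ps = (%(u, (al, be)). pb T M (PE) u + ext_d T (Cm al))"

lemma pr_over:
 assumes "agree M A u 0"
 shows "agree T (tover A) (pb T M (PE) u) 0" using pull_agree[OF T_atlas assms, of "tover A" "PE"] proj_car by (auto simp: tover_def pb_0)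

lemma Ps_AA:
 assumes x: "(u, (a, b)):C0 k" and D: "D (u, (a, b)) = 0"
 shows "Ps (u, (a, b)):AA k" "ext_d T (Ps (u, (a, b))) = 0"
proof -
 have f: "u:forms M k" "a:forms SS (k - 1)" "b = 0" "near u a" using x by (auto simp: C0_iff)
 have d: "ext_d M u = 0" "ext_d SS a = - pb SS M sp u" using D unfolding D_eq by (auto simp: zero_prod_def algebra_simps)
 have pu: "pb T M (PE) u:forms T k" by (rule pull_forms[OF sm_proj f(1)])
 have c: "Cm a:forms T (k - 1)" by (rule Cm_forms[OF f(2)])
 have "agree T (gt 1) (Ps (u, (a, b))) 0" using dCm_out[OF f(2)] ray_sp[OF f(1)] unfolding d pb_uminus by (auto simp: Ps_def agree_def)
 moreover obtain A where A: "mopen M A" "bdry M <= A" "agree M A u 0" "agree SS (over A) a 0" using f(4) by (auto simp: near_def)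
 have "agree T (tover A) (Ps (u, (a, b))) 0"
 using pr_over[OF A(3)] TT.ext_d_zero[OF tover_open[OF A(1)] Cm_over[OF A(4)]] by (auto simp: Ps_def agree_def)
 ultimately show "Ps (u, (a, b)):AA k" using A(1,2) pu TT.forms_ext_d[OF c] by (auto simp: AA_def small_def Ps_def TT.forms_add)
 have "ext_d T (pb T M (PE) u) = 0" unfolding pull_d[OF sm_proj f(1)] d(1) by (rule pb_0)
 thus "ext_d T (Ps (u, (a, b))) = 0" using TT.d_add[OF pu, of "ext_d T (Cm a)"] TT.forms_ext_d[OF c] TT.d_d[OF c] by (simp add: Ps_def)
qed

lemma Ps_cobound:
 assumes x: "x:C0 (k - 1)"
 shows "Ps (D x):ext_d T ` AA (k - 1)"
proof -
 obtain a b where e: "x = (a, (b, 0))" "near a b" "a:forms M (k - 1)" "b:forms SS (k - 1 - 1)" using x by (auto simp: C0_def)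
 let ?v = "- pb SS M sp a - ext_d SS b"
 have Dx: "D x:C0 k" using C0_D[OF x] by simp
 hence v: "?v:forms SS (k - 1)" "near (ext_d M a) ?v" unfolding e(1) D0 C0_iff by auto
 define et where "et = pb T M (PE) a + Cm ?v + ext_d T (Cm b)"
 have f: "pb T M (PE) a:forms T (k - 1)" "Cm ?v:forms T (k - 1)" "Cm b:forms T (k - 1 - 1)" "ext_d T (Cm b):forms T (k - 1)"
 using pull_forms[OF sm_proj e(3)] Cm_forms[OF v(1)] Cm_forms[OF e(4)] TT.forms_ext_d[OF Cm_forms[OF e(4)]] by auto
 have "ext_d T et = pb T M (PE) (ext_d M a) + ext_d T (Cm ?v)"
 unfolding et_def TT.d_add[OF TT.forms_add[OF f(1,2)] f(4)] TT.d_add[OF f(1,2)] TT.d_d[OF f(3)] pull_d[OF sm_proj e(3)] by simp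
 hence "Ps (D x) = ext_d T et" by (simp add: e(1) D0 Ps_def)
 moreover have "et:AA (k - 1)"
 proof -
 have "agree T (gt 1) et 0" using Cm_out[of ?v] dCm_out[OF e(4)] ray_sp[OF e(3)] by (auto simp: et_def agree_def pb_diff pb_uminus)
 moreover obtain A where A: "mopen M A" "bdry M <= A" "agree M A a 0" "agree SS (over A) b 0" using e(2) by (auto simp: near_def)
 obtain A' where A': "mopen M A'" "bdry M <= A'" "agree SS (over A') ?v 0" using v(2) by (auto simp: near_def)
 have "agree T (tover (A Int A')) et 0"
 using pr_over[OF A(3)] TT.ext_d_zero[OF tover_open[OF A(1)] Cm_over[OF A(4)]] Cm_over[OF A'(3)] by (auto simp: et_def agree_def tover_def)
 moreover have "mopen M (A Int A')" "bdry M <= A Int A'" using A A' by auto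
 ultimately show ?thesis using f by (auto simp: AA_def small_def et_def TT.forms_add)
 qed
 ultimately show ?thesis by blast
qed

lemma zs_over: "agree T (tover A) om 0 ==> A <= car M ==> agree M A (pb M T zsec om) 0" unfolding pb_0[of M T zsec, symmetric]
 by (rule pull_agree[OF atlas]) (use zsec(1,2) T_car in "auto simp: tover_def subset_iff pb_0")

definition HH :: "real => 'w set \<times> real => 'w" where "HH n q = vE (snd q * n) (sig (fst q))"

lemma sm_HH: "smo (lmfd SS) T (HH n)"
proof (rule smoI[OF S.latlas T_atlas])
 interpret L: atlas "lmfd SS" by standard (rule S.latlas)
 fix q assume "q:car (lmfd SS)"
 then obtain R t where q: "q = (R, t)" "R:car SS" by (cases q) (auto simp: S.lcar)
 show "smap (lmfd SS) T q (HH n)" unfolding HH_def q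
 by (intro smap_vscale S.latlas smap_compose[OF S.latlas S_atlas T_atlas S.smap_line_fst] L.sfn_mult S.sfn_line_snd L.sfn_const)
 (use q smap_sig in auto)
qed

lemma HH_props:
 assumes R: "R:car SS"
 shows "HH n (R, t):TE" "PE (HH n (R, t)) = sp R" "HH n (R, 0) = zsec (sp R)" "g (HH n (R, t)) = (t * n)^2"
 "n > 0 ==> ray E (HH n (R, 1)) = R" "n > 0 ==> HH n (R, 1):NE"
 using sig_props[OF R] nz_total vs_tot[of "sig R"] zsec_vscale0[of "sig R"] g_scale[of "sig R"] ray_vscale[of "sig R" n] nonzero_vscale[of "sig R" n]
 by (auto simp: HH_def)

abbreviation "KK n \<equiv> hop SS T (HH n) 0 1"

lemma KK_forms: "om:forms T k ==> KK n om:forms SS (k - 1)" by (rule hop_forms[OF sm_HH S_atlas]) auto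

lemma KK_d:
 assumes w: "om:forms T k"
 shows "ext_d SS (KK n om) = pb SS T (%R. HH n (R, 1)) om - pb SS M sp (pb M T zsec om) - KK n (ext_d T om)"
proof -
 have "pb SS M sp (pb M T zsec om) = pb SS T (%R. HH n (R, 0)) om"
 unfolding pull_comp[OF sm_sp sm_zsec w] by (rule pull_cong[OF sm_comp[OF sm_sp sm_zsec]]) (simp add: HH_props)
 thus ?thesis using hop_d[OF sm_HH S_atlas w, of 0 1 n] by simp
qed

lemma KK_proj: "u:forms M k ==> KK n (pb T M (PE) u) = 0"
 unfolding hop_tgt[OF sm_HH S_atlas sm_proj] by (rule hop_constant[OF sm_comp[OF sm_HH sm_proj] S_atlas]) (auto simp: HH_props)

lemma KK_over:
 assumes "mopen M A" "agree T (tover A) om 0"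
 shows "agree SS (over A) (KK n om) 0"
 using hop_local[OF sm_HH S_atlas over_open[OF assms(1)] assms(2), of 0 1 n] by (auto simp: hop_0 over_def tover_def HH_props)

lemma HH1_ray:
 assumes a: "al:forms SS k" and n: "n > 0"
 shows "pb SS T (%R. HH n (R, 1)) (pb T SS (ray E) al) = al"
proof -
 have s: "smo SS T (%R. HH n (R, 1))" by (rule sm_slice[OF sm_HH S_atlas])
 have "agree SS (car SS) (pb SS T (%R. HH n (R, 1)) (pb T SS (ray E) al)) (pb SS SS (%R. ray E (HH n (R, 1))) al)"
 by (rule pb_compose[OF S_atlas T_atlas S_atlas smoD(3)[OF s] smaps_ray S.fo_car[OF a] S.open_car])
 (use HH_props(6) n ray_carrier in auto)
 also have "pb SS SS (%R. ray E (HH n (R, 1))) al = al" by (rule pull_idf[OF S_atlas _ a]) (simp add: HH_props n)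
 finally show ?thesis by (rule agree_eq) (use a S.forms_zo pb_zo in blast)+
qed

lemma Ps_inj:
 assumes x: "x:C0 k" "D x = 0" and y: "et:AA (k - 1)" "Ps x = ext_d T et"
 shows "x:D ` C0 (k - 1)"
proof -
 obtain u a where e: "x = (u, (a, 0))" "near u a" "u:forms M k" "a:forms SS (k - 1)" using x by (auto simp: C0_def)
 obtain A where A: "mopen M A" "bdry M <= A" "agree M A u 0" "agree SS (over A) a 0" using e(2) by (auto simp: near_def)
 obtain A' m where A': "mopen M A'" "bdry M <= A'" "agree T (tover A') et 0" "agree T (gt m) et 0" using y(1) by (auto simp: AA_def small_def)
 define n where "n = \<bar>m\<bar> + 2"
 have "n * 1 <= n * n" unfolding n_def by (intro mult_left_mono) auto
 hence n: "n > 0" "n^2 > m" "n^2 > 1" unfolding power2_eq_square by (auto simp: n_def)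
 define th where "th = et - Cm a"
 have c: "Cm a:forms T (k - 1)" by (rule Cm_forms[OF e(4)])
 have et: "et:forms T (k - 1)" using y by (simp add: AA_def)
 have th: "th:forms T (k - 1)" unfolding th_def by (rule TT.forms_diff[OF et c])
 have dth: "ext_d T th = pb T M (PE) u" unfolding th_def TT.d_diff[OF et c] using y(2) by (simp add: Ps_def e(1) algebra_simps)
 let ?s = "pb M T zsec th"
 have "agree SS (car SS) (pb SS T (%R. HH n (R, 1)) th) (pb SS T (%R. HH n (R, 1)) (- pb T SS (ray E) a))"
 proof (rule pull_agree[OF S_atlas])
 show "agree T (gt (max m 1)) th (- pb T SS (ray E) a)" using A'(4) Cm_out[of a] by (auto simp: th_def agree_def gt_def)
 qed (use n HH_props in "auto simp: gt_def T_car")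
 hence H1: "pb SS T (%R. HH n (R, 1)) th = - a"
 unfolding pb_uminus HH1_ray[OF e(4) n(1)] by (rule agree_eq) (use e(4) S.forms_zo S.zero_out_uminus pb_zo in blast)+
 have dK: "ext_d SS (KK n th) = - a - pb SS M sp ?s" unfolding KK_d[OF th] dth KK_proj[OF e(3)] H1 by simp
 have ds: "ext_d M ?s = u"
 unfolding pull_d[OF sm_zsec th] dth pull_comp[OF sm_zsec sm_proj e(3)] by (rule pull_idf[OF atlas _ e(3)]) (simp add: zsec)
 have t: "agree T (tover (A Int A')) th 0" using A'(3) Cm_over[OF A(4)] by (auto simp: th_def agree_def tover_def)
 have o: "mopen M (A Int A')" using A A' by auto
 have nr: "near ?s (KK n th)" unfolding near_def
 by (intro exI[of _ "A Int A'"] conjI o zs_over[OF t] KK_over[OF o t] opn_car) (use A(2) A'(2) in auto)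
 have "x = D (?s, (KK n th, 0))" unfolding D0 e(1) ds dK near_bdry(1)[OF nr] pb_0 by simp
 moreover have "(?s, (KK n th, 0)):C0 (k - 1)" unfolding C0_iff using pull_forms[OF sm_zsec th] KK_forms[OF th] nr by simp
 ultimately show ?thesis by blast
qed

context
 fixes m n :: real
 assumes m: "m >= 1" and n: "n > 0" "n^2 > m"
begin

definition ps :: "'w => real" where "ps w = step (g w - m - 1)"
definition ka :: "'w => real" where "ka w = (1 - ps w) + ps w * (n / sqrt (g w))"
definition G :: "'w \<times> real => 'w" where "G q = vE (snd q * ka (fst q)) (fst q)"

lemma ka_lt: "g w < m + 1 ==> ka w = 1" using step_props(1)[of "g w - m - 1"] by (simp add: ka_def ps_def)

lemma ka_gt: "g w > m + 2 ==> ka w = n / sqrt (g w)" using step_props(2)[of "g w - m - 1"] by (simp add: ka_def ps_def)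

lemma ka_smooth: "w:TE ==> sfn T w ka"
proof (cases "g w > 0")
 case True
 thus "w:TE ==> sfn T w ka" unfolding ka_def ps_def
 by (intro TT.sfn_add TT.sfn_mult TT.sfn_divide TT.sfn_sqrt TT.sfn_const TT.sfn_diff TT.sfn_step g_smooth) auto
next
 case False
 assume w: "w:TE"
 show "sfn T w ka" by (rule TT.sfn_cong[OF TT.sfn_const[of w 1] lt_open[of "m + 1"]]) (use w False m ka_lt in "auto simp: lt_def")
qed

lemma sm_G: "smo (lmfd T) T G"
proof (rule smoI[OF TT.latlas T_atlas])
 interpret L: atlas "lmfd T" by standard (rule TT.latlas)
 fix q assume "q:car (lmfd T)"
 then obtain w t where q: "q = (w, t)" "w:car T" "w:TE" by (cases q) (auto simp: TT.lcar T_car)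
 show "smap (lmfd T) T q G" unfolding G_def q(1)
 by (intro smap_vscale TT.latlas TT.smap_line_fst[OF q(2)] L.sfn_mult TT.sfn_line_snd TT.sfn_line_fst[OF ka_smooth[OF q(3)]])
qed

lemma G_props:
 assumes w: "w:TE"
 shows "G (w, t):TE" "PE (G (w, t)) = PE w" "G (w, 0) = zsec (PE w)" "g w < m + 1 ==> G (w, 1) = w" "g w > m ==> g (G (w, 1)) > m"
 "g w > m + 2 ==> G (w, t) = HH n (ray E w, t)"
proof -
 show "G (w, t):TE" "PE (G (w, t)) = PE w" "G (w, 0) = zsec (PE w)" using vs_tot[OF w] zsec_vscale0[OF w] by (auto simp: G_def)
 show "g w < m + 1 ==> G (w, 1) = w" using ka_lt vscale_1[OF w] by (simp add: G_def)
 show "g (G (w, 1)) > m" if gw: "g w > m"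
 proof -
 have g0: "sqrt (g w) > sqrt m" "g w > 0" using gw m by auto
 have n0: "n > sqrt m" using n by (simp add: real_less_rsqrt real_less_lsqrt)
 have s: "0 <= ps w" "ps w <= 1" using step_props by (auto simp: ps_def)
 have "ka w * sqrt (g w) = (1 - ps w) * sqrt (g w) + ps w * n" using g0(2) by (simp add: ka_def field_simps)
 also have "\<dots> > sqrt m"
 proof (cases "ps w = 1")
 case False
 hence "(1 - ps w) * sqrt m < (1 - ps w) * sqrt (g w)" using s g0 by (intro mult_strict_left_mono) auto
 moreover have "ps w * sqrt m <= ps w * n" using s n0 by (intro mult_left_mono) auto
 ultimately show ?thesis by (simp add: algebra_simps)
 qed (use n0 in simp)
 finally have "(sqrt m)^2 < (ka w * sqrt (g w))^2" using m by (intro power_strict_mono) auto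
 thus ?thesis using m g0(2) by (simp add: G_def g_scale[OF w] power_mult_distrib)
 qed
 show "G (w, t) = HH n (ray E w, t)" if gw: "g w > m + 2"
 proof -
 have "w:NE" using nonzero_g[OF w] gw m by simp
 thus ?thesis by (simp add: G_def HH_def ka_gt[OF gw] sig_ray vs_vs[OF w])
 qed
qed

abbreviation "Q \<equiv> hop T T G 0 1"

lemma G1:
 assumes w: "om:forms T k" and o: "agree T (gt m) om 0"
 shows "pb T T (%w. G (w, 1)) om = om"
proof -
 have G: "smo T T (%w. G (w, 1))" by (rule sm_slice[OF sm_G T_atlas])
 have wf: "fo T (lt (m + 1)) k om" by (rule fo_mono[OF TT.fo_car[OF w]]) (auto simp: lt_def T_car)
 have "agree T (lt (m + 1)) (pb T T (%w. G (w, 1)) om) (pb T T id om)"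
 by (rule pb_cong[OF T_atlas T_atlas smaps_subset[OF smoD(3)[OF G] lt_open]]) (auto simp: lt_def T_car G_props(4))
 hence 1: "agree T (lt (m + 1)) (pb T T (%w. G (w, 1)) om) om" using pb_id[OF T_atlas lt_open wf] by (rule agree_trans)
 have "agree T (gt m) (pb T T (%w. G (w, 1)) om) (pb T T (%w. G (w, 1)) 0)"
 by (rule pull_agree[OF T_atlas o]) (auto simp: gt_def T_car G_props)
 hence 2: "agree T (gt m) (pb T T (%w. G (w, 1)) om) om" using o by (auto simp: pb_0 agree_def)
 have "agree T (car T) (pb T T (%w. G (w, 1)) om) om" by (rule agree_mono[OF agree_Un[OF 1 2]]) (auto simp: lt_def gt_def T_car)
 thus ?thesis by (rule agree_eq) (use w TT.forms_zo pb_zo in blast)+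
qed

lemma Q_out:
 assumes w: "om:forms T k"
 shows "agree T (gt (m + 2)) (Q om) (pb T SS (ray E) (KK n om))"
proof -
 have 1: "agree T (NE) (hop T T (%q. HH n (ray E (fst q), snd q)) 0 1 om) (pb T SS (ray E) (KK n om))"
 by (rule hop_map.hop_pb_source[OF hop_map_forms[OF sm_HH S_atlas w] T_atlas smaps_ray ray_carrier]) auto
 have "agree T (gt (m + 2)) (Q om) (hop T T (%q. HH n (ray E (fst q), snd q)) 0 1 om)"
 proof (rule hop_cong_local[OF T_atlas T_atlas gt_open])
 show "smaps (lmfd T) T (gt (m + 2) \<times> UNIV) G"
 by (rule smaps_subset[OF smoD(3)[OF sm_G] TT.line_openI[OF gt_open]]) (auto simp: gt_def TT.lcar T_car)
 qed (auto simp: gt_def G_props(6))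
 thus ?thesis using agree_mono[OF 1 gt_nonzero] m by (auto intro: agree_trans)
qed

lemma Ps_surj_aux:
 assumes w: "om:AA k" "ext_d T om = 0" and o: "agree T (gt m) om 0"
 shows "EX z:C0 k. D z = 0 & om - Ps z:ext_d T ` AA (k - 1)"
proof -
 let ?u = "pb M T zsec om" and ?a = "KK n om"
 have f: "om:forms T k" using w by (simp add: AA_def)
 obtain A where A: "mopen M A" "bdry M <= A" "agree T (tover A) om 0" using w(1) by (auto simp: AA_def small_def)
 have nr: "near ?u ?a" unfolding near_def by (intro exI[of _ A] conjI A zs_over[OF A(3)] KK_over[OF A(1,3)] opn_car)
 have u: "?u:forms M k" by (rule pull_forms[OF sm_zsec f])
 have a: "?a:forms SS (k - 1)" by (rule KK_forms[OF f])
 have z: "(?u, (?a, 0)):C0 k" unfolding C0_iff using u a nr by simp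
 have "agree SS (car SS) (pb SS T (%R. HH n (R, 1)) om) (pb SS T (%R. HH n (R, 1)) 0)"
 by (rule pull_agree[OF S_atlas o]) (use n HH_props in "auto simp: gt_def T_car")
 hence "pb SS T (%R. HH n (R, 1)) om = 0" unfolding pb_0 by (rule agree_eq) (simp_all add: pb_zo S.zero_out_0)
 hence "ext_d SS ?a = - pb SS M sp ?u" unfolding KK_d[OF f] w(2) hop_0 by simp
 moreover have "ext_d M ?u = 0" unfolding pull_d[OF sm_zsec f] w(2) by (rule pb_0)
 ultimately have Dz: "D (?u, (?a, 0)) = 0" unfolding D0 near_bdry(1)[OF nr] pb_0 by (simp add: zero_prod_def)
 define et where "et = Q om - Cm ?a"
 have c: "Cm ?a:forms T (k - 1)" by (rule Cm_forms[OF a])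
 have q: "Q om:forms T (k - 1)" by (rule hop_forms[OF sm_G T_atlas f]) simp
 have "pb T T (%w. G (w, 0)) om = pb T M (PE) ?u"
 unfolding pull_comp[OF sm_proj sm_zsec f] by (rule pull_cong[OF sm_slice[OF sm_G T_atlas]]) (simp add: G_props(3) T_car)
 hence "ext_d T (Q om) = om - pb T M (PE) ?u" using hop_d[OF sm_G T_atlas f, of 0 1] G1[OF f o] w(2) by (simp add: hop_0)
 hence "om - Ps (?u, (?a, 0)) = ext_d T et" unfolding et_def TT.d_diff[OF q c] by (simp add: Ps_def)
 moreover have "et:AA (k - 1)"
 proof -
 have "agree T (gt (m + 2)) (Cm ?a) (pb T SS (ray E) ?a)" by (rule agree_mono[OF Cm_out]) (use m in "auto simp: gt_def")
 hence 1: "agree T (gt (m + 2)) et 0" using Q_out[OF f] by (simp add: et_def agree_def)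
 have "agree T (tover A) (Q om) (Q 0)" by (rule hop_local[OF sm_G T_atlas tover_open[OF A(1)] A(3)]) (auto simp: tover_def G_props)
 hence "agree T (tover A) et 0" using Cm_over[OF KK_over[OF A(1,3)]] by (simp add: et_def agree_def hop_0)
 thus ?thesis using 1 A TT.forms_diff[OF q c] by (auto simp: AA_def small_def et_def)
 qed
 ultimately show ?thesis using z Dz by blast
qed

end

lemma Ps_surj:
 assumes w: "om:AA k" "ext_d T om = 0"
 shows "EX z:C0 k. D z = 0 & om - Ps z:ext_d T ` AA (k - 1)"
proof -
 obtain l where l: "agree T (gt l) om 0" using w(1) by (auto simp: AA_def small_def)
 let ?m = "max l 1"
 have "(1 + ?m)^2 > ?m" by (simp add: power2_sum add_strict_increasing2)
 thus ?thesis by (intro Ps_surj_aux[of ?m "1 + ?m"] w agree_mono[OF l]) (auto simp: gt_def)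
qed

lemma iso_A: "vs_iso (cohomology C0 D k) (cohomology AA (ext_d T) k)"
proof (rule cohomology_iso[OF C0_cplx AA_cplx, where ph = Ps])
 show "Ps z:AA k & ext_d T (Ps z) = 0" if "z:C0 k" "D z = 0" for z using Ps_AA[of "fst z" "fst (snd z)" "snd (snd z)"] that by simp
 fix x y :: "('a, 'w) cochain" and c assume x: "x:C0 k"
 obtain u a b u' a' b' where e: "x = (u, (a, b))" "y = (u', (a', b'))" by (metis prod.collapse)
 have ca: "Cm a:forms T (k - 1)" by (rule Cm_forms) (use x e in "simp add: C0_iff")
 show "Ps (c *R x) = c *R Ps x" unfolding e by (simp add: Ps_def Cm_lin pb_cmult TT.d_cmult[OF ca] scaleR_add_right)
 assume y: "y:C0 k"
 have "Cm a':forms T (k - 1)" by (rule Cm_forms) (use y e in "simp add: C0_iff")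
 thus "Ps (x + y) = Ps x + Ps y" unfolding e by (simp add: Ps_def Cm_lin pb_add TT.d_add[OF ca])
qed (fact Ps_cobound Ps_inj Ps_surj)+

end

section \<open>Compact supports\<close>

lemma subspace_image: "subspace S ==> (!!x y. f (x + y) = f x + f y) ==> (!!c x. f (c *R x) = c *R f x) ==> subspace (f ` S)"
 for f :: "'v::real_vector => 'w::real_vector" by (rule Real_Vector_Spaces.linear_subspace_image) (rule linearI)

lemma compact_append:
 assumes "compact A" "compact B"
 shows "compact ((%(x, v). append_vec n x v) ` (A \<times> B))"
proof (rule compact_continuous_image[OF _ compact_Times[OF assms]])
 have "continuous_on (A \<times> B) (%z. append_vec n (fst z) (snd z) i)" for i
 using cont_comp[OF cont_crd[of UNIV i] continuous_on_fst[OF continuous_on_id, of "A \<times> B"]]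
 cont_comp[OF cont_crd[of UNIV "i - n"] continuous_on_snd[OF continuous_on_id, of "A \<times> B"]] by (cases "i < n") simp_all
 thus "continuous_on (A \<times> B) (%(x, v). append_vec n x v)" unfolding case_prod_beta by (rule cont_prodI)
qed

context pushed
begin

lemma triv_compact:
 assumes c: "c:M" and t: "t:tE" and L: "compactin (mtop M) L" "L <= cdom c Int tdom t"
 shows "compactin (mtop T) {w:TE. PE w:L & (ALL i<trank t. \<bar>tmap t w i\<bar> <= r)}"
proof -
 let ?e = "tch c t" and ?V = "{y:quad (trank t) 0. ALL i<trank t. \<bar>y i - (0::rvec) i\<bar> <= r}"
 let ?Y = "(%(x, v). append_vec (cdim c) x v) ` (cmap c ` L \<times> ?V)"
 have e: "?e:T" by (rule T_chart[OF c t])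
 have "compactin (subtopology (mtop M) (cdom c)) L" using L by (simp add: compactin_subtopology)
 from image_compactin[OF this cmap_continuous[OF c]] have "compact (cmap c ` L)" by (simp add: cpt_iff)
 hence Y: "compact ?Y" by (rule compact_append[OF _ compact_quad_box])
 have m: "?Y = cmap ?e ` {w:TE. PE w:L & (ALL i<trank t. \<bar>tmap t w i\<bar> <= r)}" (is "_ = cmap ?e ` ?W")
 proof (intro equalityI subsetI)
 fix y assume "y:?Y"
 then obtain q v where q: "q:L" "v:?V" "y = append_vec (cdim c) (cmap c q) v" by auto
 obtain w where "w:TE" "PE w = q" "tmap t w = v" using tmap_surj[OF t, of q v] q L(2) by (auto simp: quad_def)
 thus "y:cmap ?e ` ?W" using q by (intro image_eqI[of _ _ w]) auto
 next
 fix y assume "y:cmap ?e ` ?W"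
 then obtain w where w: "w:?W" "y = append_vec (cdim c) (cmap c (PE w)) (tmap t w)" by auto
 have "tmap t w:?V" using w(1) L(2) tmap_Rn[OF t, of w] by (auto simp: quad_def)
 thus "y:?Y" using w by (intro image_eqI[of _ _ "(cmap c (PE w), tmap t w)"]) auto
 qed
 have Wc: "?W <= cdom ?e" using L(2) by auto
 hence "cmap ?e ` ?W <= cim ?e" by (rule image_mono)
 hence "compactin (tos (cim ?e)) ?Y" using Y unfolding m by (simp add: compactin_subtopology cpt_iff)
 from image_compactin[OF this TT.cinv_continuous[OF e]] have "compactin (mtop T) (cinv ?e ` cmap ?e ` ?W)" unfolding m .
 moreover have "cinv ?e ` cmap ?e ` ?W = ?W" using TT.inj[OF e] Wc by (rule inv_into_image_cancel)
 ultimately show ?thesis by simp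
qed

definition T0 :: "'w set" where "T0 = tover (interior_pts M)"
abbreviation "I0 \<equiv> restrict_mfd T T0"

lemma T0_open: "mopen T T0" unfolding T0_def by (rule tover_open[OF interior_open])

lemma I0_atlas: "atl I0" by (rule TT.restrict_atlas[OF T0_open])
lemma I0_carrier: "car I0 = T0" by (rule TT.restrict_carrier) (auto simp: T0_def tover_def T_car)
sublocale I0: atlas I0 by standard (rule I0_atlas)

lemma I0_incl: "smaps I0 T T0 id" using TT.smaps_restrict_incl[OF T0_open] I0_carrier by simp
lemma I0_into: "smaps T I0 T0 id" by (rule TT.smaps_restrict_into[OF T0_open])
lemma sm_I0: "smo I0 T id" using I0_incl by (simp add: smo_def I0_atlas T_atlas I0_carrier)

definition res :: "'w form => 'w form" where "res = pb I0 T id"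

lemma res_lin: "res (x + y) = res x + res y" "res (c *R x) = c *R res x" by (simp_all add: res_def pb_add pb_cmult)

lemma T0_cover: "bdry M <= A ==> tover A Un T0 = TE Int (tover A Un T0)" "bdry M <= A ==> TE <= tover A Un T0"
 using proj_car by (auto simp: tover_def T0_def)

lemma res_inj:
 assumes x: "x:AA k" "res x = 0"
 shows "x = 0"
proof -
 have f: "x:forms T k" using x by (simp add: AA_def)
 obtain A where A: "bdry M <= A" "agree T (tover A) x 0" using x by (auto simp: AA_def small_def)
 have "agree T T0 (pb T I0 id (pb I0 T id x)) (pb T T (%p. id (id p)) x)"
 by (rule pb_compose[OF T_atlas I0_atlas T_atlas I0_into I0_incl TT.fo_car[OF f] TT.open_car]) (auto simp: T0_def tover_def T_car)
 moreover have "agree T T0 (pb T T id x) x"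
 by (rule pb_id[OF T_atlas T0_open fo_mono[OF TT.fo_car[OF f]]]) (auto simp: T0_def tover_def T_car)
 ultimately have "agree T T0 x 0" using x(2) by (simp add: res_def pb_0 agree_def id_def)
 hence "agree T (car T) x 0" using A T0_cover(2)[OF A(1)] T_car by (auto intro: agree_mono[OF agree_Un[OF A(2)]])
 thus ?thesis by (rule agree_eq) (use f TT.forms_zo TT.zero_out_0 in blast)+
qed

lemma I0_continuous: "continuous_map (mtop I0) (mtop T) id"
 using smaps_continuous[OF I0_atlas T_atlas I0_incl] I0_carrier I0.tsp by (metis subtopology_topspace)

lemma T0_continuous: "continuous_map (subtopology (mtop T) T0) (mtop I0) id" by (rule smaps_continuous[OF T_atlas I0_atlas I0_into])

definition spt :: "'w form => 'w set" where "spt om = {p. EX c:I0. p:cdom c & om c (cmap c p) ~= 0}"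

lemma spt_T0: "spt om <= T0" using I0_carrier by (auto simp: spt_def car_def)

lemma compact_forms_res:
 assumes w: "om:compact_forms I0 k"
 shows "EX x:AA k. om = res x"
proof -
 have f: "om:forms I0 k" and S: "compactin (mtop I0) (mtop I0 closure_of spt om)"
 using w by (auto simp: compact_forms_def form_support_def spt_def)
 let ?S = "mtop I0 closure_of spt om"
 have sS: "spt om <= ?S" using closure_of_subset[of "spt om" "mtop I0"] spt_T0 I0_carrier I0.tsp by simp
 have ST: "?S <= T0" using closure_of_subset_topspace[of "mtop I0" "spt om"] I0_carrier I0.tsp by simp
 have cS: "compactin (mtop T) ?S" using image_compactin[OF S I0_continuous] by simp
 have "compactin (mtop M) (PE ` ?S)"
 using image_compactin[OF cS] smaps_continuous[OF T_atlas atlas smoD(3)[OF sm_proj]] TT.tsp by (metis subtopology_topspace)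
 hence pS: "closedin (mtop M) (PE ` ?S)" by (rule compactin_imp_closedin[OF hausdorff])
 define A where "A = car M - PE ` ?S"
 have A: "mopen M A" "bdry M <= A" unfolding A_def using openin_diff[OF open_car pS] bdry_car ST by (auto simp: T0_def tover_def)
 have "continuous_map (mtop T) euclideanreal g" unfolding continuous_map_def
 proof (intro conjI allI impI)
 fix U :: "real set" assume "openin euclideanreal U"
 thus "mopen T {x:topspace (mtop T). g x:U}" unfolding TT.tsp by (intro TT.sfn_pre TT.open_car) (auto simp: T_car g_smooth)
 qed auto
 from image_compactin[OF cS this] have "bounded (g ` ?S)" by (simp add: cpt_iff compact_imp_bounded)
 then obtain l where l: "!!w. w:?S ==> g w <= l" unfolding bounded_real by (force simp: abs_le_iff)
 let ?i = "%w. if w:T0 then 1 else 0 :: real"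
 define y where "y = pb T I0 id om"
 define x where "x = fmul ?i y"
 have x_at: "x c (cmap c w) = (if w:T0 then y c (cmap c w) else 0)" if "c:T" "w:cdom c" for c w
 using that by (auto simp: x_def fmul_def zfun_def)
 have xy: "agree T T0 x y" by (simp add: agree_def x_at)
 have van: "agree T B x 0" if B: "B Int ?S = {}" for B
 proof -
 have "agree I0 (T0 Int B) om 0" using sS B by (auto simp: agree_def spt_def)
 hence "agree T (T0 Int B) y (pb T I0 id 0)" unfolding y_def by (rule pull_agree[OF T_atlas]) (simp add: I0_carrier)
 thus ?thesis unfolding pb_0 by (simp add: agree_def x_at zfun_def)
 qed
 have vA: "agree T (tover A) x 0" by (rule van) (auto simp: tover_def A_def)
 have vg: "agree T (gt l) x 0" by (rule van) (use l in "force simp: gt_def")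
 have yf: "fo T T0 k y" unfolding y_def by (rule pb_fo[OF T_atlas I0_atlas I0_into I0.fo_car[OF f] I0.open_car]) (simp add: I0_carrier)
 have "fo T (tover A Un T0) k x"
 by (rule fo_Un[OF TT.fo_agree[OF TT.fo_zero tover_open[OF A(1)] agree_sym[OF vA]] TT.fo_agree[OF yf T0_open agree_sym[OF xy]]])
 hence "fo T (car T) k x" by (rule fo_mono) (use T0_cover(2)[OF A(2)] T_car in simp)
 hence "x:forms T k" unfolding x_def y_def by (intro TT.formsI TT.zero_out_fmul pb_zo)
 hence "x:AA k" using A vA vg by (auto simp: AA_def small_def)
 moreover have "om = res x"
 proof -
 have 1: "agree I0 (car I0) (res x) (pb I0 T id y)" unfolding res_def
 by (rule pull_agree[OF I0_atlas xy]) (unfold I0_carrier, auto simp: T_car T0_def tover_def)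
 have 2: "agree I0 (car I0) (pb I0 T id y) (pb I0 I0 (%p. id (id p)) om)" unfolding y_def
 by (rule pb_compose[OF I0_atlas T_atlas I0_atlas smoD(3)[OF sm_I0] I0_into I0.fo_car[OF f] I0.open_car]) (auto simp: I0_carrier)
 have "pb I0 I0 (%p. id (id p)) om = om" by (rule pull_idf[OF I0_atlas _ f]) simp
 hence "agree I0 (car I0) (res x) om" using agree_trans[OF 1 2] by simp
 hence "res x = om" by (rule agree_eq) (use f I0.forms_zo in "auto simp: res_def pb_zo")
 thus ?thesis ..
 qed
 ultimately show ?thesis by blast
qed

end

context proper
begin

lemma bounded_compact:
 assumes A: "mopen M A"
 shows "compactin (mtop T) {w:TE. g w <= l & PE w ~: A}"
proof -
 define P where "P p c t L Q <-> c:M & t:tE & mopen M Q & p:Q & compactin (mtop M) L & Q <= L &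
 L <= cdom c Int tdom t & (ALL w:TE. PE w:Q --> (\<Sum>i<trank t. (tmap t w i)^2) <= g w)" for p c t L Q
 have "EX c t L Q. P p c t L Q" if "p:car M" for p using proper[OF that] unfolding P_def by - (elim bexE exE conjE, (rule exI)+, intro conjI, assumption+)
 then obtain c t L Q where P: "!!p. p:car M ==> P p (c p) (t p) (L p) (Q p)" by metis
 have Q: "mopen M (Q p) & p:Q p" if "p:car M" for p using P[OF that] unfolding P_def by blast
 obtain Y where Y: "finite Y" "Y <= car M" "car M <= (\<Union>p\<in>Y. Q p)"
 by (rule finite_subcover[of "car M", OF _ Q]) (use closedin_topspace[of "mtop M", unfolded tsp] in assumption)
 define W where "W p = {w:TE. PE w:L p & (ALL i<trank (t p). \<bar>tmap (t p) w i\<bar> <= sqrt l)}" for p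
 have "compactin (mtop T) (W p)" if "p:Y" for p unfolding W_def using P[of p] that Y(2) unfolding P_def by (intro triv_compact) auto
 hence 1: "compactin (mtop T) (\<Union>p\<in>Y. W p)" using Y(1) by (intro compactin_Union) auto
 have "mopen T (gt l Un tover A)" by (intro openin_Un gt_open tover_open A)
 from closedin_diff[OF closedin_topspace this] have "closedin (mtop T) (car T - (gt l Un tover A))" unfolding TT.tsp .
 moreover have "{w:TE. g w <= l & PE w ~: A} = car T - (gt l Un tover A)" by (auto simp: gt_def tover_def T_car)
 ultimately have 2: "closedin (mtop T) {w:TE. g w <= l & PE w ~: A}" by (simp only:)
 have "{w:TE. g w <= l & PE w ~: A} <= (\<Union>p\<in>Y. W p)"
 proof
 fix w assume w: "w:{w:TE. g w <= l & PE w ~: A}"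
 then obtain p where p: "p:Y" "PE w:Q p" using Y(3) proj_car[of w] by blast
 note Pp = P[OF subsetD[OF Y(2) p(1)], unfolded P_def]
 have s: "(\<Sum>i<trank (t p). (tmap (t p) w i)^2) <= l" using Pp p(2) w by fastforce
 have "\<bar>tmap (t p) w i\<bar> <= sqrt l" if "i < trank (t p)" for i
 proof -
 have "(tmap (t p) w i)^2 <= l" using member_le_sum[of i "{..<trank (t p)}" "%i. (tmap (t p) w i)^2"] that s by simp
 thus ?thesis using real_le_rsqrt[of "\<bar>tmap (t p) w i\<bar>" l] by simp
 qed
 hence "w:W p" using Pp p(2) w by (auto simp: W_def)
 thus "w:(\<Union>p\<in>Y. W p)" using p(1) by blast
 qed
 from closed_compactin[OF 1 this 2] show ?thesis .
qed

lemma res_compact_forms: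
 assumes x: "x:AA k"
 shows "res x:compact_forms I0 k"
proof -
 have f: "res x:forms I0 k" using x pull_forms[OF sm_I0] by (simp add: AA_def res_def)
 obtain A l where A: "mopen M A" "bdry M <= A" "agree T (tover A) x 0" "agree T (gt l) x 0" using x by (auto simp: AA_def small_def)
 let ?Z = "{w:TE. g w <= l & PE w ~: A}"
 have Z0: "?Z <= T0" using A(2) proj_car by (auto simp: T0_def tover_def)
 have "compactin (subtopology (mtop T) T0) ?Z" using bounded_compact[OF A(1)] Z0 by (simp add: compactin_subtopology)
 from image_compactin[OF this T0_continuous] have cZ: "compactin (mtop I0) ?Z" by simp
 have U: "mopen T (gt l Un tover A)" by (intro openin_Un gt_open tover_open A)
 have "mopen I0 {p:car I0. id p:gt l Un tover A}" by (rule sm_preimage[OF sm_I0 U])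
 moreover have "{p:car I0. id p:gt l Un tover A} = topspace (mtop I0) - ?Z"
 unfolding I0.tsp I0_carrier by (auto simp: T0_def tover_def gt_def)
 ultimately have clZ: "closedin (mtop I0) ?Z" using Z0 by (simp add: closedin_def I0.tsp I0_carrier)
 have "agree T (gt l Un tover A) x 0" by (rule agree_Un[OF A(4,3)])
 hence "agree I0 (T0 Int (gt l Un tover A)) (res x) (pb I0 T id 0)" unfolding res_def
 by (rule pull_agree[OF I0_atlas]) (auto simp: T0_def tover_def T_car)
 hence "spt (res x) <= ?Z" using spt_T0[of "res x"] unfolding pb_0 by (fastforce simp: spt_def agree_def gt_def tover_def T0_def)
 hence "mtop I0 closure_of spt (res x) <= ?Z" using clZ by (rule closure_of_minimal)
 hence "compactin (mtop I0) (mtop I0 closure_of spt (res x))" by (rule closed_compactin[OF cZ]) simp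
 thus ?thesis using f by (simp add: compact_forms_def form_support_def spt_def)
qed

lemma iso_compact: "vs_iso (cohomology AA (ext_d T) k) (cohomology (compact_forms I0) (ext_d I0) k)"
proof -
 interpret AC: cplx AA "ext_d T" by (rule AA_cplx)
 have c: "compact_forms I0 j = res ` AA j" for j using compact_forms_res res_compact_forms by blast
 have d: "ext_d I0 (res x) = res (ext_d T x)" if "x:AA j" for x j
 unfolding res_def using pull_d[OF sm_I0, of x j] that by (simp add: AA_def)
 have dB: "ext_d I0 ` compact_forms I0 (k - 1) = res ` ext_d T ` AA (k - 1)" unfolding c by (force simp: d image_iff)
 have dA: "ext_d T x:AA k" if "x:AA (k - 1)" for x using AC.dC[OF that] by simp
 have inj: "x = y" if "x:AA k" "y:AA k" "res x = res y" for x y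
 proof -
 have "res (x - y) = 0" using that(3) by (simp add: res_def pb_diff)
 thus ?thesis using res_inj[OF subspace_diff[OF AC.C that(1,2)]] by simp
 qed
 show ?thesis unfolding cohomology_quot
 proof (rule quot_iso[OF AC.Z_sub AC.B_sub _ AC.B_Z, where ph = res])
 show "subspace (ext_d I0 ` compact_forms I0 (k - 1))" unfolding dB by (rule subspace_image[where f = res, OF AC.B_sub res_lin])
 have "res 0 = 0" by (simp add: res_def pb_0)
 thus "res z:{z:compact_forms I0 k. ext_d I0 z = 0}" if "z:{z:AA k. ext_d T z = 0}" for z using that d c by auto
 show "z:ext_d T ` AA (k - 1)" if z: "z:{z:AA k. ext_d T z = 0}" "res z:ext_d I0 ` compact_forms I0 (k - 1)" for z
 proof -
 obtain y where y: "y:AA (k - 1)" "res z = res (ext_d T y)" using z(2) unfolding dB by blast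
 thus ?thesis using inj[of z "ext_d T y"] z(1) dA by blast
 qed
 fix z' assume z': "z':{z:compact_forms I0 k. ext_d I0 z = 0}"
 then obtain z where z: "z:AA k" "z' = res z" using c by blast
 have "ext_d T z = 0" using res_inj[OF AC.dC[OF z(1)]] d[OF z(1)] z' z(2) by simp
 moreover have "z' - res z:ext_d I0 ` compact_forms I0 (k - 1)"
 using subspace_0[OF subspace_image[where f = res, OF AC.B_sub res_lin]] unfolding dB z(2) by simp
 ultimately show "EX z:{z:AA k. ext_d T z = 0}. z' - res z:ext_d I0 ` compact_forms I0 (k - 1)" using z(1) by blast
 qed (use dB res_lin in auto)
qed

lemma main: "vs_iso (cohomology CC D k) (compact_cohomology (interior_total M E) k)"
proof -
 have "interior_total M E = I0" unfolding interior_total T0_def tover_def ..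
 thus ?thesis unfolding compact_cohomology_def
 using vs_iso_span[OF cplx.closed[OF C0_cplx] iso_C0 vs_iso_trans[OF iso_A iso_compact]] by simp
qed

end

theorem lemma1p7:
 fixes X :: "'a chart set" and W :: "('a, 'w) vbundle" and k :: int
 assumes "compact_manifold_with_boundary X"
 and "vector_bundle X W"
 shows "vs_iso (cohomology (cochains X W) (cochain_D X W) k)
 (compact_cohomology (interior_total X W) k)"
proof -
 interpret hvbun X W using assms by unfold_locales (auto simp: compact_manifold_with_boundary_def manifold_with_corners_def)
 obtain g where g: "vmet X W g" and proper: "!!p. p:car X ==> EX c:X. EX t:trivs W. EX K Q. mopen X Q & p:Q &
 compactin (mtop X) K & Q <= K & K <= cdom c Int tdom t & (ALL w:total W. proj W w:Q --> (\<Sum>i<trank t. (tmap t w i)^2) <= g w)"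
 proof (rule metric_exists, goal_cases)
 case (1 g) show ?case by (rule 1(1)[OF 1(2,3)])
 qed
 interpret vmet X W g by (rule g)
 obtain F N where F: "push F" "mopen X N" "bdry X <= N" "ALL w:total W. proj W w:N --> proj W (F (w, pi / 2)):bdry X"
 by (rule push_exists) blast
 obtain h K where h: "ALL q:car X. sfn X q h" "ALL q:bdry X. h q = 1" "closedin (mtop X) K" "K <= N" "ALL q. h q ~= 0 --> q:K"
 by (rule bdry_cutoff[OF F(2,3)]) blast
 interpret proper X W g F N h K by standard (rule F(1-3) h(3,4) F(4)[rule_format] h(1,2,5)[rule_format] proper; assumption)+
 show ?thesis by (rule main)
qed

end
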